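(* Let $\mathcal{T}$ be a triangulated category and let $\mathcal{C}$ be an admissible exact subcategory of $\mathcal{T}$. A realization functor $\operatorname{D}^b(\mathcal{C})\to\mathcal{T}$ of $\mathcal{C}$ is an equivalence of triangulated categories if and only if it is fully faithful and $\operatorname{thick}_{\mathcal{T}}(\mathcal{C})=\mathcal{T}$.
   Context: Let $\Sigma$ denote the suspension of $\mathcal{T}$. A full (additive) subcategory $\mathcal{C}$ of $\mathcal{T}$ is admissible exact if it is non-negative, meaning $\operatorname{Hom}_{\mathcal{T}}(X,\Sigma^nY)=0$ for all $X,Y\in\mathcal{C}$ and $n<0$, and is closed under extensions and direct summands. Such a $\mathcal{C}$ carries an induced exact structure: the short exact sequences are exactly the sequences $L\xrightarrow{f}M\xrightarrow{g}N$ in $\mathcal{C}$ that fit into an exact triangle $L\xrightarrow{f}M\xrightarrow{g}N\xrightarrow{h}\Sigma L$ in $\mathcal{T}$. For an exact category $\mathcal{C}$, $\operatorname{D}^b(\mathcal{C})$ is the Verdier quotient of the bounded homotopy category $\operatorname{K}^b(\mathcal{C})$ by the full subcategory of bounded $\mathcal{C}$-acyclic complexes. A realization functor of $\mathcal{C}$ is a triangle functor $\operatorname{D}^b(\mathcal{C})\to\mathcal{T}$ extending the inclusion $\mathcal{C}\to\mathcal{T}$ (where $\mathcal{C}\subseteq\operatorname{D}^b(\mathcal{C})$ as complexes concentrated in degree $0$). $\operatorname{thick}_{\mathcal{T}}(\mathcal{C})$ is the smallest thick subcategory (triangulated subcategory closed under direct summands) of $\mathcal{T}$ containing $\mathcal{C}$.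 *)

theory Defs
  imports "HOL-Algebra.Group"
begin

section \<open>Categories and functors\<close>

record ('o, 'm) category =
  Obj :: "'o set"
  Arr :: "'m set"
  Dom :: "'m \<Rightarrow> 'o"
  Cod :: "'m \<Rightarrow> 'o"
  Ide :: "'o \<Rightarrow> 'm"
  Comp :: "'m \<Rightarrow> 'm \<Rightarrow> 'm"  (infixr "\<cdot>\<index>" 70)

definition Hom :: "('o, 'm, 'e) category_scheme \<Rightarrow> 'o \<Rightarrow> 'o \<Rightarrow> 'm set" where
  "Hom A X Y = {f \<in> Arr A. Dom A f = X \<and> Cod A f = Y}"

locale category =
  fixes A :: "('o, 'm, 'e) category_scheme" (structure)
  assumes Dom_closed: "f \<in> Arr A \<Longrightarrow> Dom A f \<in> Obj A"
    and Cod_closed: "f \<in> Arr A \<Longrightarrow> Cod A f \<in> Obj A"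
    and Ide_closed: "X \<in> Obj A \<Longrightarrow> Ide A X \<in> Hom A X X"
    and Comp_closed: "f \<in> Hom A X Y \<Longrightarrow> g \<in> Hom A Y Z \<Longrightarrow> g \<cdot> f \<in> Hom A X Z"
    and Comp_Ide: "f \<in> Hom A X Y \<Longrightarrow> f \<cdot> Ide A X = f"
    and Ide_Comp: "f \<in> Hom A X Y \<Longrightarrow> Ide A Y \<cdot> f = f"
    and Comp_assoc: "f \<in> Hom A W X \<Longrightarrow> g \<in> Hom A X Y \<Longrightarrow> h \<in> Hom A Y Z \<Longrightarrow>
          (h \<cdot> g) \<cdot> f = h \<cdot> (g \<cdot> f)"

definition is_iso :: "('o, 'm, 'e) category_scheme \<Rightarrow> 'm \<Rightarrow> bool" where
  "is_iso A f \<longleftrightarrow> f \<in> Arr A \<and> (\<exists>g \<in> Hom A (Cod A f) (Dom A f).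
     g \<cdot>\<^bsub>A\<^esub> f = Ide A (Dom A f) \<and> f \<cdot>\<^bsub>A\<^esub> g = Ide A (Cod A f))"

definition isomorphic :: "('o, 'm, 'e) category_scheme \<Rightarrow> 'o \<Rightarrow> 'o \<Rightarrow> bool" where
  "isomorphic A X Y \<longleftrightarrow> (\<exists>f \<in> Hom A X Y. is_iso A f)"

definition is_zero :: "('o, 'm, 'e) category_scheme \<Rightarrow> 'o \<Rightarrow> bool" where
  "is_zero A Z \<longleftrightarrow> Z \<in> Obj A \<and>
     (\<forall>X \<in> Obj A. (\<exists>!f. f \<in> Hom A X Z) \<and> (\<exists>!f. f \<in> Hom A Z X))"

record ('o, 'm, 'p, 'n) cfunctor =
  fob :: "'o \<Rightarrow> 'p"
  farr :: "'m \<Rightarrow> 'n"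

definition is_functor :: "('o, 'm, 'e) category_scheme \<Rightarrow> ('p, 'n, 'd) category_scheme \<Rightarrow>
    ('o, 'm, 'p, 'n) cfunctor \<Rightarrow> bool" where
  "is_functor A B F \<longleftrightarrow>
     (\<forall>X \<in> Obj A. fob F X \<in> Obj B) \<and>
     (\<forall>f \<in> Arr A. farr F f \<in> Hom B (fob F (Dom A f)) (fob F (Cod A f))) \<and>
     (\<forall>X \<in> Obj A. farr F (Ide A X) = Ide B (fob F X)) \<and>
     (\<forall>f \<in> Arr A. \<forall>g \<in> Arr A. Cod A f = Dom A g \<longrightarrow>
        farr F (g \<cdot>\<^bsub>A\<^esub> f) = farr F g \<cdot>\<^bsub>B\<^esub> farr F f)"

definition functor_id :: "('o, 'm, 'o, 'm) cfunctor" where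
  "functor_id = \<lparr>fob = (\<lambda>X. X), farr = (\<lambda>f. f)\<rparr>"

definition functor_comp :: "('p, 'n, 'q, 'k) cfunctor \<Rightarrow> ('o, 'm, 'p, 'n) cfunctor \<Rightarrow>
    ('o, 'm, 'q, 'k) cfunctor"  (infixr "\<circ>\<^sub>F" 55) where
  "G \<circ>\<^sub>F F = \<lparr>fob = fob G \<circ> fob F, farr = farr G \<circ> farr F\<rparr>"

definition natural_iso :: "('o, 'm, 'e) category_scheme \<Rightarrow> ('p, 'n, 'd) category_scheme \<Rightarrow>
    ('o, 'm, 'p, 'n) cfunctor \<Rightarrow> ('o, 'm, 'p, 'n) cfunctor \<Rightarrow> ('o \<Rightarrow> 'n) \<Rightarrow> bool" where
  "natural_iso A B F G \<eta> \<longleftrightarrow>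
     (\<forall>X \<in> Obj A. \<eta> X \<in> Hom B (fob F X) (fob G X) \<and> is_iso B (\<eta> X)) \<and>
     (\<forall>f \<in> Arr A. \<eta> (Cod A f) \<cdot>\<^bsub>B\<^esub> farr F f = farr G f \<cdot>\<^bsub>B\<^esub> \<eta> (Dom A f))"

definition equivalence_of_categories :: "('o, 'm, 'e) category_scheme \<Rightarrow>
    ('p, 'n, 'd) category_scheme \<Rightarrow> ('o, 'm, 'p, 'n) cfunctor \<Rightarrow> bool" where
  "equivalence_of_categories A B F \<longleftrightarrow> is_functor A B F \<and>
     (\<exists>G \<eta> \<epsilon>. is_functor B A G \<and>
        natural_iso A A (G \<circ>\<^sub>F F) functor_id \<eta> \<and> natural_iso B B (F \<circ>\<^sub>F G) functor_id \<epsilon>)"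

definition fully_faithful :: "('o, 'm, 'e) category_scheme \<Rightarrow>
    ('p, 'n, 'd) category_scheme \<Rightarrow> ('o, 'm, 'p, 'n) cfunctor \<Rightarrow> bool" where
  "fully_faithful A B F \<longleftrightarrow> is_functor A B F \<and>
     (\<forall>X \<in> Obj A. \<forall>Y \<in> Obj A. bij_betw (farr F) (Hom A X Y) (Hom B (fob F X) (fob F Y)))"


section \<open>Additive categories\<close>

record ('o, 'm) add_category = "('o, 'm) category" +
  Plus :: "'m \<Rightarrow> 'm \<Rightarrow> 'm"  (infixl "\<oplus>\<index>" 65)
  Zero :: "'o \<Rightarrow> 'o \<Rightarrow> 'm"

definition hom_group :: "('o, 'm, 'e) add_category_scheme \<Rightarrow> 'o \<Rightarrow> 'o \<Rightarrow> 'm monoid" where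
  "hom_group A X Y = \<lparr>carrier = Hom A X Y, mult = Plus A, one = Zero A X Y\<rparr>"

definition neg :: "('o, 'm, 'e) add_category_scheme \<Rightarrow> 'm \<Rightarrow> 'm" where
  "neg A f = inv\<^bsub>hom_group A (Dom A f) (Cod A f)\<^esub> f"

definition biproduct :: "('o, 'm, 'e) add_category_scheme \<Rightarrow> 'o \<Rightarrow> 'o \<Rightarrow> 'o \<Rightarrow>
    'm \<Rightarrow> 'm \<Rightarrow> 'm \<Rightarrow> 'm \<Rightarrow> bool" where
  "biproduct A X Y B i j p q \<longleftrightarrow> X \<in> Obj A \<and> Y \<in> Obj A \<and> B \<in> Obj A \<and>
     i \<in> Hom A X B \<and> j \<in> Hom A Y B \<and> p \<in> Hom A B X \<and> q \<in> Hom A B Y \<and>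
     p \<cdot>\<^bsub>A\<^esub> i = Ide A X \<and> q \<cdot>\<^bsub>A\<^esub> j = Ide A Y \<and>
     p \<cdot>\<^bsub>A\<^esub> j = Zero A Y X \<and> q \<cdot>\<^bsub>A\<^esub> i = Zero A X Y \<and>
     (i \<cdot>\<^bsub>A\<^esub> p) \<oplus>\<^bsub>A\<^esub> (j \<cdot>\<^bsub>A\<^esub> q) = Ide A B"

definition is_direct_sum :: "('o, 'm, 'e) add_category_scheme \<Rightarrow> 'o \<Rightarrow> 'o \<Rightarrow> 'o \<Rightarrow> bool" where
  "is_direct_sum A X Y B \<longleftrightarrow> (\<exists>i j p q. biproduct A X Y B i j p q)"

locale additive_category = category A
  for A :: "('o, 'm, 'e) add_category_scheme" (structure) +
  assumes hom_comm_group: "X \<in> Obj A \<Longrightarrow> Y \<in> Obj A \<Longrightarrow> comm_group (hom_group A X Y)"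
    and Comp_Plus: "f \<in> Hom A X Y \<Longrightarrow> f' \<in> Hom A X Y \<Longrightarrow> g \<in> Hom A Y Z \<Longrightarrow>
          g \<cdot> (f \<oplus> f') = (g \<cdot> f) \<oplus> (g \<cdot> f')"
    and Plus_Comp: "f \<in> Hom A X Y \<Longrightarrow> g \<in> Hom A Y Z \<Longrightarrow> g' \<in> Hom A Y Z \<Longrightarrow>
          (g \<oplus> g') \<cdot> f = (g \<cdot> f) \<oplus> (g' \<cdot> f)"
    and zero_exists: "\<exists>Z. is_zero A Z"
    and biproduct_exists: "X \<in> Obj A \<Longrightarrow> Y \<in> Obj A \<Longrightarrow> \<exists>B. is_direct_sum A X Y B"

definition additive_functor :: "('o, 'm, 'e) add_category_scheme \<Rightarrow>
    ('p, 'n, 'd) add_category_scheme \<Rightarrow> ('o, 'm, 'p, 'n) cfunctor \<Rightarrow> bool" where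
  "additive_functor A B F \<longleftrightarrow> is_functor A B F \<and>
     (\<forall>X \<in> Obj A. \<forall>Y \<in> Obj A. \<forall>f \<in> Hom A X Y. \<forall>g \<in> Hom A X Y.
        farr F (f \<oplus>\<^bsub>A\<^esub> g) = farr F f \<oplus>\<^bsub>B\<^esub> farr F g)"


section \<open>Triangulated categories\<close>

text \<open>A triangle is the triple \<open>(u, v, w)\<close> of its arrows; \<open>Tri\<close> is the set of exact
  (distinguished) triangles.  The suspension is only required to be an autoequivalence.\<close>

record ('o, 'm) tri_category = "('o, 'm) add_category" +
  Susp :: "('o, 'm, 'o, 'm) cfunctor"
  Tri :: "('m \<times> 'm \<times> 'm) set"

definition is_triangle :: "('o, 'm, 'e) tri_category_scheme \<Rightarrow> 'm \<Rightarrow> 'm \<Rightarrow> 'm \<Rightarrow> bool" where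
  "is_triangle T u v w \<longleftrightarrow> u \<in> Arr T \<and> v \<in> Arr T \<and> w \<in> Arr T \<and>
     Cod T u = Dom T v \<and> Cod T v = Dom T w \<and> Cod T w = fob (Susp T) (Dom T u)"

definition triangle_iso :: "('o, 'm, 'e) tri_category_scheme \<Rightarrow>
    'm \<times> 'm \<times> 'm \<Rightarrow> 'm \<times> 'm \<times> 'm \<Rightarrow> bool" where
  "triangle_iso T = (\<lambda>(u, v, w) (u', v', w').
     is_triangle T u v w \<and> is_triangle T u' v' w' \<and>
     (\<exists>a b c. a \<in> Hom T (Dom T u) (Dom T u') \<and> is_iso T a \<and>
              b \<in> Hom T (Dom T v) (Dom T v') \<and> is_iso T b \<and>
              c \<in> Hom T (Dom T w) (Dom T w') \<and> is_iso T c \<and>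
              b \<cdot>\<^bsub>T\<^esub> u = u' \<cdot>\<^bsub>T\<^esub> a \<and> c \<cdot>\<^bsub>T\<^esub> v = v' \<cdot>\<^bsub>T\<^esub> b \<and>
              farr (Susp T) a \<cdot>\<^bsub>T\<^esub> w = w' \<cdot>\<^bsub>T\<^esub> c))"

definition close_triangles :: "('o, 'm, 'e) tri_category_scheme \<Rightarrow>
    ('o, 'm, 'e) tri_category_scheme" where
  "close_triangles T = T\<lparr>Tri := {t. \<exists>t' \<in> Tri T. triangle_iso T t t'}\<rparr>"

locale triangulated_category = additive_category T
  for T :: "('o, 'm, 'e) tri_category_scheme" (structure) +
  assumes Susp_additive: "additive_functor T T (Susp T)"
    and Susp_equivalence: "equivalence_of_categories T T (Susp T)"
    and Tri_is_triangle: "(u, v, w) \<in> Tri T \<Longrightarrow> is_triangle T u v w"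
    and TR1_iso: "t' \<in> Tri T \<Longrightarrow> triangle_iso T t t' \<Longrightarrow> t \<in> Tri T"
    and TR1_id: "X \<in> Obj T \<Longrightarrow> is_zero T Z \<Longrightarrow>
          (Ide T X, Zero T X Z, Zero T Z (fob (Susp T) X)) \<in> Tri T"
    and TR1_cone: "u \<in> Arr T \<Longrightarrow> \<exists>v w. (u, v, w) \<in> Tri T"
    and TR2: "is_triangle T u v w \<Longrightarrow>
          (u, v, w) \<in> Tri T \<longleftrightarrow> (v, w, neg T (farr (Susp T) u)) \<in> Tri T"
    and TR3: "(u, v, w) \<in> Tri T \<Longrightarrow> (u', v', w') \<in> Tri T \<Longrightarrow>
          a \<in> Hom T (Dom T u) (Dom T u') \<Longrightarrow> b \<in> Hom T (Dom T v) (Dom T v') \<Longrightarrow>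
          b \<cdot> u = u' \<cdot> a \<Longrightarrow>
          \<exists>c \<in> Hom T (Dom T w) (Dom T w').
            c \<cdot> v = v' \<cdot> b \<and> farr (Susp T) a \<cdot> w = w' \<cdot> c"
    and TR4: "u \<in> Hom T X Y \<Longrightarrow> v \<in> Hom T Y Z \<Longrightarrow>
          (u, i, i') \<in> Tri T \<Longrightarrow> (v, j, j') \<in> Tri T \<Longrightarrow> (v \<cdot> u, k, k') \<in> Tri T \<Longrightarrow>
          \<exists>f g. f \<in> Hom T (Cod T i) (Cod T k) \<and> g \<in> Hom T (Cod T k) (Cod T j) \<and>
            (f, g, farr (Susp T) i \<cdot> j') \<in> Tri T \<and>
            k \<cdot> v = f \<cdot> i \<and> k' \<cdot> f = i' \<and> g \<cdot> k = j \<and> j' \<cdot> g = farr (Susp T) u \<cdot> k'"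

text \<open>A triangle functor is a pair of an additive functor \<open>F\<close> and a natural isomorphism
  \<open>\<phi> : F \<Sigma> \<rightarrow> \<Sigma> F\<close>.\<close>

definition triangle_functor :: "('o, 'm, 'e) tri_category_scheme \<Rightarrow>
    ('p, 'n, 'd) tri_category_scheme \<Rightarrow> ('o, 'm, 'p, 'n) cfunctor \<Rightarrow> ('o \<Rightarrow> 'n) \<Rightarrow> bool" where
  "triangle_functor S T F \<phi> \<longleftrightarrow> additive_functor S T F \<and>
     natural_iso S T (F \<circ>\<^sub>F Susp S) (Susp T \<circ>\<^sub>F F) \<phi> \<and>
     (\<forall>(u, v, w) \<in> Tri S. (farr F u, farr F v, \<phi> (Dom S u) \<cdot>\<^bsub>T\<^esub> farr F w) \<in> Tri T)"

text \<open>A quasi-inverse of a triangle functor is automatically a triangle functor.\<close>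

definition triangle_equivalence :: "('o, 'm, 'e) tri_category_scheme \<Rightarrow>
    ('p, 'n, 'd) tri_category_scheme \<Rightarrow> ('o, 'm, 'p, 'n) cfunctor \<Rightarrow> ('o \<Rightarrow> 'n) \<Rightarrow> bool" where
  "triangle_equivalence S T F \<phi> \<longleftrightarrow> triangle_functor S T F \<phi> \<and> equivalence_of_categories S T F"

text \<open>Full subcategories are given by their sets of objects.\<close>

definition closed_under_iso :: "('o, 'm, 'e) category_scheme \<Rightarrow> 'o set \<Rightarrow> bool" where
  "closed_under_iso A S \<longleftrightarrow> (\<forall>X \<in> S. \<forall>Y \<in> Obj A. isomorphic A X Y \<longrightarrow> Y \<in> S)"

definition closed_under_summands :: "('o, 'm, 'e) add_category_scheme \<Rightarrow> 'o set \<Rightarrow> bool" where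
  "closed_under_summands A S \<longleftrightarrow>
     (\<forall>X \<in> Obj A. \<forall>Y \<in> Obj A. \<forall>B \<in> S. is_direct_sum A X Y B \<longrightarrow> X \<in> S)"

definition triangulated_subcategory :: "('o, 'm, 'e) tri_category_scheme \<Rightarrow> 'o set \<Rightarrow> bool" where
  "triangulated_subcategory T S \<longleftrightarrow> S \<subseteq> Obj T \<and> closed_under_iso T S \<and>
     (\<exists>Z \<in> S. is_zero T Z) \<and>
     (\<forall>X \<in> Obj T. X \<in> S \<longleftrightarrow> fob (Susp T) X \<in> S) \<and>
     (\<forall>(u, v, w) \<in> Tri T. Dom T u \<in> S \<and> Dom T v \<in> S \<longrightarrow> Dom T w \<in> S)"

definition thick_subcategory :: "('o, 'm, 'e) tri_category_scheme \<Rightarrow> 'o set \<Rightarrow> bool" where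
  "thick_subcategory T S \<longleftrightarrow> triangulated_subcategory T S \<and> closed_under_summands T S"

definition thick_closure :: "('o, 'm, 'e) tri_category_scheme \<Rightarrow> 'o set \<Rightarrow> 'o set" where
  "thick_closure T C = \<Inter> {S. thick_subcategory T S \<and> C \<subseteq> S}"


section \<open>Verdier quotients\<close>

text \<open>Morphisms \<open>X \<rightarrow> Y\<close> of homotopy categories and of Verdier quotients are equivalence classes of
  chain maps and of roofs, tagged with \<open>X\<close> and \<open>Y\<close>.\<close>

datatype ('o, 'r) class_arr = Class_arr (source: 'o) (target: 'o) (reps: "'r set")

definition quot_system :: "('o, 'm, 'e) tri_category_scheme \<Rightarrow> 'o set \<Rightarrow> 'm set" where
  "quot_system K N = {s \<in> Arr K. \<exists>v w. (s, v, w) \<in> Tri K \<and> Cod K v \<in> N}"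

text \<open>\<open>(s, f)\<close> is the roof \<open>X \<leftarrow> W \<rightarrow> Y\<close> which represents \<open>f s\<^sup>-\<^sup>1\<close>.\<close>

definition roofs :: "('o, 'm, 'e) tri_category_scheme \<Rightarrow> 'o set \<Rightarrow> 'o \<Rightarrow> 'o \<Rightarrow> ('m \<times> 'm) set" where
  "roofs K N X Y =
     {(s, f). s \<in> quot_system K N \<and> f \<in> Arr K \<and> Dom K s = Dom K f \<and> Cod K s = X \<and> Cod K f = Y}"

definition roof_rel :: "('o, 'm, 'e) tri_category_scheme \<Rightarrow> 'o set \<Rightarrow> 'o \<Rightarrow> 'o \<Rightarrow>
    (('m \<times> 'm) \<times> ('m \<times> 'm)) set" where
  "roof_rel K N X Y = {((s, f), (t, g)). (s, f) \<in> roofs K N X Y \<and> (t, g) \<in> roofs K N X Y \<and>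
     (\<exists>W a b. a \<in> Hom K W (Dom K s) \<and> b \<in> Hom K W (Dom K t) \<and>
        s \<cdot>\<^bsub>K\<^esub> a = t \<cdot>\<^bsub>K\<^esub> b \<and> s \<cdot>\<^bsub>K\<^esub> a \<in> quot_system K N \<and>
        f \<cdot>\<^bsub>K\<^esub> a = g \<cdot>\<^bsub>K\<^esub> b)}"

definition roof_class :: "('o, 'm, 'e) tri_category_scheme \<Rightarrow> 'o set \<Rightarrow> 'm \<times> 'm \<Rightarrow>
    ('o, 'm \<times> 'm) class_arr" where
  "roof_class K N = (\<lambda>(s, f). Class_arr (Cod K s) (Cod K f)
     (roof_rel K N (Cod K s) (Cod K f) `` {(s, f)}))"

text \<open>In the composition, \<open>r\<close> and \<open>h\<close> complete \<open>f\<close> and \<open>t\<close> to an Ore square \<open>f r = t h\<close>.\<close>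

definition verdier_comp :: "('o, 'm, 'e) tri_category_scheme \<Rightarrow> 'o set \<Rightarrow>
    ('o, 'm \<times> 'm) class_arr \<Rightarrow> ('o, 'm \<times> 'm) class_arr \<Rightarrow> ('o, 'm \<times> 'm) class_arr" where
  "verdier_comp K N \<beta> \<alpha> = Class_arr (source \<alpha>) (target \<beta>)
     (roof_rel K N (source \<alpha>) (target \<beta>) ``
        {(s \<cdot>\<^bsub>K\<^esub> r, g \<cdot>\<^bsub>K\<^esub> h) | s f t g r h.
           (s, f) \<in> reps \<alpha> \<and> (t, g) \<in> reps \<beta> \<and>
           r \<in> quot_system K N \<and> h \<in> Arr K \<and> Dom K r = Dom K h \<and>
           Cod K r = Dom K f \<and> Cod K h = Dom K t \<and> f \<cdot>\<^bsub>K\<^esub> r = t \<cdot>\<^bsub>K\<^esub> h})"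

text \<open>Two roofs are added after passing to a common denominator.\<close>

definition verdier_plus :: "('o, 'm, 'e) tri_category_scheme \<Rightarrow> 'o set \<Rightarrow>
    ('o, 'm \<times> 'm) class_arr \<Rightarrow> ('o, 'm \<times> 'm) class_arr \<Rightarrow> ('o, 'm \<times> 'm) class_arr" where
  "verdier_plus K N \<alpha> \<beta> = Class_arr (source \<alpha>) (target \<alpha>)
     (roof_rel K N (source \<alpha>) (target \<alpha>) ``
        {(s, f \<oplus>\<^bsub>K\<^esub> g) | s f g. (s, f) \<in> reps \<alpha> \<and> (s, g) \<in> reps \<beta>})"

definition verdier_susp :: "('o, 'm, 'e) tri_category_scheme \<Rightarrow> 'o set \<Rightarrow>
    ('o, ('o, 'm \<times> 'm) class_arr, 'o, ('o, 'm \<times> 'm) class_arr) cfunctor" where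
  "verdier_susp K N = \<lparr>fob = fob (Susp K),
     farr = (\<lambda>\<alpha>. let X = fob (Susp K) (source \<alpha>); Y = fob (Susp K) (target \<alpha>) in
       Class_arr X Y (roof_rel K N X Y ``
         {(farr (Susp K) s, farr (Susp K) f) | s f. (s, f) \<in> reps \<alpha>}))\<rparr>"

definition quot_functor :: "('o, 'm, 'e) tri_category_scheme \<Rightarrow> 'o set \<Rightarrow>
    ('o, 'm, 'o, ('o, 'm \<times> 'm) class_arr) cfunctor" where
  "quot_functor K N = \<lparr>fob = (\<lambda>X. X), farr = (\<lambda>f. roof_class K N (Ide K (Dom K f), f))\<rparr>"

text \<open>The quotient of \<open>K\<close> by the full subcategory on \<open>N\<close>.  Its exact triangles are those isomorphic
  to images of exact triangles of \<open>K\<close>.\<close>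

definition verdier_quotient :: "('o, 'm, 'e) tri_category_scheme \<Rightarrow> 'o set \<Rightarrow>
    ('o, ('o, 'm \<times> 'm) class_arr) tri_category" where
  "verdier_quotient K N = close_triangles
     \<lparr>Obj = Obj K,
      Arr = {Class_arr X Y c | X Y c. X \<in> Obj K \<and> Y \<in> Obj K \<and>
               c \<in> roofs K N X Y // roof_rel K N X Y},
      Dom = source,
      Cod = target,
      Ide = (\<lambda>X. roof_class K N (Ide K X, Ide K X)),
      Comp = verdier_comp K N,
      Plus = verdier_plus K N,
      Zero = (\<lambda>X Y. roof_class K N (Ide K X, Zero K X Y)),
      Susp = verdier_susp K N,
      Tri = {(farr (quot_functor K N) u, farr (quot_functor K N) v, farr (quot_functor K N) w)
              | u v w. (u, v, w) \<in> Tri K}\<rparr>"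


section \<open>Exact categories and their bounded derived categories\<close>

text \<open>\<open>Ses\<close> is the set of short exact sequences \<open>L \<rightarrow> M \<rightarrow> N\<close>, given by their two arrows.\<close>

record ('o, 'm) exact_category = "('o, 'm) add_category" +
  Ses :: "('m \<times> 'm) set"

record ('o, 'm) cochain_complex =
  cob :: "int \<Rightarrow> 'o"
  cdiff :: "int \<Rightarrow> 'm"

definition bounded_complexes :: "('o, 'm, 'e) add_category_scheme \<Rightarrow>
    ('o, 'm) cochain_complex set" where
  "bounded_complexes E = {X.
     (\<forall>n. cob X n \<in> Obj E \<and> cdiff X n \<in> Hom E (cob X n) (cob X (n + 1)) \<and>
          cdiff X (n + 1) \<cdot>\<^bsub>E\<^esub> cdiff X n = Zero E (cob X n) (cob X (n + 2))) \<and>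
     (\<exists>b. \<forall>n. \<bar>n\<bar> > b \<longrightarrow> is_zero E (cob X n))}"

definition chain_maps :: "('o, 'm, 'e) add_category_scheme \<Rightarrow> ('o, 'm) cochain_complex \<Rightarrow>
    ('o, 'm) cochain_complex \<Rightarrow> (int \<Rightarrow> 'm) set" where
  "chain_maps E X Y = {f. \<forall>n. f n \<in> Hom E (cob X n) (cob Y n) \<and>
     cdiff Y n \<cdot>\<^bsub>E\<^esub> f n = f (n + 1) \<cdot>\<^bsub>E\<^esub> cdiff X n}"

definition htpy_rel :: "('o, 'm, 'e) add_category_scheme \<Rightarrow> ('o, 'm) cochain_complex \<Rightarrow>
    ('o, 'm) cochain_complex \<Rightarrow> ((int \<Rightarrow> 'm) \<times> (int \<Rightarrow> 'm)) set" where
  "htpy_rel E X Y = {(f, g). f \<in> chain_maps E X Y \<and> g \<in> chain_maps E X Y \<and>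
     (\<exists>h. \<forall>n. h n \<in> Hom E (cob X n) (cob Y (n - 1)) \<and>
        g n = f n \<oplus>\<^bsub>E\<^esub> ((cdiff Y (n - 1) \<cdot>\<^bsub>E\<^esub> h n) \<oplus>\<^bsub>E\<^esub> (h (n + 1) \<cdot>\<^bsub>E\<^esub> cdiff X n)))}"

type_synonym ('o, 'm) htpy_arr = "(('o, 'm) cochain_complex, int \<Rightarrow> 'm) class_arr"

definition htpy_class :: "('o, 'm, 'e) add_category_scheme \<Rightarrow> ('o, 'm) cochain_complex \<Rightarrow>
    ('o, 'm) cochain_complex \<Rightarrow> (int \<Rightarrow> 'm) \<Rightarrow> ('o, 'm) htpy_arr" where
  "htpy_class E X Y f = Class_arr X Y (htpy_rel E X Y `` {f})"

definition htpy_comp :: "('o, 'm, 'e) add_category_scheme \<Rightarrow> ('o, 'm) htpy_arr \<Rightarrow>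
    ('o, 'm) htpy_arr \<Rightarrow> ('o, 'm) htpy_arr" where
  "htpy_comp E \<beta> \<alpha> = Class_arr (source \<alpha>) (target \<beta>)
     (htpy_rel E (source \<alpha>) (target \<beta>) ``
        {(\<lambda>n. g n \<cdot>\<^bsub>E\<^esub> f n) | f g. f \<in> reps \<alpha> \<and> g \<in> reps \<beta>})"

definition htpy_plus :: "('o, 'm, 'e) add_category_scheme \<Rightarrow> ('o, 'm) htpy_arr \<Rightarrow>
    ('o, 'm) htpy_arr \<Rightarrow> ('o, 'm) htpy_arr" where
  "htpy_plus E \<alpha> \<beta> = Class_arr (source \<alpha>) (target \<alpha>)
     (htpy_rel E (source \<alpha>) (target \<alpha>) ``
        {(\<lambda>n. f n \<oplus>\<^bsub>E\<^esub> g n) | f g. f \<in> reps \<alpha> \<and> g \<in> reps \<beta>})"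

definition shift :: "('o, 'm, 'e) add_category_scheme \<Rightarrow> ('o, 'm) cochain_complex \<Rightarrow>
    ('o, 'm) cochain_complex" where
  "shift E X = \<lparr>cob = (\<lambda>n. cob X (n + 1)), cdiff = (\<lambda>n. neg E (cdiff X (n + 1)))\<rparr>"

definition htpy_susp :: "('o, 'm, 'e) add_category_scheme \<Rightarrow>
    (('o, 'm) cochain_complex, ('o, 'm) htpy_arr,
     ('o, 'm) cochain_complex, ('o, 'm) htpy_arr) cfunctor" where
  "htpy_susp E = \<lparr>fob = shift E,
     farr = (\<lambda>\<alpha>. Class_arr (shift E (source \<alpha>)) (shift E (target \<alpha>))
       (htpy_rel E (shift E (source \<alpha>)) (shift E (target \<alpha>)) ``
          {(\<lambda>n. f (n + 1)) | f. f \<in> reps \<alpha>}))\<rparr>"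

text \<open>\<open>Z\<close> is a mapping cone of \<open>f : X \<rightarrow> Y\<close>: its \<open>n\<close>-th term is a biproduct of \<open>X\<^sup>n\<^sup>+\<^sup>1\<close> and \<open>Y\<^sup>n\<close>
  with inclusions \<open>i, j\<close> and projections \<open>p, q\<close>, and its differential is the matrix with rows
  \<open>(-d, 0)\<close> and \<open>(f, d)\<close>.\<close>

definition mapping_cone :: "('o, 'm, 'e) add_category_scheme \<Rightarrow> ('o, 'm) cochain_complex \<Rightarrow>
    ('o, 'm) cochain_complex \<Rightarrow> (int \<Rightarrow> 'm) \<Rightarrow> ('o, 'm) cochain_complex \<Rightarrow>
    (int \<Rightarrow> 'm) \<Rightarrow> (int \<Rightarrow> 'm) \<Rightarrow> (int \<Rightarrow> 'm) \<Rightarrow> (int \<Rightarrow> 'm) \<Rightarrow> bool" where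
  "mapping_cone E X Y f Z i j p q \<longleftrightarrow>
     (\<forall>n. biproduct E (cob X (n + 1)) (cob Y n) (cob Z n) (i n) (j n) (p n) (q n) \<and>
        cdiff Z n =
          ((i (n + 1) \<cdot>\<^bsub>E\<^esub> neg E (cdiff X (n + 1)) \<cdot>\<^bsub>E\<^esub> p n) \<oplus>\<^bsub>E\<^esub>
           (j (n + 1) \<cdot>\<^bsub>E\<^esub> f (n + 1) \<cdot>\<^bsub>E\<^esub> p n)) \<oplus>\<^bsub>E\<^esub>
          (j (n + 1) \<cdot>\<^bsub>E\<^esub> cdiff Y n \<cdot>\<^bsub>E\<^esub> q n))"

definition Kb :: "('o, 'm, 'e) add_category_scheme \<Rightarrow>
    (('o, 'm) cochain_complex, ('o, 'm) htpy_arr) tri_category" where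
  "Kb E = close_triangles
     \<lparr>Obj = bounded_complexes E,
      Arr = {Class_arr X Y c | X Y c. X \<in> bounded_complexes E \<and> Y \<in> bounded_complexes E \<and>
               c \<in> chain_maps E X Y // htpy_rel E X Y},
      Dom = source,
      Cod = target,
      Ide = (\<lambda>X. htpy_class E X X (\<lambda>n. Ide E (cob X n))),
      Comp = htpy_comp E,
      Plus = htpy_plus E,
      Zero = (\<lambda>X Y. htpy_class E X Y (\<lambda>n. Zero E (cob X n) (cob Y n))),
      Susp = htpy_susp E,
      Tri = {(htpy_class E X Y f, htpy_class E Y Z j, htpy_class E Z (shift E X) p)
              | X Y Z f i j p q.
              X \<in> bounded_complexes E \<and> Y \<in> bounded_complexes E \<and> Z \<in> bounded_complexes E \<and>
              f \<in> chain_maps E X Y \<and> mapping_cone E X Y f Z i j p q}\<rparr>"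

text \<open>A complex is acyclic if every differential \<open>d\<^sup>n\<close> factors as \<open>X\<^sup>n \<rightarrow> Z\<^sup>n\<^sup>+\<^sup>1 \<rightarrow> X\<^sup>n\<^sup>+\<^sup>1\<close> in such a way
  that all the sequences \<open>Z\<^sup>n \<rightarrow> X\<^sup>n \<rightarrow> Z\<^sup>n\<^sup>+\<^sup>1\<close> are short exact.\<close>

definition bounded_acyclic_complexes :: "('o, 'm, 'e) exact_category_scheme \<Rightarrow>
    ('o, 'm) cochain_complex set" where
  "bounded_acyclic_complexes E = {X \<in> bounded_complexes E.
     \<exists>Z m e. \<forall>n. m n \<in> Hom E (Z n) (cob X n) \<and> e n \<in> Hom E (cob X n) (Z (n + 1)) \<and>
       (m n, e n) \<in> Ses E \<and> cdiff X n = m (n + 1) \<cdot>\<^bsub>E\<^esub> e n}"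

type_synonym ('o, 'm) derived_arr =
  "(('o, 'm) cochain_complex, ('o, 'm) htpy_arr \<times> ('o, 'm) htpy_arr) class_arr"

definition Db :: "('o, 'm, 'e) exact_category_scheme \<Rightarrow>
    (('o, 'm) cochain_complex, ('o, 'm) derived_arr) tri_category" where
  "Db E = verdier_quotient (Kb E) (bounded_acyclic_complexes E)"

text \<open>The embedding of \<open>E\<close> as complexes concentrated in degree \<open>0\<close>; the zero object used in the other
  degrees is an arbitrary choice.\<close>

definition zero_obj :: "('o, 'm, 'e) category_scheme \<Rightarrow> 'o" where
  "zero_obj E = (SOME Z. is_zero E Z)"

definition stalk_functor :: "('o, 'm, 'e) add_category_scheme \<Rightarrow>
    ('o, 'm, ('o, 'm) cochain_complex, ('o, 'm) htpy_arr) cfunctor" where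
  "stalk_functor E =
     (let stalk = (\<lambda>X. let S = (\<lambda>n. if n = 0 then X else zero_obj E) in
                    \<lparr>cob = S, cdiff = (\<lambda>n. Zero E (S n) (S (n + 1)))\<rparr>)
      in \<lparr>fob = stalk,
          farr = (\<lambda>f. htpy_class E (stalk (Dom E f)) (stalk (Cod E f))
                   (\<lambda>n. if n = 0 then f else Zero E (zero_obj E) (zero_obj E)))\<rparr>)"

definition Db_embedding :: "('o, 'm, 'e) exact_category_scheme \<Rightarrow>
    ('o, 'm, ('o, 'm) cochain_complex, ('o, 'm) derived_arr) cfunctor" where
  "Db_embedding E = quot_functor (Kb E) (bounded_acyclic_complexes E) \<circ>\<^sub>F stalk_functor E"


section \<open>Admissible exact subcategories and realization functors\<close>

definition full_additive_subcategory :: "('o, 'm, 'e) add_category_scheme \<Rightarrow> 'o set \<Rightarrow> bool" where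
  "full_additive_subcategory A C \<longleftrightarrow> C \<subseteq> Obj A \<and> (\<exists>Z \<in> C. is_zero A Z) \<and>
     (\<forall>X \<in> C. \<forall>Y \<in> C. \<exists>B \<in> C. is_direct_sum A X Y B)"

text \<open>\<open>Hom(X, \<Sigma>\<^sup>-\<^sup>k Y) = 0\<close> for \<open>k > 0\<close>, where \<open>\<Sigma>\<^sup>-\<^sup>k Y\<close> is any object \<open>W\<close> with \<open>\<Sigma>\<^sup>k W \<cong> Y\<close>; such a \<open>W\<close> is
  unique up to isomorphism because \<open>\<Sigma>\<close> is an equivalence.\<close>

definition non_negative :: "('o, 'm, 'e) tri_category_scheme \<Rightarrow> 'o set \<Rightarrow> bool" where
  "non_negative T C \<longleftrightarrow> (\<forall>X \<in> C. \<forall>Y \<in> C. \<forall>k > 0. \<forall>W \<in> Obj T.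
     isomorphic T ((fob (Susp T) ^^ k) W) Y \<longrightarrow> Hom T X W = {Zero T X W})"

definition closed_under_extensions :: "('o, 'm, 'e) tri_category_scheme \<Rightarrow> 'o set \<Rightarrow> bool" where
  "closed_under_extensions T C \<longleftrightarrow>
     (\<forall>(u, v, w) \<in> Tri T. Dom T u \<in> C \<and> Cod T v \<in> C \<longrightarrow> Cod T u \<in> C)"

definition admissible_exact :: "('o, 'm, 'e) tri_category_scheme \<Rightarrow> 'o set \<Rightarrow> bool" where
  "admissible_exact T C \<longleftrightarrow> full_additive_subcategory T C \<and> non_negative T C \<and>
     closed_under_extensions T C \<and> closed_under_summands T C"

definition induced_exact :: "('o, 'm, 'e) tri_category_scheme \<Rightarrow> 'o set \<Rightarrow>
    ('o, 'm) exact_category" where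
  "induced_exact T C =
     \<lparr>Obj = C,
      Arr = {f \<in> Arr T. Dom T f \<in> C \<and> Cod T f \<in> C},
      Dom = Dom T,
      Cod = Cod T,
      Ide = Ide T,
      Comp = Comp T,
      Plus = Plus T,
      Zero = Zero T,
      Ses = {(f, g). (\<exists>h. (f, g, h) \<in> Tri T) \<and> Dom T f \<in> C \<and> Cod T f \<in> C \<and> Cod T g \<in> C}\<rparr>"

text \<open>Extending the inclusion is understood up to natural isomorphism.\<close>

definition realization_functor :: "('o, 'm, 'e) tri_category_scheme \<Rightarrow> 'o set \<Rightarrow>
    (('o, 'm) cochain_complex, ('o, 'm) derived_arr, 'o, 'm) cfunctor \<Rightarrow>
    (('o, 'm) cochain_complex \<Rightarrow> 'm) \<Rightarrow> bool" where
  "realization_functor T C F \<phi> \<longleftrightarrow>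
     triangle_functor (Db (induced_exact T C)) T F \<phi> \<and>
     (\<exists>\<eta>. natural_iso (induced_exact T C) T (F \<circ>\<^sub>F Db_embedding (induced_exact T C))
        functor_id \<eta>)"

end

theory Submission
  imports Defs
begin

text \<open>The objects of \<open>D\<^sup>b(C)\<close> are built from stalk complexes by brutal truncation, so an equivalence
  forces \<open>thick(C)\<close> to be everything.  Conversely, the essential image of a fully faithful realization
  functor \<open>F\<close> is closed under suspensions and cones, and the point is that it is closed under direct
  summands although \<open>C\<close> need not be idempotent complete.  Fullness shows that every map
  \<open>P \<rightarrow> \<Sigma>\<^sup>k X\<close> with \<open>P, X \<in> C\<close> and \<open>k > 0\<close> is killed by a deflation \<open>P' \<rightarrow> P\<close>; therefore
  \<open>V\<^sub>n = C * \<Sigma>C * \<dots> * \<Sigma>\<^sup>n C\<close> is closed under extensions by objects of \<open>C\<close> on the right.  If \<open>A\<close> is a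
  retract of \<open>M \<in> V\<^sub>n\<^sub>+\<^sub>1\<close>, the cone of \<open>P \<rightarrow> M \<rightarrow> A\<close>, where \<open>P \<in> C\<close> is the first layer of \<open>M\<close>, is
  then a retract of an object of \<open>\<Sigma>V\<^sub>n\<close>.  By induction the claim reduces to \<open>V\<^sub>0 = C\<close>, which is closed
  under summands in \<open>T\<close>.\<close>

section \<open>Categories and preadditive categories\<close>

text \<open>Fullness enters through roofs. A map from \<open>P\<close> to a positive suspension of
  \<open>X\<close> is the image of a fraction \<open>P <- W -> X[k]\<close> in which
  \<open>W -> P\<close> is a quasi-isomorphism. Locally for deflations the identity of
  \<open>P\<close> lifts to \<open>W\<close>, and the resulting composite goes from a stalk in
  degree 0 to a stalk in degree \<open>- k\<close>, hence vanishes already up to homotopy. To argue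
  this way the derived category has to be opened up: its denominators, defined by acyclic cones,
  must be recognised as the maps inducing local isomorphisms on cohomology, and effaceable complexes
  must be shown acyclic. The latter already relies on closure of \<open>C\<close> under summands,
  which makes \<open>d\<close> a deflation as soon as some composite \<open>d g\<close> is one. The
  obstacle in the summand argument is that the idempotent on \<open>M\<close> does not respect the
  chosen layer \<open>P -> M\<close>. Replacing that layer by a map out of two copies of
  \<open>P\<close> makes the retract visible on cones, at the cost of an extension by one further
  object of \<open>C\<close>; absorbing this cost is the purpose of the closure of the classes
  \<open>V n\<close> under such extensions.\<close>

context category
begin

lemma HomD: "f \<in> Hom A X Y \<Longrightarrow> f \<in> Arr A \<and> Dom A f = X \<and> Cod A f = Y"
  by (simp add: Hom_def)

lemma HomI: "f \<in> Arr A \<Longrightarrow> Dom A f = X \<Longrightarrow> Cod A f = Y \<Longrightarrow> f \<in> Hom A X Y"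
  by (simp add: Hom_def)

lemma Hom_obj: "f \<in> Hom A X Y \<Longrightarrow> X \<in> Obj A \<and> Y \<in> Obj A"
  using Dom_closed Cod_closed by (auto simp: Hom_def)

lemma arr_obj [simp]: "f \<in> Arr A \<Longrightarrow> Dom A f \<in> Obj A" "f \<in> Arr A \<Longrightarrow> Cod A f \<in> Obj A"
  by (auto simp: Dom_closed Cod_closed)

lemma comp_arr [simp]:
  assumes "f \<in> Arr A" "g \<in> Arr A" "Cod A f = Dom A g"
  shows "g \<cdot> f \<in> Arr A" "Dom A (g \<cdot> f) = Dom A f" "Cod A (g \<cdot> f) = Cod A g"
  using Comp_closed[of f "Dom A f" "Dom A g" g "Cod A g"] assms by (auto simp: Hom_def)

lemma ide_arr [simp]:
  assumes "X \<in> Obj A"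
  shows "Ide A X \<in> Arr A" "Dom A (Ide A X) = X" "Cod A (Ide A X) = X"
  using Ide_closed[OF assms] by (auto simp: Hom_def)

lemma comp_ide [simp]: "f \<in> Arr A \<Longrightarrow> Dom A f = X \<Longrightarrow> f \<cdot> Ide A X = f"
  using Comp_Ide[of f] by (auto simp: Hom_def)

lemma ide_comp [simp]: "f \<in> Arr A \<Longrightarrow> Cod A f = X \<Longrightarrow> Ide A X \<cdot> f = f"
  using Ide_Comp[of f] by (auto simp: Hom_def)

lemma assoc [simp]:
  "f \<in> Arr A \<Longrightarrow> g \<in> Arr A \<Longrightarrow> h \<in> Arr A \<Longrightarrow> Cod A f = Dom A g \<Longrightarrow> Cod A g = Dom A h \<Longrightarrow>
    (h \<cdot> g) \<cdot> f = h \<cdot> (g \<cdot> f)"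
  using Comp_assoc[of f _ _ g _ h] by (auto simp: Hom_def)

lemma assoc_cong:
  assumes "g \<cdot> f = k" "f \<in> Arr A" "g \<in> Arr A" "Cod A f = Dom A g" "x \<in> Arr A" "Cod A x = Dom A f"
  shows "g \<cdot> (f \<cdot> x) = k \<cdot> x"
  using assms assoc[of x f g] by simp

lemma is_isoI:
  assumes "f \<in> Hom A X Y" "g \<in> Hom A Y X" "g \<cdot> f = Ide A X" "f \<cdot> g = Ide A Y"
  shows "is_iso A f"
  using assms unfolding is_iso_def by (auto simp: Hom_def)

lemma is_isoE:
  assumes "is_iso A f" "f \<in> Hom A X Y"
  obtains g where "g \<in> Hom A Y X" "g \<cdot> f = Ide A X" "f \<cdot> g = Ide A Y" "is_iso A g"
  using assms unfolding is_iso_def by (auto simp: Hom_def)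

lemma iso_ide [simp]: "X \<in> Obj A \<Longrightarrow> is_iso A (Ide A X)"
  by (rule is_isoI[of _ X X "Ide A X"]) (auto simp: Hom_def)

lemma iso_comp:
  assumes "is_iso A f" "f \<in> Hom A X Y" "is_iso A g" "g \<in> Hom A Y Z"
  shows "is_iso A (g \<cdot> f)"
proof -
  obtain f' where f': "f' \<in> Hom A Y X" "f' \<cdot> f = Ide A X" "f \<cdot> f' = Ide A Y"
    using is_isoE assms by blast
  obtain g' where g': "g' \<in> Hom A Z Y" "g' \<cdot> g = Ide A Y" "g \<cdot> g' = Ide A Z"
    using is_isoE assms by blast
  have a: "g' \<cdot> (g \<cdot> f) = f" "f \<cdot> (f' \<cdot> g') = g'"
    using assoc_cong[OF g'(2), of f] assoc_cong[OF f'(3), of g'] assms f'(1) g'(1)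
    by (auto simp: Hom_def)
  show ?thesis
    by (rule is_isoI[of _ X Z "f' \<cdot> g'"]) (use assms f' g' a in \<open>auto simp: Hom_def\<close>)
qed

lemma isomorphic_refl [simp]: "X \<in> Obj A \<Longrightarrow> isomorphic A X X"
  unfolding isomorphic_def using iso_ide Ide_closed by blast

lemma isomorphic_sym: "isomorphic A X Y \<Longrightarrow> isomorphic A Y X"
  unfolding isomorphic_def by (metis is_isoE)

lemma isomorphic_trans: "isomorphic A X Y \<Longrightarrow> isomorphic A Y Z \<Longrightarrow> isomorphic A X Z"
  unfolding isomorphic_def by (meson iso_comp Comp_closed)

lemma isomorphic_obj: "isomorphic A X Y \<Longrightarrow> X \<in> Obj A \<and> Y \<in> Obj A"
  unfolding isomorphic_def using Hom_obj by blast

end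

lemma functorD:
  assumes "is_functor A B F"
  shows "X \<in> Obj A \<Longrightarrow> fob F X \<in> Obj B"
    "f \<in> Arr A \<Longrightarrow> farr F f \<in> Arr B"
    "f \<in> Arr A \<Longrightarrow> Dom B (farr F f) = fob F (Dom A f)"
    "f \<in> Arr A \<Longrightarrow> Cod B (farr F f) = fob F (Cod A f)"
    "X \<in> Obj A \<Longrightarrow> farr F (Ide A X) = Ide B (fob F X)"
    "f \<in> Arr A \<Longrightarrow> g \<in> Arr A \<Longrightarrow> Cod A f = Dom A g \<Longrightarrow>
       farr F (g \<cdot>\<^bsub>A\<^esub> f) = farr F g \<cdot>\<^bsub>B\<^esub> farr F f"
  using assms unfolding is_functor_def Hom_def by blast+

lemma functor_hom: "is_functor A B F \<Longrightarrow> f \<in> Hom A X Y \<Longrightarrow> farr F f \<in> Hom B (fob F X) (fob F Y)"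
  unfolding is_functor_def Hom_def by blast

lemma functor_iso:
  assumes "category A" "category B" "is_functor A B F" "f \<in> Hom A X Y" "is_iso A f"
  shows "is_iso B (farr F f)"
proof -
  interpret A: category A by fact
  interpret B: category B by fact
  obtain g where g: "g \<in> Hom A Y X" "g \<cdot>\<^bsub>A\<^esub> f = Ide A X" "f \<cdot>\<^bsub>A\<^esub> g = Ide A Y"
    using A.is_isoE assms by blast
  note F = functorD[OF assms(3)]
  show ?thesis
    by (rule B.is_isoI[OF functor_hom[OF assms(3,4)] functor_hom[OF assms(3) g(1)]])
      (use assms(4) g F(5,6) A.Hom_obj[OF assms(4)] in \<open>auto simp: Hom_def simp flip: F(6)\<close>)
qed

lemma functor_isomorphic:
  assumes "category A" "category B" "is_functor A B F" "isomorphic A X Y"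
  shows "isomorphic B (fob F X) (fob F Y)"
  using assms functor_iso[OF assms(1-3)] functor_hom[OF assms(3)] unfolding isomorphic_def by blast

text \<open>Isolates the hom-group axioms: sign rules, the equational criterion for zero objects and
  the matrix calculus of biproducts all follow from them.\<close>

locale preadditive_category = category A
  for A :: "('o, 'm, 'e) add_category_scheme" (structure) +
  assumes hom_comm_group: "X \<in> Obj A \<Longrightarrow> Y \<in> Obj A \<Longrightarrow> comm_group (hom_group A X Y)"
    and Comp_Plus: "f \<in> Hom A X Y \<Longrightarrow> f' \<in> Hom A X Y \<Longrightarrow> g \<in> Hom A Y Z \<Longrightarrow>
          g \<cdot> (f \<oplus> f') = (g \<cdot> f) \<oplus> (g \<cdot> f')"
    and Plus_Comp: "f \<in> Hom A X Y \<Longrightarrow> g \<in> Hom A Y Z \<Longrightarrow> g' \<in> Hom A Y Z \<Longrightarrow>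
          (g \<oplus> g') \<cdot> f = (g \<cdot> f) \<oplus> (g' \<cdot> f)"

sublocale additive_category \<subseteq> preadditive_category
  by (rule preadditive_category.intro[OF category_axioms], unfold preadditive_category_axioms_def)
    (use hom_comm_group Comp_Plus Plus_Comp in blast)

section \<open>Calculus of sums, negatives, zero arrows and biproducts\<close>

context preadditive_category
begin

lemma plus_arr [simp]:
  assumes "f \<in> Arr A" "g \<in> Arr A" "Dom A f = Dom A g" "Cod A f = Cod A g"
  shows "f \<oplus> g \<in> Arr A" "Dom A (f \<oplus> g) = Dom A g" "Cod A (f \<oplus> g) = Cod A g"
proof -
  interpret G: comm_group "hom_group A (Dom A g) (Cod A g)" using assms by (simp add: hom_comm_group)
  show "f \<oplus> g \<in> Arr A" "Dom A (f \<oplus> g) = Dom A g" "Cod A (f \<oplus> g) = Cod A g"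
    using G.m_closed[of f g] assms by (auto simp: hom_group_def Hom_def)
qed

lemma zero_arr [simp]:
  assumes "X \<in> Obj A" "Y \<in> Obj A"
  shows "Zero A X Y \<in> Arr A" "Dom A (Zero A X Y) = X" "Cod A (Zero A X Y) = Y"
proof -
  interpret G: comm_group "hom_group A X Y" using assms by (simp add: hom_comm_group)
  show "Zero A X Y \<in> Arr A" "Dom A (Zero A X Y) = X" "Cod A (Zero A X Y) = Y"
    using G.one_closed by (auto simp: hom_group_def Hom_def)
qed

lemma neg_arr [simp]:
  assumes "f \<in> Arr A"
  shows "neg A f \<in> Arr A" "Dom A (neg A f) = Dom A f" "Cod A (neg A f) = Cod A f"
proof -
  interpret G: comm_group "hom_group A (Dom A f) (Cod A f)" using assms by (simp add: hom_comm_group)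
  show "neg A f \<in> Arr A" "Dom A (neg A f) = Dom A f" "Cod A (neg A f) = Cod A f"
    using G.inv_closed[of f] assms by (auto simp: hom_group_def Hom_def neg_def)
qed

lemma plus_assoc:
  assumes "f \<in> Arr A" "g \<in> Arr A" "h \<in> Arr A" "Dom A f = Dom A g" "Cod A f = Cod A g"
    "Dom A g = Dom A h" "Cod A g = Cod A h"
  shows "(f \<oplus> g) \<oplus> h = f \<oplus> (g \<oplus> h)"
proof -
  interpret G: comm_group "hom_group A (Dom A g) (Cod A g)" using assms by (simp add: hom_comm_group)
  show ?thesis
    using G.m_assoc[of f g h] assms by (auto simp: hom_group_def Hom_def)
qed

lemma plus_comm:
  assumes "f \<in> Arr A" "g \<in> Arr A" "Dom A f = Dom A g" "Cod A f = Cod A g"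
  shows "f \<oplus> g = g \<oplus> f"
proof -
  interpret G: comm_group "hom_group A (Dom A g) (Cod A g)" using assms by (simp add: hom_comm_group)
  show ?thesis
    using G.m_comm[of f g] assms by (auto simp: hom_group_def Hom_def)
qed

lemma plus_lcomm:
  assumes "f \<in> Arr A" "g \<in> Arr A" "h \<in> Arr A" "Dom A f = Dom A g" "Cod A f = Cod A g"
    "Dom A g = Dom A h" "Cod A g = Cod A h"
  shows "f \<oplus> (g \<oplus> h) = g \<oplus> (f \<oplus> h)"
  using plus_assoc[of f g h] plus_assoc[of g f h] plus_comm[of f g] assms by simp

lemmas plus_ac = plus_assoc plus_comm plus_lcomm

lemma zero_plus [simp]:
  assumes "f \<in> Arr A" "Dom A f = X" "Cod A f = Y"
  shows "Zero A X Y \<oplus> f = f" "f \<oplus> Zero A X Y = f"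
proof -
  interpret G: comm_group "hom_group A X Y" using assms by (auto simp: hom_comm_group)
  show "Zero A X Y \<oplus> f = f" "f \<oplus> Zero A X Y = f"
    using G.l_one[of f] G.r_one[of f] assms by (auto simp: hom_group_def Hom_def)
qed

lemma plus_neg [simp]:
  assumes "f \<in> Arr A"
  shows "f \<oplus> neg A f = Zero A (Dom A f) (Cod A f)" "neg A f \<oplus> f = Zero A (Dom A f) (Cod A f)"
proof -
  interpret G: comm_group "hom_group A (Dom A f) (Cod A f)" using assms by (auto simp: hom_comm_group)
  show "f \<oplus> neg A f = Zero A (Dom A f) (Cod A f)" "neg A f \<oplus> f = Zero A (Dom A f) (Cod A f)"
    using G.r_inv[of f] G.l_inv[of f] assms by (auto simp: hom_group_def Hom_def neg_def)
qed

lemma plus_neg_cancel [simp]: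
  assumes "f \<in> Arr A" "g \<in> Arr A" "Dom A f = Dom A g" "Cod A f = Cod A g"
  shows "f \<oplus> (neg A f \<oplus> g) = g" "neg A f \<oplus> (f \<oplus> g) = g"
  using plus_assoc[of f "neg A f" g] plus_assoc[of "neg A f" f g] assms by simp_all

lemma plus_left_cancel:
  assumes "f \<in> Arr A" "g \<in> Arr A" "h \<in> Arr A" "Dom A f = Dom A g" "Cod A f = Cod A g"
    "Dom A h = Dom A g" "Cod A h = Cod A g"
  shows "f \<oplus> g = f \<oplus> h \<longleftrightarrow> g = h"
  using plus_neg_cancel(2)[of f g] plus_neg_cancel(2)[of f h] assms by metis

lemma neg_unique:
  assumes "f \<oplus> g = Zero A X Y" "f \<in> Arr A" "g \<in> Arr A" "Dom A f = X" "Cod A f = Y" "Dom A g = X" "Cod A g = Y"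
  shows "g = neg A f"
  using plus_left_cancel[of f g "neg A f"] assms by simp

lemma neg_neg [simp]: "f \<in> Arr A \<Longrightarrow> neg A (neg A f) = f"
  using neg_unique[of "neg A f" f "Dom A f" "Cod A f"] by simp

lemma neg_zero [simp]: "X \<in> Obj A \<Longrightarrow> Y \<in> Obj A \<Longrightarrow> neg A (Zero A X Y) = Zero A X Y"
  using neg_unique[of "Zero A X Y" "Zero A X Y" X Y] by simp

lemma neg_plus [simp]:
  assumes "f \<in> Arr A" "g \<in> Arr A" "Dom A f = Dom A g" "Cod A f = Cod A g"
  shows "neg A (f \<oplus> g) = neg A f \<oplus> neg A g"
proof -
  have "(f \<oplus> g) \<oplus> (neg A f \<oplus> neg A g) = f \<oplus> (neg A f \<oplus> (g \<oplus> neg A g))"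
    using assms by (simp add: plus_assoc plus_lcomm del: plus_neg_cancel plus_neg)
  also have "\<dots> = Zero A (Dom A g) (Cod A g)" using assms by simp
  finally show ?thesis using neg_unique assms by simp
qed

lemma comp_plus [simp]:
  assumes "f \<in> Arr A" "g \<in> Arr A" "h \<in> Arr A" "Dom A f = Dom A g" "Cod A f = Cod A g" "Cod A g = Dom A h"
  shows "h \<cdot> (f \<oplus> g) = h \<cdot> f \<oplus> h \<cdot> g"
  using Comp_Plus[of f "Dom A g" "Cod A g" g h "Cod A h"] assms by (simp add: Hom_def)

lemma plus_comp [simp]:
  assumes "f \<in> Arr A" "g \<in> Arr A" "h \<in> Arr A" "Dom A g = Dom A h" "Cod A g = Cod A h" "Cod A f = Dom A h"
  shows "(g \<oplus> h) \<cdot> f = g \<cdot> f \<oplus> h \<cdot> f"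
  using Plus_Comp[of f "Dom A f" "Cod A f" g "Cod A h" h] assms by (simp add: Hom_def)

lemma comp_zero [simp]:
  assumes "f \<in> Arr A" "X \<in> Obj A" "Dom A f = Y"
  shows "f \<cdot> Zero A X Y = Zero A X (Cod A f)"
proof -
  have "f \<cdot> Zero A X Y \<oplus> f \<cdot> Zero A X Y = f \<cdot> (Zero A X Y \<oplus> Zero A X Y)"
    using assms by (auto simp del: zero_plus)
  also have "\<dots> = f \<cdot> Zero A X Y \<oplus> Zero A X (Cod A f)" using assms by auto
  finally show ?thesis
    using plus_left_cancel[of "f \<cdot> Zero A X Y" "f \<cdot> Zero A X Y" "Zero A X (Cod A f)"] assms by auto
qed

lemma zero_comp [simp]:
  assumes "f \<in> Arr A" "Z \<in> Obj A" "Cod A f = Y"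
  shows "Zero A Y Z \<cdot> f = Zero A (Dom A f) Z"
proof -
  have "Zero A Y Z \<cdot> f \<oplus> Zero A Y Z \<cdot> f = (Zero A Y Z \<oplus> Zero A Y Z) \<cdot> f"
    using assms by (auto simp del: zero_plus)
  also have "\<dots> = Zero A Y Z \<cdot> f \<oplus> Zero A (Dom A f) Z" using assms by auto
  finally show ?thesis
    using plus_left_cancel[of "Zero A Y Z \<cdot> f" "Zero A Y Z \<cdot> f" "Zero A (Dom A f) Z"] assms by auto
qed

lemma comp_neg [simp]:
  assumes "f \<in> Arr A" "g \<in> Arr A" "Cod A f = Dom A g"
  shows "g \<cdot> neg A f = neg A (g \<cdot> f)"
proof (rule neg_unique)
  show "g \<cdot> f \<oplus> g \<cdot> neg A f = Zero A (Dom A f) (Cod A g)"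
    using comp_plus[of f "neg A f" g] assms by simp
qed (use assms in auto)

lemma neg_comp [simp]:
  assumes "f \<in> Arr A" "g \<in> Arr A" "Cod A f = Dom A g"
  shows "neg A g \<cdot> f = neg A (g \<cdot> f)"
proof (rule neg_unique)
  show "g \<cdot> f \<oplus> neg A g \<cdot> f = Zero A (Dom A f) (Cod A g)"
    using plus_comp[of f g "neg A g"] assms by simp
qed (use assms in auto)

lemma eq_neg_iff:
  assumes "f \<in> Arr A" "g \<in> Arr A" "Dom A f = Dom A g" "Cod A f = Cod A g"
  shows "f = neg A g \<longleftrightarrow> f \<oplus> g = Zero A (Dom A g) (Cod A g)"
  using neg_unique[of g f] plus_comm[of f g] assms by auto

lemma neg_eq_zero [simp]:
  assumes "f \<in> Arr A" "Dom A f = X" "Cod A f = Y"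
  shows "neg A f = Zero A X Y \<longleftrightarrow> f = Zero A X Y"
  using assms arr_obj[of f] neg_neg[of f] neg_zero[of X Y] by metis

lemma diff_zero_iff:
  assumes "f \<in> Arr A" "g \<in> Arr A" "Dom A f = Dom A g" "Cod A f = Cod A g"
  shows "f \<oplus> neg A g = Zero A (Dom A g) (Cod A g) \<longleftrightarrow> f = g"
  using eq_neg_iff[of f "neg A g"] assms by simp

lemma plus_eq_iff:
  assumes "f \<in> Arr A" "g \<in> Arr A" "h \<in> Arr A" "Dom A f = Dom A g" "Cod A f = Cod A g"
    "Dom A h = Dom A g" "Cod A h = Cod A g"
  shows "f \<oplus> g = h \<longleftrightarrow> g = neg A f \<oplus> h"
  using assms plus_neg_cancel(1)[of f h] plus_neg_cancel(2)[of f g] by metis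

text \<open>A vanishing identity makes every arrow into or out of \<open>Z\<close> factor through
  zero. The equational form passes easily along functors and between a category and a full
  subcategory.\<close>

lemma is_zero_iff: "is_zero A Z \<longleftrightarrow> Z \<in> Obj A \<and> Ide A Z = Zero A Z Z"
proof
  assume "is_zero A Z"
  then have Z: "Z \<in> Obj A" "\<exists>!f. f \<in> Hom A Z Z" by (auto simp: is_zero_def)
  moreover have "Ide A Z \<in> Hom A Z Z" "Zero A Z Z \<in> Hom A Z Z" using Z(1) by (auto simp: Hom_def)
  ultimately show "Z \<in> Obj A \<and> Ide A Z = Zero A Z Z" by blast
next
  assume Z: "Z \<in> Obj A \<and> Ide A Z = Zero A Z Z"
  then have "f = Zero A X Z" if "f \<in> Hom A X Z" for f X
    using that ide_comp[of f Z] zero_comp[of f Z Z] by (auto simp: Hom_def)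
  moreover have "f = Zero A Z X" if "f \<in> Hom A Z X" for f X
    using that comp_ide[of f Z] comp_zero[of f Z Z] Z by (auto simp: Hom_def)
  moreover have "Zero A X Z \<in> Hom A X Z" "Zero A Z X \<in> Hom A Z X" if "X \<in> Obj A" for X
    using that Z by (auto simp: Hom_def)
  ultimately show "is_zero A Z" unfolding is_zero_def using Z by blast
qed

lemma zero_obj_arr:
  assumes "is_zero A Z" "f \<in> Arr A"
  shows "Cod A f = Z \<Longrightarrow> f = Zero A (Dom A f) Z" "Dom A f = Z \<Longrightarrow> f = Zero A Z (Cod A f)"
  using assms ide_comp[of f Z] comp_ide[of f Z] zero_comp[of f Z Z] comp_zero[of f Z Z]
  by (auto simp: is_zero_iff)

lemma zero_obj_eq:
  assumes "is_zero A Z" "f \<in> Arr A" "g \<in> Arr A" "Dom A f = Dom A g" "Cod A f = Cod A g"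
    "Dom A g = Z \<or> Cod A g = Z"
  shows "f = g"
  using assms zero_obj_arr by metis

lemma iso_zero: "isomorphic A X Z \<Longrightarrow> is_zero A Z \<Longrightarrow> is_zero A X"
proof -
  assume "isomorphic A X Z" and Z: "is_zero A Z"
  then obtain f where f: "f \<in> Hom A X Z" "is_iso A f" unfolding isomorphic_def by blast
  then obtain g where g: "g \<in> Hom A Z X" "g \<cdot> f = Ide A X" using is_isoE by metis
  have "f = Zero A X Z" using zero_obj_arr(1)[OF Z, of f] f by (auto simp: Hom_def)
  then show ?thesis using g f Hom_obj[OF f(1)] by (auto simp: is_zero_iff Hom_def)
qed

lemma zero_isomorphic: "is_zero A X \<Longrightarrow> is_zero A Y \<Longrightarrow> isomorphic A X Y"
proof -
  assume X: "is_zero A X" and Y: "is_zero A Y"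
  then have o: "X \<in> Obj A" "Y \<in> Obj A" by (auto simp: is_zero_def)
  have "is_iso A (Zero A X Y)"
    by (rule is_isoI[of _ X Y "Zero A Y X"]) (use o X Y in \<open>auto simp: Hom_def is_zero_iff\<close>)
  moreover have "Zero A X Y \<in> Hom A X Y" using o by (simp add: Hom_def)
  ultimately show ?thesis unfolding isomorphic_def by blast
qed

lemma biproductD:
  assumes "biproduct A X Y B i j p q"
  shows "X \<in> Obj A" "Y \<in> Obj A" "B \<in> Obj A" "i \<in> Arr A" "j \<in> Arr A" "p \<in> Arr A" "q \<in> Arr A"
    "Dom A i = X" "Cod A i = B" "Dom A j = Y" "Cod A j = B"
    "Dom A p = B" "Cod A p = X" "Dom A q = B" "Cod A q = Y"
    "p \<cdot> i = Ide A X" "q \<cdot> j = Ide A Y" "p \<cdot> j = Zero A Y X" "q \<cdot> i = Zero A X Y"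
    "i \<cdot> p \<oplus> j \<cdot> q = Ide A B"
  using assms by (auto simp: biproduct_def Hom_def)

lemma biproduct_assoc:
  assumes "biproduct A X Y B i j p q" "f \<in> Arr A"
  shows "Cod A f = X \<Longrightarrow> p \<cdot> (i \<cdot> f) = f" "Cod A f = Y \<Longrightarrow> q \<cdot> (j \<cdot> f) = f"
    "Cod A f = Y \<Longrightarrow> p \<cdot> (j \<cdot> f) = Zero A (Dom A f) X"
    "Cod A f = X \<Longrightarrow> q \<cdot> (i \<cdot> f) = Zero A (Dom A f) Y"
  using biproductD[OF assms(1)] assms(2) assoc_cong[of p i _ f] assoc_cong[of q j _ f]
    assoc_cong[of p j _ f] assoc_cong[of q i _ f] by simp_all

text \<open>The identity of \<open>B\<close> is \<open>i p + j q\<close>, so two components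
  determine an arrow; identities for cone differentials are checked this way, entry by
  entry.\<close>

lemma biproduct_into_eqI:
  assumes b: "biproduct A X Y B i j p q"
    and fg: "f \<in> Arr A" "g \<in> Arr A" "Cod A f = B" "Cod A g = B" "Dom A f = Dom A g"
    and eq: "p \<cdot> f = p \<cdot> g" "q \<cdot> f = q \<cdot> g"
  shows "f = g"
proof -
  note B = biproductD[OF b]
  have *: "h = i \<cdot> (p \<cdot> h) \<oplus> j \<cdot> (q \<cdot> h)" if "h \<in> Arr A" "Cod A h = B" for h
    using that B plus_comp[of h "i \<cdot> p" "j \<cdot> q"] by simp
  show ?thesis using *[of f] *[of g] fg eq by simp
qed

lemma biproduct_zero:
  assumes b: "biproduct A X Y B i j p q" and z: "is_zero A X" "is_zero A Y"
  shows "is_zero A B"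
proof -
  note B = biproductD[OF b]
  have "i = Zero A X B" "j = Zero A Y B" using z B zero_obj_arr(2) by metis+
  then have "Ide A B = Zero A B B" using B(20) B by simp
  then show ?thesis using B(3) by (simp add: is_zero_iff)
qed

end

section \<open>The homotopy category\<close>

lemma class_arr_simps [simp]:
  "source (htpy_class A X Y f) = X" "target (htpy_class A X Y f) = Y"
  "reps (htpy_class A X Y f) = htpy_rel A X Y `` {f}"
  by (simp_all add: htpy_class_def)

lemma Kb_simps [simp]:
  "Obj (Kb A) = bounded_complexes A" "Dom (Kb A) = source" "Cod (Kb A) = target"
  "Ide (Kb A) = (\<lambda>X. htpy_class A X X (\<lambda>n. Ide A (cob X n)))"
  "Comp (Kb A) = htpy_comp A"
  "Zero (Kb A) = (\<lambda>X Y. htpy_class A X Y (\<lambda>n. Zero A (cob X n) (cob Y n)))"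
  "Susp (Kb A) = htpy_susp A"
  "Arr (Kb A) = {Class_arr X Y c | X Y c. X \<in> bounded_complexes A \<and> Y \<in> bounded_complexes A \<and>
               c \<in> chain_maps A X Y // htpy_rel A X Y}"
  by (simp_all add: Kb_def close_triangles_def)

context additive_category
begin

lemma cxD [simp]:
  assumes "X \<in> bounded_complexes A"
  shows "cob X n \<in> Obj A" "cdiff X n \<in> Arr A" "Dom A (cdiff X n) = cob X n" "Cod A (cdiff X n) = cob X (n + 1)"
    "m = n + 1 \<Longrightarrow> cdiff X m \<cdot> cdiff X n = Zero A (cob X n) (cob X (m + 1))"
  using assms by (auto simp: bounded_complexes_def Hom_def add.assoc)

lemma cx_dd_comp [simp]:
  assumes "X \<in> bounded_complexes A" "m = n + 1" "f \<in> Arr A" "Cod A f = cob X n"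
  shows "cdiff X m \<cdot> (cdiff X n \<cdot> f) = Zero A (Dom A f) (cob X (m + 1))"
  using assms assoc_cong[OF cxD(5)[OF assms(1,2)], of f] by simp

lemma chainD:
  assumes "f \<in> chain_maps A X Y"
  shows "f n \<in> Arr A" "Dom A (f n) = cob X n" "Cod A (f n) = cob Y n"
  using assms by (auto simp: chain_maps_def Hom_def)

lemma chain_comm: "f \<in> chain_maps A X Y \<Longrightarrow> cdiff Y n \<cdot> f n = f (n + 1) \<cdot> cdiff X n"
  by (auto simp: chain_maps_def)

lemma chain_comm': "f \<in> chain_maps A X Y \<Longrightarrow> cdiff Y (n - 1) \<cdot> f (n - 1) = f n \<cdot> cdiff X (n - 1)"
  using chain_comm[of f X Y "n - 1"] by simp

lemma chain_mapsI:
  assumes "\<And>n. f n \<in> Arr A" "\<And>n. Dom A (f n) = cob X n" "\<And>n. Cod A (f n) = cob Y n"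
    "\<And>n. cdiff Y n \<cdot> f n = f (n + 1) \<cdot> cdiff X n"
  shows "f \<in> chain_maps A X Y"
  using assms by (auto simp: chain_maps_def Hom_def)

lemma htpyI:
  assumes "f \<in> chain_maps A X Y" "g \<in> chain_maps A X Y"
    "\<And>n. h n \<in> Arr A" "\<And>n. Dom A (h n) = cob X n" "\<And>n. Cod A (h n) = cob Y (n - 1)"
    "\<And>n. g n = f n \<oplus> (cdiff Y (n - 1) \<cdot> h n \<oplus> h (n + 1) \<cdot> cdiff X n)"
  shows "(f, g) \<in> htpy_rel A X Y"
  using assms by (auto simp: htpy_rel_def Hom_def)

lemma htpyE:
  assumes "(f, g) \<in> htpy_rel A X Y"
  obtains h where "f \<in> chain_maps A X Y" "g \<in> chain_maps A X Y"
    "\<And>n. h n \<in> Arr A" "\<And>n. Dom A (h n) = cob X n" "\<And>n. Cod A (h n) = cob Y (n - 1)"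
    "\<And>n. g n = f n \<oplus> (cdiff Y (n - 1) \<cdot> h n \<oplus> h (n + 1) \<cdot> cdiff X n)"
  using assms by (auto simp: htpy_rel_def Hom_def)

lemma chain_ide: "X \<in> bounded_complexes A \<Longrightarrow> (\<lambda>n. Ide A (cob X n)) \<in> chain_maps A X X"
  by (rule chain_mapsI) auto

lemma chain_zero:
  "X \<in> bounded_complexes A \<Longrightarrow> Y \<in> bounded_complexes A \<Longrightarrow>
    (\<lambda>n. Zero A (cob X n) (cob Y n)) \<in> chain_maps A X Y"
  by (rule chain_mapsI) auto

lemma chain_comp:
  assumes "X \<in> bounded_complexes A" "Y \<in> bounded_complexes A" "Z \<in> bounded_complexes A"
    and f: "f \<in> chain_maps A X Y" and g: "g \<in> chain_maps A Y Z"
  shows "(\<lambda>n. g n \<cdot> f n) \<in> chain_maps A X Z"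
proof (rule chain_mapsI)
  fix n
  show "cdiff Z n \<cdot> (g n \<cdot> f n) = (g (n + 1) \<cdot> f (n + 1)) \<cdot> cdiff X n"
    using assms assoc_cong[OF chain_comm[OF g, of n], of "f n"] chain_comm[OF f, of n]
    by (simp add: chainD[OF f] chainD[OF g])
qed (use assms in \<open>auto simp: chainD[OF f] chainD[OF g]\<close>)

lemma chain_diff:
  assumes "X \<in> bounded_complexes A" "Y \<in> bounded_complexes A"
    and f: "f \<in> chain_maps A X Y" and g: "g \<in> chain_maps A X Y"
  shows "(\<lambda>n. f n \<oplus> neg A (g n)) \<in> chain_maps A X Y"
  by (rule chain_mapsI) (use assms in \<open>auto simp: chain_comm[OF f] chain_comm[OF g] chainD[OF f] chainD[OF g]\<close>)

lemma htpy_refl: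
  assumes "X \<in> bounded_complexes A" "Y \<in> bounded_complexes A" "f \<in> chain_maps A X Y"
  shows "(f, f) \<in> htpy_rel A X Y"
  by (rule htpyI[where h = "\<lambda>n. Zero A (cob X n) (cob Y (n - 1))"])
    (use assms in \<open>auto simp: chainD[OF assms(3)]\<close>)

lemma htpy_sym:
  assumes X: "X \<in> bounded_complexes A" and Y: "Y \<in> bounded_complexes A" and "(f, g) \<in> htpy_rel A X Y"
  shows "(g, f) \<in> htpy_rel A X Y"
proof -
  from assms(3) obtain h where h: "f \<in> chain_maps A X Y" "g \<in> chain_maps A X Y"
    "\<And>n. h n \<in> Arr A" "\<And>n. Dom A (h n) = cob X n" "\<And>n. Cod A (h n) = cob Y (n - 1)"
    "\<And>n. g n = f n \<oplus> (cdiff Y (n - 1) \<cdot> h n \<oplus> h (n + 1) \<cdot> cdiff X n)" by (elim htpyE) blast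
  note [simp] = chainD[OF h(1)] chainD[OF h(2)]
  let ?b = "\<lambda>n. cdiff Y (n - 1) \<cdot> h n \<oplus> h (n + 1) \<cdot> cdiff X n"
  have b: "?b n \<in> Arr A" "Dom A (?b n) = cob X n" "Cod A (?b n) = cob Y n" for n using X Y h by auto
  have "f n = g n \<oplus> neg A (?b n)" for n
    unfolding h(6) using b[of n] h(1) plus_assoc[of "f n" "?b n" "neg A (?b n)"]
    by (simp del: neg_plus)
  moreover have "neg A (?b n) = cdiff Y (n - 1) \<cdot> neg A (h n) \<oplus> neg A (h (n + 1)) \<cdot> cdiff X n" for n
    using X Y h by simp
  ultimately show ?thesis
    by (intro htpyI[where h = "\<lambda>n. neg A (h n)"]) (use h in auto)
qed

lemma htpy_trans:
  assumes X: "X \<in> bounded_complexes A" and Y: "Y \<in> bounded_complexes A"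
    and "(f, g) \<in> htpy_rel A X Y" "(g, k) \<in> htpy_rel A X Y"
  shows "(f, k) \<in> htpy_rel A X Y"
proof -
  from assms(3) obtain h where h: "f \<in> chain_maps A X Y" "g \<in> chain_maps A X Y"
    "\<And>n. h n \<in> Arr A" "\<And>n. Dom A (h n) = cob X n" "\<And>n. Cod A (h n) = cob Y (n - 1)"
    "\<And>n. g n = f n \<oplus> (cdiff Y (n - 1) \<cdot> h n \<oplus> h (n + 1) \<cdot> cdiff X n)" by (elim htpyE) blast
  from assms(4) obtain h' where h': "k \<in> chain_maps A X Y"
    "\<And>n. h' n \<in> Arr A" "\<And>n. Dom A (h' n) = cob X n" "\<And>n. Cod A (h' n) = cob Y (n - 1)"
    "\<And>n. k n = g n \<oplus> (cdiff Y (n - 1) \<cdot> h' n \<oplus> h' (n + 1) \<cdot> cdiff X n)" by (elim htpyE) blast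
  note [simp] = chainD[OF h(1)] chainD[OF h(2)] chainD[OF h'(1)]
  show ?thesis
    by (rule htpyI[where h = "\<lambda>n. h n \<oplus> h' n"]) (use X Y h(1,3-5) h'(1-4) in \<open>auto simp: h(6) h'(5) plus_ac\<close>)
qed

lemma htpy_equiv:
  assumes X: "X \<in> bounded_complexes A" and Y: "Y \<in> bounded_complexes A"
  shows "equiv (chain_maps A X Y) (htpy_rel A X Y)"
proof (rule equivI)
  show "htpy_rel A X Y \<subseteq> chain_maps A X Y \<times> chain_maps A X Y" by (auto simp: htpy_rel_def)
  show "refl_on (chain_maps A X Y) (htpy_rel A X Y)"
    using htpy_refl[OF X Y] by (auto simp: refl_on_def)
  show "sym (htpy_rel A X Y)" using htpy_sym[OF X Y] by (auto intro: symI)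
  show "trans (htpy_rel A X Y)" using htpy_trans[OF X Y] by (blast intro: transI)
qed

lemma htpy_comp_left:
  assumes X: "X \<in> bounded_complexes A" and Y: "Y \<in> bounded_complexes A" and Z: "Z \<in> bounded_complexes A"
    and "(f, g) \<in> htpy_rel A X Y" and k: "k \<in> chain_maps A Y Z"
  shows "(\<lambda>n. k n \<cdot> f n, \<lambda>n. k n \<cdot> g n) \<in> htpy_rel A X Z"
proof -
  from assms(4) obtain h where h: "f \<in> chain_maps A X Y" "g \<in> chain_maps A X Y"
    "\<And>n. h n \<in> Arr A" "\<And>n. Dom A (h n) = cob X n" "\<And>n. Cod A (h n) = cob Y (n - 1)"
    "\<And>n. g n = f n \<oplus> (cdiff Y (n - 1) \<cdot> h n \<oplus> h (n + 1) \<cdot> cdiff X n)" by (elim htpyE) blast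
  note [simp] = chainD[OF h(1)] chainD[OF h(2)] chainD[OF k]
  have *: "cdiff Z (n - 1) \<cdot> (k (n - 1) \<cdot> h n) = k n \<cdot> (cdiff Y (n - 1) \<cdot> h n)" for n
    using assoc_cong[OF chain_comm'[OF k, of n], of "h n"] Y Z k h by simp
  show ?thesis
    by (rule htpyI[where h = "\<lambda>n. k (n - 1) \<cdot> h n", OF chain_comp[OF X Y Z h(1) k] chain_comp[OF X Y Z h(2) k]])
      (use X Y Z k h(1,3-5) * in \<open>auto simp: h(6)\<close>)
qed

lemma htpy_comp_right:
  assumes X: "X \<in> bounded_complexes A" and Y: "Y \<in> bounded_complexes A" and W: "W \<in> bounded_complexes A"
    and "(f, g) \<in> htpy_rel A X Y" and k: "k \<in> chain_maps A W X"
  shows "(\<lambda>n. f n \<cdot> k n, \<lambda>n. g n \<cdot> k n) \<in> htpy_rel A W Y"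
proof -
  from assms(4) obtain h where h: "f \<in> chain_maps A X Y" "g \<in> chain_maps A X Y"
    "\<And>n. h n \<in> Arr A" "\<And>n. Dom A (h n) = cob X n" "\<And>n. Cod A (h n) = cob Y (n - 1)"
    "\<And>n. g n = f n \<oplus> (cdiff Y (n - 1) \<cdot> h n \<oplus> h (n + 1) \<cdot> cdiff X n)" by (elim htpyE) blast
  note [simp] = chainD[OF h(1)] chainD[OF h(2)] chainD[OF k]
  show ?thesis
    by (rule htpyI[where h = "\<lambda>n. h n \<cdot> k n", OF chain_comp[OF W X Y k h(1)] chain_comp[OF W X Y k h(2)]])
      (use X Y W k h(1,3-5) in \<open>auto simp: h(6) chain_comm[OF k]\<close>)
qed

lemma htpy_class_eq:
  assumes "X \<in> bounded_complexes A" "Y \<in> bounded_complexes A" "f \<in> chain_maps A X Y" "g \<in> chain_maps A X Y"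
  shows "htpy_class A X Y f = htpy_class A X Y g \<longleftrightarrow> (f, g) \<in> htpy_rel A X Y"
  using eq_equiv_class_iff[OF htpy_equiv[OF assms(1,2)] assms(3,4)] by (simp add: htpy_class_def)

lemma Kb_Hom_iff:
  "\<alpha> \<in> Hom (Kb A) X Y \<longleftrightarrow> X \<in> bounded_complexes A \<and> Y \<in> bounded_complexes A \<and>
     (\<exists>f \<in> chain_maps A X Y. \<alpha> = htpy_class A X Y f)"
  unfolding Hom_def by (force simp: quotient_def htpy_class_def)

lemma Kb_homI: "X \<in> bounded_complexes A \<Longrightarrow> Y \<in> bounded_complexes A \<Longrightarrow> f \<in> chain_maps A X Y \<Longrightarrow>
    htpy_class A X Y f \<in> Hom (Kb A) X Y"
  using Kb_Hom_iff by blast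

lemma Kb_homE:
  assumes "\<alpha> \<in> Hom (Kb A) X Y"
  obtains f where "X \<in> bounded_complexes A" "Y \<in> bounded_complexes A" "f \<in> chain_maps A X Y"
    "\<alpha> = htpy_class A X Y f"
  using assms Kb_Hom_iff by blast

text \<open>\<open>htpy_comp\<close> multiplies all pairs of representatives and saturates.
  Homotopies survive composition on either side, so one pair of representatives already computes the
  class.\<close>

lemma Kb_comp:
  assumes X: "X \<in> bounded_complexes A" and Y: "Y \<in> bounded_complexes A" and Z: "Z \<in> bounded_complexes A"
    and f: "f \<in> chain_maps A X Y" and g: "g \<in> chain_maps A Y Z"
  shows "htpy_comp A (htpy_class A Y Z g) (htpy_class A X Y f) = htpy_class A X Z (\<lambda>n. g n \<cdot> f n)"
proof -
  note gf = chain_comp[OF X Y Z f g]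
  note eqv = htpy_equiv[OF X Z]
  have rel: "((\<lambda>n. g n \<cdot> f n), (\<lambda>n. g' n \<cdot> f' n)) \<in> htpy_rel A X Z"
    if "(f, f') \<in> htpy_rel A X Y" "(g, g') \<in> htpy_rel A Y Z" for f' g'
  proof -
    have f': "f' \<in> chain_maps A X Y" using that(1) by (auto simp: htpy_rel_def)
    show ?thesis
      using htpy_trans[OF X Z htpy_comp_left[OF X Y Z that(1) g] htpy_comp_right[OF Y Z X that(2) f']] .
  qed
  have "htpy_rel A X Z `` {\<lambda>n. g' n \<cdot> f' n |f' g'. (f, f') \<in> htpy_rel A X Y \<and> (g, g') \<in> htpy_rel A Y Z}
    = htpy_rel A X Z `` {\<lambda>n. g n \<cdot> f n}" (is "?L = ?R")
  proof
    show "?L \<subseteq> ?R" using rel htpy_trans[OF X Z] by blast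
    show "?R \<subseteq> ?L" using htpy_refl[OF X Y f] htpy_refl[OF Y Z g] by blast
  qed
  then show ?thesis by (simp add: htpy_comp_def htpy_class_def)
qed

lemma category_Kb: "category (Kb A)"
proof
  fix f assume "f \<in> Arr (Kb A)"
  then show "Dom (Kb A) f \<in> Obj (Kb A)" "Cod (Kb A) f \<in> Obj (Kb A)" by auto
next
  fix X assume "X \<in> Obj (Kb A)"
  then show "Ide (Kb A) X \<in> Hom (Kb A) X X" using Kb_homI[OF _ _ chain_ide] by simp
next
  fix f g X Y Z assume "f \<in> Hom (Kb A) X Y" "g \<in> Hom (Kb A) Y Z"
  then show "Comp (Kb A) g f \<in> Hom (Kb A) X Z"
    by (elim Kb_homE) (simp add: Kb_comp chain_comp Kb_homI)
next
  fix f X Y assume "f \<in> Hom (Kb A) X Y"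
  then obtain k where k: "X \<in> bounded_complexes A" "Y \<in> bounded_complexes A" "k \<in> chain_maps A X Y"
    "f = htpy_class A X Y k" by (elim Kb_homE)
  then show "Comp (Kb A) f (Ide (Kb A) X) = f" "Comp (Kb A) (Ide (Kb A) Y) f = f"
    by (simp_all add: Kb_comp chain_ide chainD[OF k(3)])
next
  fix f g h W X Y Z assume "f \<in> Hom (Kb A) W X" "g \<in> Hom (Kb A) X Y" "h \<in> Hom (Kb A) Y Z"
  then obtain f' g' h' where k: "W \<in> bounded_complexes A" "X \<in> bounded_complexes A" "Y \<in> bounded_complexes A"
    "Z \<in> bounded_complexes A" "f' \<in> chain_maps A W X" "f = htpy_class A W X f'"
    "g' \<in> chain_maps A X Y" "g = htpy_class A X Y g'" "h' \<in> chain_maps A Y Z" "h = htpy_class A Y Z h'"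
    by (elim Kb_homE) blast
  note [simp] = chainD[OF k(5)] chainD[OF k(7)] chainD[OF k(9)]
  show "Comp (Kb A) (Comp (Kb A) h g) f = Comp (Kb A) h (Comp (Kb A) g f)"
    using k by (simp add: Kb_comp chain_comp)
qed

lemma Kb_zero_hom: "X \<in> bounded_complexes A \<Longrightarrow> Y \<in> bounded_complexes A \<Longrightarrow> Zero (Kb A) X Y \<in> Hom (Kb A) X Y"
  using Kb_homI[OF _ _ chain_zero] by simp

lemma Kb_comp_zero:
  assumes "f \<in> Hom (Kb A) X Y" "W \<in> bounded_complexes A"
  shows "Comp (Kb A) f (Zero (Kb A) W X) = Zero (Kb A) W Y"
proof -
  from assms(1) obtain k where k: "X \<in> bounded_complexes A" "Y \<in> bounded_complexes A" "k \<in> chain_maps A X Y"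
    "f = htpy_class A X Y k" by (elim Kb_homE)
  then show ?thesis using assms(2) by (simp add: Kb_comp chain_zero chainD[OF k(3)])
qed

lemma Kb_zero_comp:
  assumes "f \<in> Hom (Kb A) X Y" "Z \<in> bounded_complexes A"
  shows "Comp (Kb A) (Zero (Kb A) Y Z) f = Zero (Kb A) X Z"
proof -
  from assms(1) obtain k where k: "X \<in> bounded_complexes A" "Y \<in> bounded_complexes A" "k \<in> chain_maps A X Y"
    "f = htpy_class A X Y k" by (elim Kb_homE)
  then show ?thesis using assms(2) by (simp add: Kb_comp chain_zero chainD[OF k(3)])
qed

text \<open>The same homotopy witnesses both relations: \<open>0 = (f - g) + b\<close> and
  \<open>g = f + b\<close> are one equation, with \<open>b\<close> the boundary term of the
  homotopy.\<close>

lemma htpy_diff_iff: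
  assumes X: "X \<in> bounded_complexes A" and Y: "Y \<in> bounded_complexes A"
    and f: "f \<in> chain_maps A X Y" and g: "g \<in> chain_maps A X Y"
  shows "((\<lambda>n. f n \<oplus> neg A (g n)), (\<lambda>n. Zero A (cob X n) (cob Y n))) \<in> htpy_rel A X Y
    \<longleftrightarrow> (f, g) \<in> htpy_rel A X Y"
proof -
  note [simp] = chainD[OF f] chainD[OF g]
  have *: "Zero A (cob X n) (cob Y n) = (f n \<oplus> neg A (g n)) \<oplus> b \<longleftrightarrow> g n = f n \<oplus> b"
    if "b \<in> Arr A" "Dom A b = cob X n" "Cod A b = cob Y n" for n b
  proof -
    have "(f n \<oplus> neg A (g n)) \<oplus> b = neg A (g n) \<oplus> (f n \<oplus> b)"
      using that by (subst plus_comm[of "f n"]) (simp_all add: plus_assoc)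
    then have "Zero A (cob X n) (cob Y n) = (f n \<oplus> neg A (g n)) \<oplus> b
        \<longleftrightarrow> neg A (g n) \<oplus> (f n \<oplus> b) = Zero A (cob X n) (cob Y n)" by (simp only: eq_commute)
    also have "\<dots> \<longleftrightarrow> f n \<oplus> b = neg A (neg A (g n)) \<oplus> Zero A (cob X n) (cob Y n)"
      by (rule plus_eq_iff) (use that X Y in simp_all)
    also have "\<dots> \<longleftrightarrow> g n = f n \<oplus> b" using that by (simp add: eq_commute[of _ "g n"])
    finally show ?thesis .
  qed
  have "(\<forall>n. h n \<in> Hom A (cob X n) (cob Y (n - 1)) \<and>
       Zero A (cob X n) (cob Y n) = (f n \<oplus> neg A (g n)) \<oplus> (cdiff Y (n - 1) \<cdot> h n \<oplus> h (n + 1) \<cdot> cdiff X n)) \<longleftrightarrow>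
     (\<forall>n. h n \<in> Hom A (cob X n) (cob Y (n - 1)) \<and>
       g n = f n \<oplus> (cdiff Y (n - 1) \<cdot> h n \<oplus> h (n + 1) \<cdot> cdiff X n))" for h
  proof -
    have iff: "Zero A (cob X n) (cob Y n) = (f n \<oplus> neg A (g n)) \<oplus> (cdiff Y (n - 1) \<cdot> h n \<oplus> h (n + 1) \<cdot> cdiff X n)
       \<longleftrightarrow> g n = f n \<oplus> (cdiff Y (n - 1) \<cdot> h n \<oplus> h (n + 1) \<cdot> cdiff X n)"
      if "\<forall>n. h n \<in> Hom A (cob X n) (cob Y (n - 1))" for n
      by (rule *) (use X Y that[rule_format, of n] that[rule_format, of "n + 1"] in \<open>simp_all add: Hom_def\<close>)
    show ?thesis
    proof (cases "\<forall>n. h n \<in> Hom A (cob X n) (cob Y (n - 1))")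
      case True
      then show ?thesis using iff[OF True] by simp
    next
      case False
      then show ?thesis by blast
    qed
  qed
  then show ?thesis
    using chain_diff[OF X Y f g] chain_zero[OF X Y] f g by (simp add: htpy_rel_def)
qed

text \<open>Replaces subtraction in the homotopy category. The class of \<open>f - g\<close> turns
  equality of composites into vanishing, on both sides, which reduces cancellation of
  quasi-isomorphisms to the case of zero.\<close>

lemma Kb_diff:
  assumes "\<alpha> \<in> Hom (Kb A) X Y" "\<beta> \<in> Hom (Kb A) X Y"
  shows "\<exists>\<delta> \<in> Hom (Kb A) X Y.
    (\<forall>W. \<forall>\<gamma> \<in> Hom (Kb A) W X. Comp (Kb A) \<delta> \<gamma> = Zero (Kb A) W Y \<longleftrightarrow> Comp (Kb A) \<alpha> \<gamma> = Comp (Kb A) \<beta> \<gamma>) \<and>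
    (\<forall>Z. \<forall>\<gamma> \<in> Hom (Kb A) Y Z. Comp (Kb A) \<gamma> \<delta> = Zero (Kb A) X Z \<longleftrightarrow> Comp (Kb A) \<gamma> \<alpha> = Comp (Kb A) \<gamma> \<beta>)"
proof -
  from assms obtain f g where X: "X \<in> bounded_complexes A" and Y: "Y \<in> bounded_complexes A"
    and f: "f \<in> chain_maps A X Y" "\<alpha> = htpy_class A X Y f"
    and g: "g \<in> chain_maps A X Y" "\<beta> = htpy_class A X Y g" by (elim Kb_homE) blast
  let ?d = "\<lambda>n. f n \<oplus> neg A (g n)"
  note d = chain_diff[OF X Y f(1) g(1)]
  show ?thesis
  proof (intro bexI[of _ "htpy_class A X Y ?d"] conjI allI ballI)
    fix W \<gamma> assume "\<gamma> \<in> Hom (Kb A) W X"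
    then obtain k where W: "W \<in> bounded_complexes A" and k: "k \<in> chain_maps A W X" "\<gamma> = htpy_class A W X k"
      by (elim Kb_homE)
    note [simp] = chainD[OF f(1)] chainD[OF g(1)] chainD[OF k(1)]
    have "(\<lambda>n. ?d n \<cdot> k n) = (\<lambda>n. f n \<cdot> k n \<oplus> neg A (g n \<cdot> k n))" using k f g by auto
    then show "Comp (Kb A) (htpy_class A X Y ?d) \<gamma> = Zero (Kb A) W Y \<longleftrightarrow> Comp (Kb A) \<alpha> \<gamma> = Comp (Kb A) \<beta> \<gamma>"
      using htpy_diff_iff[OF W Y chain_comp[OF W X Y k(1) f(1)] chain_comp[OF W X Y k(1) g(1)]]
        htpy_class_eq[OF W Y chain_comp[OF W X Y k(1) f(1)] chain_comp[OF W X Y k(1) g(1)]]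
        chain_diff[OF W Y chain_comp[OF W X Y k(1) f(1)] chain_comp[OF W X Y k(1) g(1)]]
      by (simp add: k f g Kb_comp X Y W d htpy_class_eq chain_comp chain_zero chain_diff)
  next
    fix Z \<gamma> assume "\<gamma> \<in> Hom (Kb A) Y Z"
    then obtain k where Z: "Z \<in> bounded_complexes A" and k: "k \<in> chain_maps A Y Z" "\<gamma> = htpy_class A Y Z k"
      by (elim Kb_homE)
    note [simp] = chainD[OF f(1)] chainD[OF g(1)] chainD[OF k(1)]
    have "(\<lambda>n. k n \<cdot> ?d n) = (\<lambda>n. k n \<cdot> f n \<oplus> neg A (k n \<cdot> g n))" using k f g by auto
    then show "Comp (Kb A) \<gamma> (htpy_class A X Y ?d) = Zero (Kb A) X Z \<longleftrightarrow> Comp (Kb A) \<gamma> \<alpha> = Comp (Kb A) \<gamma> \<beta>"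
      using htpy_diff_iff[OF X Z chain_comp[OF X Y Z f(1) k(1)] chain_comp[OF X Y Z g(1) k(1)]]
        htpy_class_eq[OF X Z chain_comp[OF X Y Z f(1) k(1)] chain_comp[OF X Y Z g(1) k(1)]]
        chain_diff[OF X Z chain_comp[OF X Y Z f(1) k(1)] chain_comp[OF X Y Z g(1) k(1)]]
      by (simp add: k f g Kb_comp X Y Z d htpy_class_eq chain_comp chain_zero chain_diff)
  qed (rule Kb_homI[OF X Y d])
qed

end

lemma close_triangles_simps [simp]:
  "Obj (close_triangles T) = Obj T" "Arr (close_triangles T) = Arr T" "Dom (close_triangles T) = Dom T"
  "Cod (close_triangles T) = Cod T" "Ide (close_triangles T) = Ide T" "Comp (close_triangles T) = Comp T"
  "Plus (close_triangles T) = Plus T" "Zero (close_triangles T) = Zero T" "Susp (close_triangles T) = Susp T"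
  "Hom (close_triangles T) = Hom T" "is_iso (close_triangles T) = is_iso T"
  by (simp_all add: close_triangles_def Hom_def is_iso_def fun_eq_iff)

lemma triangle_iso_close: "triangle_iso (close_triangles T) = triangle_iso T"
  by (simp add: triangle_iso_def is_triangle_def)

lemma Tri_close: "Tri (close_triangles T) = {t. \<exists>t' \<in> Tri T. triangle_iso (close_triangles T) t t'}"
  unfolding triangle_iso_close by (simp add: close_triangles_def)

text \<open>The comparison is given by identities; the input about the suspension is its value on
  identities, and this is the equation that has to be checked for the Verdier quotient.\<close>

lemma triangle_iso_refl:
  fixes T (structure)
  assumes "category T" "is_triangle T u v w"
    and "\<And>X. X \<in> Obj T \<Longrightarrow> farr (Susp T) (Ide T X) = Ide T (fob (Susp T) X)"
  shows "triangle_iso T (u, v, w) (u, v, w)"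
proof -
  interpret category T by fact
  note t = assms(2)[unfolded is_triangle_def]
  show ?thesis unfolding triangle_iso_def prod.case
    by (intro conjI assms(2) exI[of _ "Ide T (Dom T u)"] exI[of _ "Ide T (Dom T v)"] exI[of _ "Ide T (Dom T w)"])
      (use t assms(3) in \<open>auto simp: Hom_def\<close>)
qed

lemma shift_simps [simp]:
  "cob (shift A X) n = cob X (n + 1)" "cdiff (shift A X) n = neg A (cdiff X (n + 1))"
  by (simp_all add: shift_def)

lemma htpy_susp_ob [simp]: "fob (htpy_susp A) = shift A"
  by (simp add: htpy_susp_def)

text \<open>Carries the same sign as \<open>shift\<close>, so the two signs cancel and
  \<open>shift A (unshift A X)\<close> is \<open>X\<close> itself, not merely an isomorphic
  complex.\<close>

definition unshift :: "('o, 'm, 'e) add_category_scheme \<Rightarrow> ('o, 'm) cochain_complex \<Rightarrow> ('o, 'm) cochain_complex" where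
  "unshift A X = \<lparr>cob = (\<lambda>n. cob X (n - 1)), cdiff = (\<lambda>n. neg A (cdiff X (n - 1)))\<rparr>"

text \<open>Stalks occur in every degree because cohomology is tested in every degree. The zero
  object is the arbitrary \<open>zero_obj\<close> of the embedding, so degree 0 agrees literally
  with \<open>stalk_functor\<close>.\<close>

definition stalk :: "('o, 'm, 'e) add_category_scheme \<Rightarrow> int \<Rightarrow> 'o \<Rightarrow> ('o, 'm) cochain_complex" where
  "stalk A k P = \<lparr>cob = (\<lambda>n. if n = k then P else zero_obj A),
     cdiff = (\<lambda>n. Zero A (if n = k then P else zero_obj A) (if n + 1 = k then P else zero_obj A))\<rparr>"

definition stalk_map :: "('o, 'm, 'e) add_category_scheme \<Rightarrow> int \<Rightarrow> 'm \<Rightarrow> ('o, 'm) htpy_arr" where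
  "stalk_map A k f = htpy_class A (stalk A k (Dom A f)) (stalk A k (Cod A f))
     (\<lambda>n. if n = k then f else Zero A (zero_obj A) (zero_obj A))"

lemma stalk_functor_simps: "fob (stalk_functor A) = stalk A 0" "farr (stalk_functor A) = stalk_map A 0"
  unfolding stalk_functor_def stalk_def stalk_map_def Let_def by (simp_all only: cfunctor.simps)

text \<open>The generating triangles before closure under isomorphism. Exactness is verified on
  them, where maps and homotopies have explicit representatives.\<close>

definition std_triangles :: "('o, 'm, 'e) add_category_scheme \<Rightarrow>
    (('o, 'm) htpy_arr \<times> ('o, 'm) htpy_arr \<times> ('o, 'm) htpy_arr) set" where
  "std_triangles A = {(htpy_class A X Y f, htpy_class A Y Z j, htpy_class A Z (shift A X) p)
              | X Y Z f i j p q.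
              X \<in> bounded_complexes A \<and> Y \<in> bounded_complexes A \<and> Z \<in> bounded_complexes A \<and>
              f \<in> chain_maps A X Y \<and> mapping_cone A X Y f Z i j p q}"

lemma Tri_Kb: "Tri (Kb A) = {t. \<exists>t' \<in> std_triangles A. triangle_iso (Kb A) t t'}"
  unfolding Kb_def Tri_close by (simp add: std_triangles_def)

section \<open>The shift as an autoequivalence of the bounded homotopy category\<close>

context additive_category
begin

lemma cxI:
  assumes "\<And>n. cob X n \<in> Obj A" "\<And>n. cdiff X n \<in> Arr A" "\<And>n. Dom A (cdiff X n) = cob X n"
    "\<And>n. Cod A (cdiff X n) = cob X (n + 1)" "\<And>n. cdiff X (n + 1) \<cdot> cdiff X n = Zero A (cob X n) (cob X (n + 2))"
    "\<And>n. \<bar>n\<bar> > b \<Longrightarrow> is_zero A (cob X n)"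
  shows "X \<in> bounded_complexes A"
  unfolding bounded_complexes_def Hom_def
  by (intro CollectI conjI allI exI[of _ b] impI assms)

lemma cx_bound:
  assumes "X \<in> bounded_complexes A"
  obtains b where "b \<ge> 0" "\<And>n. \<bar>n\<bar> > b \<Longrightarrow> is_zero A (cob X n)"
proof -
  obtain b where "\<And>n. \<bar>n\<bar> > b \<Longrightarrow> is_zero A (cob X n)" using assms unfolding bounded_complexes_def by blast
  then show ?thesis using that[of "\<bar>b\<bar>"] by simp
qed

lemma shift_cx [simp]:
  assumes X: "X \<in> bounded_complexes A"
  shows "shift A X \<in> bounded_complexes A"
proof -
  obtain b where b: "b \<ge> 0" "\<And>n. \<bar>n\<bar> > b \<Longrightarrow> is_zero A (cob X n)" using cx_bound[OF X] by blast
  show ?thesis by (rule cxI[where b = "b + 1"]) (use X b in simp_all)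
qed

lemma unshift_cx [simp]:
  assumes X: "X \<in> bounded_complexes A"
  shows "unshift A X \<in> bounded_complexes A"
proof -
  obtain b where b: "b \<ge> 0" "\<And>n. \<bar>n\<bar> > b \<Longrightarrow> is_zero A (cob X n)" using cx_bound[OF X] by blast
  have "n + 2 - 1 = n + (1::int)" for n by simp
  then show ?thesis by (intro cxI[where b = "b + 1"]) (use X b in \<open>simp_all add: unshift_def add.commute[of 1]\<close>)
qed

lemma shift_unshift [simp]: "X \<in> bounded_complexes A \<Longrightarrow> shift A (unshift A X) = X"
  by (simp add: shift_def unshift_def)

lemma chain_shift_iff:
  assumes X: "X \<in> bounded_complexes A" and Y: "Y \<in> bounded_complexes A"
  shows "(\<lambda>n. f (n + 1)) \<in> chain_maps A (shift A X) (shift A Y) \<longleftrightarrow> f \<in> chain_maps A X Y"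
proof
  assume f: "f \<in> chain_maps A X Y"
  note [simp] = chainD[OF f]
  show "(\<lambda>n. f (n + 1)) \<in> chain_maps A (shift A X) (shift A Y)"
    by (rule chain_mapsI) (use X Y f chain_comm[OF f] in auto)
next
  assume "(\<lambda>n. f (n + 1)) \<in> chain_maps A (shift A X) (shift A Y)"
  then have *: "f (n + 1) \<in> Hom A (cob X (n + 1)) (cob Y (n + 1)) \<and>
      neg A (cdiff Y (n + 1)) \<cdot> f (n + 1) = f (n + 1 + 1) \<cdot> neg A (cdiff X (n + 1))" for n
    by (simp add: chain_maps_def)
  have f: "f n \<in> Hom A (cob X n) (cob Y n)" for n
    using *[of "n - 1"] by simp
  have c: "neg A (cdiff Y n \<cdot> f n) = neg A (f (n + 1) \<cdot> cdiff X n)" for n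
    using *[of "n - 1", THEN conjunct2] f[of n] f[of "n + 1"] X Y by (auto simp: Hom_def)
  have "cdiff Y n \<cdot> f n = f (n + 1) \<cdot> cdiff X n" for n
    using arg_cong[OF c[of n], of "neg A"] f[of n] f[of "n + 1"] X Y by (simp add: Hom_def)
  then show "f \<in> chain_maps A X Y" using f by (simp add: chain_maps_def)
qed

text \<open>For chain maps the signs of both shifted differentials cancel; in a homotopy each
  summand contains a single differential, so the homotopy itself changes sign.\<close>

lemma htpy_shift_iff:
  assumes X: "X \<in> bounded_complexes A" and Y: "Y \<in> bounded_complexes A"
  shows "((\<lambda>n. f (n + 1)), (\<lambda>n. g (n + 1))) \<in> htpy_rel A (shift A X) (shift A Y) \<longleftrightarrow> (f, g) \<in> htpy_rel A X Y"
proof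
  assume "(f, g) \<in> htpy_rel A X Y"
  then obtain h where h: "f \<in> chain_maps A X Y" "g \<in> chain_maps A X Y"
    "\<And>n. h n \<in> Arr A" "\<And>n. Dom A (h n) = cob X n" "\<And>n. Cod A (h n) = cob Y (n - 1)"
    "\<And>n. g n = f n \<oplus> (cdiff Y (n - 1) \<cdot> h n \<oplus> h (n + 1) \<cdot> cdiff X n)" by (elim htpyE) blast
  note [simp] = chainD[OF h(1)] chainD[OF h(2)]
  show "((\<lambda>n. f (n + 1)), (\<lambda>n. g (n + 1))) \<in> htpy_rel A (shift A X) (shift A Y)"
    by (rule htpyI[where h = "\<lambda>n. neg A (h (n + 1))",
          OF iffD2[OF chain_shift_iff[OF X Y] h(1)] iffD2[OF chain_shift_iff[OF X Y] h(2)]])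
      (use X Y h(1-5) in \<open>auto simp: h(6)\<close>)
next
  assume "((\<lambda>n. f (n + 1)), (\<lambda>n. g (n + 1))) \<in> htpy_rel A (shift A X) (shift A Y)"
  then obtain h where fg: "(\<lambda>n. f (n + 1)) \<in> chain_maps A (shift A X) (shift A Y)"
      "(\<lambda>n. g (n + 1)) \<in> chain_maps A (shift A X) (shift A Y)"
    and h': "\<And>n. h n \<in> Arr A" "\<And>n. Dom A (h n) = cob (shift A X) n" "\<And>n. Cod A (h n) = cob (shift A Y) (n - 1)"
    "\<And>n. g (n + 1) = f (n + 1) \<oplus> (cdiff (shift A Y) (n - 1) \<cdot> h n \<oplus> h (n + 1) \<cdot> cdiff (shift A X) n)"
    by (elim htpyE) blast
  note h = iffD1[OF chain_shift_iff[OF X Y] fg(1)] iffD1[OF chain_shift_iff[OF X Y] fg(2)] h'[simplified]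
  note [simp] = chainD[OF h(1)] chainD[OF h(2)]
  show "(f, g) \<in> htpy_rel A X Y"
  proof (rule htpyI[where h = "\<lambda>n. neg A (h (n - 1))"])
    fix n show "g n = f n \<oplus> (cdiff Y (n - 1) \<cdot> neg A (h (n - 1)) \<oplus> neg A (h (n + 1 - 1)) \<cdot> cdiff X n)"
      using X Y h(1-5) h(6)[of "n - 1"] by simp
  qed (use X Y h(1-5) in auto)
qed

lemma Kb_susp:
  assumes X: "X \<in> bounded_complexes A" and Y: "Y \<in> bounded_complexes A" and f: "f \<in> chain_maps A X Y"
  shows "farr (htpy_susp A) (htpy_class A X Y f) = htpy_class A (shift A X) (shift A Y) (\<lambda>n. f (n + 1))"
proof -
  have "htpy_rel A (shift A X) (shift A Y) `` {\<lambda>n. f' (n + 1) |f'. (f, f') \<in> htpy_rel A X Y}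
    = htpy_rel A (shift A X) (shift A Y) `` {\<lambda>n. f (n + 1)}" (is "?L = ?R")
  proof
    show "?L \<subseteq> ?R" using htpy_trans[OF shift_cx[OF X] shift_cx[OF Y]]
      by (auto simp flip: htpy_shift_iff[OF X Y])
    show "?R \<subseteq> ?L" using htpy_refl[OF X Y f] by blast
  qed
  then show ?thesis by (simp add: htpy_susp_def htpy_class_def)
qed

lemma is_functor_Kb_susp: "is_functor (Kb A) (Kb A) (Susp (Kb A))"
proof -
  interpret K: category "Kb A" by (rule category_Kb)
  show ?thesis unfolding is_functor_def
  proof (intro conjI ballI impI)
    fix f assume "f \<in> Arr (Kb A)"
    then have "f \<in> Hom (Kb A) (source f) (target f)" by (auto simp: Hom_def)
    then obtain f' X Y where k: "X \<in> bounded_complexes A" "Y \<in> bounded_complexes A"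
      "f' \<in> chain_maps A X Y" "f = htpy_class A X Y f'" by (elim Kb_homE) blast
    then show "farr (Susp (Kb A)) f \<in> Hom (Kb A) (fob (Susp (Kb A)) (Dom (Kb A) f)) (fob (Susp (Kb A)) (Cod (Kb A) f))"
      by (simp add: Kb_susp Kb_homI chain_shift_iff)
  next
    fix f g assume "f \<in> Arr (Kb A)" "g \<in> Arr (Kb A)" "Cod (Kb A) f = Dom (Kb A) g"
    then have "f \<in> Hom (Kb A) (source f) (target f)" "g \<in> Hom (Kb A) (target f) (target g)" by (auto simp: Hom_def)
    then obtain f' g' X Y Z where k: "X \<in> bounded_complexes A" "Y \<in> bounded_complexes A"
      "Z \<in> bounded_complexes A" "f' \<in> chain_maps A X Y" "f = htpy_class A X Y f'"
      "g' \<in> chain_maps A Y Z" "g = htpy_class A Y Z g'" by (elim Kb_homE) blast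
    show "farr (Susp (Kb A)) (Comp (Kb A) g f) = Comp (Kb A) (farr (Susp (Kb A)) g) (farr (Susp (Kb A)) f)"
      using k chain_comp[OF k(1-4,6)] by (simp add: Kb_comp Kb_susp chain_shift_iff)
  qed (auto simp: Kb_susp chain_ide)
qed

text \<open>Reindexing by \<open>n - 1\<close> undoes the shift on representatives. Together with
  \<open>unshift\<close> this permits maps, and later denominators, to be desuspended.\<close>

lemma bij_betw_Kb_susp:
  assumes X: "X \<in> bounded_complexes A" and Y: "Y \<in> bounded_complexes A"
  shows "bij_betw (farr (htpy_susp A)) (Hom (Kb A) X Y) (Hom (Kb A) (shift A X) (shift A Y))"
proof (rule bij_betw_imageI)
  show "inj_on (farr (htpy_susp A)) (Hom (Kb A) X Y)"
  proof (rule inj_onI)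
    fix \<alpha> \<beta> assume a: "\<alpha> \<in> Hom (Kb A) X Y" "\<beta> \<in> Hom (Kb A) X Y" "farr (htpy_susp A) \<alpha> = farr (htpy_susp A) \<beta>"
    then obtain f g where k: "f \<in> chain_maps A X Y" "\<alpha> = htpy_class A X Y f"
      "g \<in> chain_maps A X Y" "\<beta> = htpy_class A X Y g" by (elim Kb_homE) blast
    then show "\<alpha> = \<beta>" using a(3) X Y by (simp add: Kb_susp htpy_class_eq chain_shift_iff htpy_shift_iff)
  qed
  show "farr (htpy_susp A) ` Hom (Kb A) X Y = Hom (Kb A) (shift A X) (shift A Y)"
  proof (intro equalityI subsetI)
    fix \<alpha> assume "\<alpha> \<in> farr (htpy_susp A) ` Hom (Kb A) X Y"
    then show "\<alpha> \<in> Hom (Kb A) (shift A X) (shift A Y)"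
      using functor_hom[OF is_functor_Kb_susp] by auto
  next
    fix \<alpha> assume "\<alpha> \<in> Hom (Kb A) (shift A X) (shift A Y)"
    then obtain f where f: "f \<in> chain_maps A (shift A X) (shift A Y)" "\<alpha> = htpy_class A (shift A X) (shift A Y) f"
      by (elim Kb_homE)
    have g: "(\<lambda>n. f (n - 1)) \<in> chain_maps A X Y"
      using chain_shift_iff[OF X Y, of "\<lambda>n. f (n - 1)"] f(1) by simp
    have "\<alpha> = farr (htpy_susp A) (htpy_class A X Y (\<lambda>n. f (n - 1)))" using f g X Y by (simp add: Kb_susp)
    then show "\<alpha> \<in> farr (htpy_susp A) ` Hom (Kb A) X Y" using Kb_homI[OF X Y g] by blast
  qed
qed

end

section \<open>Mapping cones\<close>

locale cone = additive_category A for A :: "('o, 'm, 'e) add_category_scheme" (structure) +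
  fixes X Y Z :: "('o, 'm) cochain_complex" and f i j p q :: "int \<Rightarrow> 'm"
  assumes X: "X \<in> bounded_complexes A" and Y: "Y \<in> bounded_complexes A"
    and f: "f \<in> chain_maps A X Y" and mc: "mapping_cone A X Y f Z i j p q"
begin

lemma bp: "biproduct A (cob X (n + 1)) (cob Y n) (cob Z n) (i n) (j n) (p n) (q n)"
  using mc by (simp add: mapping_cone_def)

lemmas B = biproductD[OF bp]

lemma bpD [simp]:
  "cob Z n \<in> Obj A" "i n \<in> Arr A" "j n \<in> Arr A" "p n \<in> Arr A" "q n \<in> Arr A"
  "Dom A (i n) = cob X (n + 1)" "Cod A (i n) = cob Z n" "Dom A (j n) = cob Y n" "Cod A (j n) = cob Z n"
  "Dom A (p n) = cob Z n" "Cod A (p n) = cob X (n + 1)" "Dom A (q n) = cob Z n" "Cod A (q n) = cob Y n"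
  "p n \<cdot> i n = Ide A (cob X (n + 1))" "q n \<cdot> j n = Ide A (cob Y n)"
  "p n \<cdot> j n = Zero A (cob Y n) (cob X (n + 1))" "q n \<cdot> i n = Zero A (cob X (n + 1)) (cob Y n)"
  by (fact B)+

lemmas bp_comp [simp] = biproduct_assoc[OF bp]

lemmas XYf [simp] = X Y f chainD[OF f]

lemma dZ: "cdiff Z n = ((i (n + 1) \<cdot> neg A (cdiff X (n + 1)) \<cdot> p n) \<oplus> (j (n + 1) \<cdot> f (n + 1) \<cdot> p n)) \<oplus>
   (j (n + 1) \<cdot> cdiff Y n \<cdot> q n)"
  using mc by (simp add: mapping_cone_def)

lemma dZ_arr [simp]:
  "cdiff Z n \<in> Arr A" "Dom A (cdiff Z n) = cob Z n" "Cod A (cdiff Z n) = cob Z (n + 1)"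
  unfolding dZ by auto

lemma p_d: "m = n + 1 \<Longrightarrow> p m \<cdot> cdiff Z n = neg A (cdiff X m \<cdot> p n)"
  unfolding dZ by simp

lemma q_d: "m = n + 1 \<Longrightarrow> q m \<cdot> cdiff Z n = f m \<cdot> p n \<oplus> cdiff Y n \<cdot> q n"
  unfolding dZ by simp

lemma d_i: "cdiff Z n \<cdot> i n = neg A (i (n + 1) \<cdot> cdiff X (n + 1)) \<oplus> j (n + 1) \<cdot> f (n + 1)"
  unfolding dZ by simp

lemma d_j: "cdiff Z n \<cdot> j n = j (n + 1) \<cdot> cdiff Y n"
  unfolding dZ by simp

lemma p_d_comp: "m = n + 1 \<Longrightarrow> g \<in> Arr A \<Longrightarrow> Cod A g = cob Z n \<Longrightarrow>
    p m \<cdot> (cdiff Z n \<cdot> g) = neg A (cdiff X m \<cdot> p n \<cdot> g)"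
  by (subst assoc_cong[OF p_d]) auto

lemma q_d_comp: "m = n + 1 \<Longrightarrow> g \<in> Arr A \<Longrightarrow> Cod A g = cob Z n \<Longrightarrow>
    q m \<cdot> (cdiff Z n \<cdot> g) = f m \<cdot> p n \<cdot> g \<oplus> cdiff Y n \<cdot> q n \<cdot> g"
  by (subst assoc_cong[OF q_d]) auto

lemmas pq_d = p_d q_d p_d_comp q_d_comp

lemma Z [simp]: "Z \<in> bounded_complexes A"
proof -
  obtain b1 where b1: "b1 \<ge> 0" "\<And>n. \<bar>n\<bar> > b1 \<Longrightarrow> is_zero A (cob X n)" using cx_bound[OF X] by blast
  obtain b2 where b2: "b2 \<ge> 0" "\<And>n. \<bar>n\<bar> > b2 \<Longrightarrow> is_zero A (cob Y n)" using cx_bound[OF Y] by blast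
  show ?thesis
  \<comment> \<open>In degree \<open>n\<close> the cone contains \<open>X\<close> in degree
    \<open>n + 1\<close>, hence the extra 1 in the bound for \<open>X\<close>.\<close>
  proof (rule cxI[where b = "max (b1 + 1) b2"])
    fix n
    have fd: "cdiff Y (n + 1) \<cdot> (f (n + 1) \<cdot> p n) = f (n + 2) \<cdot> (cdiff X (n + 1) \<cdot> p n)"
      using assoc_cong[OF chain_comm[OF f, of "n + 1"], of "p n"] by (simp add: add.assoc)
    show "cdiff Z (n + 1) \<cdot> cdiff Z n = Zero A (cob Z n) (cob Z (n + 2))"
      by (rule biproduct_into_eqI[OF bp[of "n + 2"]]) (use fd in \<open>auto simp: pq_d add.assoc\<close>)
    assume n: "\<bar>n\<bar> > max (b1 + 1) b2"
    show "is_zero A (cob Z n)" by (rule biproduct_zero[OF bp]) (use n b1 b2 in auto)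
  qed auto
qed

lemma chain_j: "j \<in> chain_maps A Y Z"
  by (rule chain_mapsI) (auto simp: d_j)

lemma chain_p: "p \<in> chain_maps A Z (shift A X)"
  by (rule chain_mapsI) (auto simp: pq_d)

text \<open>The inclusions \<open>i\<close> of the summands of \<open>X\<close> are the null
  homotopy: the formula for \<open>d i\<close> rearranges to \<open>d i + i d = j f\<close>.\<close>

lemma jf_null: "((\<lambda>n. Zero A (cob X n) (cob Z n)), (\<lambda>n. j n \<cdot> f n)) \<in> htpy_rel A X Z"
proof (rule htpyI[where h = "\<lambda>n. i (n - 1)", OF chain_zero[OF X Z] chain_comp[OF X Y Z f chain_j]])
  fix n
  show "j n \<cdot> f n = Zero A (cob X n) (cob Z n) \<oplus> (cdiff Z (n - 1) \<cdot> i (n - 1) \<oplus> i (n + 1 - 1) \<cdot> cdiff X n)"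
    by (simp add: d_i plus_assoc plus_comm[of "j n \<cdot> f n" "i n \<cdot> cdiff X n"])
qed auto

text \<open>The projections \<open>q\<close> are the null homotopy: \<open>q d = f p + d q\<close>,
  and the shifted differential contributes the \<open>- d q\<close> that leaves
  \<open>f p\<close>.\<close>

lemma fp_null: "((\<lambda>n. Zero A (cob Z n) (cob (shift A Y) n)), (\<lambda>n. f (n + 1) \<cdot> p n)) \<in> htpy_rel A Z (shift A Y)"
proof (rule htpyI[where h = q])
  show "(\<lambda>n. Zero A (cob Z n) (cob (shift A Y) n)) \<in> chain_maps A Z (shift A Y)" by (rule chain_zero) auto
  show "(\<lambda>n. f (n + 1) \<cdot> p n) \<in> chain_maps A Z (shift A Y)"
    using chain_comp[OF Z _ _ chain_p, of "shift A Y" "\<lambda>n. f (n + 1)"] by (simp add: chain_shift_iff)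
  fix n
  show "f (n + 1) \<cdot> p n = Zero A (cob Z n) (cob (shift A Y) n) \<oplus>
      (cdiff (shift A Y) (n - 1) \<cdot> q n \<oplus> q (n + 1) \<cdot> cdiff Z n)"
    by (simp add: pq_d plus_comm[of "f (n + 1) \<cdot> p n"])
qed auto

text \<open>A null homotopy \<open>h\<close> of \<open>j g\<close> has two components. The
  \<open>X\<close>-component \<open>p h\<close> is a chain map \<open>a\<close>, and the
  \<open>Y\<close>-component \<open>q h\<close> is a homotopy from \<open>f a\<close> to
  \<open>g\<close>.\<close>

lemma exact_Y:
  assumes W: "W \<in> bounded_complexes A" and g: "g \<in> chain_maps A W Y"
    and null: "((\<lambda>n. Zero A (cob W n) (cob Z n)), (\<lambda>n. j n \<cdot> g n)) \<in> htpy_rel A W Z"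
  shows "\<exists>a \<in> chain_maps A W X. ((\<lambda>n. f n \<cdot> a n), g) \<in> htpy_rel A W Y"
proof -
  from null obtain h where h: "\<And>n. h n \<in> Arr A" "\<And>n. Dom A (h n) = cob W n" "\<And>n. Cod A (h n) = cob Z (n - 1)"
    "\<And>n. j n \<cdot> g n = Zero A (cob W n) (cob Z n) \<oplus> (cdiff Z (n - 1) \<cdot> h n \<oplus> h (n + 1) \<cdot> cdiff W n)"
    by (elim htpyE) blast
  note [simp] = W chainD[OF g] h(1-3)
  define a where "a = (\<lambda>n. p (n - 1) \<cdot> h n)"
  have a: "a \<in> chain_maps A W X"
  proof (rule chain_mapsI)
    fix n
    have "p n \<cdot> (j n \<cdot> g n) = neg A (cdiff X n \<cdot> a n) \<oplus> a (n + 1) \<cdot> cdiff W n"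
      unfolding h(4) by (simp add: pq_d a_def)
    then have "neg A (cdiff X n \<cdot> a n) \<oplus> a (n + 1) \<cdot> cdiff W n = Zero A (cob W n) (cob X (n + 1))" by simp
    then show "cdiff X n \<cdot> a n = a (n + 1) \<cdot> cdiff W n"
      by (subst (asm) plus_eq_iff) (simp_all add: a_def)
  qed (auto simp: a_def)
  have "((\<lambda>n. f n \<cdot> a n), g) \<in> htpy_rel A W Y"
  proof (rule htpyI[where h = "\<lambda>n. q (n - 1) \<cdot> h n", OF chain_comp[OF W X Y a f] g])
    fix n
    have "q n \<cdot> (j n \<cdot> g n) = (f n \<cdot> a n \<oplus> cdiff Y (n - 1) \<cdot> q (n - 1) \<cdot> h n) \<oplus> q n \<cdot> h (n + 1) \<cdot> cdiff W n"
      unfolding h(4) by (simp add: pq_d a_def)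
    then show "g n = f n \<cdot> a n \<oplus> (cdiff Y (n - 1) \<cdot> q (n - 1) \<cdot> h n \<oplus> (q (n + 1 - 1) \<cdot> h (n + 1)) \<cdot> cdiff W n)"
      by (simp add: plus_assoc a_def)
  qed auto
  then show ?thesis using a by blast
qed

text \<open>With \<open>h\<close> a null homotopy of \<open>p g\<close>, the chain map
  \<open>q g - f h\<close> lifts \<open>g\<close> to \<open>Y\<close>: subtracting
  \<open>f h\<close> repairs the failure of \<open>q g\<close> to commute with differentials, and
  \<open>i h\<close> is the remaining homotopy.\<close>

lemma exact_Z:
  assumes W: "W \<in> bounded_complexes A" and g: "g \<in> chain_maps A W Z"
    and null: "((\<lambda>n. Zero A (cob W n) (cob (shift A X) n)), (\<lambda>n. p n \<cdot> g n)) \<in> htpy_rel A W (shift A X)"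
  shows "\<exists>b \<in> chain_maps A W Y. ((\<lambda>n. j n \<cdot> b n), g) \<in> htpy_rel A W Z"
proof -
  from null obtain h where h': "\<And>n. h n \<in> Arr A" "\<And>n. Dom A (h n) = cob W n" "\<And>n. Cod A (h n) = cob (shift A X) (n - 1)"
    "\<And>n. p n \<cdot> g n = Zero A (cob W n) (cob (shift A X) n) \<oplus>
       (cdiff (shift A X) (n - 1) \<cdot> h n \<oplus> h (n + 1) \<cdot> cdiff W n)"
    by (elim htpyE) blast
  have h: "Cod A (h n) = cob X n" for n using h'(3)[of n] by simp
  note [simp] = W chainD[OF g] h h'(1,2)
  have pg: "p n \<cdot> g n = neg A (cdiff X n \<cdot> h n) \<oplus> h (n + 1) \<cdot> cdiff W n" for n
    using h'(4)[of n] by simp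
  define b where "b = (\<lambda>n. q n \<cdot> g n \<oplus> neg A (f n \<cdot> h n))"
  have fd: "cdiff Y n \<cdot> (f n \<cdot> h n) = f (n + 1) \<cdot> (cdiff X n \<cdot> h n)" for n
    using assoc_cong[OF chain_comm[OF f, of n], of "h n"] by simp
  have b: "b \<in> chain_maps A W Y"
  proof (rule chain_mapsI)
    fix n
    have "f (n + 1) \<cdot> (p n \<cdot> g n) \<oplus> cdiff Y n \<cdot> (q n \<cdot> g n) = q (n + 1) \<cdot> (cdiff Z n \<cdot> g n)"
      by (simp add: pq_d)
    also have "\<dots> = (q (n + 1) \<cdot> g (n + 1)) \<cdot> cdiff W n" by (simp add: chain_comm[OF g])
    finally have "f (n + 1) \<cdot> (p n \<cdot> g n) \<oplus> cdiff Y n \<cdot> (q n \<cdot> g n) = q (n + 1) \<cdot> g (n + 1) \<cdot> cdiff W n" by simp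
    then have "cdiff Y n \<cdot> q n \<cdot> g n = neg A (f (n + 1) \<cdot> (p n \<cdot> g n)) \<oplus> q (n + 1) \<cdot> g (n + 1) \<cdot> cdiff W n"
      by (subst (asm) plus_eq_iff) auto
    then show "cdiff Y n \<cdot> b n = b (n + 1) \<cdot> cdiff W n"
      unfolding pg b_def by (simp add: fd plus_assoc plus_comm[of _ "neg A (f (n + 1) \<cdot> (cdiff X n \<cdot> h n))"]
          plus_comm[of "neg A (f (n + 1) \<cdot> (h (n + 1) \<cdot> cdiff W n))"])
  qed (auto simp: b_def)
  have "((\<lambda>n. j n \<cdot> b n), g) \<in> htpy_rel A W Z"
  proof (rule htpyI[where h = "\<lambda>n. i (n - 1) \<cdot> h n", OF chain_comp[OF W Y Z b chain_j] g])
    fix n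
    have d: "cdiff Z (n - 1) \<cdot> (i (n - 1) \<cdot> h n) = neg A (i n \<cdot> cdiff X n \<cdot> h n) \<oplus> j n \<cdot> f n \<cdot> h n"
      using assoc_cong[OF d_i[of "n - 1"], of "h n"] by simp
    show "g n = j n \<cdot> b n \<oplus> (cdiff Z (n - 1) \<cdot> (i (n - 1) \<cdot> h n) \<oplus> (i (n + 1 - 1) \<cdot> h (n + 1)) \<cdot> cdiff W n)"
    proof (rule biproduct_into_eqI[OF bp[of n]])
      show "q n \<cdot> g n = q n \<cdot> (j n \<cdot> b n \<oplus> (cdiff Z (n - 1) \<cdot> (i (n - 1) \<cdot> h n) \<oplus> (i (n + 1 - 1) \<cdot> h (n + 1)) \<cdot> cdiff W n))"
        by (simp add: d b_def plus_assoc)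
    qed (simp_all add: d b_def pg)
  qed (simp_all add: b_def)
  then show ?thesis using b by blast
qed

text \<open>A null homotopy \<open>h\<close> of \<open>f g\<close> is exactly the missing second
  component: \<open>i g + j h\<close> is a chain map into the cone, lifting \<open>g\<close>
  strictly.\<close>

lemma exact_SX:
  assumes W: "W \<in> bounded_complexes A" and g: "g \<in> chain_maps A W (shift A X)"
    and null: "((\<lambda>n. Zero A (cob W n) (cob (shift A Y) n)), (\<lambda>n. f (n + 1) \<cdot> g n)) \<in> htpy_rel A W (shift A Y)"
  shows "\<exists>c \<in> chain_maps A W Z. (\<lambda>n. p n \<cdot> c n) = g"
proof -
  from null obtain h where h': "\<And>n. h n \<in> Arr A" "\<And>n. Dom A (h n) = cob W n" "\<And>n. Cod A (h n) = cob (shift A Y) (n - 1)"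
    "\<And>n. f (n + 1) \<cdot> g n = Zero A (cob W n) (cob (shift A Y) n) \<oplus>
       (cdiff (shift A Y) (n - 1) \<cdot> h n \<oplus> h (n + 1) \<cdot> cdiff W n)"
    by (elim htpyE) blast
  have h: "Cod A (h n) = cob Y n" for n using h'(3)[of n] by simp
  have g': "Cod A (g n) = cob X (n + 1)" for n using chainD[OF g] by simp
  note [simp] = W chainD(1,2)[OF g] g' h h'(1,2)
  have fg: "f (n + 1) \<cdot> g n = neg A (cdiff Y n \<cdot> h n) \<oplus> h (n + 1) \<cdot> cdiff W n" for n
    using h'(4)[of n] by simp
  define c where "c = (\<lambda>n. i n \<cdot> g n \<oplus> j n \<cdot> h n)"
  have "c \<in> chain_maps A W Z"
  proof (rule chain_mapsI)
    fix n
    have pc: "neg A (cdiff X (n + 1) \<cdot> g n) = g (n + 1) \<cdot> cdiff W n"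
      using chain_comm[OF g, of n] by simp
    show "cdiff Z n \<cdot> c n = c (n + 1) \<cdot> cdiff W n"
    proof (rule biproduct_into_eqI[OF bp])
      show "p (n + 1) \<cdot> (cdiff Z n \<cdot> c n) = p (n + 1) \<cdot> (c (n + 1) \<cdot> cdiff W n)"
        by (simp add: c_def pq_d pc)
      show "q (n + 1) \<cdot> (cdiff Z n \<cdot> c n) = q (n + 1) \<cdot> (c (n + 1) \<cdot> cdiff W n)"
        by (simp add: c_def pq_d fg plus_assoc plus_comm[of "h (n + 1) \<cdot> cdiff W n"])
    qed (simp_all add: c_def)
  qed (simp_all add: c_def)
  moreover have "(\<lambda>n. p n \<cdot> c n) = g" by (simp add: c_def)
  ultimately show ?thesis by blast
qed

end

section \<open>Mapping cone triangles in the homotopy category and their exactness\<close>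

context additive_category
begin

lemma cone_exists:
  assumes X: "X \<in> bounded_complexes A" and Y: "Y \<in> bounded_complexes A" and f: "f \<in> chain_maps A X Y"
  shows "\<exists>Z i j p q. mapping_cone A X Y f Z i j p q"
proof -
  have "\<forall>n. \<exists>B i j p q. biproduct A (cob X (n + 1)) (cob Y n) B i j p q"
    using biproduct_exists X Y by (auto simp: is_direct_sum_def)
  then obtain B i j p q where b: "\<And>n. biproduct A (cob X (n + 1)) (cob Y n) (B n) (i n) (j n) (p n) (q n)"
    by metis
  show ?thesis
    by (rule exI[of _ "\<lparr>cob = B, cdiff = \<lambda>n. ((i (n + 1) \<cdot> neg A (cdiff X (n + 1)) \<cdot> p n) \<oplus>
          (j (n + 1) \<cdot> f (n + 1) \<cdot> p n)) \<oplus> (j (n + 1) \<cdot> cdiff Y n \<cdot> q n)\<rparr>"],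
        rule exI[of _ i], rule exI[of _ j], rule exI[of _ p], rule exI[of _ q])
      (use b in \<open>simp add: mapping_cone_def\<close>)
qed

lemma std_triangleE:
  assumes "(u, v, w) \<in> std_triangles A"
  obtains X Y Z f i j p q where "cone A X Y Z f i j p q" "u = htpy_class A X Y f" "v = htpy_class A Y Z j"
    "w = htpy_class A Z (shift A X) p"
  using assms additive_category_axioms by (auto simp: std_triangles_def cone_def cone_axioms_def)

lemma std_triangleI:
  assumes "cone A X Y Z f i j p q"
  shows "(htpy_class A X Y f, htpy_class A Y Z j, htpy_class A Z (shift A X) p) \<in> std_triangles A"
  using assms cone.Z[OF assms] unfolding std_triangles_def cone_def cone_axioms_def by blast

lemma std_exists:
  assumes "u \<in> Hom (Kb A) X Y"
  shows "\<exists>v w. (u, v, w) \<in> std_triangles A"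
proof -
  obtain f where X: "X \<in> bounded_complexes A" and Y: "Y \<in> bounded_complexes A" and f: "f \<in> chain_maps A X Y"
    and u: "u = htpy_class A X Y f" using Kb_homE[OF assms] by metis
  obtain Z i j p q where "mapping_cone A X Y f Z i j p q" using cone_exists[OF X Y f] by blast
  then have "cone A X Y Z f i j p q" using X Y f additive_category_axioms by (simp add: cone_def cone_axioms_def)
  from std_triangleI[OF this] show ?thesis using u by blast
qed

lemma std_is_triangle:
  assumes "(u, v, w) \<in> std_triangles A"
  shows "is_triangle (Kb A) u v w"
proof -
  obtain X Y Z f i j p q where c: "cone A X Y Z f i j p q" "u = htpy_class A X Y f" "v = htpy_class A Y Z j"
    "w = htpy_class A Z (shift A X) p" using std_triangleE[OF assms] .
  interpret cone A X Y Z f i j p q by fact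
  have "u \<in> Hom (Kb A) X Y" "v \<in> Hom (Kb A) Y Z" "w \<in> Hom (Kb A) Z (shift A X)"
    using c chain_j chain_p by (auto intro!: Kb_homI)
  then show ?thesis by (simp add: is_triangle_def Hom_def)
qed

lemma std_Tri: "(u, v, w) \<in> std_triangles A \<Longrightarrow> (u, v, w) \<in> Tri (Kb A)"
  unfolding Tri_Kb using triangle_iso_refl[OF category_Kb std_is_triangle, of u v w]
    functorD(5)[OF is_functor_Kb_susp] by blast

lemma std_zero:
  assumes "(u, v, w) \<in> std_triangles A"
  shows "Comp (Kb A) v u = Zero (Kb A) (Dom (Kb A) u) (Cod (Kb A) v)"
    "Comp (Kb A) w v = Zero (Kb A) (Dom (Kb A) v) (Cod (Kb A) w)"
    "Comp (Kb A) (farr (Susp (Kb A)) u) w = Zero (Kb A) (Dom (Kb A) w) (fob (Susp (Kb A)) (Cod (Kb A) u))"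
proof -
  obtain X Y Z f i j p q where c: "cone A X Y Z f i j p q" "u = htpy_class A X Y f" "v = htpy_class A Y Z j"
    "w = htpy_class A Z (shift A X) p" using std_triangleE[OF assms] .
  interpret cone A X Y Z f i j p q by fact
  note sf = iffD2[OF chain_shift_iff[OF X Y] f]
  show "Comp (Kb A) v u = Zero (Kb A) (Dom (Kb A) u) (Cod (Kb A) v)"
    unfolding c using Kb_comp[OF X Y Z f chain_j] htpy_sym[OF X Z jf_null]
      htpy_class_eq[OF X Z chain_comp[OF X Y Z f chain_j] chain_zero[OF X Z]] by simp
  show "Comp (Kb A) w v = Zero (Kb A) (Dom (Kb A) v) (Cod (Kb A) w)"
    unfolding c using Kb_comp[OF Y Z shift_cx[OF X] chain_j chain_p] by simp
  show "Comp (Kb A) (farr (Susp (Kb A)) u) w = Zero (Kb A) (Dom (Kb A) w) (fob (Susp (Kb A)) (Cod (Kb A) u))"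
    unfolding c using Kb_comp[OF Z shift_cx[OF X] shift_cx[OF Y] chain_p sf] htpy_sym[OF Z shift_cx[OF Y] fp_null]
      htpy_class_eq[OF Z shift_cx[OF Y] chain_comp[OF Z shift_cx[OF X] shift_cx[OF Y] chain_p sf]
        chain_zero[OF Z shift_cx[OF Y]]] Kb_susp[OF X Y f] by simp
qed

lemma std_exact1:
  assumes "(u, v, w) \<in> std_triangles A" "g \<in> Hom (Kb A) W (Cod (Kb A) u)"
    "Comp (Kb A) v g = Zero (Kb A) W (Cod (Kb A) v)"
  shows "\<exists>a \<in> Hom (Kb A) W (Dom (Kb A) u). g = Comp (Kb A) u a"
proof -
  obtain X Y Z f i j p q where c: "cone A X Y Z f i j p q" "u = htpy_class A X Y f" "v = htpy_class A Y Z j"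
    "w = htpy_class A Z (shift A X) p" using std_triangleE[OF assms(1)] .
  interpret cone A X Y Z f i j p q by fact
  obtain g' where g: "W \<in> bounded_complexes A" "g' \<in> chain_maps A W Y" "g = htpy_class A W Y g'"
    using Kb_homE[OF assms(2)] c by (metis Kb_simps(3) class_arr_simps(2))
  note W = g(1)
  have "((\<lambda>n. Zero A (cob W n) (cob Z n)), (\<lambda>n. j n \<cdot> g' n)) \<in> htpy_rel A W Z"
    using assms(3) Kb_comp[OF W Y Z g(2) chain_j] g(3) c
      htpy_class_eq[OF W Z chain_zero[OF W Z] chain_comp[OF W Y Z g(2) chain_j]] by simp
  from exact_Y[OF W g(2) this] obtain a where a: "a \<in> chain_maps A W X" "((\<lambda>n. f n \<cdot> a n), g') \<in> htpy_rel A W Y"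
    by blast
  have "g = Comp (Kb A) u (htpy_class A W X a)"
    using a(2) c g(3) Kb_comp[OF W X Y a(1) f] htpy_class_eq[OF W Y chain_comp[OF W X Y a(1) f] g(2)] by simp
  then show ?thesis using Kb_homI[OF W X a(1)] c by auto
qed

lemma std_exact2:
  assumes "(u, v, w) \<in> std_triangles A" "g \<in> Hom (Kb A) W (Cod (Kb A) v)"
    "Comp (Kb A) w g = Zero (Kb A) W (Cod (Kb A) w)"
  shows "\<exists>a \<in> Hom (Kb A) W (Dom (Kb A) v). g = Comp (Kb A) v a"
proof -
  obtain X Y Z f i j p q where c: "cone A X Y Z f i j p q" "u = htpy_class A X Y f" "v = htpy_class A Y Z j"
    "w = htpy_class A Z (shift A X) p" using std_triangleE[OF assms(1)] .
  interpret cone A X Y Z f i j p q by fact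
  obtain g' where g: "W \<in> bounded_complexes A" "g' \<in> chain_maps A W Z" "g = htpy_class A W Z g'"
    using Kb_homE[OF assms(2)] c by (metis Kb_simps(3) class_arr_simps(2))
  note W = g(1)
  note SX = shift_cx[OF X]
  have "((\<lambda>n. Zero A (cob W n) (cob (shift A X) n)), (\<lambda>n. p n \<cdot> g' n)) \<in> htpy_rel A W (shift A X)"
    using assms(3) Kb_comp[OF W Z SX g(2) chain_p] g(3) c
      htpy_class_eq[OF W SX chain_zero[OF W SX] chain_comp[OF W Z SX g(2) chain_p]] by simp
  from exact_Z[OF W g(2) this] obtain a where a: "a \<in> chain_maps A W Y" "((\<lambda>n. j n \<cdot> a n), g') \<in> htpy_rel A W Z"
    by blast
  have "g = Comp (Kb A) v (htpy_class A W Y a)"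
    using a(2) c g(3) Kb_comp[OF W Y Z a(1) chain_j] htpy_class_eq[OF W Z chain_comp[OF W Y Z a(1) chain_j] g(2)] by simp
  then show ?thesis using Kb_homI[OF W Y a(1)] c by auto
qed

lemma std_exact3:
  assumes "(u, v, w) \<in> std_triangles A" "g \<in> Hom (Kb A) W (Cod (Kb A) w)"
    "Comp (Kb A) (farr (Susp (Kb A)) u) g = Zero (Kb A) W (fob (Susp (Kb A)) (Cod (Kb A) u))"
  shows "\<exists>a \<in> Hom (Kb A) W (Dom (Kb A) w). g = Comp (Kb A) w a"
proof -
  obtain X Y Z f i j p q where c: "cone A X Y Z f i j p q" "u = htpy_class A X Y f" "v = htpy_class A Y Z j"
    "w = htpy_class A Z (shift A X) p" using std_triangleE[OF assms(1)] .
  interpret cone A X Y Z f i j p q by fact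
  obtain g' where g: "W \<in> bounded_complexes A" "g' \<in> chain_maps A W (shift A X)" "g = htpy_class A W (shift A X) g'"
    using Kb_homE[OF assms(2)] c by (metis Kb_simps(3) class_arr_simps(2))
  note W = g(1)
  note SX = shift_cx[OF X] and SY = shift_cx[OF Y]
  note sf = iffD2[OF chain_shift_iff[OF X Y] f]
  have "((\<lambda>n. Zero A (cob W n) (cob (shift A Y) n)), (\<lambda>n. f (n + 1) \<cdot> g' n)) \<in> htpy_rel A W (shift A Y)"
    using assms(3) Kb_comp[OF W SX SY g(2) sf] g(3) c Kb_susp[OF X Y f]
      htpy_class_eq[OF W SY chain_zero[OF W SY] chain_comp[OF W SX SY g(2) sf]] by simp
  from exact_SX[OF W g(2) this] obtain a where a: "a \<in> chain_maps A W Z" "(\<lambda>n. p n \<cdot> a n) = g'"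
    by blast
  have "g = Comp (Kb A) w (htpy_class A W Z a)"
    using a(2) c g(3) Kb_comp[OF W Z SX a(1) chain_p] by simp
  then show ?thesis using Kb_homI[OF W Z a(1)] c by auto
qed

section \<open>Stalk complexes\<close>

lemma zero_obj: "is_zero A (zero_obj A)"
  unfolding zero_obj_def using zero_exists by (rule someI_ex)

lemma zero_obj_Obj [simp]: "zero_obj A \<in> Obj A"
  using zero_obj by (simp add: is_zero_def)

lemma stalk_simps [simp]:
  "cob (stalk A k P) k = P" "n \<noteq> k \<Longrightarrow> cob (stalk A k P) n = zero_obj A"
  "cdiff (stalk A k P) n = Zero A (cob (stalk A k P) n) (cob (stalk A k P) (n + 1))"
  by (auto simp: stalk_def)

lemma stalk_ob [simp]: "P \<in> Obj A \<Longrightarrow> cob (stalk A k P) n \<in> Obj A"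
  by (simp add: stalk_def)

lemma stalk_cx [simp]: "P \<in> Obj A \<Longrightarrow> stalk A k P \<in> bounded_complexes A"
  by (rule cxI[where b = "\<bar>k\<bar>"]) (auto simp: zero_obj add.commute[of 2] add.assoc)

text \<open>Shifting lowers degrees, so the \<open>m\<close>-fold suspension of a stalk in degree 0
  is the stalk in degree \<open>- m\<close>.\<close>

lemma shift_stalk: "P \<in> Obj A \<Longrightarrow> shift A (stalk A (k + 1) P) = stalk A k P"
  by (simp add: shift_def stalk_def)

lemma stalk_chain_eqI:
  assumes "P \<in> Obj A" "f \<in> chain_maps A (stalk A k P) X" "g \<in> chain_maps A (stalk A k P) X" "f k = g k"
  shows "f = g"
proof
  fix n
  show "f n = g n"
    using assms zero_obj_eq[OF zero_obj, of "f n" "g n"] chainD[OF assms(2), of n] chainD[OF assms(3), of n]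
    by (cases "n = k") auto
qed

text \<open>For a cocycle \<open>x\<close> this is the chain map it defines; homotopy classes of
  maps out of stalks thereby play the role of generalised elements of cohomology.\<close>

definition from_stalk :: "int \<Rightarrow> 'o \<Rightarrow> ('o, 'm) cochain_complex \<Rightarrow> 'm \<Rightarrow> int \<Rightarrow> 'm" where
  "from_stalk k P X x = (\<lambda>n. if n = k then x else Zero A (cob (stalk A k P) n) (cob X n))"

lemma from_stalk_chain:
  assumes "P \<in> Obj A" "X \<in> bounded_complexes A" "x \<in> Arr A" "Dom A x = P" "Cod A x = cob X k"
    "cdiff X k \<cdot> x = Zero A P (cob X (k + 1))"
  shows "from_stalk k P X x \<in> chain_maps A (stalk A k P) X"
proof (rule chain_mapsI)
  fix n
  show "cdiff X n \<cdot> from_stalk k P X x n = from_stalk k P X x (n + 1) \<cdot> cdiff (stalk A k P) n"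
  proof (cases "n = k")
    case True
    then show ?thesis using assms by (simp add: from_stalk_def)
  next
    case False
    then show ?thesis using assms
      by (intro zero_obj_eq[OF zero_obj]) (auto simp: from_stalk_def)
  qed
qed (use assms in \<open>auto simp: from_stalk_def\<close>)

end

context additive_category
begin

lemma stalk_homE:
  assumes "h \<in> Hom (Kb A) (stalk A k P) X" "P \<in> Obj A"
  obtains x where "X \<in> bounded_complexes A" "x \<in> Arr A" "Dom A x = P" "Cod A x = cob X k"
    "cdiff X k \<cdot> x = Zero A P (cob X (k + 1))" "h = htpy_class A (stalk A k P) X (from_stalk k P X x)"
proof -
  obtain f where f: "X \<in> bounded_complexes A" "f \<in> chain_maps A (stalk A k P) X" "h = htpy_class A (stalk A k P) X f"
    using Kb_homE[OF assms(1)] by metis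
  note [simp] = chainD[OF f(2)]
  have x: "f k \<in> Arr A" "Dom A (f k) = P" "Cod A (f k) = cob X k" "cdiff X k \<cdot> f k = Zero A P (cob X (k + 1))"
    using chain_comm[OF f(2), of k] assms(2) by simp_all
  have "f = from_stalk k P X (f k)"
    by (rule stalk_chain_eqI[OF assms(2) f(2) from_stalk_chain[OF assms(2) f(1) x]]) (simp add: from_stalk_def)
  then show ?thesis using that[OF f(1) x] f(3) by simp
qed

text \<open>A homotopy out of a stalk has one possibly nonzero component, in degree
  \<open>k\<close>, and this component exhibits the cocycle \<open>x\<close> as a
  coboundary.\<close>

lemma from_stalk_null:
  assumes P: "P \<in> Obj A" and X: "X \<in> bounded_complexes A" and x: "x \<in> Arr A" "Dom A x = P" "Cod A x = cob X k"
    "cdiff X k \<cdot> x = Zero A P (cob X (k + 1))"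
  shows "htpy_class A (stalk A k P) X (from_stalk k P X x) = Zero (Kb A) (stalk A k P) X \<longleftrightarrow>
    (\<exists>y \<in> Arr A. Dom A y = P \<and> Cod A y = cob X (k - 1) \<and> x = cdiff X (k - 1) \<cdot> y)"
proof -
  note S = stalk_cx[OF P, of k]
  note c = from_stalk_chain[OF P X x]
  have "htpy_class A (stalk A k P) X (from_stalk k P X x) = Zero (Kb A) (stalk A k P) X \<longleftrightarrow>
    ((\<lambda>n. Zero A (cob (stalk A k P) n) (cob X n)), from_stalk k P X x) \<in> htpy_rel A (stalk A k P) X"
    using htpy_class_eq[OF S X chain_zero[OF S X] c] by auto
  also have "\<dots> \<longleftrightarrow> (\<exists>y \<in> Arr A. Dom A y = P \<and> Cod A y = cob X (k - 1) \<and> x = cdiff X (k - 1) \<cdot> y)"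
  proof
    assume "((\<lambda>n. Zero A (cob (stalk A k P) n) (cob X n)), from_stalk k P X x) \<in> htpy_rel A (stalk A k P) X"
    then obtain h where h: "\<And>n. h n \<in> Arr A" "\<And>n. Dom A (h n) = cob (stalk A k P) n" "\<And>n. Cod A (h n) = cob X (n - 1)"
      "\<And>n. from_stalk k P X x n = Zero A (cob (stalk A k P) n) (cob X n) \<oplus>
         (cdiff X (n - 1) \<cdot> h n \<oplus> h (n + 1) \<cdot> cdiff (stalk A k P) n)"
      by (elim htpyE) blast
    have "x = cdiff X (k - 1) \<cdot> h k" using h(4)[of k] P X h(1-3) by (simp add: from_stalk_def)
    then show "\<exists>y \<in> Arr A. Dom A y = P \<and> Cod A y = cob X (k - 1) \<and> x = cdiff X (k - 1) \<cdot> y"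
      using h(1)[of k] h(2)[of k] h(3)[of k] by auto
  next
    assume "\<exists>y \<in> Arr A. Dom A y = P \<and> Cod A y = cob X (k - 1) \<and> x = cdiff X (k - 1) \<cdot> y"
    then obtain y where y: "y \<in> Arr A" "Dom A y = P" "Cod A y = cob X (k - 1)" "x = cdiff X (k - 1) \<cdot> y" by blast
    let ?h = "\<lambda>n. if n = k then y else Zero A (cob (stalk A k P) n) (cob X (n - 1))"
    show "((\<lambda>n. Zero A (cob (stalk A k P) n) (cob X n)), from_stalk k P X x) \<in> htpy_rel A (stalk A k P) X"
    proof (rule htpyI[where h = ?h, OF chain_zero[OF S X] c])
      fix n
      show "from_stalk k P X x n = Zero A (cob (stalk A k P) n) (cob X n) \<oplus>
         (cdiff X (n - 1) \<cdot> ?h n \<oplus> ?h (n + 1) \<cdot> cdiff (stalk A k P) n)"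
      proof (cases "n = k")
        case True
        then show ?thesis using P X y by (simp add: from_stalk_def)
      next
        case False
        then show ?thesis using P X y x by (intro zero_obj_eq[OF zero_obj]) (auto simp: from_stalk_def)
      qed
    qed (use P X y in auto)
  qed
  finally show ?thesis .
qed

lemma from_stalk_hom:
  assumes "P \<in> Obj A" "X \<in> bounded_complexes A" "x \<in> Arr A" "Dom A x = P" "Cod A x = cob X k"
    "cdiff X k \<cdot> x = Zero A P (cob X (k + 1))"
  shows "htpy_class A (stalk A k P) X (from_stalk k P X x) \<in> Hom (Kb A) (stalk A k P) X"
  using assms from_stalk_chain[OF assms] by (simp add: Kb_homI)

lemma stalk_map_from_stalk:
  assumes "e \<in> Hom A P P'"
  shows "stalk_map A k e = htpy_class A (stalk A k P) (stalk A k P') (from_stalk k P (stalk A k P') e)"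
proof -
  have "(\<lambda>n. if n = k then e else Zero A (zero_obj A) (zero_obj A)) = from_stalk k P (stalk A k P') e"
    by (auto simp: from_stalk_def)
  then show ?thesis using assms by (simp add: stalk_map_def Hom_def)
qed

lemma stalk_map_hom:
  assumes "e \<in> Hom A P P'"
  shows "stalk_map A k e \<in> Hom (Kb A) (stalk A k P) (stalk A k P')"
  unfolding stalk_map_from_stalk[OF assms]
  by (rule from_stalk_hom) (use assms Hom_obj[OF assms] in \<open>auto simp: Hom_def\<close>)

lemma from_stalk_comp:
  assumes P: "P \<in> Obj A" and X: "X \<in> bounded_complexes A" and x: "x \<in> Arr A" "Dom A x = P" "Cod A x = cob X k"
    "cdiff X k \<cdot> x = Zero A P (cob X (k + 1))" and e: "e \<in> Hom A P' P"
  shows "Comp (Kb A) (htpy_class A (stalk A k P) X (from_stalk k P X x)) (stalk_map A k e) =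
    htpy_class A (stalk A k P') X (from_stalk k P' X (x \<cdot> e))"
proof -
  have P': "P' \<in> Obj A" using Hom_obj e by blast
  have e': "e \<in> Arr A" "Dom A e = P'" "Cod A e = P" using e by (auto simp: Hom_def)
  have ce: "from_stalk k P' (stalk A k P) e \<in> chain_maps A (stalk A k P') (stalk A k P)"
    by (rule from_stalk_chain) (use P P' e' in auto)
  note cx = from_stalk_chain[OF P X x]
  have dxe: "cdiff X k \<cdot> (x \<cdot> e) = Zero A P' (cob X (k + 1))"
    using assoc_cong[OF x(4), of e] x(1-3) e' X by simp
  note comp = chain_comp[OF stalk_cx[OF P'] stalk_cx[OF P] X ce cx]
  have "(\<lambda>n. from_stalk k P X x n \<cdot> from_stalk k P' (stalk A k P) e n) = from_stalk k P' X (x \<cdot> e)"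
    by (rule stalk_chain_eqI[OF P' comp from_stalk_chain]) (use P P' X x e' dxe in \<open>auto simp: from_stalk_def\<close>)
  then show ?thesis using Kb_comp[OF stalk_cx[OF P'] stalk_cx[OF P] X ce cx]
    by (simp add: stalk_map_from_stalk[OF e])
qed

lemma stalk_map_comp:
  assumes "e \<in> Hom A P P'" "e' \<in> Hom A P' P''"
  shows "stalk_map A k (e' \<cdot> e) = Comp (Kb A) (stalk_map A k e') (stalk_map A k e)"
proof -
  note o = Hom_obj[OF assms(1)] Hom_obj[OF assms(2)]
  show ?thesis unfolding stalk_map_from_stalk[OF assms(2)] stalk_map_from_stalk[OF Comp_closed[OF assms]]
    by (subst from_stalk_comp) (use assms o in \<open>auto simp: Hom_def\<close>)
qed

lemma stalk_map_susp:
  assumes "e \<in> Hom A P P'"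
  shows "farr (Susp (Kb A)) (stalk_map A (k + 1) e) = stalk_map A k e"
proof -
  note o = Hom_obj[OF assms(1)]
  have e': "e \<in> Arr A" "Dom A e = P" "Cod A e = P'" using assms by (auto simp: Hom_def)
  have ce: "from_stalk (k + 1) P (stalk A (k + 1) P') e \<in> chain_maps A (stalk A (k + 1) P) (stalk A (k + 1) P')"
    by (rule from_stalk_chain) (use o e' in auto)
  have "(\<lambda>n. from_stalk (k + 1) P (stalk A (k + 1) P') e (n + 1)) = from_stalk k P (stalk A k P') e"
    by (auto simp: from_stalk_def fun_eq_iff stalk_def)
  then show ?thesis unfolding stalk_map_from_stalk[OF assms]
    using Kb_susp[OF _ _ ce] o by (simp add: shift_stalk)
qed

text \<open>In degree \<open>k\<close> the target is a zero object, so there is no nonzero cocycle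
  to start from. This vanishing is what finally kills maps into positive suspensions.\<close>

lemma stalk_hom_zero:
  assumes "h \<in> Hom (Kb A) (stalk A k P) (stalk A l P')" "k \<noteq> l" "P \<in> Obj A" "P' \<in> Obj A"
  shows "h = Zero (Kb A) (stalk A k P) (stalk A l P')"
proof -
  obtain x where x: "x \<in> Arr A" "Dom A x = P" "Cod A x = cob (stalk A l P') k"
    "cdiff (stalk A l P') k \<cdot> x = Zero A P (cob (stalk A l P') (k + 1))"
    "h = htpy_class A (stalk A k P) (stalk A l P') (from_stalk k P (stalk A l P') x)"
    using stalk_homE[OF assms(1,3)] by metis
  have z: "x = cdiff (stalk A l P') (k - 1) \<cdot> Zero A P (cob (stalk A l P') (k - 1))"
    by (rule zero_obj_eq[OF zero_obj]) (use x assms in auto)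
  have "\<exists>y \<in> Arr A. Dom A y = P \<and> Cod A y = cob (stalk A l P') (k - 1) \<and> x = cdiff (stalk A l P') (k - 1) \<cdot> y"
    by (rule bexI[of _ "Zero A P (cob (stalk A l P') (k - 1))"]) (use z assms in auto)
  then show ?thesis using from_stalk_null[OF assms(3) stalk_cx[OF assms(4)] x(1-4)] x(5) by blast
qed

end

section \<open>Calculus of right fractions\<close>

lemma roof_class_simps [simp]:
  "source (roof_class K N (s, f)) = Cod K s" "target (roof_class K N (s, f)) = Cod K f"
  "reps (roof_class K N (s, f)) = roof_rel K N (Cod K s) (Cod K f) `` {(s, f)}"
  by (simp_all add: roof_class_def)

lemma verdier_simps [simp]:
  "Obj (verdier_quotient K N) = Obj K" "Dom (verdier_quotient K N) = source" "Cod (verdier_quotient K N) = target"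
  "Ide (verdier_quotient K N) = (\<lambda>X. roof_class K N (Ide K X, Ide K X))"
  "Comp (verdier_quotient K N) = verdier_comp K N"
  "Susp (verdier_quotient K N) = verdier_susp K N"
  "Arr (verdier_quotient K N) = {Class_arr X Y c | X Y c. X \<in> Obj K \<and> Y \<in> Obj K \<and>
               c \<in> roofs K N X Y // roof_rel K N X Y}"
  by (simp_all add: verdier_quotient_def)

lemma Tri_verdier: "Tri (verdier_quotient K N) = {t. \<exists>t' \<in> {(farr (quot_functor K N) u, farr (quot_functor K N) v, farr (quot_functor K N) w)
              | u v w. (u, v, w) \<in> Tri K}. triangle_iso (verdier_quotient K N) t t'}"
  unfolding verdier_quotient_def Tri_close by simp

text \<open>A roof stands for \<open>f\<close> after the inverse of \<open>s\<close>, so the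
  conditions are one-sided: denominators are moved to the right past numerators, and cancellation on
  the left is traded for cancellation on the right.\<close>

locale right_fractions = category K for K :: "('o, 'm, 'e) tri_category_scheme" (structure) +
  fixes N :: "'o set" and Q :: "'m set"
  defines "Q \<equiv> quot_system K N"
  assumes Q_ide [simp]: "X \<in> Obj K \<Longrightarrow> Ide K X \<in> Q"
    and Q_comp: "s \<in> Q \<Longrightarrow> t \<in> Q \<Longrightarrow> Cod K s = Dom K t \<Longrightarrow> t \<cdot> s \<in> Q"
    and Ore: "f \<in> Arr K \<Longrightarrow> t \<in> Q \<Longrightarrow> Cod K f = Cod K t \<Longrightarrow>
      \<exists>r \<in> Q. \<exists>h \<in> Arr K. Cod K r = Dom K f \<and> Cod K h = Dom K t \<and> Dom K r = Dom K h \<and> f \<cdot> r = t \<cdot> h"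
    and Q_cancel: "t \<in> Q \<Longrightarrow> f \<in> Arr K \<Longrightarrow> g \<in> Arr K \<Longrightarrow> Dom K f = Dom K g \<Longrightarrow> Cod K f = Dom K t \<Longrightarrow>
      Cod K g = Dom K t \<Longrightarrow> t \<cdot> f = t \<cdot> g \<Longrightarrow> \<exists>r \<in> Q. Cod K r = Dom K f \<and> f \<cdot> r = g \<cdot> r"
begin

abbreviation "V \<equiv> verdier_quotient K N"
abbreviation "qf \<equiv> farr (quot_functor K N)"

lemma Q_arr [simp]: "s \<in> Q \<Longrightarrow> s \<in> Arr K"
  by (simp add: Q_def quot_system_def)

lemma roofs_iff: "(s, f) \<in> roofs K N X Y \<longleftrightarrow>
    s \<in> Q \<and> f \<in> Arr K \<and> Dom K s = Dom K f \<and> Cod K s = X \<and> Cod K f = Y"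
  by (simp add: roofs_def Q_def)

lemma roof_relI:
  assumes "(s, f) \<in> roofs K N X Y" "(t, g) \<in> roofs K N X Y" "a \<in> Arr K" "b \<in> Arr K" "Dom K a = Dom K b"
    "Cod K a = Dom K s" "Cod K b = Dom K t" "s \<cdot> a = t \<cdot> b" "s \<cdot> a \<in> Q" "f \<cdot> a = g \<cdot> b"
  shows "((s, f), (t, g)) \<in> roof_rel K N X Y"
  unfolding roof_rel_def mem_Collect_eq prod.case
  by (intro conjI exI[of _ "Dom K a"] exI[of _ a] exI[of _ b])
    (use assms in \<open>simp_all add: Hom_def Q_def\<close>)

lemma roof_relE:
  assumes "((s, f), (t, g)) \<in> roof_rel K N X Y"
  obtains a b where "(s, f) \<in> roofs K N X Y" "(t, g) \<in> roofs K N X Y" "a \<in> Arr K" "b \<in> Arr K" "Dom K a = Dom K b"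
    "Cod K a = Dom K s" "Cod K b = Dom K t" "s \<cdot> a = t \<cdot> b" "s \<cdot> a \<in> Q" "f \<cdot> a = g \<cdot> b"
proof -
  obtain W a b where "(s, f) \<in> roofs K N X Y" "(t, g) \<in> roofs K N X Y" "a \<in> Hom K W (Dom K s)"
    "b \<in> Hom K W (Dom K t)" "s \<cdot> a = t \<cdot> b" "s \<cdot> a \<in> Q" "f \<cdot> a = g \<cdot> b"
    using assms unfolding roof_rel_def Q_def by blast
  then show ?thesis using that[of a b] by (simp add: Hom_def)
qed

lemma roof_refl: "(s, f) \<in> roofs K N X Y \<Longrightarrow> ((s, f), (s, f)) \<in> roof_rel K N X Y"
  by (rule roof_relI[where a = "Ide K (Dom K s)" and b = "Ide K (Dom K s)"]) (auto simp: roofs_iff)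

lemma roof_sym: "((s, f), (t, g)) \<in> roof_rel K N X Y \<Longrightarrow> ((t, g), (s, f)) \<in> roof_rel K N X Y"
  by (elim roof_relE, rule roof_relI) auto

text \<open>Complete \<open>s a\<close> and \<open>s a'\<close> to an Ore square, then cancel
  \<open>s\<close> by a further denominator. Two-out-of-three is not among the axioms, so
  \<open>a\<close> and \<open>a'\<close> themselves cannot be treated as denominators; membership is
  tracked for the composites with \<open>s\<close>.\<close>

lemma Ore_joint:
  assumes "s \<in> Q" "a \<in> Arr K" "a' \<in> Arr K" "Cod K a = Dom K s" "Cod K a' = Dom K s" "s \<cdot> a \<in> Q" "s \<cdot> a' \<in> Q"
  obtains c e where "c \<in> Arr K" "e \<in> Arr K" "Dom K c = Dom K e" "Cod K c = Dom K a" "Cod K e = Dom K a'"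
    "a \<cdot> c = a' \<cdot> e" "s \<cdot> a \<cdot> c \<in> Q"
proof -
  obtain r h where r: "r \<in> Q" "h \<in> Arr K" "Cod K r = Dom K a" "Cod K h = Dom K a'" "Dom K r = Dom K h"
    "(s \<cdot> a) \<cdot> r = (s \<cdot> a') \<cdot> h"
    using Ore[of "s \<cdot> a" "s \<cdot> a'"] assms by (metis comp_arr Q_arr)
  have "s \<cdot> (a \<cdot> r) = s \<cdot> (a' \<cdot> h)" using r assms by simp
  then obtain k where k: "k \<in> Q" "Cod K k = Dom K r" "(a \<cdot> r) \<cdot> k = (a' \<cdot> h) \<cdot> k"
    using Q_cancel[OF assms(1), of "a \<cdot> r" "a' \<cdot> h"] assms r by auto
  have "(s \<cdot> a) \<cdot> (r \<cdot> k) \<in> Q" using Q_comp[OF Q_comp[OF k(1) r(1)] assms(6)] k r assms by simp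
  then show ?thesis using that[of "r \<cdot> k" "h \<cdot> k"] k r assms by auto
qed

text \<open>Both refinements lie over the middle roof, where \<open>Ore_joint\<close> merges
  them.\<close>

lemma roof_trans:
  assumes "((s, f), (s', f')) \<in> roof_rel K N X Y" "((s', f'), (s'', f'')) \<in> roof_rel K N X Y"
  shows "((s, f), (s'', f'')) \<in> roof_rel K N X Y"
proof -
  obtain a a' where a: "(s, f) \<in> roofs K N X Y" "(s', f') \<in> roofs K N X Y" "a \<in> Arr K" "a' \<in> Arr K" "Dom K a = Dom K a'"
    "Cod K a = Dom K s" "Cod K a' = Dom K s'" "s \<cdot> a = s' \<cdot> a'" "s \<cdot> a \<in> Q" "f \<cdot> a = f' \<cdot> a'" using roof_relE[OF assms(1)] .
  obtain b b' where b: "(s'', f'') \<in> roofs K N X Y" "b \<in> Arr K" "b' \<in> Arr K" "Dom K b = Dom K b'"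
    "Cod K b = Dom K s'" "Cod K b' = Dom K s''" "s' \<cdot> b = s'' \<cdot> b'" "s' \<cdot> b \<in> Q" "f' \<cdot> b = f'' \<cdot> b'" using roof_relE[OF assms(2)] .
  obtain c e where c: "c \<in> Arr K" "e \<in> Arr K" "Dom K c = Dom K e" "Cod K c = Dom K a'" "Cod K e = Dom K b"
    "a' \<cdot> c = b \<cdot> e" "s' \<cdot> a' \<cdot> c \<in> Q"
    using Ore_joint[of s' a' b] a b by (auto simp: roofs_iff)
  have eqs: "s \<cdot> (a \<cdot> c) = s' \<cdot> (a' \<cdot> c)" "s' \<cdot> (b \<cdot> e) = s'' \<cdot> (b' \<cdot> e)"
    "f \<cdot> (a \<cdot> c) = f' \<cdot> (a' \<cdot> c)" "f' \<cdot> (b \<cdot> e) = f'' \<cdot> (b' \<cdot> e)"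
    using assoc_cong[OF a(8), of c] assoc_cong[OF a(10), of c] assoc_cong[OF b(7), of e] assoc_cong[OF b(9), of e]
      a b c by (auto simp: roofs_iff)
  show ?thesis
    by (rule roof_relI[where a = "a \<cdot> c" and b = "b' \<cdot> e"]) (use a b c eqs in \<open>auto simp: roofs_iff\<close>)
qed

lemma roof_equiv: "equiv (roofs K N X Y) (roof_rel K N X Y)"
proof (rule equivI)
  show "roof_rel K N X Y \<subseteq> roofs K N X Y \<times> roofs K N X Y" by (auto simp: roof_rel_def)
  show "refl_on (roofs K N X Y) (roof_rel K N X Y)" using roof_refl by (auto simp: refl_on_def)
  show "sym (roof_rel K N X Y)" using roof_sym by (auto intro!: symI)
  show "trans (roof_rel K N X Y)" by (rule transI) (use roof_trans in \<open>metis surj_pair\<close>)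
qed

lemma roof_class_eq:
  assumes "(s, f) \<in> roofs K N X Y" "(t, g) \<in> roofs K N X Y"
  shows "roof_class K N (s, f) = roof_class K N (t, g) \<longleftrightarrow> ((s, f), (t, g)) \<in> roof_rel K N X Y"
  using eq_equiv_class_iff[OF roof_equiv assms] assms by (simp add: roof_class_def roofs_iff)

lemma V_Hom_iff: "\<alpha> \<in> Hom V X Y \<longleftrightarrow> X \<in> Obj K \<and> Y \<in> Obj K \<and> (\<exists>s f. (s, f) \<in> roofs K N X Y \<and> \<alpha> = roof_class K N (s, f))"
proof
  assume "\<alpha> \<in> Hom V X Y"
  then obtain s f where "X \<in> Obj K" "Y \<in> Obj K" "(s, f) \<in> roofs K N X Y" "\<alpha> = Class_arr X Y (roof_rel K N X Y `` {(s, f)})"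
    by (auto simp: Hom_def quotient_def)
  then show "X \<in> Obj K \<and> Y \<in> Obj K \<and> (\<exists>s f. (s, f) \<in> roofs K N X Y \<and> \<alpha> = roof_class K N (s, f))"
    by (auto simp: roof_class_def roofs_iff)
next
  assume "X \<in> Obj K \<and> Y \<in> Obj K \<and> (\<exists>s f. (s, f) \<in> roofs K N X Y \<and> \<alpha> = roof_class K N (s, f))"
  then show "\<alpha> \<in> Hom V X Y"
    by (auto simp: Hom_def roof_class_def roofs_iff intro!: quotientI)
qed

lemma V_homI: "(s, f) \<in> roofs K N X Y \<Longrightarrow> roof_class K N (s, f) \<in> Hom V X Y"
  using V_Hom_iff by (auto simp: roofs_iff)

lemma V_homE:
  assumes "\<alpha> \<in> Hom V X Y"
  obtains s f where "X \<in> Obj K" "Y \<in> Obj K" "(s, f) \<in> roofs K N X Y" "\<alpha> = roof_class K N (s, f)"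
  using assms V_Hom_iff by blast

text \<open>Two completions of the same pair of roofs are merged over \<open>s\<close> by
  \<open>Ore_joint\<close>; their right legs then agree after \<open>t\<close>, and a further
  denominator cancels \<open>t\<close>.\<close>

lemma comp_indep:
  assumes s: "s \<in> Q" "f \<in> Arr K" "Dom K s = Dom K f" and t: "t \<in> Q" "g \<in> Arr K" "Dom K t = Dom K g" "Cod K f = Cod K t"
    and r: "r \<in> Arr K" "h \<in> Arr K" "Dom K r = Dom K h" "Cod K r = Dom K f" "Cod K h = Dom K t" "f \<cdot> r = t \<cdot> h" "s \<cdot> r \<in> Q"
    and r': "r' \<in> Arr K" "h' \<in> Arr K" "Dom K r' = Dom K h'" "Cod K r' = Dom K f" "Cod K h' = Dom K t" "f \<cdot> r' = t \<cdot> h'" "s \<cdot> r' \<in> Q"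
  shows "((s \<cdot> r, g \<cdot> h), (s \<cdot> r', g \<cdot> h')) \<in> roof_rel K N (Cod K s) (Cod K g)"
proof -
  obtain c e where c: "c \<in> Arr K" "e \<in> Arr K" "Dom K c = Dom K e" "Cod K c = Dom K r" "Cod K e = Dom K r'"
    "r \<cdot> c = r' \<cdot> e" "s \<cdot> r \<cdot> c \<in> Q" using Ore_joint[of s r r'] assms by auto
  have "t \<cdot> (h \<cdot> c) = f \<cdot> (r \<cdot> c)" using assoc_cong[OF r(6), of c] s t r c by simp
  also have "\<dots> = t \<cdot> (h' \<cdot> e)" using assoc_cong[OF r'(6), of e] s t r' c by simp
  finally obtain k where k: "k \<in> Q" "Cod K k = Dom K c" "(h \<cdot> c) \<cdot> k = (h' \<cdot> e) \<cdot> k"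
    using Q_cancel[OF t(1), of "h \<cdot> c" "h' \<cdot> e"] c r r' by auto
  have "(s \<cdot> r \<cdot> c) \<cdot> k \<in> Q" using Q_comp[OF k(1) c(7)] k c s r r' by simp
  moreover have "r \<cdot> (c \<cdot> k) = r' \<cdot> (e \<cdot> k)" using assoc_cong[OF c(6), of k] c k r r' by simp
  ultimately show ?thesis
    by (intro roof_relI[where a = "c \<cdot> k" and b = "e \<cdot> k"])
      (use s t r r' c k in \<open>auto simp: roofs_iff\<close>)
qed

text \<open>An Ore square on the refined arrows \<open>f a\<close> and \<open>t b\<close> completes
  both pairs of representatives at once; \<open>comp_indep\<close> compares it with each given
  completion.\<close>

lemma comp_welldef:
  assumes 1: "((s, f), (s', f')) \<in> roof_rel K N X Y" and 2: "((t, g), (t', g')) \<in> roof_rel K N Y Z"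
    and r: "r \<in> Arr K" "h \<in> Arr K" "Dom K r = Dom K h" "Cod K r = Dom K f" "Cod K h = Dom K t" "f \<cdot> r = t \<cdot> h" "s \<cdot> r \<in> Q"
    and r': "r' \<in> Arr K" "h' \<in> Arr K" "Dom K r' = Dom K h'" "Cod K r' = Dom K f'" "Cod K h' = Dom K t'" "f' \<cdot> r' = t' \<cdot> h'" "s' \<cdot> r' \<in> Q"
  shows "((s \<cdot> r, g \<cdot> h), (s' \<cdot> r', g' \<cdot> h')) \<in> roof_rel K N X Z"
proof -
  obtain a a' where a: "(s, f) \<in> roofs K N X Y" "(s', f') \<in> roofs K N X Y" "a \<in> Arr K" "a' \<in> Arr K" "Dom K a = Dom K a'"
    "Cod K a = Dom K s" "Cod K a' = Dom K s'" "s \<cdot> a = s' \<cdot> a'" "s \<cdot> a \<in> Q" "f \<cdot> a = f' \<cdot> a'" using roof_relE[OF 1] .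
  obtain b b' where b: "(t, g) \<in> roofs K N Y Z" "(t', g') \<in> roofs K N Y Z" "b \<in> Arr K" "b' \<in> Arr K" "Dom K b = Dom K b'"
    "Cod K b = Dom K t" "Cod K b' = Dom K t'" "t \<cdot> b = t' \<cdot> b'" "t \<cdot> b \<in> Q" "g \<cdot> b = g' \<cdot> b'" using roof_relE[OF 2] .
  note A = a[unfolded roofs_iff] and B = b[unfolded roofs_iff]
  obtain r0 h0 where r0: "r0 \<in> Q" "h0 \<in> Arr K" "Cod K r0 = Dom K a" "Cod K h0 = Dom K b" "Dom K r0 = Dom K h0"
    "(f \<cdot> a) \<cdot> r0 = (t \<cdot> b) \<cdot> h0"
    using Ore[of "f \<cdot> a" "t \<cdot> b"] A B by auto
  have sr: "(s \<cdot> a) \<cdot> r0 \<in> Q" using Q_comp[OF r0(1) a(9)] r0 A by simp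
  have e: "s \<cdot> (a \<cdot> r0) = s' \<cdot> (a' \<cdot> r0)" "f \<cdot> (a \<cdot> r0) = f' \<cdot> (a' \<cdot> r0)" "g \<cdot> (b \<cdot> h0) = g' \<cdot> (b' \<cdot> h0)"
    "t \<cdot> (b \<cdot> h0) = t' \<cdot> (b' \<cdot> h0)"
    using assoc_cong[OF a(8), of r0] assoc_cong[OF a(10), of r0] assoc_cong[OF b(8), of h0] assoc_cong[OF b(10), of h0]
      A B r0 by auto
  have e2: "f \<cdot> (a \<cdot> r0) = t \<cdot> (b \<cdot> h0)" using r0 A(1,3,6) B(1,3,6) by simp
  have sr1: "s \<cdot> (a \<cdot> r0) \<in> Q" using sr r0 A(1,3,6) by simp
  have r0': "Cod K r0 = Dom K a'" "Cod K h0 = Dom K b'" using r0 A(5) B(5) by auto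
  have "((s \<cdot> r, g \<cdot> h), (s \<cdot> (a \<cdot> r0), g \<cdot> (b \<cdot> h0))) \<in> roof_rel K N (Cod K s) (Cod K g)"
    by (rule comp_indep[of s f t g]) (use A(1-7) B(1-7) r r0(1-5) e2 sr1 in auto)
  moreover have "((s' \<cdot> (a' \<cdot> r0), g' \<cdot> (b' \<cdot> h0)), (s' \<cdot> r', g' \<cdot> h')) \<in> roof_rel K N (Cod K s') (Cod K g')"
    by (rule comp_indep[of s' f' t' g'])
      (use A(1-7) B(1-7) r' r0(1-5) r0' e2[unfolded e] sr1[unfolded e] in auto)
  ultimately show ?thesis using roof_trans e A B by simp
qed

text \<open>The defining set ranges over all representatives and all Ore squares, but
  \<open>comp_welldef\<close> puts its members into one class. Asking for \<open>s \<cdot> r\<close>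
  instead of \<open>r\<close> to be a denominator admits squares in which \<open>r\<close> is any
  arrow.\<close>

lemma V_comp:
  assumes sf: "(s, f) \<in> roofs K N X Y" and tg: "(t, g) \<in> roofs K N Y Z"
    and r: "r \<in> Arr K" "h \<in> Arr K" "Dom K r = Dom K h" "Cod K r = Dom K f" "Cod K h = Dom K t" "f \<cdot> r = t \<cdot> h" "s \<cdot> r \<in> Q"
  shows "verdier_comp K N (roof_class K N (t, g)) (roof_class K N (s, f)) = roof_class K N (s \<cdot> r, g \<cdot> h)"
proof -
  note S = sf[unfolded roofs_iff] and G = tg[unfolded roofs_iff]
  let ?S = "{(s' \<cdot> r, g' \<cdot> h) | s' f' t' g' r h.
           (s', f') \<in> roof_rel K N X Y `` {(s, f)} \<and> (t', g') \<in> roof_rel K N Y Z `` {(t, g)} \<and>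
           r \<in> quot_system K N \<and> h \<in> Arr K \<and> Dom K r = Dom K h \<and>
           Cod K r = Dom K f' \<and> Cod K h = Dom K t' \<and> f' \<cdot> r = t' \<cdot> h}"
  have sub: "((s \<cdot> r, g \<cdot> h), x) \<in> roof_rel K N X Z" if "x \<in> ?S" for x
  proof -
    from that obtain s' f' t' g' r' h' where x: "x = (s' \<cdot> r', g' \<cdot> h')" "((s, f), (s', f')) \<in> roof_rel K N X Y"
      "((t, g), (t', g')) \<in> roof_rel K N Y Z" "r' \<in> Q" "h' \<in> Arr K" "Dom K r' = Dom K h'"
      "Cod K r' = Dom K f'" "Cod K h' = Dom K t'" "f' \<cdot> r' = t' \<cdot> h'" unfolding Q_def by blast
    have s': "s' \<in> Q" "Dom K s' = Dom K f'" using roof_relE[OF x(2)] by (auto simp: roofs_iff)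
    show ?thesis unfolding x(1)
      by (rule comp_welldef[OF x(2,3) r]) (use x s' Q_comp[of r' s'] in auto)
  qed
  obtain r0 h0 where r0: "r0 \<in> Q" "h0 \<in> Arr K" "Cod K r0 = Dom K f" "Cod K h0 = Dom K t" "Dom K r0 = Dom K h0"
    "f \<cdot> r0 = t \<cdot> h0" using Ore[of f t] S G by auto
  have in_S: "(s \<cdot> r0, g \<cdot> h0) \<in> ?S"
    using roof_refl[OF sf] roof_refl[OF tg] r0 unfolding Q_def by blast
  have "roof_rel K N X Z `` ?S = roof_rel K N X Z `` {(s \<cdot> r, g \<cdot> h)}" (is "?L = ?R")
  proof
    show "?L \<subseteq> ?R"
    proof
      fix y assume "y \<in> ?L"
      then obtain x where x: "x \<in> ?S" "(x, y) \<in> roof_rel K N X Z" by blast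
      show "y \<in> ?R" using roof_trans[of "s \<cdot> r" "g \<cdot> h" "fst x" "snd x" X Z "fst y" "snd y"] sub[OF x(1)] x(2) by simp
    qed
    show "?R \<subseteq> ?L"
    proof
      fix y assume "y \<in> ?R"
      then have y: "((s \<cdot> r, g \<cdot> h), y) \<in> roof_rel K N X Z" by simp
      have "((s \<cdot> r0, g \<cdot> h0), y) \<in> roof_rel K N X Z"
        using roof_trans[OF roof_sym[OF sub[OF in_S]], of "fst y" "snd y"] y by simp
      then show "y \<in> ?L" using in_S by blast
    qed
  qed
  then show ?thesis using S G r by (simp add: verdier_comp_def roof_class_def)
qed

lemma category_V: "category V"
proof
  fix f assume "f \<in> Arr V"
  then show "Dom V f \<in> Obj V" "Cod V f \<in> Obj V" by auto
next
  fix X assume "X \<in> Obj V"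
  then show "Ide V X \<in> Hom V X X" by (simp, intro V_homI) (simp add: roofs_iff)
next
  fix \<alpha> \<beta> X Y Z assume "\<alpha> \<in> Hom V X Y" "\<beta> \<in> Hom V Y Z"
  then obtain s f t g where S: "(s, f) \<in> roofs K N X Y" "\<alpha> = roof_class K N (s, f)"
    "(t, g) \<in> roofs K N Y Z" "\<beta> = roof_class K N (t, g)" by (elim V_homE) blast
  obtain r h where r: "r \<in> Q" "h \<in> Arr K" "Cod K r = Dom K f" "Cod K h = Dom K t" "Dom K r = Dom K h"
    "f \<cdot> r = t \<cdot> h" using Ore[of f t] S by (auto simp: roofs_iff)
  have "Comp V \<beta> \<alpha> = roof_class K N (s \<cdot> r, g \<cdot> h)" unfolding S(2,4) verdier_simps
    by (rule V_comp[OF S(1,3)]) (use r S Q_comp[of r s] in \<open>auto simp: roofs_iff\<close>)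
  moreover have "(s \<cdot> r, g \<cdot> h) \<in> roofs K N X Z" using r S Q_comp[of r s] by (auto simp: roofs_iff)
  ultimately show "Comp V \<beta> \<alpha> \<in> Hom V X Z" using V_homI by simp
next
  fix \<alpha> X Y assume "\<alpha> \<in> Hom V X Y"
  then obtain s f where S: "X \<in> Obj K" "Y \<in> Obj K" "(s, f) \<in> roofs K N X Y" "\<alpha> = roof_class K N (s, f)" by (elim V_homE)
  note S' = S(3)[unfolded roofs_iff]
  show "Comp V \<alpha> (Ide V X) = \<alpha>" unfolding S(4) verdier_simps
    by (subst V_comp[OF _ S(3), of "Ide K X" "Ide K X" X s "Ide K (Dom K s)"])
      (use S S' in \<open>auto simp: roofs_iff\<close>)
  show "Comp V (Ide V Y) \<alpha> = \<alpha>" unfolding S(4) verdier_simps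
    by (subst V_comp[OF S(3), of "Ide K Y" "Ide K Y" Y "Ide K (Dom K s)" f])
      (use S S' in \<open>auto simp: roofs_iff\<close>)
next
  fix \<alpha> \<beta> \<gamma> W X Y Z assume "\<alpha> \<in> Hom V W X" "\<beta> \<in> Hom V X Y" "\<gamma> \<in> Hom V Y Z"
  then obtain s1 f1 s2 f2 s3 f3 where S: "(s1, f1) \<in> roofs K N W X" "\<alpha> = roof_class K N (s1, f1)"
    "(s2, f2) \<in> roofs K N X Y" "\<beta> = roof_class K N (s2, f2)"
    "(s3, f3) \<in> roofs K N Y Z" "\<gamma> = roof_class K N (s3, f3)" by (elim V_homE) blast
  note S' = S(1,3,5)[unfolded roofs_iff]
  obtain r1 h1 where r1: "r1 \<in> Q" "h1 \<in> Arr K" "Cod K r1 = Dom K f1" "Cod K h1 = Dom K s2" "Dom K r1 = Dom K h1"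
    "f1 \<cdot> r1 = s2 \<cdot> h1" using Ore[of f1 s2] S' by auto
  obtain r2 h2 where r2: "r2 \<in> Q" "h2 \<in> Arr K" "Cod K r2 = Dom K f2" "Cod K h2 = Dom K s3" "Dom K r2 = Dom K h2"
    "f2 \<cdot> r2 = s3 \<cdot> h2" using Ore[of f2 s3] S' by auto
  \<comment> \<open>This third square sits on the other two; the staircase computes both
    bracketings.\<close>
  obtain r3 h3 where r3: "r3 \<in> Q" "h3 \<in> Arr K" "Cod K r3 = Dom K h1" "Cod K h3 = Dom K r2" "Dom K r3 = Dom K h3"
    "h1 \<cdot> r3 = r2 \<cdot> h3" using Ore[of h1 r2] r1 r2 S' by auto
  have q: "s1 \<cdot> r1 \<in> Q" "s2 \<cdot> r2 \<in> Q" "(s1 \<cdot> r1) \<cdot> r3 \<in> Q"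
    using Q_comp[of r1 s1] Q_comp[of r2 s2] Q_comp[of r3 "s1 \<cdot> r1"] r1 r2 r3 S' by auto
  have e: "f1 \<cdot> (r1 \<cdot> r3) = (s2 \<cdot> r2) \<cdot> h3" "(f2 \<cdot> h1) \<cdot> r3 = s3 \<cdot> (h2 \<cdot> h3)"
    using assoc_cong[OF r1(6), of r3] assoc_cong[OF r2(6), of h3] r1 r2 r3 S' by auto
  have "Comp V (Comp V \<gamma> \<beta>) \<alpha> = roof_class K N (s1 \<cdot> (r1 \<cdot> r3), (f3 \<cdot> h2) \<cdot> h3)"
    unfolding S(2,4,6) verdier_simps
    by (subst V_comp[OF S(3,5), of r2 h2], (use r2 S' q in auto)[7], rule V_comp[OF S(1), of "s2 \<cdot> r2" "f3 \<cdot> h2" Z])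
      (use r1 r2 r3 S' q e in \<open>auto simp: roofs_iff\<close>)
  also have "\<dots> = roof_class K N ((s1 \<cdot> r1) \<cdot> r3, f3 \<cdot> (h2 \<cdot> h3))" using r1 r2 r3 S' by simp
  also have "\<dots> = Comp V \<gamma> (Comp V \<beta> \<alpha>)"
    unfolding S(2,4,6) verdier_simps
    by (subst V_comp[OF S(1,3), of r1 h1], (use r1 S' q in auto)[7], rule V_comp[OF _ S(5), symmetric, of "s1 \<cdot> r1" "f2 \<cdot> h1" W])
      (use r1 r2 r3 S' q e in \<open>auto simp: roofs_iff\<close>)
  finally show "Comp V (Comp V \<gamma> \<beta>) \<alpha> = Comp V \<gamma> (Comp V \<beta> \<alpha>)" .
qed

lemma qf_def: "qf f = roof_class K N (Ide K (Dom K f), f)"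
  by (simp add: quot_functor_def)

lemma qf_roof: "f \<in> Arr K \<Longrightarrow> (Ide K (Dom K f), f) \<in> roofs K N (Dom K f) (Cod K f)"
  by (simp add: roofs_iff)

lemma qf_hom: "f \<in> Hom K X Y \<Longrightarrow> qf f \<in> Hom V X Y"
  using V_homI[OF qf_roof] by (auto simp: qf_def Hom_def[of K])

lemma qf_comp:
  assumes "f \<in> Arr K" "g \<in> Arr K" "Cod K f = Dom K g"
  shows "qf (g \<cdot> f) = Comp V (qf g) (qf f)"
  unfolding qf_def verdier_simps
  by (subst V_comp[OF qf_roof[OF assms(1)], of "Ide K (Dom K g)" g "Cod K g" "Ide K (Dom K f)" f])
    (use assms in \<open>auto simp: roofs_iff\<close>)

text \<open>Clears the denominator: the fraction becomes an equation between images of arrows of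
  \<open>K\<close>. Fullness of a realization functor is exploited in this form.\<close>

lemma roof_comp_qf:
  assumes "(s, f) \<in> roofs K N X Y"
  shows "Comp V (roof_class K N (s, f)) (qf s) = qf f"
  unfolding qf_def verdier_simps
  by (subst V_comp[OF qf_roof, of s s f Y "Ide K (Dom K s)" "Ide K (Dom K s)"])
    (use assms in \<open>auto simp: roofs_iff\<close>)

lemma qf_eqI:
  assumes "f \<in> Arr K" "g \<in> Arr K" "Dom K f = Dom K g" "Cod K f = Cod K g" "s \<in> Q" "Cod K s = Dom K f" "f \<cdot> s = g \<cdot> s"
  shows "qf f = qf g"
proof -
  have "((Ide K (Dom K f), f), (Ide K (Dom K f), g)) \<in> roof_rel K N (Dom K f) (Cod K f)"
    by (rule roof_relI[where a = s and b = s]) (use assms in \<open>auto simp: roofs_iff\<close>)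
  then show ?thesis
    unfolding qf_def using roof_class_eq[of "Ide K (Dom K f)" f "Dom K f" "Cod K f" "Ide K (Dom K f)" g] assms by (auto simp: roofs_iff)
qed

end

section \<open>Quasi-isomorphisms\<close>

text \<open>A complex is acyclic iff its cohomology, tested on generalised elements, vanishes locally for the
  deflations.  In this form quasi-isomorphisms visibly compose, so no octahedron in the homotopy
  category is needed.\<close>

locale deflations = additive_category A
  for A :: "('o, 'm, 'e) add_category_scheme" (structure) +
  fixes D :: "'m set"
  assumes D_arr: "e \<in> D \<Longrightarrow> e \<in> Arr A"
    and D_ide: "P \<in> Obj A \<Longrightarrow> Ide A P \<in> D"
    and D_comp: "e \<in> D \<Longrightarrow> e' \<in> D \<Longrightarrow> Cod A e' = Dom A e \<Longrightarrow> e \<cdot> e' \<in> D"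
begin

abbreviation "K \<equiv> Kb A"
abbreviation "S \<equiv> farr (Susp (Kb A))"
abbreviation "So \<equiv> fob (Susp (Kb A))"
abbreviation Kcomp (infixr "\<odot>" 70) where "g \<odot> f \<equiv> Comp (Kb A) g f"

sublocale K: category "Kb A" by (rule category_Kb)

declare Kb_simps [simp del]

lemma Obj_K: "Obj K = bounded_complexes A" by (simp add: Kb_simps)

lemma S_hom: "f \<in> Hom K X Y \<Longrightarrow> S f \<in> Hom K (So X) (So Y)"
  by (rule functor_hom[OF is_functor_Kb_susp])

lemma S_comp: "f \<in> Hom K X Y \<Longrightarrow> g \<in> Hom K Y Z \<Longrightarrow> S (g \<odot> f) = S g \<odot> S f"
  by (rule functorD(6)[OF is_functor_Kb_susp]) (auto simp: Hom_def)

lemma S_bij: "X \<in> Obj K \<Longrightarrow> Y \<in> Obj K \<Longrightarrow> bij_betw S (Hom K X Y) (Hom K (So X) (So Y))"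
  using bij_betw_Kb_susp by (simp add: Kb_simps)

lemma S_inj: "f \<in> Hom K X Y \<Longrightarrow> g \<in> Hom K X Y \<Longrightarrow> S f = S g \<Longrightarrow> f = g"
  using S_bij[of X Y] K.Hom_obj[of f X Y] unfolding bij_betw_def inj_on_def by blast

lemma S_lift: "g \<in> Hom K (So X) (So Y) \<Longrightarrow> X \<in> Obj K \<Longrightarrow> Y \<in> Obj K \<Longrightarrow> \<exists>f \<in> Hom K X Y. g = S f"
  using S_bij[of X Y] unfolding bij_betw_def by blast

lemma S_surj: "X \<in> Obj K \<Longrightarrow> \<exists>Y \<in> Obj K. So Y = X"
  by (rule bexI[of _ "unshift A X"]) (simp_all add: Kb_simps)

lemma So_obj: "X \<in> Obj K \<Longrightarrow> So X \<in> Obj K"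
  by (simp add: Kb_simps)

lemma zero_hom: "X \<in> Obj K \<Longrightarrow> Y \<in> Obj K \<Longrightarrow> Zero K X Y \<in> Hom K X Y"
  using Kb_zero_hom by (simp add: Obj_K)

lemma comp_zero_K: "f \<in> Hom K X Y \<Longrightarrow> W \<in> Obj K \<Longrightarrow> f \<odot> Zero K W X = Zero K W Y"
  using Kb_comp_zero by (simp add: Obj_K)

lemma zero_comp_K: "f \<in> Hom K X Y \<Longrightarrow> Z \<in> Obj K \<Longrightarrow> Zero K Y Z \<odot> f = Zero K X Z"
  using Kb_zero_comp by (simp add: Obj_K)

lemma S_zero: "X \<in> Obj K \<Longrightarrow> Y \<in> Obj K \<Longrightarrow> S (Zero K X Y) = Zero K (So X) (So Y)"
  using Kb_susp[OF _ _ chain_zero] by (simp add: Kb_simps)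

lemma S_eq_zero: "f \<in> Hom K X Y \<Longrightarrow> S f = Zero K (So X) (So Y) \<Longrightarrow> f = Zero K X Y"
  using S_inj[of f X Y "Zero K X Y"] S_zero[of X Y] zero_hom[of X Y] K.Hom_obj[of f X Y] by simp

lemma stalk_obj: "P \<in> Obj A \<Longrightarrow> stalk A k P \<in> Obj K"
  by (simp add: Obj_K)

lemma So_stalk: "P \<in> Obj A \<Longrightarrow> So (stalk A (k + 1) P) = stalk A k P"
  using shift_stalk by (simp add: Kb_simps)

lemma D_obj: "e \<in> D \<Longrightarrow> Dom A e \<in> Obj A" "e \<in> D \<Longrightarrow> Cod A e \<in> Obj A"
  using D_arr by auto

lemma sm_hom: "e \<in> D \<Longrightarrow> stalk_map A k e \<in> Hom K (stalk A k (Dom A e)) (stalk A k (Cod A e))"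
  using stalk_map_hom D_arr by (auto simp: Hom_def[of A])

lemma sm_comp: "e \<in> D \<Longrightarrow> e' \<in> D \<Longrightarrow> Cod A e' = Dom A e \<Longrightarrow>
    stalk_map A k (e \<cdot> e') = stalk_map A k e \<odot> stalk_map A k e'"
  using stalk_map_comp[of e' "Dom A e'" "Dom A e" e "Cod A e"] D_arr by (auto simp: Hom_def)

lemma S_sm: "e \<in> D \<Longrightarrow> S (stalk_map A (k + 1) e) = stalk_map A k e"
  using stalk_map_susp[of e "Dom A e" "Cod A e"] D_arr by (auto simp: Hom_def)

definition effaceable :: "('o, 'm) cochain_complex \<Rightarrow> bool" where
  "effaceable X \<longleftrightarrow> X \<in> Obj K \<and> (\<forall>k. \<forall>P \<in> Obj A. \<forall>h \<in> Hom K (stalk A k P) X.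
     \<exists>e \<in> D. Cod A e = P \<and> h \<odot> stalk_map A k e = Zero K (stalk A k (Dom A e)) X)"

text \<open>Local surjectivity and local injectivity on cohomology elements in all degrees, for the
  covers given by deflations.\<close>

definition qis :: "('o, 'm) htpy_arr \<Rightarrow> bool" where
  "qis s \<longleftrightarrow> s \<in> Arr K \<and>
     (\<forall>k. \<forall>P \<in> Obj A. \<forall>h \<in> Hom K (stalk A k P) (Cod K s). \<exists>e \<in> D. Cod A e = P \<and>
        (\<exists>h' \<in> Hom K (stalk A k (Dom A e)) (Dom K s). h \<odot> stalk_map A k e = s \<odot> h')) \<and>
     (\<forall>k. \<forall>P \<in> Obj A. \<forall>h \<in> Hom K (stalk A k P) (Dom K s). s \<odot> h = Zero K (stalk A k P) (Cod K s) \<longrightarrow>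
        (\<exists>e \<in> D. Cod A e = P \<and> h \<odot> stalk_map A k e = Zero K (stalk A k (Dom A e)) (Dom K s)))"

lemma qisI:
  assumes "s \<in> Hom K X Y"
    "\<And>k P h. P \<in> Obj A \<Longrightarrow> h \<in> Hom K (stalk A k P) Y \<Longrightarrow> \<exists>e \<in> D. Cod A e = P \<and>
        (\<exists>h' \<in> Hom K (stalk A k (Dom A e)) X. h \<odot> stalk_map A k e = s \<odot> h')"
    "\<And>k P h. P \<in> Obj A \<Longrightarrow> h \<in> Hom K (stalk A k P) X \<Longrightarrow> s \<odot> h = Zero K (stalk A k P) Y \<Longrightarrow>
        \<exists>e \<in> D. Cod A e = P \<and> h \<odot> stalk_map A k e = Zero K (stalk A k (Dom A e)) X"
  shows "qis s"
  using assms unfolding qis_def Hom_def[of K X Y] by auto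

lemma qisE:
  assumes "qis s" "s \<in> Hom K X Y"
  shows "P \<in> Obj A \<Longrightarrow> h \<in> Hom K (stalk A k P) Y \<Longrightarrow> \<exists>e \<in> D. Cod A e = P \<and>
        (\<exists>h' \<in> Hom K (stalk A k (Dom A e)) X. h \<odot> stalk_map A k e = s \<odot> h')"
    "P \<in> Obj A \<Longrightarrow> h \<in> Hom K (stalk A k P) X \<Longrightarrow> s \<odot> h = Zero K (stalk A k P) Y \<Longrightarrow>
        \<exists>e \<in> D. Cod A e = P \<and> h \<odot> stalk_map A k e = Zero K (stalk A k (Dom A e)) X"
  using assms unfolding qis_def Hom_def[of K X Y] by auto

lemma effaceableE:
  assumes "effaceable X" "P \<in> Obj A" "h \<in> Hom K (stalk A k P) X"
  obtains e where "e \<in> D" "Cod A e = P" "h \<odot> stalk_map A k e = Zero K (stalk A k (Dom A e)) X"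
  using assms unfolding effaceable_def by blast

lemma qis_iso:
  assumes "is_iso K s" "s \<in> Hom K X Y"
  shows "qis s"
proof (rule qisI[OF assms(2)])
  obtain t where t: "t \<in> Hom K Y X" "t \<odot> s = Ide K X" "s \<odot> t = Ide K Y" using K.is_isoE[OF assms] by metis
  fix k P h assume P: "P \<in> Obj A"
  note i = D_ide[OF P] and sm = sm_hom[OF D_ide[OF P], of k]
  {
    assume h: "h \<in> Hom K (stalk A k P) Y"
    let ?h = "h \<odot> stalk_map A k (Ide A P)"
    have h1: "?h \<in> Hom K (stalk A k P) Y" using K.Comp_closed[OF _ h] sm P by simp
    have "?h = s \<odot> (t \<odot> ?h)" using K.Comp_assoc[OF h1 t(1) assms(2)] t(3) K.Ide_Comp[OF h1] by simp
    then show "\<exists>e \<in> D. Cod A e = P \<and> (\<exists>h' \<in> Hom K (stalk A k (Dom A e)) X. h \<odot> stalk_map A k e = s \<odot> h')"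
      using i P K.Comp_closed[OF h1 t(1)] by (intro bexI[of _ "Ide A P"] conjI bexI[of _ "t \<odot> ?h"]) auto
  }
  {
    assume h: "h \<in> Hom K (stalk A k P) X" "s \<odot> h = Zero K (stalk A k P) Y"
    have "h = t \<odot> (s \<odot> h)" using K.Comp_assoc[OF h(1) assms(2) t(1)] t(2) K.Ide_Comp[OF h(1)] by simp
    then have "h = Zero K (stalk A k P) X" using h(2) comp_zero_K[OF t(1)] stalk_obj[OF P] by simp
    then have "h \<odot> stalk_map A k (Ide A P) = Zero K (stalk A k P) X"
      using zero_comp_K[OF sm, of X] K.Hom_obj[OF h(1)] P by simp
    then show "\<exists>e \<in> D. Cod A e = P \<and> h \<odot> stalk_map A k e = Zero K (stalk A k (Dom A e)) X"
      using i P by (intro bexI[of _ "Ide A P"]) auto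
  }
qed

text \<open>A cohomology element of \<open>Z\<close> is lifted along \<open>t\<close> over one
  deflation and along \<open>s\<close> over a second one; injectivity is treated likewise. Closure
  of \<open>D\<close> under composition combines the two.\<close>

lemma qis_comp:
  assumes s: "qis s" "s \<in> Hom K X Y" and t: "qis t" "t \<in> Hom K Y Z"
  shows "qis (t \<odot> s)"
proof (rule qisI[OF K.Comp_closed[OF s(2) t(2)]])
  fix k P h assume P: "P \<in> Obj A"
  {
    assume h: "h \<in> Hom K (stalk A k P) Z"
    from qisE(1)[OF t P h] obtain e h' where e: "e \<in> D" "Cod A e = P" "h' \<in> Hom K (stalk A k (Dom A e)) Y"
      "h \<odot> stalk_map A k e = t \<odot> h'" by blast
    from qisE(1)[OF s D_obj(1)[OF e(1)] e(3)] obtain e' h'' where e': "e' \<in> D" "Cod A e' = Dom A e"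
      "h'' \<in> Hom K (stalk A k (Dom A e')) X" "h' \<odot> stalk_map A k e' = s \<odot> h''" by blast
    note sm = sm_hom[OF e(1), of k, unfolded e(2)] sm_hom[OF e'(1), of k, unfolded e'(2)]
    have "h \<odot> stalk_map A k (e \<cdot> e') = (h \<odot> stalk_map A k e) \<odot> stalk_map A k e'"
      using sm_comp[OF e(1) e'(1,2)] K.Comp_assoc[OF sm(2,1) h] by simp
    also have "\<dots> = t \<odot> (s \<odot> h'')" using e(4) K.Comp_assoc[OF sm(2) e(3) t(2)] e'(4) by simp
    also have "\<dots> = (t \<odot> s) \<odot> h''" using K.Comp_assoc[OF e'(3) s(2) t(2)] by simp
    finally show "\<exists>e \<in> D. Cod A e = P \<and> (\<exists>h' \<in> Hom K (stalk A k (Dom A e)) X. h \<odot> stalk_map A k e = (t \<odot> s) \<odot> h')"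
      using D_comp[OF e(1) e'(1,2)] e e' D_arr by (intro bexI[of _ "e \<cdot> e'"]) auto
  }
  {
    assume h: "h \<in> Hom K (stalk A k P) X" "(t \<odot> s) \<odot> h = Zero K (stalk A k P) Z"
    have sh: "s \<odot> h \<in> Hom K (stalk A k P) Y" "t \<odot> (s \<odot> h) = Zero K (stalk A k P) Z"
      using K.Comp_closed[OF h(1) s(2)] h(2) K.Comp_assoc[OF h(1) s(2) t(2)] by auto
    from qisE(2)[OF t P sh] obtain e where e: "e \<in> D" "Cod A e = P"
      "(s \<odot> h) \<odot> stalk_map A k e = Zero K (stalk A k (Dom A e)) Y" by blast
    note sm1 = sm_hom[OF e(1), of k, unfolded e(2)]
    have "s \<odot> (h \<odot> stalk_map A k e) = Zero K (stalk A k (Dom A e)) Y"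
      using e(3) K.Comp_assoc[OF sm1 h(1) s(2)] by simp
    from qisE(2)[OF s D_obj(1)[OF e(1)] K.Comp_closed[OF sm1 h(1)] this]
    obtain e' where e': "e' \<in> D" "Cod A e' = Dom A e"
      "(h \<odot> stalk_map A k e) \<odot> stalk_map A k e' = Zero K (stalk A k (Dom A e')) X" by blast
    note sm2 = sm_hom[OF e'(1), of k, unfolded e'(2)]
    have "h \<odot> stalk_map A k (e \<cdot> e') = Zero K (stalk A k (Dom A e')) X"
      using sm_comp[OF e(1) e'(1,2)] K.Comp_assoc[OF sm2 sm1 h(1)] e'(3) by simp
    then show "\<exists>e \<in> D. Cod A e = P \<and> h \<odot> stalk_map A k e = Zero K (stalk A k (Dom A e)) X"
      using D_comp[OF e(1) e'(1,2)] e e' D_arr by (intro bexI[of _ "e \<cdot> e'"]) auto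
  }
qed

text \<open>Suspension identifies maps out of the stalk in degree \<open>k\<close> with maps out of
  the stalk in degree \<open>k - 1\<close>, so the conditions on \<open>S r\<close> are those on
  \<open>r\<close>, reindexed.\<close>

lemma qis_unshift:
  assumes r: "r \<in> Hom K X Y" and q: "qis (S r)"
  shows "qis r"
proof (rule qisI[OF r])
  note o = K.Hom_obj[OF r]
  fix k P h assume P: "P \<in> Obj A"
  have k: "So (stalk A k Q) = stalk A (k - 1) Q" if "Q \<in> Obj A" for Q using So_stalk[OF that, of "k - 1"] by simp
  have k': "S (stalk_map A k e) = stalk_map A (k - 1) e" if "e \<in> D" for e using S_sm[OF that, of "k - 1"] by simp
  {
    assume h: "h \<in> Hom K (stalk A k P) Y"
    from qisE(1)[OF q S_hom[OF r] P, of "S h" "k - 1"] S_hom[OF h] k[OF P] obtain e h'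
      where e: "e \<in> D" "Cod A e = P" "h' \<in> Hom K (stalk A (k - 1) (Dom A e)) (So X)"
      "S h \<odot> stalk_map A (k - 1) e = S r \<odot> h'" by auto
    obtain h'' where h'': "h'' \<in> Hom K (stalk A k (Dom A e)) X" "h' = S h''"
      using S_lift[of h' "stalk A k (Dom A e)" X] e(3) k[OF D_obj(1)[OF e(1)]] o stalk_obj[OF D_obj(1)[OF e(1)]] by auto
    note sm = sm_hom[OF e(1), of k, unfolded e(2)]
    have "S (h \<odot> stalk_map A k e) = S (r \<odot> h'')"
      using S_comp[OF sm h] S_comp[OF h''(1) r] e(4) h''(2) k'[OF e(1)] by simp
    then have "h \<odot> stalk_map A k e = r \<odot> h''"
      using S_inj K.Comp_closed[OF sm h] K.Comp_closed[OF h''(1) r] by blast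
    then show "\<exists>e \<in> D. Cod A e = P \<and> (\<exists>h' \<in> Hom K (stalk A k (Dom A e)) X. h \<odot> stalk_map A k e = r \<odot> h')"
      using e h'' by blast
  }
  {
    assume h: "h \<in> Hom K (stalk A k P) X" "r \<odot> h = Zero K (stalk A k P) Y"
    have "S r \<odot> S h = Zero K (stalk A (k - 1) P) (So Y)"
      using S_comp[OF h(1) r] h(2) S_zero[OF stalk_obj[OF P], of Y k] o k[OF P] by simp
    with qisE(2)[OF q S_hom[OF r] P, of "S h" "k - 1"] S_hom[OF h(1)] k[OF P] obtain e
      where e: "e \<in> D" "Cod A e = P" "S h \<odot> stalk_map A (k - 1) e = Zero K (stalk A (k - 1) (Dom A e)) (So X)" by auto
    note sm = sm_hom[OF e(1), of k, unfolded e(2)]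
    have "h \<odot> stalk_map A k e = Zero K (stalk A k (Dom A e)) X"
      by (rule S_eq_zero[OF K.Comp_closed[OF sm h(1)]])
        (use S_comp[OF sm h(1)] e k'[OF e(1)] k[OF D_obj(1)[OF e(1)]] in simp)
    then show "\<exists>e \<in> D. Cod A e = P \<and> h \<odot> stalk_map A k e = Zero K (stalk A k (Dom A e)) X" using e by blast
  }
qed

lemma stdD:
  assumes "(u, v, w) \<in> std_triangles A" "u \<in> Hom K X Y" "Cod K v = Z"
  shows "v \<in> Hom K Y Z" "w \<in> Hom K Z (So X)"
    "v \<odot> u = Zero K X Z" "w \<odot> v = Zero K Y (So X)" "S u \<odot> w = Zero K Z (So Y)"
    "g \<in> Hom K W Y \<Longrightarrow> v \<odot> g = Zero K W Z \<Longrightarrow> \<exists>a \<in> Hom K W X. g = u \<odot> a"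
    "g \<in> Hom K W Z \<Longrightarrow> w \<odot> g = Zero K W (So X) \<Longrightarrow> \<exists>a \<in> Hom K W Y. g = v \<odot> a"
    "g \<in> Hom K W (So X) \<Longrightarrow> S u \<odot> g = Zero K W (So Y) \<Longrightarrow> \<exists>a \<in> Hom K W Z. g = w \<odot> a"
proof -
  have t: "u \<in> Arr K" "v \<in> Arr K" "w \<in> Arr K" "Cod K u = Dom K v" "Cod K v = Dom K w" "Cod K w = So (Dom K u)"
    using std_is_triangle[OF assms(1)] by (auto simp: is_triangle_def)
  have d: "Dom K u = X" "Cod K u = Y" "Dom K v = Y" "Cod K v = Z" "Dom K w = Z" "Cod K w = So X"
    using t assms(2,3) by (auto simp: Hom_def)
  note facts = std_zero[OF assms(1)] std_exact1[OF assms(1)] std_exact2[OF assms(1)] std_exact3[OF assms(1)]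
  note facts' = facts[unfolded d]
  show "v \<in> Hom K Y Z" "w \<in> Hom K Z (So X)" using t d by (auto simp: Hom_def)
  show "v \<odot> u = Zero K X Z" "w \<odot> v = Zero K Y (So X)" "S u \<odot> w = Zero K Z (So Y)"
    by (fact facts')+
  show "g \<in> Hom K W Y \<Longrightarrow> v \<odot> g = Zero K W Z \<Longrightarrow> \<exists>a \<in> Hom K W X. g = u \<odot> a"
    "g \<in> Hom K W Z \<Longrightarrow> w \<odot> g = Zero K W (So X) \<Longrightarrow> \<exists>a \<in> Hom K W Y. g = v \<odot> a"
    "g \<in> Hom K W (So X) \<Longrightarrow> S u \<odot> g = Zero K W (So Y) \<Longrightarrow> \<exists>a \<in> Hom K W Z. g = w \<odot> a"
    by (fact facts')+
qed

lemma effaceable_iso: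
  assumes "effaceable X" "isomorphic K X Y"
  shows "effaceable Y"
proof -
  obtain a where a: "a \<in> Hom K X Y" "is_iso K a" using assms(2) by (auto simp: isomorphic_def)
  obtain b where b: "b \<in> Hom K Y X" "a \<odot> b = Ide K Y" using K.is_isoE[OF a(2,1)] by metis
  show ?thesis unfolding effaceable_def
  proof (intro conjI allI ballI)
    show "Y \<in> Obj K" using K.Hom_obj[OF a(1)] by simp
    fix k P h assume P: "P \<in> Obj A" and h: "h \<in> Hom K (stalk A k P) Y"
    obtain e where e: "e \<in> D" "Cod A e = P" "(b \<odot> h) \<odot> stalk_map A k e = Zero K (stalk A k (Dom A e)) X"
      using effaceableE[OF assms(1) P K.Comp_closed[OF h b(1)]] .
    note sm = sm_hom[OF e(1), of k, unfolded e(2)]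
    have "h \<odot> stalk_map A k e = (a \<odot> b) \<odot> (h \<odot> stalk_map A k e)"
      using b(2) K.Ide_Comp[OF K.Comp_closed[OF sm h]] by simp
    also have "\<dots> = a \<odot> ((b \<odot> h) \<odot> stalk_map A k e)"
      using K.Comp_assoc[OF K.Comp_closed[OF sm h] b(1) a(1)] K.Comp_assoc[OF sm h b(1)] by simp
    also have "\<dots> = Zero K (stalk A k (Dom A e)) Y"
      using e(3) comp_zero_K[OF a(1)] stalk_obj[OF D_obj(1)[OF e(1)]] by simp
    finally show "\<exists>e \<in> D. Cod A e = P \<and> h \<odot> stalk_map A k e = Zero K (stalk A k (Dom A e)) Y" using e by blast
  qed
qed

text \<open>In the long exact sequence the two terms next to \<open>w\<close> come from the middle
  vertex and vanish locally.\<close>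

lemma qis_third:
  assumes std: "(u, v, w) \<in> std_triangles A" and eff: "effaceable (Cod K u)"
  shows "qis w"
proof -
  obtain X Y where u: "u \<in> Hom K X Y" using std_is_triangle[OF std] by (auto simp: is_triangle_def Hom_def)
  define Z where "Z = Cod K v"
  note t = u stdD[OF std u Z_def[symmetric]]
  have eff: "effaceable Y" using eff t(1) by (simp add: Hom_def)
  note o = K.Hom_obj[OF t(1)]
  show ?thesis
  proof (rule qisI[OF t(3)])
    fix k P h assume P: "P \<in> Obj A"
    {
      assume h: "h \<in> Hom K (stalk A k P) (So X)"
      have Suh: "S u \<odot> h \<in> Hom K (stalk A k P) (So Y)" using K.Comp_closed[OF h S_hom[OF t(1)]] .
      obtain g where g: "g \<in> Hom K (stalk A (k + 1) P) Y" "S u \<odot> h = S g"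
        using S_lift[of "S u \<odot> h" "stalk A (k + 1) P" Y] Suh So_stalk[OF P, of k] stalk_obj[OF P] o by auto
      obtain e where e: "e \<in> D" "Cod A e = P" "g \<odot> stalk_map A (k + 1) e = Zero K (stalk A (k + 1) (Dom A e)) Y"
        using effaceableE[OF eff P g(1)] .
      note sm = sm_hom[OF e(1), of "k + 1", unfolded e(2)] sm_hom[OF e(1), of k, unfolded e(2)]
      have "S g \<odot> stalk_map A k e = Zero K (stalk A k (Dom A e)) (So Y)"
        using S_comp[OF sm(1) g(1)] e(3) S_sm[OF e(1), of k] So_stalk[OF D_obj(1)[OF e(1)], of k]
          S_zero[OF stalk_obj[OF D_obj(1)[OF e(1)]], of Y] o by simp
      then have "S u \<odot> (h \<odot> stalk_map A k e) = Zero K (stalk A k (Dom A e)) (So Y)"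
        using g(2) K.Comp_assoc[OF sm(2) h S_hom[OF t(1)]] by simp
      from t(9)[OF K.Comp_closed[OF sm(2) h] this]
      show "\<exists>e \<in> D. Cod A e = P \<and> (\<exists>h' \<in> Hom K (stalk A k (Dom A e)) Z. h \<odot> stalk_map A k e = w \<odot> h')"
        using e by blast
    }
    {
      assume h: "h \<in> Hom K (stalk A k P) Z" "w \<odot> h = Zero K (stalk A k P) (So X)"
      obtain g where g: "g \<in> Hom K (stalk A k P) Y" "h = v \<odot> g" using t(8)[OF h] by blast
      obtain e where e: "e \<in> D" "Cod A e = P" "g \<odot> stalk_map A k e = Zero K (stalk A k (Dom A e)) Y"
        using effaceableE[OF eff P g(1)] .
      note sm = sm_hom[OF e(1), of k, unfolded e(2)]
      have "h \<odot> stalk_map A k e = Zero K (stalk A k (Dom A e)) Z"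
        using K.Comp_assoc[OF sm g(1) t(2)] g(2) e(3) comp_zero_K[OF t(2)] stalk_obj[OF D_obj(1)[OF e(1)]] by simp
      then show "\<exists>e \<in> D. Cod A e = P \<and> h \<odot> stalk_map A k e = Zero K (stalk A k (Dom A e)) Z" using e by blast
    }
  qed
qed

text \<open>The long exact sequence, with every lift made after a deflation. For a class
  \<open>h\<close> of the cone two deflations are composed: one kills its image in the cohomology of
  \<open>X\<close>, the second lifts what is left of \<open>h\<close> along \<open>u\<close>, and
  \<open>v u\<close> is zero.\<close>

lemma qis_iff_effaceable_cone:
  assumes std: "(u, v, w) \<in> std_triangles A"
  shows "qis u \<longleftrightarrow> effaceable (Cod K v)"
proof -
  obtain X Y where u: "u \<in> Hom K X Y" using std_is_triangle[OF std] by (auto simp: is_triangle_def Hom_def)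
  define Z where "Z = Cod K v"
  note t = u stdD[OF std u Z_def[symmetric]]
  have Z: "Cod K v = Z" by (simp add: Z_def)
  note o = K.Hom_obj[OF t(1)] K.Hom_obj[OF t(2)]
  show ?thesis
  proof
    assume "effaceable (Cod K v)"
    then have eff: "effaceable Z" using Z by simp
    show "qis u"
    proof (rule qisI[OF t(1)])
      fix k P h assume P: "P \<in> Obj A"
      {
        assume h: "h \<in> Hom K (stalk A k P) Y"
        obtain e where e: "e \<in> D" "Cod A e = P" "(v \<odot> h) \<odot> stalk_map A k e = Zero K (stalk A k (Dom A e)) Z"
          using effaceableE[OF eff P K.Comp_closed[OF h t(2)]] .
        note sm = sm_hom[OF e(1), of k, unfolded e(2)]
        have "v \<odot> (h \<odot> stalk_map A k e) = Zero K (stalk A k (Dom A e)) Z"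
          using K.Comp_assoc[OF sm h t(2)] e(3) by simp
        from t(7)[OF K.Comp_closed[OF sm h] this]
        show "\<exists>e \<in> D. Cod A e = P \<and> (\<exists>h' \<in> Hom K (stalk A k (Dom A e)) X. h \<odot> stalk_map A k e = u \<odot> h')"
          using e by blast
      }
      {
        assume h: "h \<in> Hom K (stalk A k P) X" "u \<odot> h = Zero K (stalk A k P) Y"
        have k: "So (stalk A k R) = stalk A (k - 1) R" if "R \<in> Obj A" for R using So_stalk[OF that, of "k - 1"] by simp
        have Sh: "S h \<in> Hom K (stalk A (k - 1) P) (So X)" using S_hom[OF h(1)] k[OF P] by simp
        have "S u \<odot> S h = Zero K (stalk A (k - 1) P) (So Y)"
          using S_comp[OF h(1) t(1)] h(2) S_zero[OF stalk_obj[OF P], of Y k] o k[OF P] by simp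
        from t(9)[OF Sh this] obtain g where g: "g \<in> Hom K (stalk A (k - 1) P) Z" "S h = w \<odot> g" by blast
        obtain e where e: "e \<in> D" "Cod A e = P" "g \<odot> stalk_map A (k - 1) e = Zero K (stalk A (k - 1) (Dom A e)) Z"
          using effaceableE[OF eff P g(1)] .
        note sm = sm_hom[OF e(1), of k, unfolded e(2)] sm_hom[OF e(1), of "k - 1", unfolded e(2)]
        have "S h \<odot> stalk_map A (k - 1) e = Zero K (stalk A (k - 1) (Dom A e)) (So X)"
          using g(2) K.Comp_assoc[OF sm(2) g(1) t(3)] e(3) comp_zero_K[OF t(3)] stalk_obj[OF D_obj(1)[OF e(1)]] by simp
        then have "S (h \<odot> stalk_map A k e) = Zero K (So (stalk A k (Dom A e))) (So X)"
          using S_comp[OF sm(1) h(1)] S_sm[OF e(1), of "k - 1"] k[OF D_obj(1)[OF e(1)]] by simp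
        from S_eq_zero[OF K.Comp_closed[OF sm(1) h(1)] this]
        show "\<exists>e \<in> D. Cod A e = P \<and> h \<odot> stalk_map A k e = Zero K (stalk A k (Dom A e)) X" using e by blast
      }
    qed
  next
    assume q: "qis u"
    have "effaceable Z" unfolding effaceable_def
    proof (intro conjI allI ballI)
      show "Z \<in> Obj K" using o by simp
      fix k P h assume P: "P \<in> Obj A" and h: "h \<in> Hom K (stalk A k P) Z"
      have wh: "w \<odot> h \<in> Hom K (stalk A k P) (So X)" using K.Comp_closed[OF h t(3)] .
      obtain g where g: "g \<in> Hom K (stalk A (k + 1) P) X" "w \<odot> h = S g"
        using S_lift[of "w \<odot> h" "stalk A (k + 1) P" X] wh So_stalk[OF P, of k] stalk_obj[OF P] o by auto
      have "S (u \<odot> g) = Zero K (So (stalk A (k + 1) P)) (So Y)"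
        using S_comp[OF g(1) t(1)] g(2) K.Comp_assoc[OF h t(3) S_hom[OF t(1)]] t(6) zero_comp_K[OF h, of "So Y"]
          So_obj o So_stalk[OF P, of k] by simp
      then have "u \<odot> g = Zero K (stalk A (k + 1) P) Y" using S_eq_zero K.Comp_closed[OF g(1) t(1)] by blast
      from qisE(2)[OF q t(1) P g(1) this] obtain e where e: "e \<in> D" "Cod A e = P"
        "g \<odot> stalk_map A (k + 1) e = Zero K (stalk A (k + 1) (Dom A e)) X" by blast
      note sm = sm_hom[OF e(1), of k, unfolded e(2)] sm_hom[OF e(1), of "k + 1", unfolded e(2)]
      note Pe = D_obj(1)[OF e(1)]
      have "w \<odot> (h \<odot> stalk_map A k e) = S (g \<odot> stalk_map A (k + 1) e)"
        using K.Comp_assoc[OF sm(1) h t(3)] g(2) S_comp[OF sm(2) g(1)] S_sm[OF e(1), of k] by simp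
      also have "\<dots> = Zero K (stalk A k (Dom A e)) (So X)"
        using e(3) S_zero[OF stalk_obj[OF Pe], of X] o So_stalk[OF Pe, of k] by simp
      finally obtain h' where h': "h' \<in> Hom K (stalk A k (Dom A e)) Y" "h \<odot> stalk_map A k e = v \<odot> h'"
        using t(8)[OF K.Comp_closed[OF sm(1) h]] by blast
      from qisE(1)[OF q t(1) Pe h'(1)] obtain e' h'' where e': "e' \<in> D" "Cod A e' = Dom A e"
        "h'' \<in> Hom K (stalk A k (Dom A e')) X" "h' \<odot> stalk_map A k e' = u \<odot> h''" by blast
      note sm' = sm_hom[OF e'(1), of k, unfolded e'(2)]
      have "h \<odot> stalk_map A k (e \<cdot> e') = (v \<odot> h') \<odot> stalk_map A k e'"
        using sm_comp[OF e(1) e'(1,2)] K.Comp_assoc[OF sm' sm(1) h] h'(2) by simp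
      also have "\<dots> = (v \<odot> u) \<odot> h''"
        using K.Comp_assoc[OF sm' h'(1) t(2)] e'(4) K.Comp_assoc[OF e'(3) t(1,2)] by simp
      also have "\<dots> = Zero K (stalk A k (Dom A e')) Z" using t(4) zero_comp_K[OF e'(3)] o by simp
      finally show "\<exists>e \<in> D. Cod A e = P \<and> h \<odot> stalk_map A k e = Zero K (stalk A k (Dom A e)) Z"
        using D_comp[OF e(1) e'(1,2)] e e' D_arr by (intro bexI[of _ "e \<cdot> e'"]) auto
    qed
    then show "effaceable (Cod K v)" using Z by simp
  qed
qed

text \<open>The denominator is the desuspended third map of the triangle on \<open>X \<rightarrow> Y \<rightarrow> cone t\<close>.\<close>

lemma qis_Ore:
  assumes f: "f \<in> Hom K X Y" and t: "t \<in> Hom K W Y" "qis t"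
  shows "\<exists>V r h. r \<in> Hom K V X \<and> qis r \<and> h \<in> Hom K V W \<and> f \<odot> r = t \<odot> h"
proof -
  obtain v w where std: "(t, v, w) \<in> std_triangles A" using std_exists[OF t(1)] by blast
  define N where "N = Cod K v"
  note N = stdD(1,6)[OF std t(1) N_def[symmetric]]
  have eff: "effaceable N" using qis_iff_effaceable_cone[OF std] t(2) N(1) by (simp add: Hom_def)
  have vf: "v \<odot> f \<in> Hom K X N" using K.Comp_closed[OF f N(1)] .
  obtain v' w' where std': "(v \<odot> f, v', w') \<in> std_triangles A" using std_exists[OF vf] by blast
  define M where "M = Cod K v'"
  note M = stdD(2,5)[OF std' vf M_def[symmetric]]
  have q: "qis w'" using qis_third[OF std'] eff vf by (simp add: Hom_def)
  note oM = K.Hom_obj[OF M(1)] and oX = K.Hom_obj[OF f] and oN = K.Hom_obj[OF N(1)]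
  obtain V where V: "V \<in> Obj K" "So V = M" using S_surj oM by blast
  obtain r where r: "r \<in> Hom K V X" "w' = S r" using S_lift[of w' V X] M(1) V oX by auto
  have "S ((v \<odot> f) \<odot> r) = Zero K (So V) (So N)" using S_comp[OF r(1) vf] M(2) r(2) V(2) by simp
  then have "(v \<odot> f) \<odot> r = Zero K V N" using S_eq_zero K.Comp_closed[OF r(1) vf] by blast
  then have "v \<odot> (f \<odot> r) = Zero K V N" using K.Comp_assoc[OF r(1) f N(1)] by simp
  from N(2)[OF K.Comp_closed[OF r(1) f] this] obtain h where "h \<in> Hom K V W" "f \<odot> r = t \<odot> h" by blast
  then show ?thesis using r qis_unshift[OF r(1)] q by blast
qed

text \<open>From \<open>t f = 0\<close>, the suspension of \<open>f\<close> factors as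
  \<open>w m\<close> through the connecting map of the cone of \<open>t\<close>. The third map of
  the triangle on \<open>m\<close> is a quasi-isomorphism annihilated by the suspension of
  \<open>m\<close>; it ends in the double suspension of \<open>W\<close>, so it is desuspended
  twice.\<close>

lemma qis_cancel_zero:
  assumes f: "f \<in> Hom K W X" and t: "t \<in> Hom K X Y" "qis t" and z: "t \<odot> f = Zero K W Y"
  shows "\<exists>V r. r \<in> Hom K V W \<and> qis r \<and> f \<odot> r = Zero K V X"
proof -
  obtain v w where std: "(t, v, w) \<in> std_triangles A" using std_exists[OF t(1)] by blast
  define N where "N = Cod K v"
  note N = stdD(1,2,8)[OF std t(1) N_def[symmetric]]
  have eff: "effaceable N" using qis_iff_effaceable_cone[OF std] t(2) N(1) by (simp add: Hom_def)
  note oW = K.Hom_obj[OF f] and oY = K.Hom_obj[OF t(1)]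
  have "S t \<odot> S f = Zero K (So W) (So Y)" using S_comp[OF f t(1)] z S_zero oW oY by simp
  from N(3)[OF S_hom[OF f] this] obtain m where m: "m \<in> Hom K (So W) N" "S f = w \<odot> m" by blast
  obtain v' w' where std': "(m, v', w') \<in> std_triangles A" using std_exists[OF m(1)] by blast
  define M where "M = Cod K v'"
  note M = stdD(2,5)[OF std' m(1) M_def[symmetric]]
  have q: "qis w'" using qis_third[OF std'] eff m(1) by (simp add: Hom_def)
  note oM = K.Hom_obj[OF M(1)]
  obtain V1 where V1: "V1 \<in> Obj K" "So V1 = M" using S_surj oM by blast
  obtain r1 where r1: "r1 \<in> Hom K V1 (So W)" "w' = S r1" using S_lift[of w' V1 "So W"] M(1) V1 oW So_obj by auto
  obtain V where V: "V \<in> Obj K" "So V = V1" using S_surj V1 by blast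
  obtain r where r: "r \<in> Hom K V W" "r1 = S r" using S_lift[of r1 V W] r1(1) V oW by auto
  have "S (m \<odot> r1) = Zero K (So V1) (So N)" using S_comp[OF r1(1) m(1)] M(2) r1(2) V1(2) by simp
  then have mr: "m \<odot> r1 = Zero K V1 N" using S_eq_zero K.Comp_closed[OF r1(1) m(1)] by blast
  have "S (f \<odot> r) = (w \<odot> m) \<odot> r1" using S_comp[OF r(1) f] m(2) r(2) by simp
  also have "\<dots> = Zero K V1 (So X)"
    using K.Comp_assoc[OF r1(1) m(1) N(2)] mr comp_zero_K[OF N(2)] V1(1) by simp
  finally have "f \<odot> r = Zero K V X" using S_eq_zero[OF K.Comp_closed[OF r(1) f]] V by simp
  then show ?thesis using r qis_unshift[OF r(1)] qis_unshift[OF r1(1)] r1(2) q by blast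
qed

lemma qis_cancel:
  assumes f: "f \<in> Hom K W X" and g: "g \<in> Hom K W X" and t: "t \<in> Hom K X Y" "qis t" and z: "t \<odot> f = t \<odot> g"
  shows "\<exists>V r. r \<in> Hom K V W \<and> qis r \<and> f \<odot> r = g \<odot> r"
proof -
  obtain d where d: "d \<in> Hom K W X"
    "\<And>V r. r \<in> Hom K V W \<Longrightarrow> d \<odot> r = Zero K V X \<longleftrightarrow> f \<odot> r = g \<odot> r"
    "\<And>Z r. r \<in> Hom K X Z \<Longrightarrow> r \<odot> d = Zero K W Z \<longleftrightarrow> r \<odot> f = r \<odot> g"
    using Kb_diff[OF f g] by blast
  then show ?thesis using qis_cancel_zero[OF d(1) t] z t(1) by blast
qed

text \<open>The cone in \<open>quot_system\<close> is known only up to an isomorphism of triangles.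
  Effaceability and being a quasi-isomorphism are both invariant under isomorphism, so a mapping
  cone may be used instead.\<close>

lemma quot_system_iff:
  assumes N: "\<And>X. X \<in> N \<Longrightarrow> effaceable X" "\<And>X. effaceable X \<Longrightarrow> X \<in> N"
  shows "s \<in> quot_system K N \<longleftrightarrow> qis s"
proof
  assume "s \<in> quot_system K N"
  then obtain v w where s: "s \<in> Arr K" "(s, v, w) \<in> Tri K" "Cod K v \<in> N" by (auto simp: quot_system_def)
  then obtain u' v' w' where std: "(u', v', w') \<in> std_triangles A" "triangle_iso K (s, v, w) (u', v', w')"
    unfolding Tri_Kb by auto
  then obtain a b c where t: "is_triangle K s v w" "is_triangle K u' v' w'"
    "a \<in> Hom K (Dom K s) (Dom K u')" "is_iso K a" "b \<in> Hom K (Dom K v) (Dom K v')" "is_iso K b"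
    "c \<in> Hom K (Dom K w) (Dom K w')" "is_iso K c" "b \<odot> s = u' \<odot> a"
    unfolding triangle_iso_def by auto
  have "isomorphic K (Cod K v) (Cod K v')" using t unfolding isomorphic_def is_triangle_def by auto
  then have "qis u'" using qis_iff_effaceable_cone[OF std(1)] effaceable_iso N s(3) by blast
  moreover have u': "u' \<in> Hom K (Dom K u') (Dom K v')" "s \<in> Hom K (Dom K s) (Dom K v)"
    using t(1,2) by (auto simp: is_triangle_def Hom_def)
  ultimately have q: "qis (u' \<odot> a)" using qis_comp[OF qis_iso[OF t(4,3)] t(3)] by blast
  obtain b' where b': "b' \<in> Hom K (Dom K v') (Dom K v)" "b' \<odot> b = Ide K (Dom K v)" "is_iso K b'"
    using K.is_isoE[OF t(6,5)] by metis
  have "s = b' \<odot> (u' \<odot> a)"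
    using K.Comp_assoc[OF u'(2) t(5) b'(1)] b'(2) t(9) K.Ide_Comp[OF u'(2)] by simp
  then show "qis s" using qis_comp[OF q K.Comp_closed[OF t(3) u'(1)] qis_iso[OF b'(3,1)] b'(1)] by simp
next
  assume q: "qis s"
  then have s: "s \<in> Hom K (Dom K s) (Cod K s)" by (auto simp: qis_def Hom_def)
  obtain v w where std: "(s, v, w) \<in> std_triangles A" using std_exists[OF s] by blast
  then show "s \<in> quot_system K N" unfolding quot_system_def
    using qis_iff_effaceable_cone[OF std] q N(2) std_Tri[OF std] s by (auto simp: Hom_def)
qed

lemma right_fractions_Kb:
  assumes N: "\<And>X. X \<in> N \<Longrightarrow> effaceable X" "\<And>X. effaceable X \<Longrightarrow> X \<in> N"
  shows "right_fractions K N"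
proof -
  have iff: "s \<in> quot_system K N \<longleftrightarrow> qis s" for s using quot_system_iff N by blast
  show ?thesis
  proof unfold_locales
    fix X assume "X \<in> Obj K"
    then show "Ide K X \<in> quot_system K N" unfolding iff using qis_iso[of "Ide K X" X X] K.Ide_closed by simp
  next
    fix s t assume "s \<in> quot_system K N" "t \<in> quot_system K N" "Cod K s = Dom K t"
    then show "t \<odot> s \<in> quot_system K N" unfolding iff using qis_comp[of s "Dom K s" "Cod K s" t "Cod K t"] by (auto simp: qis_def Hom_def)
  next
    fix f t assume "f \<in> Arr K" "t \<in> quot_system K N" "Cod K f = Cod K t"
    then obtain V r h where "r \<in> Hom K V (Dom K f) \<and> qis r \<and> h \<in> Hom K V (Dom K t) \<and> f \<odot> r = t \<odot> h"
      using qis_Ore[of f "Dom K f" "Cod K f" t "Dom K t"] unfolding iff by (auto simp: qis_def Hom_def)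
    then show "\<exists>r \<in> quot_system K N. \<exists>h \<in> Arr K. Cod K r = Dom K f \<and> Cod K h = Dom K t \<and> Dom K r = Dom K h \<and> f \<odot> r = t \<odot> h"
      using iff by (intro bexI[of _ r] bexI[of _ h]) (auto simp: Hom_def)
  next
    fix t f g assume a: "t \<in> quot_system K N" "f \<in> Arr K" "g \<in> Arr K" "Dom K f = Dom K g" "Cod K f = Dom K t"
      "Cod K g = Dom K t" "t \<odot> f = t \<odot> g"
    have "\<exists>V r. r \<in> Hom K V (Dom K f) \<and> qis r \<and> f \<odot> r = g \<odot> r"
      by (rule qis_cancel[of f "Dom K f" "Dom K t" g t "Cod K t"]) (use a iff in \<open>auto simp: qis_def Hom_def\<close>)
    then show "\<exists>r \<in> quot_system K N. Cod K r = Dom K f \<and> f \<odot> r = g \<odot> r"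
      using iff by (auto simp: Hom_def)
  qed
qed

end

section \<open>Equivalences of categories\<close>

lemma (in category) is_iso_inverse:
  assumes "is_iso A f" "f \<in> Hom A X Y"
  shows "\<exists>g \<in> Hom A Y X. g \<cdot> f = Ide A X \<and> f \<cdot> g = Ide A Y \<and> is_iso A g"
proof -
  obtain g where "g \<in> Hom A Y X" "g \<cdot> f = Ide A X" "f \<cdot> g = Ide A Y" "is_iso A g"
    using is_isoE[OF assms] .
  then show ?thesis by blast
qed

lemma (in category) iso_epi:
  assumes "\<eta> \<in> Hom A Y X" "is_iso A \<eta>" and f: "f \<in> Hom A X Z" and g: "g \<in> Hom A X Z"
    and e: "f \<cdot> \<eta> = g \<cdot> \<eta>"
  shows "f = g"
proof -
  obtain t where t: "t \<in> Hom A X Y" "\<eta> \<cdot> t = Ide A X"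
    using is_iso_inverse[OF assms(2,1)] by blast
  show ?thesis using Comp_assoc[OF t(1) assms(1) f] Comp_assoc[OF t(1) assms(1) g] e t(2)
      Comp_Ide[OF f] Comp_Ide[OF g] by metis
qed

lemma functor_simps [simp]:
  "fob (G \<circ>\<^sub>F F) X = fob G (fob F X)" "farr (G \<circ>\<^sub>F F) f = farr G (farr F f)"
  "fob functor_id X = X" "farr functor_id g = g"
  by (simp_all add: functor_comp_def functor_id_def)

lemma natural_isoD:
  assumes "natural_iso A B F G \<eta>"
  shows "X \<in> Obj A \<Longrightarrow> \<eta> X \<in> Hom B (fob F X) (fob G X)" "X \<in> Obj A \<Longrightarrow> is_iso B (\<eta> X)"
    "f \<in> Hom A X Y \<Longrightarrow> \<eta> Y \<cdot>\<^bsub>B\<^esub> farr F f = farr G f \<cdot>\<^bsub>B\<^esub> \<eta> X"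
  using assms unfolding natural_iso_def Hom_def[of A] by blast+

lemma equivalence_essentially_surjective:
  assumes "equivalence_of_categories A B F" "Y \<in> Obj B"
  shows "\<exists>X \<in> Obj A. isomorphic B (fob F X) Y"
proof -
  obtain G \<epsilon> where G: "is_functor B A G" "natural_iso B B (F \<circ>\<^sub>F G) functor_id \<epsilon>"
    using assms(1) unfolding equivalence_of_categories_def by blast
  have "\<epsilon> Y \<in> Hom B (fob F (fob G Y)) Y" "is_iso B (\<epsilon> Y)"
    using natural_isoD(1,2)[OF G(2) assms(2)] by simp_all
  then show ?thesis using functorD(1)[OF G(1) assms(2)] unfolding isomorphic_def by blast
qed

lemma natural_iso_id_faithful:
  assumes "category A" "category B" "is_functor A B F" "is_functor B A G"
    and n: "natural_iso A A (G \<circ>\<^sub>F F) functor_id \<eta>"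
    and f: "f \<in> Hom A X Y" and g: "g \<in> Hom A X Y" and eq: "farr F f = farr F g"
  shows "f = g"
proof -
  interpret A: category A by fact
  have o: "X \<in> Obj A" using A.Hom_obj[OF f] by blast
  have \<eta>: "\<eta> X \<in> Hom A (fob G (fob F X)) X" "is_iso A (\<eta> X)"
    using natural_isoD(1,2)[OF n o] by simp_all
  have nat: "\<eta> Y \<cdot>\<^bsub>A\<^esub> farr G (farr F h) = h \<cdot>\<^bsub>A\<^esub> \<eta> X" if "h \<in> Hom A X Y" for h
    using natural_isoD(3)[OF n that] by simp
  have e: "f \<cdot>\<^bsub>A\<^esub> \<eta> X = g \<cdot>\<^bsub>A\<^esub> \<eta> X" using nat[OF f] nat[OF g] eq by simp
  show ?thesis using A.iso_epi[OF \<eta> f g e] .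
qed

lemma equivalence_imp_fully_faithful:
  assumes A: "category A" and B: "category B" and eqv: "equivalence_of_categories A B F"
  shows "fully_faithful A B F"
proof -
  interpret A: category A by fact
  interpret B: category B by fact
  obtain G \<eta> \<epsilon> where F: "is_functor A B F" and G: "is_functor B A G"
    and \<eta>: "natural_iso A A (G \<circ>\<^sub>F F) functor_id \<eta>" and \<epsilon>: "natural_iso B B (F \<circ>\<^sub>F G) functor_id \<epsilon>"
    using eqv unfolding equivalence_of_categories_def by blast
  show ?thesis unfolding fully_faithful_def
  proof (intro conjI F ballI bij_betw_imageI)
    fix X Y assume X: "X \<in> Obj A" and Y: "Y \<in> Obj A"
    show "inj_on (farr F) (Hom A X Y)"
      using natural_iso_id_faithful[OF A B F G \<eta>] by (auto intro: inj_onI)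
    show "farr F ` Hom A X Y = Hom B (fob F X) (fob F Y)"
    proof (intro equalityI subsetI)
      fix g assume g: "g \<in> Hom B (fob F X) (fob F Y)"
      have \<eta>X: "\<eta> X \<in> Hom A (fob G (fob F X)) X" "is_iso A (\<eta> X)"
        and \<eta>Y: "\<eta> Y \<in> Hom A (fob G (fob F Y)) Y" "is_iso A (\<eta> Y)"
        using natural_isoD(1,2)[OF \<eta> X] natural_isoD(1,2)[OF \<eta> Y] by simp_all
      obtain t where t: "t \<in> Hom A X (fob G (fob F X))" "t \<cdot>\<^bsub>A\<^esub> \<eta> X = Ide A (fob G (fob F X))"
        using A.is_iso_inverse[OF \<eta>X(2,1)] by blast
      obtain t' where t': "t' \<in> Hom A Y (fob G (fob F Y))" "t' \<cdot>\<^bsub>A\<^esub> \<eta> Y = Ide A (fob G (fob F Y))"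
        using A.is_iso_inverse[OF \<eta>Y(2,1)] by blast
      note Gg = functor_hom[OF G g]
      \<comment> \<open>Naturality forces this choice. Then \<open>G F f\<close> and
        \<open>G g\<close> agree after \<open>\<eta> Y\<close>, and faithfulness of
        \<open>G\<close>, coming from \<open>\<epsilon>\<close>, yields
        \<open>F f = g\<close>.\<close>
      define f where "f = (\<eta> Y \<cdot>\<^bsub>A\<^esub> farr G g) \<cdot>\<^bsub>A\<^esub> t"
      have p: "\<eta> Y \<cdot>\<^bsub>A\<^esub> farr G g \<in> Hom A (fob G (fob F X)) Y" using A.Comp_closed[OF Gg \<eta>Y(1)] .
      have f: "f \<in> Hom A X Y" unfolding f_def using A.Comp_closed[OF t(1) p] .
      have GFf: "farr G (farr F f) \<in> Hom A (fob G (fob F X)) (fob G (fob F Y))"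
        using functor_hom[OF G functor_hom[OF F f]] .
      have "\<eta> Y \<cdot>\<^bsub>A\<^esub> farr G (farr F f) = f \<cdot>\<^bsub>A\<^esub> \<eta> X"
        using natural_isoD(3)[OF \<eta> f] by simp
      also have "\<dots> = \<eta> Y \<cdot>\<^bsub>A\<^esub> farr G g"
        unfolding f_def using A.Comp_assoc[OF \<eta>X(1) t(1) p] t(2) A.Comp_Ide[OF p] by simp
      finally have "t' \<cdot>\<^bsub>A\<^esub> (\<eta> Y \<cdot>\<^bsub>A\<^esub> farr G (farr F f)) = t' \<cdot>\<^bsub>A\<^esub> (\<eta> Y \<cdot>\<^bsub>A\<^esub> farr G g)" by simp
      then have "farr G (farr F f) = farr G g"
        using A.Comp_assoc[OF GFf \<eta>Y(1) t'(1)] A.Comp_assoc[OF Gg \<eta>Y(1) t'(1)] t'(2)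
          A.Ide_Comp[OF Gg] A.Ide_Comp[OF GFf] by simp
      then have "farr F f = g" using natural_iso_id_faithful[OF B A G F \<epsilon> functor_hom[OF F f] g] by blast
      then show "g \<in> farr F ` Hom A X Y" using f by blast
    qed (use functor_hom[OF F] in blast)
  qed
qed

lemma fully_faithful_inj:
  assumes "category A" "fully_faithful A B F" "f \<in> Hom A X Y" "g \<in> Hom A X Y" "farr F f = farr F g"
  shows "f = g"
proof -
  have "inj_on (farr F) (Hom A X Y)"
    using assms(2) category.Hom_obj[OF assms(1,3)] bij_betw_imp_inj_on unfolding fully_faithful_def by blast
  from inj_onD[OF this assms(5,3,4)] show ?thesis .
qed

lemma fully_faithful_full:
  assumes "fully_faithful A B F" "g \<in> Hom B (fob F X) (fob F Y)" "X \<in> Obj A" "Y \<in> Obj A"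
  shows "\<exists>f \<in> Hom A X Y. farr F f = g"
proof -
  have "farr F ` Hom A X Y = Hom B (fob F X) (fob F Y)"
    using assms(1,3,4) bij_betw_imp_surj_on unfolding fully_faithful_def by blast
  then show ?thesis using assms(2) by (simp add: image_iff set_eq_iff) metis
qed

lemma equivalenceI:
  assumes A: "category A" and B: "category B" and ff: "fully_faithful A B F"
    and es: "\<And>Y. Y \<in> Obj B \<Longrightarrow> \<exists>X \<in> Obj A. isomorphic B (fob F X) Y"
  shows "equivalence_of_categories A B F"
proof -
  interpret A: category A by fact
  interpret B: category B by fact
  have F: "is_functor A B F" using ff by (simp add: fully_faithful_def)
  have inj: "f = g" if "f \<in> Hom A X Y" "g \<in> Hom A X Y" "farr F f = farr F g" for f g X Y
    using fully_faithful_inj[OF A ff that] .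
  have full: "\<exists>f \<in> Hom A X Y. farr F f = g" if "g \<in> Hom B (fob F X) (fob F Y)" "X \<in> Obj A" "Y \<in> Obj A" for g X Y
    using fully_faithful_full[OF ff that] .
  have Fcomp: "farr F (g \<cdot>\<^bsub>A\<^esub> f) = farr F g \<cdot>\<^bsub>B\<^esub> farr F f" if "f \<in> Hom A X Y" "g \<in> Hom A Y Z" for f g X Y Z
    using functorD(6)[OF F] that by (auto simp: Hom_def)
  have "\<forall>Y. \<exists>X e e'. Y \<in> Obj B \<longrightarrow> X \<in> Obj A \<and> e \<in> Hom B (fob F X) Y \<and> e' \<in> Hom B Y (fob F X) \<and>
      e' \<cdot>\<^bsub>B\<^esub> e = Ide B (fob F X) \<and> e \<cdot>\<^bsub>B\<^esub> e' = Ide B Y"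
    using es B.is_iso_inverse unfolding isomorphic_def by meson
  then obtain Go e e' where G: "\<And>Y. Y \<in> Obj B \<Longrightarrow> Go Y \<in> Obj A" "\<And>Y. Y \<in> Obj B \<Longrightarrow> e Y \<in> Hom B (fob F (Go Y)) Y"
    "\<And>Y. Y \<in> Obj B \<Longrightarrow> e' Y \<in> Hom B Y (fob F (Go Y))"
    "\<And>Y. Y \<in> Obj B \<Longrightarrow> e' Y \<cdot>\<^bsub>B\<^esub> e Y = Ide B (fob F (Go Y))" "\<And>Y. Y \<in> Obj B \<Longrightarrow> e Y \<cdot>\<^bsub>B\<^esub> e' Y = Ide B Y"
    by metis
  \<comment> \<open>\<open>Ga g\<close> will be the preimage under \<open>F\<close> of this
    conjugate by the chosen isomorphisms.\<close>
  define conj where "conj g = e' (Cod B g) \<cdot>\<^bsub>B\<^esub> (g \<cdot>\<^bsub>B\<^esub> e (Dom B g))" for g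
  have conj: "conj g \<in> Hom B (fob F (Go X)) (fob F (Go Y))" if "g \<in> Hom B X Y" for g X Y
    using that G(2)[of X] G(3)[of Y] B.Hom_obj[OF that] unfolding conj_def by (auto simp: Hom_def)
  have "\<forall>g. \<exists>f. g \<in> Arr B \<longrightarrow> f \<in> Hom A (Go (Dom B g)) (Go (Cod B g)) \<and> farr F f = conj g"
    using full[OF conj] G(1) by (metis B.HomI B.arr_obj)
  then obtain Ga where "\<And>g. g \<in> Arr B \<Longrightarrow> Ga g \<in> Hom A (Go (Dom B g)) (Go (Cod B g)) \<and> farr F (Ga g) = conj g"
    by metis
  then have Ga: "Ga g \<in> Hom A (Go X) (Go Y)" "farr F (Ga g) = e' Y \<cdot>\<^bsub>B\<^esub> (g \<cdot>\<^bsub>B\<^esub> e X)" if "g \<in> Hom B X Y" for g X Y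
    using that by (auto simp: Hom_def[of B] conj_def)
  define GG where "GG = \<lparr>fob = Go, farr = Ga\<rparr>"
  \<comment> \<open>This equation determines \<open>Ga g\<close>, since each \<open>e Y\<close> is
    monic and \<open>F\<close> is faithful; functoriality of \<open>GG\<close> and naturality of
    \<open>e\<close> are read off from it.\<close>
  have ecomp: "e Y \<cdot>\<^bsub>B\<^esub> farr F (Ga g) = g \<cdot>\<^bsub>B\<^esub> e X" if "g \<in> Hom B X Y" for g X Y
  proof -
    have o: "X \<in> Obj B" "Y \<in> Obj B" using B.Hom_obj[OF that] by auto
    note p = B.Comp_closed[OF G(2)[OF o(1)] that]
    show ?thesis unfolding Ga(2)[OF that]
      using B.Comp_assoc[OF p G(3,2)[OF o(2)]] G(5)[OF o(2)] B.Ide_Comp[OF p] by simp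
  qed
  have emono: "h = h'" if "e Y \<cdot>\<^bsub>B\<^esub> h = e Y \<cdot>\<^bsub>B\<^esub> h'" "h \<in> Hom B X (fob F (Go Y))" "h' \<in> Hom B X (fob F (Go Y))" "Y \<in> Obj B"
    for h h' X Y
  proof -
    have *: "e' Y \<cdot>\<^bsub>B\<^esub> (e Y \<cdot>\<^bsub>B\<^esub> k) = k" if "k \<in> Hom B X (fob F (Go Y))" for k
      using B.Comp_assoc[OF that G(2,3)[OF \<open>Y \<in> Obj B\<close>]] G(4)[OF \<open>Y \<in> Obj B\<close>] B.Ide_Comp[OF that] by simp
    show ?thesis using *[OF that(2)] *[OF that(3)] that(1) by metis
  qed
  have FGa: "farr F (Ga g) \<in> Hom B (fob F (Go X)) (fob F (Go Y))" if "g \<in> Hom B X Y" for g X Y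
    using functor_hom[OF F Ga(1)[OF that]] .
  have GF: "is_functor B A GG" unfolding is_functor_def
  proof (intro conjI ballI impI)
    fix X assume X: "X \<in> Obj B"
    show "fob GG X \<in> Obj A" using G(1)[OF X] by (simp add: GG_def)
    have i: "Ide B X \<in> Hom B X X" "Ide A (Go X) \<in> Hom A (Go X) (Go X)" using X G(1)[OF X] A.Ide_closed B.Ide_closed by auto
    have "farr F (Ga (Ide B X)) = farr F (Ide A (Go X))"
      by (rule emono[OF _ FGa[OF i(1)] functor_hom[OF F i(2)] X])
        (use ecomp[OF i(1)] functorD(5)[OF F G(1)[OF X]] B.Comp_Ide[OF G(2)[OF X]] B.Ide_Comp[OF G(2)[OF X]] in simp)
    then show "farr GG (Ide B X) = Ide A (fob GG X)" using inj[OF Ga(1)[OF i(1)] i(2)] by (simp add: GG_def)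
  next
    fix f assume "f \<in> Arr B"
    then show "farr GG f \<in> Hom A (fob GG (Dom B f)) (fob GG (Cod B f))"
      using Ga(1)[of f "Dom B f" "Cod B f"] by (simp add: GG_def Hom_def[of B])
  next
    fix f g assume fg: "f \<in> Arr B" "g \<in> Arr B" "Cod B f = Dom B g"
    define X Y Z where "X = Dom B f" and "Y = Cod B f" and "Z = Cod B g"
    have f: "f \<in> Hom B X Y" and g: "g \<in> Hom B Y Z" using fg by (auto simp: X_def Y_def Z_def Hom_def)
    note gf = B.Comp_closed[OF f g]
    have o: "X \<in> Obj B" "Y \<in> Obj B" "Z \<in> Obj B" using B.Hom_obj[OF f] B.Hom_obj[OF g] by auto
    have "e Z \<cdot>\<^bsub>B\<^esub> farr F (Ga g \<cdot>\<^bsub>A\<^esub> Ga f) = (e Z \<cdot>\<^bsub>B\<^esub> farr F (Ga g)) \<cdot>\<^bsub>B\<^esub> farr F (Ga f)"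
      using Fcomp[OF Ga(1)[OF f] Ga(1)[OF g]] B.Comp_assoc[OF FGa[OF f] FGa[OF g] G(2)[OF o(3)]] by simp
    also have "\<dots> = g \<cdot>\<^bsub>B\<^esub> (f \<cdot>\<^bsub>B\<^esub> e X)"
      using ecomp[OF g] B.Comp_assoc[OF FGa[OF f] G(2)[OF o(2)] g] ecomp[OF f] by simp
    also have "\<dots> = e Z \<cdot>\<^bsub>B\<^esub> farr F (Ga (g \<cdot>\<^bsub>B\<^esub> f))"
      using ecomp[OF gf] B.Comp_assoc[OF G(2)[OF o(1)] f g] by simp
    finally have "farr F (Ga g \<cdot>\<^bsub>A\<^esub> Ga f) = farr F (Ga (g \<cdot>\<^bsub>B\<^esub> f))"
      using emono functor_hom[OF F A.Comp_closed[OF Ga(1)[OF f] Ga(1)[OF g]]] FGa[OF gf] o(3) by blast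
    then show "farr GG (g \<cdot>\<^bsub>B\<^esub> f) = farr GG g \<cdot>\<^bsub>A\<^esub> farr GG f"
      using inj[OF A.Comp_closed[OF Ga(1)[OF f] Ga(1)[OF g]] Ga(1)[OF gf]] by (simp add: GG_def)
  qed
  have \<epsilon>: "natural_iso B B (F \<circ>\<^sub>F GG) functor_id e" unfolding natural_iso_def
  proof (intro conjI ballI)
    fix X assume X: "X \<in> Obj B"
    show "e X \<in> Hom B (fob (F \<circ>\<^sub>F GG) X) (fob functor_id X)" using G(2)[OF X] by (simp add: GG_def)
    show "is_iso B (e X)" using B.is_isoI[OF G(2,3,4,5)[OF X]] .
  next
    fix f assume "f \<in> Arr B"
    then show "e (Cod B f) \<cdot>\<^bsub>B\<^esub> farr (F \<circ>\<^sub>F GG) f = farr functor_id f \<cdot>\<^bsub>B\<^esub> e (Dom B f)"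
      using ecomp[of f "Dom B f" "Cod B f"] by (simp add: GG_def Hom_def)
  qed
  have Fo: "fob F X \<in> Obj B" if "X \<in> Obj A" for X using functorD(1)[OF F that] .
  have "\<forall>X. \<exists>h h'. X \<in> Obj A \<longrightarrow> h \<in> Hom A (Go (fob F X)) X \<and> farr F h = e (fob F X) \<and>
      h' \<in> Hom A X (Go (fob F X)) \<and> farr F h' = e' (fob F X)"
    using full G(1-3)[OF Fo] Fo by metis
  then obtain h h' where h: "\<And>X. X \<in> Obj A \<Longrightarrow> h X \<in> Hom A (Go (fob F X)) X" "\<And>X. X \<in> Obj A \<Longrightarrow> farr F (h X) = e (fob F X)"
    "\<And>X. X \<in> Obj A \<Longrightarrow> h' X \<in> Hom A X (Go (fob F X))" "\<And>X. X \<in> Obj A \<Longrightarrow> farr F (h' X) = e' (fob F X)" by metis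
  have \<eta>: "natural_iso A A (GG \<circ>\<^sub>F F) functor_id h" unfolding natural_iso_def
  proof (intro conjI ballI)
    fix X assume X: "X \<in> Obj A"
    show "h X \<in> Hom A (fob (GG \<circ>\<^sub>F F) X) (fob functor_id X)" using h(1)[OF X] by (simp add: GG_def)
    have "h' X \<cdot>\<^bsub>A\<^esub> h X = Ide A (Go (fob F X))"
      by (rule inj[OF A.Comp_closed[OF h(1,3)[OF X]] A.Ide_closed[OF G(1)[OF Fo[OF X]]]])
        (use Fcomp[OF h(1,3)[OF X]] h(2,4)[OF X] G(4)[OF Fo[OF X]] functorD(5)[OF F G(1)[OF Fo[OF X]]] in simp)
    moreover have "h X \<cdot>\<^bsub>A\<^esub> h' X = Ide A X"
      by (rule inj[OF A.Comp_closed[OF h(3,1)[OF X]] A.Ide_closed[OF X]])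
        (use Fcomp[OF h(3,1)[OF X]] h(2,4)[OF X] G(5)[OF Fo[OF X]] functorD(5)[OF F X] in simp)
    ultimately show "is_iso A (h X)" using A.is_isoI[OF h(1,3)[OF X]] by blast
  next
    fix f assume "f \<in> Arr A"
    then have f: "f \<in> Hom A (Dom A f) (Cod A f)" "Dom A f \<in> Obj A" "Cod A f \<in> Obj A" by (auto simp: Hom_def)
    note Ff = functor_hom[OF F f(1)]
    have "h (Cod A f) \<cdot>\<^bsub>A\<^esub> Ga (farr F f) = f \<cdot>\<^bsub>A\<^esub> h (Dom A f)"
      by (rule inj[OF A.Comp_closed[OF Ga(1)[OF Ff] h(1)[OF f(3)]] A.Comp_closed[OF h(1)[OF f(2)] f(1)]])
        (use Fcomp[OF Ga(1)[OF Ff] h(1)[OF f(3)]] Fcomp[OF h(1)[OF f(2)] f(1)] h(2) f ecomp[OF Ff] in simp)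
    then show "h (Cod A f) \<cdot>\<^bsub>A\<^esub> farr (GG \<circ>\<^sub>F F) f = farr functor_id f \<cdot>\<^bsub>A\<^esub> h (Dom A f)"
      by (simp add: GG_def)
  qed
  show ?thesis unfolding equivalence_of_categories_def using F GF \<eta> \<epsilon> by blast
qed

section \<open>Triangulated categories\<close>

context triangulated_category
begin

abbreviation "S \<equiv> farr (Susp T)"
abbreviation "So \<equiv> fob (Susp T)"

lemma Susp_functor: "is_functor T T (Susp T)"
  using Susp_additive by (simp add: additive_functor_def)

lemma S_simps [simp]:
  "X \<in> Obj T \<Longrightarrow> So X \<in> Obj T" "f \<in> Arr T \<Longrightarrow> S f \<in> Arr T" "f \<in> Arr T \<Longrightarrow> Dom T (S f) = So (Dom T f)"
  "f \<in> Arr T \<Longrightarrow> Cod T (S f) = So (Cod T f)" "X \<in> Obj T \<Longrightarrow> S (Ide T X) = Ide T (So X)"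
  "f \<in> Arr T \<Longrightarrow> g \<in> Arr T \<Longrightarrow> Cod T f = Dom T g \<Longrightarrow> S (g \<cdot> f) = S g \<cdot> S f"
  by (fact functorD[OF Susp_functor])+

lemma S_hom: "f \<in> Hom T X Y \<Longrightarrow> S f \<in> Hom T (So X) (So Y)"
  by (rule functor_hom[OF Susp_functor])

lemma S_plus [simp]:
  assumes "f \<in> Arr T" "g \<in> Arr T" "Dom T f = Dom T g" "Cod T f = Cod T g"
  shows "S (f \<oplus> g) = S f \<oplus> S g"
proof -
  have "f \<in> Hom T (Dom T g) (Cod T g)" "g \<in> Hom T (Dom T g) (Cod T g)" using assms by (simp_all add: Hom_def)
  then show ?thesis using Susp_additive Hom_obj[of g] unfolding additive_functor_def by blast
qed

lemma S_zero [simp]: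
  assumes "X \<in> Obj T" "Y \<in> Obj T"
  shows "S (Zero T X Y) = Zero T (So X) (So Y)"
proof -
  have "S (Zero T X Y) \<oplus> S (Zero T X Y) = S (Zero T X Y) \<oplus> Zero T (So X) (So Y)"
    using S_plus[of "Zero T X Y" "Zero T X Y"] assms by simp
  then show ?thesis using assms by (subst (asm) plus_left_cancel) simp_all
qed

lemma S_neg [simp]:
  assumes "f \<in> Arr T"
  shows "S (neg T f) = neg T (S f)"
proof (rule neg_unique)
  show "S f \<oplus> S (neg T f) = Zero T (So (Dom T f)) (So (Cod T f))"
    using S_plus[of f "neg T f"] assms by simp
qed (use assms in simp_all)

lemma S_ff: "fully_faithful T T (Susp T)"
  by (rule equivalence_imp_fully_faithful[OF category_axioms category_axioms Susp_equivalence])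

lemma S_inj: "f \<in> Hom T X Y \<Longrightarrow> g \<in> Hom T X Y \<Longrightarrow> S f = S g \<Longrightarrow> f = g"
  by (rule fully_faithful_inj[OF category_axioms S_ff])

lemma S_full: "g \<in> Hom T (So X) (So Y) \<Longrightarrow> X \<in> Obj T \<Longrightarrow> Y \<in> Obj T \<Longrightarrow> \<exists>f \<in> Hom T X Y. g = S f"
  using fully_faithful_full[OF S_ff, of g X Y] by blast

lemma S_surj: "Y \<in> Obj T \<Longrightarrow> \<exists>X \<in> Obj T. isomorphic T (So X) Y"
  by (rule equivalence_essentially_surjective[OF Susp_equivalence])

lemma S_iso: "isomorphic T X Y \<Longrightarrow> isomorphic T (So X) (So Y)"
  by (rule functor_isomorphic[OF category_axioms category_axioms Susp_functor])

lemma S_reflects_is_iso: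
  assumes "is_iso T (S f)" "f \<in> Hom T X Y"
  shows "is_iso T f"
proof -
  note o = Hom_obj[OF assms(2)]
  obtain g where g: "g \<in> Hom T (So Y) (So X)" "g \<cdot> S f = Ide T (So X)" "S f \<cdot> g = Ide T (So Y)"
    using is_iso_inverse[OF assms(1) S_hom[OF assms(2)]] by blast
  obtain h where h: "h \<in> Hom T Y X" "g = S h" using S_full[OF g(1)] o by blast
  have "h \<cdot> f = Ide T X"
    by (rule S_inj[of _ X X]) (use h g o assms(2) Comp_closed[OF assms(2) h(1)] in \<open>auto simp: Ide_closed Hom_def\<close>)
  moreover have "f \<cdot> h = Ide T Y"
    by (rule S_inj[of _ Y Y]) (use h g o assms(2) Comp_closed[OF h(1) assms(2)] in \<open>auto simp: Ide_closed Hom_def\<close>)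
  ultimately show ?thesis using is_isoI[OF assms(2) h(1)] by blast
qed

lemma S_reflects_iso:
  assumes "isomorphic T (So X) (So Y)" "X \<in> Obj T" "Y \<in> Obj T"
  shows "isomorphic T X Y"
proof -
  obtain g where g: "g \<in> Hom T (So X) (So Y)" "is_iso T g" using assms(1) unfolding isomorphic_def by blast
  obtain f where "f \<in> Hom T X Y" "g = S f" using S_full[OF g(1) assms(2,3)] by blast
  then show ?thesis using S_reflects_is_iso g(2) unfolding isomorphic_def by blast
qed

lemma S_zero_obj: "is_zero T Z \<Longrightarrow> is_zero T (So Z)"
  using S_simps(5)[of Z] by (simp add: is_zero_iff)

definition tri :: "'m \<Rightarrow> 'm \<Rightarrow> 'm \<Rightarrow> 'o \<Rightarrow> 'o \<Rightarrow> 'o \<Rightarrow> bool" where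
  "tri u v w X Y Z \<longleftrightarrow> (u, v, w) \<in> Tri T \<and> u \<in> Hom T X Y \<and> v \<in> Hom T Y Z \<and> w \<in> Hom T Z (So X)"

lemma triD:
  assumes "tri u v w X Y Z"
  shows "(u, v, w) \<in> Tri T" "u \<in> Hom T X Y" "v \<in> Hom T Y Z" "w \<in> Hom T Z (So X)"
    "u \<in> Arr T" "v \<in> Arr T" "w \<in> Arr T" "Dom T u = X" "Cod T u = Y" "Dom T v = Y" "Cod T v = Z"
    "Dom T w = Z" "Cod T w = So X" "X \<in> Obj T" "Y \<in> Obj T" "Z \<in> Obj T"
proof -
  show *: "(u, v, w) \<in> Tri T" "u \<in> Hom T X Y" "v \<in> Hom T Y Z" "w \<in> Hom T Z (So X)" using assms by (auto simp: tri_def)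
  show "u \<in> Arr T" "v \<in> Arr T" "w \<in> Arr T" "Dom T u = X" "Cod T u = Y" "Dom T v = Y" "Cod T v = Z"
    "Dom T w = Z" "Cod T w = So X" using * by (auto simp: Hom_def)
  show "X \<in> Obj T" "Y \<in> Obj T" "Z \<in> Obj T" using Hom_obj[OF *(2)] Hom_obj[OF *(3)] by auto
qed

lemma triI:
  assumes "(u, v, w) \<in> Tri T" "Dom T u = X" "Dom T v = Y" "Dom T w = Z"
  shows "tri u v w X Y Z"
  using assms Tri_is_triangle[OF assms(1)] by (auto simp: tri_def is_triangle_def Hom_def)

lemma Tri_tri: "(u, v, w) \<in> Tri T \<Longrightarrow> tri u v w (Dom T u) (Dom T v) (Dom T w)"
  by (rule triI) auto

lemma is_triangleI:
  "u \<in> Hom T X Y \<Longrightarrow> v \<in> Hom T Y Z \<Longrightarrow> w \<in> Hom T Z (So X) \<Longrightarrow> is_triangle T u v w"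
  by (simp add: is_triangle_def Hom_def)

lemma tri_cone: "u \<in> Hom T X Y \<Longrightarrow> \<exists>v w Z. tri u v w X Y Z"
proof -
  assume u: "u \<in> Hom T X Y"
  then obtain v w where t: "(u, v, w) \<in> Tri T" using TR1_cone[of u] by (auto simp: Hom_def)
  have "tri u v w X Y (Dom T w)"
    by (rule triI[OF t]) (use u Tri_is_triangle[OF t] in \<open>auto simp: Hom_def is_triangle_def\<close>)
  then show ?thesis by blast
qed

lemma tri_rot:
  assumes t: "tri u v w X Y Z"
  shows "tri v w (neg T (S u)) Y Z (So X)"
  by (rule triI[OF iffD1[OF TR2[OF is_triangleI[OF triD(2-4)[OF t]]] triD(1)[OF t]]])
    (simp_all add: triD[OF t])

lemma tri_unrot:
  assumes t: "tri v w (neg T (S u)) Y Z (So X)" and u: "u \<in> Hom T X Y"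
  shows "tri u v w X Y Z"
  using iffD2[OF TR2[OF is_triangleI[OF u triD(2,3)[OF t]]] triD(1)[OF t]] u triD(2,3)[OF t]
  by (simp add: tri_def)

lemma tri_morph:
  assumes "tri u v w X Y Z" "tri u' v' w' X' Y' Z'" "a \<in> Hom T X X'" "b \<in> Hom T Y Y'" "b \<cdot> u = u' \<cdot> a"
  shows "\<exists>c \<in> Hom T Z Z'. c \<cdot> v = v' \<cdot> b \<and> S a \<cdot> w = w' \<cdot> c"
  using TR3[OF triD(1)[OF assms(1)] triD(1)[OF assms(2)], of a b] assms(3-5) triD[OF assms(1)] triD[OF assms(2)] by simp

lemma tri_ide: "X \<in> Obj T \<Longrightarrow> is_zero T Z \<Longrightarrow> tri (Ide T X) (Zero T X Z) (Zero T Z (So X)) X X Z"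
  by (rule triI[OF TR1_id]) (auto simp: is_zero_def)

lemma tri_ide':
  assumes X: "X \<in> Obj T" and Z: "is_zero T Z"
  shows "tri (Zero T Z X) (Ide T X) (Zero T X (So Z)) Z X X"
proof (rule tri_unrot)
  have z: "Z \<in> Obj T" using Z by (simp add: is_zero_def)
  show "tri (Ide T X) (Zero T X (So Z)) (neg T (S (Zero T Z X))) X X (So Z)"
    using tri_ide[OF X S_zero_obj[OF Z]] X z by simp
  show "Zero T Z X \<in> Hom T Z X" using X z by (simp add: Hom_def)
qed

text \<open>Map the triangle on the identity of \<open>X\<close> to the given one: the third vertex
  of the former is zero, so \<open>v u\<close> factors through a zero object. The other equations
  follow by rotation.\<close>

lemma tri_zero:
  assumes "tri u v w X Y Z"
  shows "v \<cdot> u = Zero T X Z" "w \<cdot> v = Zero T Y (So X)" "S u \<cdot> w = Zero T Z (So Y)"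
proof -
  have *: "v \<cdot> u = Zero T X Z" if t: "tri u v w X Y Z" for u v w X Y Z
  proof -
    obtain Z0 where Z0: "is_zero T Z0" using zero_exists by blast
    then have o: "Z0 \<in> Obj T" by (simp add: is_zero_def)
    note t' = triD[OF t]
    obtain c where c: "c \<in> Hom T Z0 Z" "c \<cdot> Zero T X Z0 = v \<cdot> u"
      using tri_morph[OF tri_ide[OF t'(14) Z0] t, of "Ide T X" u] t' by (auto simp: Hom_def)
    then show ?thesis using o t' by (auto simp: Hom_def)
  qed
  show "v \<cdot> u = Zero T X Z" using *[OF assms] .
  show "w \<cdot> v = Zero T Y (So X)" using *[OF tri_rot[OF assms]] .
  show "S u \<cdot> w = Zero T Z (So Y)"
    using *[OF tri_rot[OF tri_rot[OF assms]]] triD[OF assms] by simp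
qed

text \<open>TR3 only supplies maps between third vertices. Applied to the rotated trivial triangle
  on \<open>W\<close>, it yields the factorisation after suspension, and the suspension is fully
  faithful.\<close>

lemma tri_exact:
  assumes t: "tri u v w X Y Z" and f: "f \<in> Hom T W Y" "v \<cdot> f = Zero T W Z"
  shows "\<exists>g \<in> Hom T W X. f = u \<cdot> g"
proof -
  obtain Z0 where Z0: "is_zero T Z0" using zero_exists by blast
  then have o: "Z0 \<in> Obj T" by (simp add: is_zero_def)
  note t' = triD[OF t] and f' = HomD[OF f(1)]
  have W: "W \<in> Obj T" using Hom_obj[OF f(1)] by blast
  obtain c where c: "c \<in> Hom T (So W) (So X)" "S f \<cdot> neg T (S (Ide T W)) = neg T (S u) \<cdot> c"
    using tri_morph[OF tri_rot[OF tri_ide[OF W Z0]] tri_rot[OF t] f(1), of "Zero T Z0 Z"] f f' t' o W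
    by (auto simp: Hom_def)
  obtain g where g: "g \<in> Hom T W X" "c = S g" using S_full[OF c(1) W t'(14)] by blast
  note g' = HomD[OF g(1)]
  have "neg T (S f) = neg T (S (u \<cdot> g))" using c(2) g(2) g' f' t' W by simp
  then have "neg T (neg T (S f)) = neg T (neg T (S (u \<cdot> g)))" by simp
  then have "S f = S (u \<cdot> g)" using g' f' t' W by simp
  then have "f = u \<cdot> g" using S_inj[OF f(1) Comp_closed[OF g(1) t'(2)]] by blast
  then show ?thesis using g by blast
qed

lemma tri_exact2:
  assumes t: "tri u v w X Y Z" and f: "f \<in> Hom T W Z" "w \<cdot> f = Zero T W (So X)"
  shows "\<exists>g \<in> Hom T W Y. f = v \<cdot> g"
  by (rule tri_exact[OF tri_rot[OF t] f])

lemma tri_exact3: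
  assumes t: "tri u v w X Y Z" and f: "f \<in> Hom T W (So X)" "S u \<cdot> f = Zero T W (So Y)"
  shows "\<exists>g \<in> Hom T W Z. f = w \<cdot> g"
  by (rule tri_exact[OF tri_rot[OF tri_rot[OF t]] f(1)])
    (use f HomD[OF f(1)] triD[OF t] Hom_obj[OF f(1)] in simp)

text \<open>Map the triangle to \<open>0 -> W = W\<close> by TR3; the third component is the
  factorisation.\<close>

lemma tri_coexact:
  assumes t: "tri u v w X Y Z" and f: "f \<in> Hom T Y W" "f \<cdot> u = Zero T X W"
  shows "\<exists>g \<in> Hom T Z W. f = g \<cdot> v"
proof -
  obtain Z0 where Z0: "is_zero T Z0" using zero_exists by blast
  then have o: "Z0 \<in> Obj T" by (simp add: is_zero_def)
  note t' = triD[OF t] and f' = HomD[OF f(1)]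
  have W: "W \<in> Obj T" using Hom_obj[OF f(1)] by blast
  obtain c where c: "c \<in> Hom T Z W" "c \<cdot> v = Ide T W \<cdot> f"
    using tri_morph[OF t tri_ide'[OF W Z0] _ f(1), of "Zero T X Z0"] f f' t' o W by (auto simp: Hom_def)
  then show ?thesis using f' by auto
qed

lemma tri_coexact2:
  assumes t: "tri u v w X Y Z" and f: "f \<in> Hom T Z W" "f \<cdot> v = Zero T Y W"
  shows "\<exists>g \<in> Hom T (So X) W. f = g \<cdot> w"
  by (rule tri_coexact[OF tri_rot[OF t] f])

text \<open>If \<open>c v = v\<close> and \<open>w c = w\<close> then \<open>c - 1\<close> squares to zero.\<close>

lemma tri_endo_iso:
  assumes t: "tri u v w X Y Z" and c: "c \<in> Hom T Z Z" "c \<cdot> v = v" "w \<cdot> c = w"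
  shows "is_iso T c"
proof -
  note t' [simp] = triD(5-)[OF t] and c' [simp] = HomD[OF c(1), THEN conjunct1] HomD[OF c(1), THEN conjunct2, THEN conjunct1]
    HomD[OF c(1), THEN conjunct2, THEN conjunct2]
  define n where "n = c \<oplus> neg T (Ide T Z)"
  have n: "n \<in> Hom T Z Z" by (simp add: n_def Hom_def)
  have n' [simp]: "n \<in> Arr T" "Dom T n = Z" "Cod T n = Z" using n by (auto simp: Hom_def)
  have nv: "n \<cdot> v = Zero T Y Z" using c by (simp add: n_def)
  have wn: "w \<cdot> n = Zero T Z (So X)" using c by (simp add: n_def)
  obtain x where x: "x \<in> Hom T (So X) Z" "n = x \<cdot> w" using tri_coexact2[OF t n nv] by blast
  obtain y where y: "y \<in> Hom T Z Y" "n = v \<cdot> y" using tri_exact2[OF t n wn] by blast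
  have x': "x \<in> Arr T" "Dom T x = So X" "Cod T x = Z" using x by (auto simp: Hom_def)
  have "n \<cdot> n = x \<cdot> (w \<cdot> n)" using x(2) x' assoc[of n w x] by simp
  then have nn: "n \<cdot> n = Zero T Z Z" using wn x' by simp
  have cn: "c = n \<oplus> Ide T Z" by (simp add: n_def plus_assoc)
  show ?thesis
  proof (rule is_isoI[OF c(1)])
    \<comment> \<open>As \<open>n \<cdot> n\<close> vanishes, \<open>1 - n\<close> inverts
      \<open>c = 1 + n\<close>.\<close>
    show "Ide T Z \<oplus> neg T n \<in> Hom T Z Z" by (simp add: Hom_def)
    show "(Ide T Z \<oplus> neg T n) \<cdot> c = Ide T Z" unfolding cn using nn by (simp add: plus_assoc plus_comm[of "Ide T Z"])
    show "c \<cdot> (Ide T Z \<oplus> neg T n) = Ide T Z" unfolding cn using nn by (simp add: plus_assoc plus_comm[of "Ide T Z"])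
  qed
qed

lemma split_iso:
  assumes "f \<in> Hom T X Y" "g \<in> Hom T Y X" "is_iso T (g \<cdot> f)" "is_iso T (f \<cdot> g)"
  shows "is_iso T f"
proof -
  obtain a where a: "a \<in> Hom T X X" "a \<cdot> (g \<cdot> f) = Ide T X"
    using is_iso_inverse[OF assms(3) Comp_closed[OF assms(1,2)]] by blast
  obtain b where b: "b \<in> Hom T Y Y" "(f \<cdot> g) \<cdot> b = Ide T Y"
    using is_iso_inverse[OF assms(4) Comp_closed[OF assms(2,1)]] by blast
  define l r where "l = a \<cdot> g" and "r = g \<cdot> b"
  have l: "l \<in> Hom T Y X" "l \<cdot> f = Ide T X" using a assms unfolding l_def by (auto simp: Hom_def)
  have r: "r \<in> Hom T Y X" "f \<cdot> r = Ide T Y" using b assms unfolding r_def by (auto simp: Hom_def)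
  have "l = l \<cdot> (f \<cdot> r)" using r l Comp_Ide[OF l(1)] by simp
  also have "\<dots> = r" using Comp_assoc[OF r(1) assms(1) l(1)] l(2) Ide_Comp[OF r(1)] by simp
  finally show ?thesis using is_isoI[OF assms(1) l(1)] l r by simp
qed

text \<open>Inverting \<open>a\<close> and \<open>b\<close> and completing by TR3 gives
  \<open>c'\<close> in the opposite direction. It need not invert \<open>c\<close>, but both
  composites fix the adjacent maps, so \<open>tri_endo_iso\<close> applies to them.\<close>

lemma tri_five:
  assumes t: "tri u v w X Y Z" and t': "tri u' v' w' X' Y' Z'"
    and a: "a \<in> Hom T X X'" "is_iso T a" and b: "b \<in> Hom T Y Y'" "is_iso T b"
    and c: "c \<in> Hom T Z Z'" and eq: "b \<cdot> u = u' \<cdot> a" "c \<cdot> v = v' \<cdot> b" "S a \<cdot> w = w' \<cdot> c"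
  shows "is_iso T c"
proof -
  obtain a' where a': "a' \<in> Hom T X' X" "a' \<cdot> a = Ide T X" "a \<cdot> a' = Ide T X'" using is_iso_inverse[OF a(2,1)] by blast
  obtain b' where b': "b' \<in> Hom T Y' Y" "b' \<cdot> b = Ide T Y" "b \<cdot> b' = Ide T Y'" using is_iso_inverse[OF b(2,1)] by blast
  note d = triD(5-)[OF t] and d' = triD(5-)[OF t']
  have arr: "a \<in> Arr T" "Dom T a = X" "Cod T a = X'" "a' \<in> Arr T" "Dom T a' = X'" "Cod T a' = X"
    "b \<in> Arr T" "Dom T b = Y" "Cod T b = Y'" "b' \<in> Arr T" "Dom T b' = Y'" "Cod T b' = Y"
    "c \<in> Arr T" "Dom T c = Z" "Cod T c = Z'"
    using a b a' b' c by (auto simp: Hom_def)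
  have "b' \<cdot> u' = b' \<cdot> (u' \<cdot> (a \<cdot> a'))" using a'(3) d' by simp
  also have "\<dots> = b' \<cdot> ((b \<cdot> u) \<cdot> a')" using eq(1) d d' arr assoc[of a' a u'] by simp
  also have "\<dots> = u \<cdot> a'" using assoc_cong[OF b'(2), of "u \<cdot> a'"] d arr by simp
  finally have e1: "b' \<cdot> u' = u \<cdot> a'" .
  obtain c' where c': "c' \<in> Hom T Z' Z" "c' \<cdot> v' = v \<cdot> b'" "S a' \<cdot> w' = w \<cdot> c'"
    using tri_morph[OF t' t a'(1) b'(1) e1] by blast
  have arr': "c' \<in> Arr T" "Dom T c' = Z'" "Cod T c' = Z" using c' by (auto simp: Hom_def)
  have Sa: "S a' \<cdot> S a = Ide T (So X)" "S a \<cdot> S a' = Ide T (So X')"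
    using S_simps(6)[of a a'] S_simps(6)[of a' a] a' arr d d' by auto
  have 1: "is_iso T (c' \<cdot> c)"
  proof (rule tri_endo_iso[OF t Comp_closed[OF c c'(1)]])
    have "(c' \<cdot> c) \<cdot> v = c' \<cdot> (v' \<cdot> b)" using eq(2) arr arr' d by simp
    also have "\<dots> = v \<cdot> (b' \<cdot> b)" using assoc_cong[OF c'(2), of b] arr arr' d d' by simp
    finally show "(c' \<cdot> c) \<cdot> v = v" using b'(2) d by simp
    have "w \<cdot> (c' \<cdot> c) = S a' \<cdot> (w' \<cdot> c)" using assoc_cong[OF c'(3)[symmetric], of c] arr arr' d d' by simp
    also have "\<dots> = w" unfolding eq(3)[symmetric] using assoc_cong[OF Sa(1), of w] arr d by simp
    finally show "w \<cdot> (c' \<cdot> c) = w" .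
  qed
  have 2: "is_iso T (c \<cdot> c')"
  proof (rule tri_endo_iso[OF t' Comp_closed[OF c'(1) c]])
    have "(c \<cdot> c') \<cdot> v' = c \<cdot> (v \<cdot> b')" using c'(2) arr arr' d' by simp
    also have "\<dots> = v' \<cdot> (b \<cdot> b')" using assoc_cong[OF eq(2), of b'] arr arr' d d' by simp
    finally show "(c \<cdot> c') \<cdot> v' = v'" using b'(3) d' by simp
    have "w' \<cdot> (c \<cdot> c') = S a \<cdot> (w \<cdot> c')" using assoc_cong[OF eq(3)[symmetric], of c'] arr arr' d d' by simp
    also have "\<dots> = w'" unfolding c'(3)[symmetric] using assoc_cong[OF Sa(2), of w'] arr d' by simp
    finally show "w' \<cdot> (c \<cdot> c') = w'" .
  qed
  show ?thesis by (rule split_iso[OF c c'(1) 1 2])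
qed

lemma tri_iso:
  assumes t: "tri u v w X Y Z" and t': "u' \<in> Hom T X' Y'" "v' \<in> Hom T Y' Z'" "w' \<in> Hom T Z' (So X')"
    and a: "a \<in> Hom T X' X" "is_iso T a" and b: "b \<in> Hom T Y' Y" "is_iso T b"
    and c: "c \<in> Hom T Z' Z" "is_iso T c" and eq: "b \<cdot> u' = u \<cdot> a" "c \<cdot> v' = v \<cdot> b" "S a \<cdot> w' = w \<cdot> c"
  shows "tri u' v' w' X' Y' Z'"
proof -
  have "triangle_iso T (u', v', w') (u, v, w)" unfolding triangle_iso_def prod.case
    using is_triangleI[OF t'] is_triangleI[OF triD(2-4)[OF t]] a b c eq triD[OF t] t' by (auto simp: Hom_def)
  from TR1_iso[OF triD(1)[OF t] this] show ?thesis using t' by (simp add: tri_def)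
qed

end

section \<open>Triangles with prescribed vertices, octahedra, retracts and biproducts\<close>

context triangulated_category
begin

text \<open>After one rotation the triangle compares with that of the identity of \<open>Y\<close>,
  and \<open>S u\<close> is the comparison on third vertices; the five lemma makes it
  invertible.\<close>

lemma tri_cone_zero:
  assumes t: "tri u v w X Y Z" and Z: "is_zero T Z"
  shows "is_iso T u"
proof -
  note d = triD(5-)[OF t]
  have t2: "tri (Zero T Y Z) (Zero T Z (So Y)) (neg T (S (Ide T Y))) Y Z (So Y)"
    using tri_rot[OF tri_ide[OF d(11) Z]] .
  have v: "v = Zero T Y Z" using zero_obj_arr(1)[OF Z, of v] d by simp
  have "is_iso T (S u)"
    by (rule tri_five[OF tri_rot[OF t] t2, of "Ide T Y" "Ide T Z"])
      (use d v tri_zero(3)[OF t] in \<open>auto simp: Hom_def\<close>)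
  then show ?thesis by (rule S_reflects_is_iso[OF _ triD(2)[OF t]])
qed

text \<open>Extension and cone arguments concern the vertices only; forgetting the maps also absorbs
  the signs produced by rotation.\<close>

definition dtri :: "'o \<Rightarrow> 'o \<Rightarrow> 'o \<Rightarrow> bool" where
  "dtri X Y Z \<longleftrightarrow> (\<exists>u v w. tri u v w X Y Z)"

lemma dtriI: "tri u v w X Y Z \<Longrightarrow> dtri X Y Z"
  by (auto simp: dtri_def)

lemma dtri_obj: "dtri X Y Z \<Longrightarrow> X \<in> Obj T \<and> Y \<in> Obj T \<and> Z \<in> Obj T"
  unfolding dtri_def using triD(14-16) by blast

lemma dtri_rot: "dtri X Y Z \<Longrightarrow> dtri Y Z (So X)"
  unfolding dtri_def using tri_rot by blast

text \<open>Fullness of the suspension supplies \<open>u\<close> with \<open>S u = - x\<close>,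
  which absorbs the sign in TR2.\<close>

lemma tri_unrot_ex:
  assumes t: "tri v w x Y Z (So X)" and X: "X \<in> Obj T"
  shows "\<exists>u. tri u v w X Y Z"
proof -
  note d = triD[OF t]
  have "neg T x \<in> Hom T (So X) (So Y)" using d by (simp add: Hom_def)
  then obtain u where u: "u \<in> Hom T X Y" "neg T x = S u" using S_full X d(14) by blast
  have "x = neg T (S u)" using u(2) d by (metis neg_neg)
  then show ?thesis using tri_unrot t u(1) by blast
qed

lemma dtri_unrot: "dtri Y Z (So X) \<Longrightarrow> X \<in> Obj T \<Longrightarrow> dtri X Y Z"
  unfolding dtri_def using tri_unrot_ex by blast

lemma dtri_unshift:
  assumes "dtri (So X) (So Y) (So Z)" "X \<in> Obj T" "Y \<in> Obj T" "Z \<in> Obj T"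
  shows "dtri X Y Z"
  using dtri_unrot[OF dtri_unrot[OF dtri_unrot[OF assms(1,4)] assms(3)] assms(2)] .

lemma dtri_shift: "dtri X Y Z \<Longrightarrow> dtri (So X) (So Y) (So Z)"
  by (intro dtri_rot)

lemma tri_iso_third:
  assumes t: "tri u v w X Y Z" and Z: "isomorphic T Z Z'"
  shows "\<exists>v' w'. tri u v' w' X Y Z'"
proof -
  obtain c where c: "c \<in> Hom T Z' Z" "is_iso T c" using isomorphic_sym[OF Z] unfolding isomorphic_def by blast
  obtain c' where c': "c' \<in> Hom T Z Z'" "c \<cdot> c' = Ide T Z" using is_iso_inverse[OF c(2,1)] by blast
  note d = triD[OF t]
  have cv: "c \<cdot> (c' \<cdot> v) = v" using assoc_cong[OF c'(2), of v] c c' d by (simp add: Hom_def)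
  have "tri u (c' \<cdot> v) (w \<cdot> c) X Y Z'"
    by (rule tri_iso[OF t d(2) _ _ _ _ _ _ c, of _ _ "Ide T X" "Ide T Y"])
      (use c c' d cv in \<open>auto simp: Hom_def\<close>)
  then show ?thesis by blast
qed

lemma dtri_iso_third: "dtri X Y Z \<Longrightarrow> isomorphic T Z Z' \<Longrightarrow> dtri X Y Z'"
  unfolding dtri_def using tri_iso_third by blast

lemma dtri_iso_second:
  assumes "dtri X Y Z" "isomorphic T Y Y'"
  shows "dtri X Y' Z"
proof -
  note o = dtri_obj[OF assms(1)] isomorphic_obj[OF assms(2)]
  have "dtri Z (So X) (So Y')" using dtri_iso_third[OF dtri_rot[OF dtri_rot[OF assms(1)]] S_iso[OF assms(2)]] .
  then show ?thesis using dtri_unrot dtri_unrot o by blast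
qed

text \<open>The suspension is merely an equivalence, so a fibre is reached through an object
  \<open>X\<close> whose suspension is isomorphic to the cone \<open>W\<close>.\<close>

lemma tri_cocone:
  assumes t: "tri v w x Y Z W" and W: "isomorphic T W (So X)" and X: "X \<in> Obj T"
  shows "\<exists>u w'. tri u v w' X Y Z"
  using tri_iso_third[OF t W] tri_unrot_ex[OF _ X] by blast

text \<open>The cone of \<open>w\<close> is desuspended to a candidate \<open>Y\<close>, and the
  triangle is rotated back twice.\<close>

lemma tri_third:
  assumes w: "w \<in> Hom T Z (So X)" and X: "X \<in> Obj T"
  shows "\<exists>u v Y. tri u v w X Y Z"
proof -
  obtain y z R where t: "tri w y z Z (So X) R" using tri_cone[OF w] by blast
  obtain Y where Y: "Y \<in> Obj T" "isomorphic T (So Y) R" using S_surj[OF triD(16)[OF t]] by blast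
  obtain v w' where "tri v w w' Y Z (So X)" using tri_cocone[OF t isomorphic_sym[OF Y(2)] Y(1)] by blast
  then show ?thesis using tri_unrot_ex[OF _ X] by blast
qed

text \<open>Of TR4 the triangle of cones is retained, with its connecting map explicit: the
  vanishing of that map is used for deflations and for the layers \<open>V n\<close>.\<close>

lemma octahedron:
  assumes 1: "tri u i i' X Y Z'" and 2: "tri v j j' Y Z X'" and 3: "tri (v \<cdot> u) k k' X Z Y'"
  shows "\<exists>f g. tri f g (S i \<cdot> j') Z' Y' X'"
proof -
  obtain f g where fg: "f \<in> Hom T Z' Y'" "g \<in> Hom T Y' X'" "(f, g, S i \<cdot> j') \<in> Tri T"
    using TR4[OF triD(2)[OF 1] triD(2)[OF 2] triD(1)[OF 1] triD(1)[OF 2] triD(1)[OF 3]] triD[OF 1] triD[OF 2] triD[OF 3]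
    by auto
  then have "tri f g (S i \<cdot> j') Z' Y' X'"
    using triD[OF 1] triD[OF 2] by (intro triI) (auto simp: Hom_def)
  then show ?thesis by blast
qed

lemma dtri_zero_third: "dtri X Y Z \<Longrightarrow> is_zero T Z \<Longrightarrow> isomorphic T X Y"
  unfolding dtri_def isomorphic_def using tri_cone_zero triD(2) by blast

lemma dtri_zero_first: "dtri X Y Z \<Longrightarrow> is_zero T X \<Longrightarrow> isomorphic T Y Z"
  using dtri_zero_third[OF dtri_rot] S_zero_obj by blast

definition retract :: "'o \<Rightarrow> 'o \<Rightarrow> bool" where
  "retract X Y \<longleftrightarrow> (\<exists>s \<in> Hom T X Y. \<exists>r \<in> Hom T Y X. r \<cdot> s = Ide T X)"

lemma retract_trans:
  assumes "retract X Y" "retract Y Z"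
  shows "retract X Z"
proof -
  obtain s r where 1: "s \<in> Hom T X Y" "r \<in> Hom T Y X" "r \<cdot> s = Ide T X" using assms(1) by (auto simp: retract_def)
  obtain s' r' where 2: "s' \<in> Hom T Y Z" "r' \<in> Hom T Z Y" "r' \<cdot> s' = Ide T Y" using assms(2) by (auto simp: retract_def)
  have "(r \<cdot> r') \<cdot> (s' \<cdot> s) = r \<cdot> ((r' \<cdot> s') \<cdot> s)"
    using Comp_assoc[OF Comp_closed[OF 1(1) 2(1)] 2(2) 1(2)] Comp_assoc[OF 1(1) 2(1,2)] by simp
  also have "\<dots> = Ide T X" using 1 2(3) Ide_Comp[OF 1(1)] by simp
  finally show ?thesis unfolding retract_def using Comp_closed[OF 1(1) 2(1)] Comp_closed[OF 2(2) 1(2)] by blast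
qed

lemma retract_iso: "isomorphic T X Y \<Longrightarrow> retract X Y"
  unfolding retract_def isomorphic_def using is_iso_inverse by blast

lemma retract_S: "retract X Y \<Longrightarrow> retract (So X) (So Y)"
  unfolding retract_def
proof (elim bexE)
  fix s r assume "s \<in> Hom T X Y" "r \<in> Hom T Y X" "r \<cdot> s = Ide T X"
  then show "\<exists>s \<in> Hom T (So X) (So Y). \<exists>r \<in> Hom T (So Y) (So X). r \<cdot> s = Ide T (So X)"
    using S_simps(6)[of s r] Hom_obj[of s X Y]
    by (intro bexI[of _ "S s"] bexI[of _ "S r"]) (auto simp: Hom_def)
qed

lemma retract_unS:
  assumes "retract (So X) (So Y)" "X \<in> Obj T" "Y \<in> Obj T"
  shows "retract X Y"
proof -
  obtain s' r' where "s' \<in> Hom T (So X) (So Y)" "r' \<in> Hom T (So Y) (So X)" "r' \<cdot> s' = Ide T (So X)"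
    using assms(1) by (auto simp: retract_def)
  then obtain s r where sr: "s \<in> Hom T X Y" "r \<in> Hom T Y X" "S r \<cdot> S s = Ide T (So X)"
    using S_full assms(2,3) by metis
  have "r \<cdot> s = Ide T X"
    by (rule S_inj[OF Comp_closed[OF sr(1,2)] Ide_closed[OF assms(2)]]) (use sr assms in \<open>auto simp: Hom_def\<close>)
  then show ?thesis using sr by (auto simp: retract_def)
qed

lemma direct_sum_retract: "is_direct_sum T X Y B \<Longrightarrow> retract X B"
  unfolding is_direct_sum_def biproduct_def retract_def by blast

text \<open>As \<open>s\<close> is split, the connecting map \<open>w\<close> of its cone vanishes
  and \<open>q\<close> has a section \<open>j\<close>. Correcting it to \<open>k = j - s r j\<close>
  gives \<open>r k = 0\<close>. The defect \<open>1 - s r - k q\<close> is killed by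
  \<open>q\<close>, so it factors through \<open>s\<close>, and it is killed by \<open>r\<close>, so
  it is zero.\<close>

lemma retract_direct_sum:
  assumes "retract A X"
  shows "\<exists>Q. is_direct_sum T A Q X"
proof -
  obtain s r where sr: "s \<in> Hom T A X" "r \<in> Hom T X A" "r \<cdot> s = Ide T A" using assms by (auto simp: retract_def)
  obtain q w Q where t: "tri s q w A X Q" using tri_cone[OF sr(1)] by blast
  note d [simp] = triD(5-)[OF t]
  have r [simp]: "r \<in> Arr T" "Dom T r = X" "Cod T r = A" using sr(2) by (auto simp: Hom_def)
  have qs: "q \<cdot> s = Zero T A Q" using tri_zero(1)[OF t] .
  have SrSs: "S r \<cdot> S s = Ide T (So A)" using S_simps(6)[of s r] sr(3) by simp
  have "w = S r \<cdot> (S s \<cdot> w)" using assoc_cong[OF SrSs, of w] by simp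
  then have w: "w = Zero T Q (So A)" using tri_zero(3)[OF t] by simp
  obtain j where j: "j \<in> Hom T Q X" "Ide T Q = q \<cdot> j"
    using tri_exact2[OF t Ide_closed[OF d(12)]] w by auto
  have j' [simp]: "j \<in> Arr T" "Dom T j = Q" "Cod T j = X" using j(1) by (auto simp: Hom_def)
  define k where "k = j \<oplus> neg T (s \<cdot> r \<cdot> j)"
  have k [simp]: "k \<in> Arr T" "Dom T k = Q" "Cod T k = X" by (simp_all add: k_def)
  have qk: "q \<cdot> k = Ide T Q" using assoc_cong[OF qs, of "r \<cdot> j"] j(2) by (simp add: k_def)
  have rk: "r \<cdot> k = Zero T Q A" using assoc_cong[OF sr(3), of "r \<cdot> j"] by (simp add: k_def)
  define m where "m = Ide T X \<oplus> neg T (s \<cdot> r \<oplus> k \<cdot> q)"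
  have m: "m \<in> Hom T X X" by (simp add: m_def Hom_def)
  have "q \<cdot> m = Zero T X Q"
    using assoc_cong[OF qs, of r] assoc_cong[OF qk, of q] by (simp add: m_def)
  then obtain x where x: "x \<in> Hom T X A" "m = s \<cdot> x" using tri_exact[OF t m] by blast
  have "r \<cdot> m = Zero T X A"
    using assoc_cong[OF sr(3), of r] assoc_cong[OF rk, of q] by (simp add: m_def)
  moreover have "r \<cdot> m = x" using x assoc_cong[OF sr(3), of x] by (auto simp: Hom_def)
  ultimately have "x = Zero T X A" by simp
  then have "m = Zero T X X" using x(2) by simp
  moreover have "Ide T X \<oplus> neg T (s \<cdot> r \<oplus> k \<cdot> q) = Zero T X X \<longleftrightarrow> Ide T X = s \<cdot> r \<oplus> k \<cdot> q"
    using diff_zero_iff[of "Ide T X" "s \<cdot> r \<oplus> k \<cdot> q"] by (simp del: neg_plus)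
  ultimately have "Ide T X = s \<cdot> r \<oplus> k \<cdot> q" by (simp only: m_def)
  then have "biproduct T A Q X s k r q" unfolding biproduct_def
    using sr(3) qk rk qs by (simp add: Hom_def)
  then show ?thesis unfolding is_direct_sum_def by blast
qed

text \<open>With \<open>w\<close> zero, the identity of \<open>So X\<close> factors through
  \<open>- S u\<close>; desuspending the factor gives a retraction of \<open>u\<close> up to
  sign.\<close>

lemma tri_zero_third_retract:
  assumes t: "tri u v w X Y Z" and w: "w = Zero T Z (So X)"
  shows "retract X Y"
proof -
  note d [simp] = triD(5-)[OF t]
  have "Ide T (So X) \<cdot> w = Zero T Z (So X)" using w by simp
  from tri_coexact[OF tri_rot[OF tri_rot[OF t]] Ide_closed this]
  obtain g where g: "g \<in> Hom T (So Y) (So X)" "Ide T (So X) = g \<cdot> neg T (S u)" by auto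
  then obtain h where h: "h \<in> Hom T Y X" "g = S h" using S_full by (metis d(10,11))
  have h' [simp]: "h \<in> Arr T" "Dom T h = Y" "Cod T h = X" using h by (auto simp: Hom_def)
  have "neg T h \<cdot> u = Ide T X"
    by (rule S_inj[of _ X X]) (use g h in \<open>simp_all add: Hom_def\<close>)
  moreover have "neg T h \<in> Hom T Y X" by (simp add: Hom_def)
  ultimately show ?thesis unfolding retract_def using triD(2)[OF t] by blast
qed

text \<open>The splitting \<open>p\<close> makes the connecting map of the cone of \<open>i\<close>
  vanish, and then \<open>v j\<close> identifies the second summand with the cone, with inverse
  induced by \<open>q\<close>.\<close>

lemma tri_biproduct:
  assumes b: "biproduct T X Y B i j p q"
  shows "tri i q (Zero T Y (So X)) X B Y"
proof -
  note B [simp] = biproductD[OF b] and Bc [simp] = biproduct_assoc[OF b]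
  obtain v w N where t: "tri i v w X B N" using tri_cone[of i X B] by (auto simp: Hom_def)
  note d [simp] = triD(5-)[OF t]
  have "q \<in> Hom T B Y" by (simp add: Hom_def)
  from tri_coexact[OF t this] obtain c where c: "c \<in> Hom T N Y" "q = c \<cdot> v" by auto
  have c' [simp]: "c \<in> Arr T" "Dom T c = N" "Cod T c = Y" using c by (auto simp: Hom_def)
  have SpSi: "S p \<cdot> S i = Ide T (So X)" using S_simps(6)[of i p] by simp
  have "w = S p \<cdot> (S i \<cdot> w)" using assoc_cong[OF SpSi, of w] by simp
  then have w: "w = Zero T N (So X)" using tri_zero(3)[OF t] by simp
  have cvj: "c \<cdot> (v \<cdot> j) = Ide T Y" using assoc_cong[OF c(2)[symmetric], of j] by simp
  have vjq: "v \<cdot> (j \<cdot> q) = v"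
  proof -
    have "v = v \<cdot> (i \<cdot> p \<oplus> j \<cdot> q)" by simp
    also have "\<dots> = v \<cdot> (j \<cdot> q)" using assoc_cong[OF tri_zero(1)[OF t], of p] by (simp del: B(20))
    finally show ?thesis by simp
  qed
  have e: "((v \<cdot> j) \<cdot> c) \<cdot> v = v" using vjq c(2) by simp
  define n where "n = (v \<cdot> j) \<cdot> c \<oplus> neg T (Ide T N)"
  have n: "n \<in> Hom T N N" by (simp add: n_def Hom_def)
  have "n \<cdot> v = Zero T B N" using e by (simp add: n_def)
  then obtain y where "y \<in> Hom T (So X) N" "n = y \<cdot> w" using tri_coexact2[OF t n] by blast
  then have "n = Zero T N N" using w by (auto simp: Hom_def)
  moreover have "(v \<cdot> j) \<cdot> c \<oplus> neg T (Ide T N) = Zero T N N \<longleftrightarrow> (v \<cdot> j) \<cdot> c = Ide T N"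
    by (subst diff_zero_iff[of "(v \<cdot> j) \<cdot> c" "Ide T N", symmetric]) simp_all
  ultimately have vjc: "(v \<cdot> j) \<cdot> c = Ide T N" by (simp only: n_def)
  have iso: "is_iso T (v \<cdot> j)" by (rule is_isoI[of _ Y N c]) (use cvj vjc in \<open>simp_all add: Hom_def\<close>)
  show ?thesis
    by (rule tri_iso[OF t, where a = "Ide T X" and b = "Ide T B" and c = "v \<cdot> j"])
      (use vjq w iso in \<open>simp_all add: Hom_def\<close>)
qed

end

section \<open>Admissible exact subcategories\<close>

locale admissible = triangulated_category T for T :: "('o, 'm) tri_category" (structure) +
  fixes C :: "'o set"
  assumes adm: "admissible_exact T C"
begin

lemma C_obj: "X \<in> C \<Longrightarrow> X \<in> Obj T"
  using adm by (auto simp: admissible_exact_def full_additive_subcategory_def)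

text \<open>Closure under summands asks for a complement, which \<open>retract_direct_sum\<close>
  constructs in \<open>T\<close>.\<close>

lemma C_retract: "retract X Y \<Longrightarrow> Y \<in> C \<Longrightarrow> X \<in> C"
proof -
  assume r: "retract X Y" and Y: "Y \<in> C"
  obtain Q where "is_direct_sum T X Q Y" using retract_direct_sum[OF r] by blast
  moreover from this have "X \<in> Obj T" "Q \<in> Obj T" by (auto simp: is_direct_sum_def biproduct_def)
  ultimately show "X \<in> C" using adm Y by (auto simp: admissible_exact_def closed_under_summands_def)
qed

lemma C_iso: "isomorphic T X Y \<Longrightarrow> X \<in> C \<Longrightarrow> Y \<in> C"
  using C_retract retract_iso isomorphic_sym by blast

lemma C_zero: "is_zero T Z \<Longrightarrow> Z \<in> C"
  using adm C_iso zero_isomorphic by (auto simp: admissible_exact_def full_additive_subcategory_def)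

lemma C_ext: "dtri X Y Z \<Longrightarrow> X \<in> C \<Longrightarrow> Z \<in> C \<Longrightarrow> Y \<in> C"
proof -
  assume d: "dtri X Y Z" and C: "X \<in> C" "Z \<in> C"
  then obtain u v w where t: "tri u v w X Y Z" by (auto simp: dtri_def)
  have "closed_under_extensions T C" using adm by (simp add: admissible_exact_def)
  then have "Dom T u \<in> C \<and> Cod T v \<in> C \<longrightarrow> Cod T u \<in> C"
    unfolding closed_under_extensions_def using triD(1)[OF t] by blast
  then show "Y \<in> C" using C triD[OF t] by simp
qed

lemma C_sum: "X \<in> C \<Longrightarrow> Y \<in> C \<Longrightarrow> \<exists>B \<in> C. \<exists>i j p q. biproduct T X Y B i j p q"
  using adm by (simp add: admissible_exact_def full_additive_subcategory_def is_direct_sum_def)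

text \<open>The case \<open>k = 1\<close> of non-negativity, moved from maps \<open>X -> W\<close>
  with \<open>So W\<close> isomorphic to \<open>Y\<close> to maps \<open>So X -> Y\<close>.\<close>

lemma C_nonneg:
  assumes "X \<in> C" "Y \<in> C" "f \<in> Hom T (So X) Y"
  shows "f = Zero T (So X) Y"
proof -
  obtain W where W: "W \<in> Obj T" "isomorphic T (So W) Y" using S_surj C_obj[OF assms(2)] by blast
  obtain e where e: "e \<in> Hom T (So W) Y" "is_iso T e" using W by (auto simp: isomorphic_def)
  obtain e' where e': "e' \<in> Hom T Y (So W)" "e \<cdot> e' = Ide T Y" using is_iso_inverse[OF e(2,1)] by blast
  obtain h where h: "h \<in> Hom T X W" "e' \<cdot> f = S h"
    using S_full[OF Comp_closed[OF assms(3) e'(1)]] C_obj[OF assms(1)] W(1) by blast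
  have nn: "\<forall>X \<in> C. \<forall>Y \<in> C. \<forall>k > 0. \<forall>W \<in> Obj T.
     isomorphic T ((fob (Susp T) ^^ k) W) Y \<longrightarrow> Hom T X W = {Zero T X W}"
    using adm by (simp add: admissible_exact_def non_negative_def)
  have "Hom T X W = {Zero T X W}" using nn[rule_format, OF assms(1,2), of 1 W] W by simp
  then have "e' \<cdot> f = Zero T (So X) (So W)" using h S_zero C_obj[OF assms(1)] W(1) by simp
  moreover have "f = e \<cdot> (e' \<cdot> f)" using Comp_assoc[OF assms(3) e'(1) e(1)] e'(2) Ide_Comp[OF assms(3)] by simp
  ultimately show ?thesis using e(1) C_obj[OF assms(1)] by (simp add: Hom_def)
qed

text \<open>The suspended difference of \<open>f\<close> and \<open>g\<close> is killed by
  \<open>S m\<close>, so it comes from a map of \<open>So Q\<close> to \<open>N\<close>, and such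
  maps vanish by non-negativity. Thus inflations are monic within \<open>C\<close>.\<close>

lemma C_mono:
  assumes t: "tri m e w L M N" and C: "L \<in> C" "N \<in> C" "Q \<in> C"
    and f: "f \<in> Hom T Q L" and g: "g \<in> Hom T Q L" and eq: "m \<cdot> f = m \<cdot> g"
  shows "f = g"
proof -
  note d [simp] = triD(5-)[OF t]
  have fg [simp]: "f \<in> Arr T" "Dom T f = Q" "Cod T f = L" "g \<in> Arr T" "Dom T g = Q" "Cod T g = L"
    using f g by (auto simp: Hom_def)
  have Q: "Q \<in> Obj T" using C C_obj by simp
  have "S (f \<oplus> neg T g) \<in> Hom T (So Q) (So L)" by (simp add: Hom_def)
  moreover have "S m \<cdot> S (f \<oplus> neg T g) = S (m \<cdot> (f \<oplus> neg T g))" by simp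
  then have "S m \<cdot> S (f \<oplus> neg T g) = Zero T (So Q) (So M)" using eq Q by simp
  ultimately obtain h where h: "h \<in> Hom T (So Q) N" "S (f \<oplus> neg T g) = w \<cdot> h" using tri_exact3[OF t] by blast
  have "h = Zero T (So Q) N" using C_nonneg[OF C(3,2) h(1)] .
  then have "S (f \<oplus> neg T g) = S (Zero T Q L)" using h(2) Q by simp
  then have "f \<oplus> neg T g = Zero T Q L"
    using S_inj[of "f \<oplus> neg T g" Q L "Zero T Q L"] Q by (simp add: Hom_def)
  then show ?thesis using diff_zero_iff[of f g] by simp
qed

text \<open>The deflations of the induced exact structure.\<close>

definition D :: "'m set" where
  "D = {e. \<exists>u w L M P. tri u e w L M P \<and> L \<in> C \<and> M \<in> C \<and> P \<in> C}"

lemma DI: "tri u e w L M P \<Longrightarrow> L \<in> C \<Longrightarrow> M \<in> C \<Longrightarrow> P \<in> C \<Longrightarrow> e \<in> D"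
  unfolding D_def by blast

lemma DE:
  assumes "e \<in> D" "e \<in> Hom T M P"
  obtains u w L where "tri u e w L M P" "L \<in> C" "M \<in> C" "P \<in> C"
proof -
  obtain u w L M' P' where t: "tri u e w L M' P'" "L \<in> C" "M' \<in> C" "P' \<in> C" using assms(1) unfolding D_def by blast
  then have "M' = M" "P' = P" using triD(10,11)[OF t(1)] assms(2) by (auto simp: Hom_def)
  then show ?thesis using that t by blast
qed

lemma D_dom_cod: "e \<in> D \<Longrightarrow> e \<in> Hom T (Dom T e) (Cod T e) \<and> Dom T e \<in> C \<and> Cod T e \<in> C"
proof -
  assume "e \<in> D"
  then obtain u w L M P where t: "tri u e w L M P" "L \<in> C" "M \<in> C" "P \<in> C" unfolding D_def by blast
  then show ?thesis using triD(3,10,11)[OF t(1)] by simp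
qed

lemma D_ide: "P \<in> C \<Longrightarrow> Ide T P \<in> D"
proof -
  assume P: "P \<in> C"
  obtain Z where Z: "is_zero T Z" using zero_exists by blast
  show ?thesis using DI[OF tri_ide'[OF C_obj[OF P] Z] C_zero[OF Z] P P] .
qed

text \<open>By the octahedron the cone of \<open>e e'\<close> is an extension of the suspensions of
  the two kernels; its desuspension lies in \<open>C\<close> by closure under extensions.\<close>

lemma D_comp:
  assumes "e \<in> D" "e' \<in> D" "Cod T e' = Dom T e"
  shows "e \<cdot> e' \<in> D"
proof -
  obtain u w L M P where t: "tri u e w L M P" and C: "L \<in> C" "M \<in> C" "P \<in> C" using assms(1) unfolding D_def by blast
  have e': "e' \<in> Hom T (Dom T e') M" using D_dom_cod[OF assms(2)] assms(3) triD(10)[OF t] by simp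
  obtain u' w' L' where t': "tri u' e' w' L' (Dom T e') M" and C': "L' \<in> C" "Dom T e' \<in> C" using DE[OF assms(2) e'] by blast
  obtain k k' Y where t3: "tri (e \<cdot> e') k k' (Dom T e') P Y" using tri_cone[OF Comp_closed[OF e' triD(3)[OF t]]] by blast
  have "dtri (So L') Y (So L)" using octahedron[OF tri_rot[OF t'] tri_rot[OF t] t3] dtriI by blast
  moreover obtain L2 where L2: "L2 \<in> Obj T" "isomorphic T (So L2) Y" using S_surj triD(16)[OF t3] by blast
  ultimately have "dtri (So L') (So L2) (So L)" using dtri_iso_second isomorphic_sym by blast
  then have "L2 \<in> C" using dtri_unshift C_ext C C' C_obj L2(1) by blast
  moreover obtain a b where "tri a (e \<cdot> e') b L2 (Dom T e') P" using tri_cocone[OF t3 isomorphic_sym[OF L2(2)] L2(1)] by blast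
  ultimately show ?thesis using DI C C' by blast
qed

text \<open>Pull back the extension class: completing \<open>w g\<close> to a triangle gives
  \<open>e'\<close>, with \<open>Q'\<close> in \<open>C\<close> by extension closure. As
  \<open>w\<close> annihilates \<open>g e'\<close>, that composite factors through \<open>e\<close>.
  A commutative square is enough, no universal property is claimed.\<close>

lemma D_pullback:
  assumes e: "e \<in> D" "e \<in> Hom T M P" and g: "g \<in> Hom T Q P" and Q: "Q \<in> C"
  shows "\<exists>e' g' Q'. e' \<in> D \<and> e' \<in> Hom T Q' Q \<and> g' \<in> Hom T Q' M \<and> g \<cdot> e' = e \<cdot> g'"
proof -
  obtain u w L where t: "tri u e w L M P" and C: "L \<in> C" "M \<in> C" "P \<in> C" using DE[OF e] by blast
  have wg: "w \<cdot> g \<in> Hom T Q (So L)" using Comp_closed[OF g triD(4)[OF t]] .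
  obtain a e' Q' where t': "tri a e' (w \<cdot> g) L Q' Q" using tri_third[OF wg C_obj[OF C(1)]] by blast
  have Q': "Q' \<in> C" using C_ext[OF dtriI[OF t']] C Q by blast
  note e' = triD(3)[OF t']
  have "w \<cdot> (g \<cdot> e') = Zero T Q' (So L)" using tri_zero(2)[OF t'] Comp_assoc[OF e' g triD(4)[OF t]] by simp
  from tri_exact2[OF t Comp_closed[OF e' g] this] obtain g' where "g' \<in> Hom T Q' M" "g \<cdot> e' = e \<cdot> g'" by blast
  then show ?thesis using DI[OF t' C(1) Q' Q] e' by blast
qed

text \<open>The obscure axiom. Let \<open>R\<close> be the fibre of \<open>w d\<close>, an extension
  of \<open>M\<close> by \<open>L\<close> and hence in \<open>C\<close>. The octahedron relates the
  cones of \<open>d\<close> and \<open>w d\<close> with a connecting map that vanishes because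
  \<open>i d = 0\<close>, so the kernel of \<open>d\<close> is a retract of \<open>R\<close> and
  lies in \<open>C\<close> by closure under summands.\<close>

lemma D_obscure:
  assumes d: "d \<in> Hom T M P" "M \<in> C" and g: "g \<in> Hom T Q M" and dg: "d \<cdot> g \<in> D"
  shows "d \<in> D"
proof -
  obtain u w L where t: "tri u (d \<cdot> g) w L Q P" and C: "L \<in> C" "Q \<in> C" "P \<in> C"
    using DE[OF dg Comp_closed[OF g d(1)]] by blast
  obtain i i' N where ti: "tri d i i' M P N" using tri_cone[OF d(1)] by blast
  obtain k k' Y where t3: "tri (w \<cdot> d) k k' M (So L) Y" using tri_cone[OF Comp_closed[OF d(1) triD(4)[OF t]]] by blast
  obtain f f' where oct: "tri f f' (S i \<cdot> neg T (S (d \<cdot> g))) N Y (So Q)"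
    using octahedron[OF ti tri_rot[OF tri_rot[OF t]] t3] by blast
  have g': "g \<in> Arr T" "Dom T g = Q" "Cod T g = M" using g by (auto simp: Hom_def)
  note di = triD(5-)[OF ti]
  have Q: "Q \<in> Obj T" using C C_obj by simp
  have "i \<cdot> (d \<cdot> g) = Zero T Q N" using assoc_cong[OF tri_zero(1)[OF ti], of g] g' di by simp
  then have "S (i \<cdot> (d \<cdot> g)) = Zero T (So Q) (So N)" using Q di by simp
  moreover have "S (i \<cdot> (d \<cdot> g)) = S i \<cdot> S (d \<cdot> g)" using g' di by (intro S_simps(6)) simp_all
  ultimately have "S i \<cdot> neg T (S (d \<cdot> g)) = Zero T (So Q) (So N)" using g' di Q by simp
  then have r: "retract N Y" using tri_zero_third_retract[OF oct] by blast
  obtain R where R: "R \<in> Obj T" "isomorphic T (So R) Y" using S_surj triD(16)[OF t3] by blast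
  obtain K where K: "K \<in> Obj T" "isomorphic T (So K) N" using S_surj di(12) by blast
  have "dtri M (So L) (So R)" using dtri_iso_third[OF dtriI[OF t3] isomorphic_sym[OF R(2)]] .
  then have "dtri L R M" using dtri_unrot R(1) C_obj C by blast
  then have "R \<in> C" using C_ext C d(2) by blast
  moreover have "retract (So K) (So R)"
    using retract_trans[OF retract_iso[OF K(2)] retract_trans[OF r retract_iso[OF isomorphic_sym[OF R(2)]]]] .
  ultimately have "K \<in> C" using retract_unS K(1) R(1) C_retract by blast
  moreover obtain a b where "tri a d b K M P" using tri_cocone[OF ti isomorphic_sym[OF K(2)] K(1)] by blast
  ultimately show ?thesis using DI d(2) C by blast
qed

text \<open>A triangle \<open>B -> P -> X\<close> makes \<open>X\<close> an extension of the
  suspension of \<open>B\<close> by \<open>P\<close>, so each step prepends a layer from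
  \<open>C\<close> and suspends the rest.\<close>

primrec V :: "nat \<Rightarrow> 'o set" where
  "V 0 = C"
| "V (Suc n) = {X. \<exists>B \<in> V n. \<exists>P \<in> C. dtri B P X}"

lemma V_obj: "X \<in> V n \<Longrightarrow> X \<in> Obj T"
  using C_obj dtri_obj by (cases n) auto

lemma V_iso: "isomorphic T X Y \<Longrightarrow> X \<in> V n \<Longrightarrow> Y \<in> V n"
  by (cases n) (use C_iso in simp, use dtri_iso_third in simp, blast)

text \<open>Effaceability, by deflations, of maps from objects of \<open>C\<close> into
  \<open>Y\<close>.\<close>

definition locally_killed :: "'o \<Rightarrow> bool" where
  "locally_killed Y \<longleftrightarrow> Y \<in> Obj T \<and>
     (\<forall>P \<in> C. \<forall>h \<in> Hom T P Y. \<exists>e \<in> D. Cod T e = P \<and> h \<cdot> e = Zero T (Dom T e) Y)"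

lemma locally_killedE:
  assumes "locally_killed Y" "P \<in> C" "h \<in> Hom T P Y"
  obtains e P' where "e \<in> D" "e \<in> Hom T P' P" "P' \<in> C" "h \<cdot> e = Zero T P' Y"
  using assms D_dom_cod unfolding locally_killed_def by metis

text \<open>Kill the image in \<open>Z\<close> by one deflation, lift to \<open>X\<close> by
  exactness, and kill the lift by a second deflation.\<close>

lemma locally_killed_ext:
  assumes "dtri X Y Z" "locally_killed X" "locally_killed Z"
  shows "locally_killed Y"
  unfolding locally_killed_def
proof (intro conjI ballI)
  show "Y \<in> Obj T" using dtri_obj[OF assms(1)] by simp
  obtain u v w where t: "tri u v w X Y Z" using assms(1) by (auto simp: dtri_def)
  fix P h assume P: "P \<in> C" and h: "h \<in> Hom T P Y"
  obtain e P' where e: "e \<in> D" "e \<in> Hom T P' P" "P' \<in> C" "(v \<cdot> h) \<cdot> e = Zero T P' Z"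
    using locally_killedE[OF assms(3) P Comp_closed[OF h triD(3)[OF t]]] .
  have "v \<cdot> (h \<cdot> e) = Zero T P' Z" using e(4) Comp_assoc[OF e(2) h triD(3)[OF t]] by simp
  from tri_exact[OF t Comp_closed[OF e(2) h] this] obtain h' where h': "h' \<in> Hom T P' X" "h \<cdot> e = u \<cdot> h'" by blast
  obtain e' P'' where e': "e' \<in> D" "e' \<in> Hom T P'' P'" "P'' \<in> C" "h' \<cdot> e' = Zero T P'' X"
    using locally_killedE[OF assms(2) e(3) h'(1)] .
  have "h \<cdot> (e \<cdot> e') = (u \<cdot> h') \<cdot> e'" using h'(2) Comp_assoc[OF e'(2) e(2) h] by simp
  also have "\<dots> = Zero T P'' Y" using Comp_assoc[OF e'(2) h'(1) triD(2)[OF t]] e'(4) triD[OF t] C_obj[OF e'(3)] by simp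
  finally show "\<exists>e \<in> D. Cod T e = P \<and> h \<cdot> e = Zero T (Dom T e) Y"
    using D_comp[OF e(1) e'(1)] e(2) e'(2) by (intro bexI[of _ "e \<cdot> e'"]) (auto simp: Hom_def)
qed

lemma dtri_shifts: "dtri X Y Z \<Longrightarrow> dtri ((So ^^ k) X) ((So ^^ k) Y) ((So ^^ k) Z)"
  by (induction k) (auto intro: dtri_shift)

section \<open>Layers and retracts when maps from \<open>C\<close> into its positive suspensions are
  locally killed\<close>

context
  assumes killed: "\<And>X k. X \<in> C \<Longrightarrow> k \<ge> 1 \<Longrightarrow> locally_killed ((So ^^ k) X)"
begin

text \<open>The \<open>k\<close>-th suspension of \<open>B\<close> is an extension of the next
  suspension of \<open>B1\<close> by the \<open>k\<close>-th suspension of \<open>P1\<close>; the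
  induction therefore runs over all \<open>k\<close> at once.\<close>

lemma killed_V: "B \<in> V n \<Longrightarrow> k \<ge> 1 \<Longrightarrow> locally_killed ((So ^^ k) B)"
proof (induction n arbitrary: B k)
  case (Suc n)
  then obtain B1 P1 where B: "B1 \<in> V n" "P1 \<in> C" "dtri B1 P1 B" by auto
  have "dtri ((So ^^ k) P1) ((So ^^ k) B) ((So ^^ Suc k) B1)"
    using dtri_shifts[OF dtri_rot[OF B(3)], of k] by (simp add: funpow_swap1)
  then show ?case using locally_killed_ext killed[OF B(2) Suc(3)] Suc.IH[OF B(1), of "Suc k"] by simp
qed (use killed in simp)

text \<open>A deflation \<open>e : P' -> P\<close> with kernel \<open>K\<close> kills the class
  \<open>h\<close> of the extension, so the pullback \<open>W0\<close> of \<open>B'\<close> to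
  \<open>P'\<close> is the sum of \<open>B\<close> and \<open>P'\<close>, and \<open>B'\<close> is
  the cone of \<open>K -> W0\<close>. The object \<open>W1\<close>, sum of \<open>P1\<close> and
  \<open>P'\<close>, lies in \<open>C\<close> and maps to \<open>W0\<close> with fibre
  \<open>B1\<close>. Then \<open>W1 -> B'\<close> has as fibre an extension of \<open>K\<close> by
  \<open>B1\<close>, to which the induction hypothesis applies.\<close>

lemma V_ext: "B \<in> V n \<Longrightarrow> P \<in> C \<Longrightarrow> dtri B B' P \<Longrightarrow> B' \<in> V n"
proof (induction n arbitrary: B P B')
  case 0
  then show ?case using C_ext by simp
next
  case (Suc n)
  obtain B1 P1 where B1: "B1 \<in> V n" "P1 \<in> C" "dtri B1 P1 B" using Suc.prems(1) by auto
  obtain b' b x where tb: "tri b' b x B1 P1 B" using B1(3) by (auto simp: dtri_def)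
  obtain a a' h where ta: "tri a a' h B B' P" using Suc.prems(3) by (auto simp: dtri_def)
  have "locally_killed (So B)" using killed_V[OF Suc.prems(1), of 1] by simp
  then obtain e P' where e: "e \<in> D" "e \<in> Hom T P' P" "P' \<in> C" "h \<cdot> e = Zero T P' (So B)"
    using locally_killedE[OF _ Suc.prems(2) triD(4)[OF ta]] by blast
  obtain \<kappa> \<delta> K where te: "tri \<kappa> e \<delta> K P' P" and K: "K \<in> C" using DE[OF e(1,2)] by blast
  obtain W1 i1 j1 p1 q1 where W1: "W1 \<in> C" "biproduct T P1 P' W1 i1 j1 p1 q1" using C_sum[OF B1(2) e(3)] by blast
  note ti = tri_biproduct[OF W1(2)]
  obtain k k' W0 where tk: "tri (i1 \<cdot> b') k k' B1 W1 W0" using tri_cone[OF Comp_closed[OF triD(2)[OF tb] triD(2)[OF ti]]] by blast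
  obtain f g where "tri f g (S b \<cdot> Zero T P' (So P1)) B W0 P'" using octahedron[OF tb ti tk] by blast
  then have tfg: "tri f g (Zero T P' (So B)) B W0 P'" using triD[OF tb] C_obj[OF e(3)] by simp
  have o: "B \<in> Obj T" "P' \<in> Obj T" "W0 \<in> Obj T" "P \<in> Obj T" "B' \<in> Obj T" "K \<in> Obj T" "B1 \<in> Obj T" "W1 \<in> Obj T"
    using V_obj Suc.prems e(3) triD[OF tk] triD[OF ta] triD[OF te] triD[OF tb] C_obj by blast+
  \<comment> \<open>Three rotations suspend the triangle and one is undone, so that the suspension
    of \<open>W0\<close> appears as a cone of the zero map \<open>h e\<close>.\<close>
  have "tri (neg T (S f)) (neg T (S g)) (neg T (S (Zero T P' (So B)))) (So B) (So W0) (So P')"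
    using tri_rot[OF tri_rot[OF tri_rot[OF tfg]]] .
  then have t0: "tri (Zero T P' (So B)) (neg T (S f)) (neg T (S g)) P' (So B) (So W0)"
    by (rule tri_unrot) (use o in \<open>simp add: Hom_def\<close>)
  \<comment> \<open>Octahedron for \<open>h e\<close>: the cones of \<open>e\<close>,
    \<open>h e\<close> and \<open>h\<close> are the suspensions of \<open>K\<close>,
    \<open>W0\<close> and \<open>B'\<close>.\<close>
  have "dtri (So K) (So W0) (So B')"
    using octahedron[OF tri_rot[OF te] tri_rot[OF tri_rot[OF ta]]] t0 e(4) dtriI by metis
  then have "dtri K W0 B'" using dtri_unshift o by blast
  then obtain c \<omega> c' where tc: "tri c \<omega> c' K W0 B'" by (auto simp: dtri_def)
  obtain l l' N where tl: "tri (\<omega> \<cdot> k) l l' W1 B' N" using tri_cone[OF Comp_closed[OF triD(3)[OF tk] triD(3)[OF tc]]] by blast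
  \<comment> \<open>Octahedron for \<open>W1 -> W0 -> B'\<close>: \<open>N\<close> is the suspension
    of the fibre sought.\<close>
  have dN: "dtri (So B1) N (So K)" using octahedron[OF tri_rot[OF tk] tri_rot[OF tc] tl] dtriI by blast
  obtain M where M: "M \<in> Obj T" "isomorphic T (So M) N" using S_surj triD(16)[OF tl] by blast
  have "dtri B1 M K" using dtri_unshift[OF dtri_iso_second[OF dN isomorphic_sym[OF M(2)]]] o M(1) by blast
  then have "M \<in> V n" using Suc.IH[OF B1(1) K] by blast
  moreover have "dtri M W1 B'"
    using dtri_unrot[OF dtri_iso_third[OF dtriI[OF tl] isomorphic_sym[OF M(2)]] M(1)] .
  ultimately show ?case using W1(1) by auto
qed

text \<open>For \<open>e = s r\<close> and \<open>c : P \<rightarrow> M\<close> the cone of \<open>r c\<close> is a retract of the cone of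
  \<open>(e c, (1 - e) c) : P \<oplus> P \<rightarrow> M\<close>, and the latter is an extension of the cone of \<open>c\<close> because
  \<open>e c + (1 - e) c = c\<close>.\<close>

lemma retract_V:
  assumes I: "\<And>X Y. isomorphic T X Y \<Longrightarrow> X \<in> I \<Longrightarrow> Y \<in> I" "C \<subseteq> I" "\<And>X. X \<in> I \<Longrightarrow> So X \<in> I"
    "\<And>X Y Z. dtri X Y Z \<Longrightarrow> X \<in> I \<Longrightarrow> Z \<in> I \<Longrightarrow> Y \<in> I"
  shows "M \<in> V n \<Longrightarrow> retract A M \<Longrightarrow> A \<in> I"
proof (induction n arbitrary: A M)
  case 0
  then show ?case using C_retract I(2) by auto
next
  case (Suc n)
  obtain B P where B: "B \<in> V n" "P \<in> C" "dtri B P M" using Suc.prems(1) by auto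
  obtain b c v where t: "tri b c v B P M" using B(3) by (auto simp: dtri_def)
  obtain s r where sr: "s \<in> Hom T A M" "r \<in> Hom T M A" "r \<cdot> s = Ide T A" using Suc.prems(2) by (auto simp: retract_def)
  note d [simp] = triD(5-)[OF t]
  have sr' [simp]: "s \<in> Arr T" "Dom T s = A" "Cod T s = M" "r \<in> Arr T" "Dom T r = M" "Cod T r = A"
    using sr by (auto simp: Hom_def)
  obtain y z A1 where t1: "tri (r \<cdot> c) y z P A A1" using tri_cone[of "r \<cdot> c" P A] by (auto simp: Hom_def)
  note d1 [simp] = triD(6,7,10-13,15,16)[OF t1]
  obtain W i j p q where bp: "biproduct T P P W i j p q" using C_sum[OF B(2) B(2)] by blast
  note bp' [simp] = biproductD[OF bp] biproduct_assoc[OF bp]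
  \<comment> \<open>Restricting \<open>\<phi>\<close> along \<open>i\<close> and composing it with
    \<open>r\<close> give the two commuting squares that exhibit \<open>r \<cdot> c\<close> as a
    retract of \<open>\<phi>\<close> in the category of arrows.\<close>
  define \<phi> where "\<phi> = s \<cdot> r \<cdot> c \<cdot> p \<oplus> (c \<oplus> neg T (s \<cdot> r \<cdot> c)) \<cdot> q"
  have \<phi> [simp]: "\<phi> \<in> Arr T" "Dom T \<phi> = W" "Cod T \<phi> = M" by (simp_all add: \<phi>_def)
  have rsc: "r \<cdot> (s \<cdot> f) = f" if "f \<in> Arr T" "Cod T f = A" for f using assoc_cong[OF sr(3), of f] that by simp
  have \<phi>i: "\<phi> \<cdot> i = s \<cdot> (r \<cdot> c)" by (simp add: \<phi>_def)
  have \<phi>j: "\<phi> \<cdot> j = c \<oplus> neg T (s \<cdot> r \<cdot> c)" by (simp add: \<phi>_def)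
  have r\<phi>: "r \<cdot> \<phi> = (r \<cdot> c) \<cdot> p" by (simp add: \<phi>_def rsc)
  have \<phi>ij: "\<phi> \<cdot> (i \<oplus> j) = c" using \<phi>i \<phi>j by (simp add: plus_lcomm[of _ c])
  obtain y' z' X where t2: "tri \<phi> y' z' W M X" using tri_cone[of \<phi> W M] by (auto simp: Hom_def)
  note d2 [simp] = triD(6,7,10-13,15,16)[OF t2]
  have "i \<in> Hom T P W" "p \<in> Hom T W P" by (simp_all add: Hom_def)
  obtain c1 where c1: "c1 \<in> Hom T A1 X" "c1 \<cdot> y = y' \<cdot> s" "S i \<cdot> z = z' \<cdot> c1"
    using tri_morph[OF t1 t2 \<open>i \<in> Hom T P W\<close> sr(1) \<phi>i[symmetric]] by blast
  obtain c2 where c2: "c2 \<in> Hom T X A1" "c2 \<cdot> y' = y \<cdot> r" "S p \<cdot> z' = z \<cdot> c2"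
    using tri_morph[OF t2 t1 \<open>p \<in> Hom T W P\<close> sr(2) r\<phi>] by blast
  have c [simp]: "c1 \<in> Arr T" "Dom T c1 = A1" "Cod T c1 = X" "c2 \<in> Arr T" "Dom T c2 = X" "Cod T c2 = A1"
    using c1 c2 by (auto simp: Hom_def)
  \<comment> \<open>Completions by TR3 are not functorial, so \<open>c2 \<cdot> c1\<close> need not
    be the identity; being invertible, it can be corrected by \<open>a\<close>.\<close>
  have iso: "is_iso T (c2 \<cdot> c1)"
  proof (rule tri_endo_iso[OF t1 Comp_closed[OF c1(1) c2(1)]])
    have "(c2 \<cdot> c1) \<cdot> y = c2 \<cdot> (y' \<cdot> s)" using c1(2) by simp
    also have "\<dots> = y \<cdot> (r \<cdot> s)" using assoc_cong[OF c2(2), of s] by simp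
    finally show "(c2 \<cdot> c1) \<cdot> y = y" using sr(3) by simp
    have SpSi: "S p \<cdot> S i = Ide T (So P)" using S_simps(6)[of i p] by simp
    have "z \<cdot> (c2 \<cdot> c1) = S p \<cdot> (z' \<cdot> c1)" using assoc_cong[OF c2(3)[symmetric], of c1] by simp
    also have "\<dots> = z" unfolding c1(3)[symmetric] using assoc_cong[OF SpSi, of z] by simp
    finally show "z \<cdot> (c2 \<cdot> c1) = z" .
  qed
  obtain a where a: "a \<in> Hom T A1 A1" "a \<cdot> (c2 \<cdot> c1) = Ide T A1"
    using is_iso_inverse[OF iso Comp_closed[OF c1(1) c2(1)]] by blast
  have ret: "retract A1 X" unfolding retract_def
    using c1(1) Comp_closed[OF c2(1) a(1)] Comp_assoc[OF c1(1) c2(1) a(1)] a(2) by auto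
  \<comment> \<open>Change of basis on \<open>W\<close> that makes \<open>i \<oplus> j\<close>,
    along which \<open>\<phi>\<close> restricts to \<open>c\<close>, the first inclusion; its cone
    is then \<open>P\<close>.\<close>
  have "biproduct T P P W (i \<oplus> j) j p (q \<oplus> neg T p)" unfolding biproduct_def
  proof (intro conjI)
    have "(i \<oplus> j) \<cdot> p \<oplus> j \<cdot> (q \<oplus> neg T p) = (i \<cdot> p \<oplus> j \<cdot> q) \<oplus> (j \<cdot> p \<oplus> neg T (j \<cdot> p))"
      by (simp add: plus_ac del: bp'(20) plus_neg plus_neg_cancel)
    then show "(i \<oplus> j) \<cdot> p \<oplus> j \<cdot> (q \<oplus> neg T p) = Ide T W" by simp
  qed (simp_all add: Hom_def)
  from tri_biproduct[OF this] have tD: "tri (i \<oplus> j) (q \<oplus> neg T p) (Zero T P (So P)) P W P" .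
  have "tri (\<phi> \<cdot> (i \<oplus> j)) v (neg T (S b)) P M (So B)" unfolding \<phi>ij by (rule tri_rot[OF t])
  \<comment> \<open>Octahedron for \<open>\<phi> \<cdot> (i \<oplus> j) = c\<close>: after rotation
    \<open>X\<close> is an extension of the suspension of \<open>P\<close> by the suspension of
    \<open>B\<close>.\<close>
  from octahedron[OF tD t2 this] have dX: "dtri P (So B) X" using dtriI by blast
  obtain B' where B': "B' \<in> Obj T" "isomorphic T (So B') X" using S_surj triD(16)[OF t2] by blast
  have "dtri B B' P"
    using dtri_unrot[OF dtri_unrot[OF dtri_iso_third[OF dX isomorphic_sym[OF B'(2)]] B'(1)]] V_obj[OF B(1)] by blast
  then have B'V: "B' \<in> V n" using V_ext[OF B(1,2)] by blast
  obtain A2 where A2: "A2 \<in> Obj T" "isomorphic T (So A2) A1" using S_surj[OF d1(8)] by blast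
  have "retract (So A2) (So B')"
    using retract_trans[OF retract_iso[OF A2(2)] retract_trans[OF ret retract_iso[OF isomorphic_sym[OF B'(2)]]]] .
  then have "A2 \<in> I" using Suc.IH[OF B'V] retract_unS A2(1) B'(1) by blast
  then have "A1 \<in> I" using I(1)[OF A2(2) I(3)] by blast
  then show ?case using I(4)[OF dtriI[OF t1]] I(2) B(2) by blast
qed

end

end

section \<open>Cocycle form of effaceability; quasi-isomorphisms and suspension\<close>

context deflations
begin

text \<open>Maps out of stalks up to homotopy are cocycles modulo coboundaries by
  \<open>from_stalk_null\<close>, so effacing a map means making its cocycle a coboundary after a
  deflation.\<close>

lemma effaceable_iff:
  "effaceable X \<longleftrightarrow> X \<in> bounded_complexes A \<and>
    (\<forall>k. \<forall>P \<in> Obj A. \<forall>x \<in> Hom A P (cob X k). cdiff X k \<cdot> x = Zero A P (cob X (k + 1)) \<longrightarrow>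
      (\<exists>e \<in> D. Cod A e = P \<and> (\<exists>y \<in> Hom A (Dom A e) (cob X (k - 1)). x \<cdot> e = cdiff X (k - 1) \<cdot> y)))"
    (is "_ \<longleftrightarrow> _ \<and> ?R")
proof (cases "X \<in> bounded_complexes A")
  case X: True
  have key: "h \<odot> stalk_map A k e = Zero K (stalk A k (Dom A e)) X \<longleftrightarrow>
      (\<exists>y \<in> Hom A (Dom A e) (cob X (k - 1)). x \<cdot> e = cdiff X (k - 1) \<cdot> y)"
    if P: "P \<in> Obj A" and x: "x \<in> Hom A P (cob X k)" "cdiff X k \<cdot> x = Zero A P (cob X (k + 1))"
      and h: "h = htpy_class A (stalk A k P) X (from_stalk k P X x)" and e: "e \<in> D" "Cod A e = P" for k P x h e
  proof -
    have x': "x \<in> Arr A" "Dom A x = P" "Cod A x = cob X k" using x by (auto simp: Hom_def)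
    have e': "e \<in> Hom A (Dom A e) P" "e \<in> Arr A" using e D_arr by (auto simp: Hom_def)
    have xe: "cdiff X k \<cdot> (x \<cdot> e) = Zero A (Dom A e) (cob X (k + 1))"
      using assoc_cong[OF x(2), of e] x' e' e(2) X by simp
    have "h \<odot> stalk_map A k e = htpy_class A (stalk A k (Dom A e)) X (from_stalk k (Dom A e) X (x \<cdot> e))"
      unfolding h by (rule from_stalk_comp[OF P X x' x(2) e'(1)])
    then show ?thesis
      using from_stalk_null[of "Dom A e" X "x \<cdot> e" k] X x' e' e(2) xe by (auto simp: Hom_def)
  qed
  have "effaceable X \<longleftrightarrow> ?R"
  proof
    assume eff: "effaceable X"
    show ?R
    proof (intro allI ballI impI)
      fix k P x assume P: "P \<in> Obj A" and x: "x \<in> Hom A P (cob X k)" "cdiff X k \<cdot> x = Zero A P (cob X (k + 1))"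
      let ?h = "htpy_class A (stalk A k P) X (from_stalk k P X x)"
      have "?h \<in> Hom K (stalk A k P) X" by (rule from_stalk_hom) (use P X x in \<open>auto simp: Hom_def\<close>)
      then obtain e where e: "e \<in> D" "Cod A e = P" "?h \<odot> stalk_map A k e = Zero K (stalk A k (Dom A e)) X"
        using effaceableE[OF eff P] by blast
      then show "\<exists>e \<in> D. Cod A e = P \<and> (\<exists>y \<in> Hom A (Dom A e) (cob X (k - 1)). x \<cdot> e = cdiff X (k - 1) \<cdot> y)"
        using key[OF P x refl e(1,2)] by blast
    qed
  next
    assume R: ?R
    show "effaceable X" unfolding effaceable_def
    proof (intro conjI allI ballI)
      show "X \<in> Obj K" using X by (simp add: Obj_K)
      fix k P h assume P: "P \<in> Obj A" and h: "h \<in> Hom K (stalk A k P) X"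
      obtain x where x': "x \<in> Arr A" "Dom A x = P" "Cod A x = cob X k"
        and x: "cdiff X k \<cdot> x = Zero A P (cob X (k + 1))" and hx: "h = htpy_class A (stalk A k P) X (from_stalk k P X x)"
        using stalk_homE[OF h P] by blast
      have xh: "x \<in> Hom A P (cob X k)" using x' by (simp add: Hom_def)
      from R[rule_format, OF P xh x] obtain e where e: "e \<in> D" "Cod A e = P"
        "\<exists>y \<in> Hom A (Dom A e) (cob X (k - 1)). x \<cdot> e = cdiff X (k - 1) \<cdot> y" by blast
      then show "\<exists>e \<in> D. Cod A e = P \<and> h \<odot> stalk_map A k e = Zero K (stalk A k (Dom A e)) X"
        using key[OF P xh x hx e(1,2)] by blast
    qed
  qed
  then show ?thesis using X by simp
next
  case False
  then show ?thesis by (simp add: effaceable_def Obj_K)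
qed

text \<open>Converse of \<open>qis_unshift\<close>; it lets the suspension act on roofs of the
  quotient.\<close>

lemma qis_shift:
  assumes s: "s \<in> Hom K X Y" and q: "qis s"
  shows "qis (S s)"
proof (rule qisI[OF S_hom[OF s]])
  note o = K.Hom_obj[OF s]
  fix k P h assume P: "P \<in> Obj A"
  {
    assume h: "h \<in> Hom K (stalk A k P) (So Y)"
    obtain g where g: "g \<in> Hom K (stalk A (k + 1) P) Y" "h = S g"
      using S_lift[of h "stalk A (k + 1) P" Y] h So_stalk[OF P, of k] o stalk_obj[OF P] by auto
    from qisE(1)[OF q s P g(1)] obtain e h' where e: "e \<in> D" "Cod A e = P"
      "h' \<in> Hom K (stalk A (k + 1) (Dom A e)) X" "g \<odot> stalk_map A (k + 1) e = s \<odot> h'" by blast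
    note sm = sm_hom[OF e(1), of "k + 1", unfolded e(2)]
    have "h \<odot> stalk_map A k e = S s \<odot> S h'"
      using S_comp[OF sm g(1)] S_comp[OF e(3) s] e(4) g(2) S_sm[OF e(1), of k] by simp
    then show "\<exists>e \<in> D. Cod A e = P \<and> (\<exists>h' \<in> Hom K (stalk A k (Dom A e)) (So X). h \<odot> stalk_map A k e = S s \<odot> h')"
      using e S_hom[OF e(3)] So_stalk[OF D_obj(1)[OF e(1)], of k] by auto
  }
  {
    assume h: "h \<in> Hom K (stalk A k P) (So X)" "S s \<odot> h = Zero K (stalk A k P) (So Y)"
    obtain g where g: "g \<in> Hom K (stalk A (k + 1) P) X" "h = S g"
      using S_lift[of h "stalk A (k + 1) P" X] h So_stalk[OF P, of k] o stalk_obj[OF P] by auto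
    have "S (s \<odot> g) = Zero K (So (stalk A (k + 1) P)) (So Y)"
      using S_comp[OF g(1) s] h(2) g(2) So_stalk[OF P, of k] by simp
    then have "s \<odot> g = Zero K (stalk A (k + 1) P) Y" using S_eq_zero K.Comp_closed[OF g(1) s] by blast
    from qisE(2)[OF q s P g(1) this] obtain e where e: "e \<in> D" "Cod A e = P"
      "g \<odot> stalk_map A (k + 1) e = Zero K (stalk A (k + 1) (Dom A e)) X" by blast
    note sm = sm_hom[OF e(1), of "k + 1", unfolded e(2)]
    have "h \<odot> stalk_map A k e = Zero K (stalk A k (Dom A e)) (So X)"
      using S_comp[OF sm g(1)] e(3) g(2) S_sm[OF e(1), of k] S_zero[OF stalk_obj[OF D_obj(1)[OF e(1)]], of X "k + 1"]
        o So_stalk[OF D_obj(1)[OF e(1)], of k] by simp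
    then show "\<exists>e \<in> D. Cod A e = P \<and> h \<odot> stalk_map A k e = Zero K (stalk A k (Dom A e)) (So X)" using e by blast
  }
qed

abbreviation "Z0 \<equiv> stalk A 0 (zero_obj A)"

lemma Z0: "Z0 \<in> Obj K" "Ide K Z0 = Zero K Z0 Z0"
proof -
  show "Z0 \<in> Obj K" by (simp add: Obj_K)
  have "Ide A (zero_obj A) = Zero A (zero_obj A) (zero_obj A)" using zero_obj by (simp add: is_zero_iff)
  moreover have "cob Z0 n = zero_obj A" for n by (simp add: stalk_def)
  ultimately show "Ide K Z0 = Zero K Z0 Z0" by (simp add: Kb_simps)
qed

text \<open>All cohomology elements of \<open>X\<close> are locally zero, hence locally images from
  the zero complex, which has no nonzero elements itself.\<close>

lemma qis_zero:
  assumes "effaceable X"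
  shows "qis (Zero K Z0 X)"
proof -
  have X: "X \<in> Obj K" using assms by (simp add: effaceable_def)
  note z = zero_hom[OF Z0(1) X]
  show ?thesis
  proof (rule qisI[OF z])
    fix k P h assume P: "P \<in> Obj A"
    {
      assume h: "h \<in> Hom K (stalk A k P) X"
      obtain e where e: "e \<in> D" "Cod A e = P" "h \<odot> stalk_map A k e = Zero K (stalk A k (Dom A e)) X"
        using effaceableE[OF assms P h] .
      have o: "stalk A k (Dom A e) \<in> Obj K" using stalk_obj D_obj e(1) by blast
      have "h \<odot> stalk_map A k e = Zero K Z0 X \<odot> Zero K (stalk A k (Dom A e)) Z0"
        using e(3) comp_zero_K[OF z o] by simp
      then show "\<exists>e \<in> D. Cod A e = P \<and> (\<exists>h' \<in> Hom K (stalk A k (Dom A e)) Z0. h \<odot> stalk_map A k e = Zero K Z0 X \<odot> h')"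
        using e zero_hom[OF o Z0(1)] by blast
    }
    {
      assume h: "h \<in> Hom K (stalk A k P) Z0"
      have "h \<odot> stalk_map A k (Ide A P) \<in> Hom K (stalk A k P) Z0"
        using K.Comp_closed[OF _ h] sm_hom[OF D_ide[OF P], of k] P by simp
      then have "h \<odot> stalk_map A k (Ide A P) = Zero K (stalk A k P) Z0"
        using K.Ide_Comp zero_comp_K Z0 by metis
      then show "\<exists>e \<in> D. Cod A e = P \<and> h \<odot> stalk_map A k e = Zero K (stalk A k (Dom A e)) Z0"
        using D_ide[OF P] P by (intro bexI[of _ "Ide A P"]) auto
    }
  qed
qed

end

section \<open>The induced exact structure\<close>

lemma induced_exact_simps:
  "Obj (induced_exact T C) = C" "Dom (induced_exact T C) = Dom T" "Cod (induced_exact T C) = Cod T"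
  "Ide (induced_exact T C) = Ide T" "Comp (induced_exact T C) = Comp T" "Plus (induced_exact T C) = Plus T"
  "Zero (induced_exact T C) = Zero T"
  "Arr (induced_exact T C) = {f \<in> Arr T. Dom T f \<in> C \<and> Cod T f \<in> C}"
  "Ses (induced_exact T C) = {(f, g). (\<exists>h. (f, g, h) \<in> Tri T) \<and> Dom T f \<in> C \<and> Cod T f \<in> C \<and> Cod T g \<in> C}"
  by (simp_all add: induced_exact_def)

context admissible
begin

abbreviation "E \<equiv> induced_exact T C"

lemma Hom_E: "f \<in> Hom E X Y \<longleftrightarrow> f \<in> Hom T X Y \<and> X \<in> C \<and> Y \<in> C"
  by (auto simp: Hom_def induced_exact_simps)

lemma Hom_E_eq: "X \<in> C \<Longrightarrow> Y \<in> C \<Longrightarrow> Hom E X Y = Hom T X Y"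
  using Hom_E by blast

lemma biproduct_E: "X \<in> C \<Longrightarrow> Y \<in> C \<Longrightarrow> B \<in> C \<Longrightarrow> biproduct T X Y B i j p q \<Longrightarrow> biproduct E X Y B i j p q"
  by (simp add: biproduct_def Hom_E induced_exact_simps)

lemma is_zero_E: "is_zero T Z \<Longrightarrow> is_zero E Z"
  using C_zero[of Z] Hom_E_eq C_obj by (simp add: is_zero_def induced_exact_simps)

lemma additive_E: "additive_category E"
proof (intro additive_category.intro category.intro additive_category_axioms.intro)
  fix f assume "f \<in> Arr E"
  then show "Dom E f \<in> Obj E" "Cod E f \<in> Obj E" by (auto simp: induced_exact_simps)
next
  fix X assume "X \<in> Obj E"
  then show "Ide E X \<in> Hom E X X" using Ide_closed[of X] C_obj by (simp add: Hom_E) (simp add: induced_exact_simps)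
next
  fix f g X Y Z assume "f \<in> Hom E X Y" "g \<in> Hom E Y Z"
  then show "Comp E g f \<in> Hom E X Z" using Comp_closed by (auto simp: Hom_E) (auto simp: induced_exact_simps)
next
  fix f X Y assume "f \<in> Hom E X Y"
  then show "Comp E f (Ide E X) = f" "Comp E (Ide E Y) f = f" using Comp_Ide Ide_Comp
    by (auto simp: Hom_E) (auto simp: induced_exact_simps)
next
  fix f g h W X Y Z assume "f \<in> Hom E W X" "g \<in> Hom E X Y" "h \<in> Hom E Y Z"
  then show "Comp E (Comp E h g) f = Comp E h (Comp E g f)" using Comp_assoc[of f W X g Y h Z]
    unfolding Hom_E by (simp add: induced_exact_simps)
next
  fix X Y assume o: "X \<in> Obj E" "Y \<in> Obj E"
  then have "hom_group E X Y = hom_group T X Y" by (simp add: hom_group_def Hom_E_eq induced_exact_simps)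
  then show "comm_group (hom_group E X Y)" using o hom_comm_group C_obj by (simp add: induced_exact_simps)
next
  fix f f' g X Y Z assume "f \<in> Hom E X Y" "f' \<in> Hom E X Y" "g \<in> Hom E Y Z"
  then show "Comp E g (Plus E f f') = Plus E (Comp E g f) (Comp E g f')" using Comp_Plus[of f X Y f' g Z]
    unfolding Hom_E by (simp add: induced_exact_simps)
next
  fix f g g' X Y Z assume "f \<in> Hom E X Y" "g \<in> Hom E Y Z" "g' \<in> Hom E Y Z"
  then show "Comp E (Plus E g g') f = Plus E (Comp E g f) (Comp E g' f)" using Plus_Comp[of f X Y g Z g']
    unfolding Hom_E by (simp add: induced_exact_simps)
next
  show "\<exists>Z. is_zero E Z" using zero_exists is_zero_E by blast
next
  fix X Y assume "X \<in> Obj E" "Y \<in> Obj E"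
  then have o: "X \<in> C" "Y \<in> C" by (simp_all add: induced_exact_simps)
  obtain B i j p q where "B \<in> C" "biproduct T X Y B i j p q" using C_sum[OF o] by blast
  then show "\<exists>B. is_direct_sum E X Y B" using biproduct_E[OF o] unfolding is_direct_sum_def by blast
qed

sublocale ex: additive_category E by (rule additive_E)

sublocale ex: deflations E D
proof
  fix e assume "e \<in> D"
  then show "e \<in> Arr E" using D_dom_cod[of e] by (auto simp: induced_exact_simps Hom_def)
next
  fix P assume "P \<in> Obj E"
  then show "Ide E P \<in> D" using D_ide by (simp add: induced_exact_simps)
next
  fix e e' assume "e \<in> D" "e' \<in> D" "Cod E e' = Dom E e"
  then show "Comp E e e' \<in> D" using D_comp by (simp add: induced_exact_simps)
qed

lemma is_zero_E_iff: "is_zero E Z \<longleftrightarrow> is_zero T Z"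
  using is_zero_E[of Z] C_obj by (auto simp: ex.is_zero_iff is_zero_iff induced_exact_simps)

lemma cx_T:
  assumes "X \<in> bounded_complexes E"
  shows "cob X n \<in> C" "cdiff X n \<in> Hom T (cob X n) (cob X (n + 1))"
    "m = n + 1 \<Longrightarrow> cdiff X m \<cdot> cdiff X n = Zero T (cob X n) (cob X (m + 1))"
  using ex.cxD[OF assms, of n] ex.cxD(5)[OF assms, of m n]
  by (auto simp: induced_exact_simps Hom_def)

lemma effaceable_E:
  "ex.effaceable X \<longleftrightarrow> X \<in> bounded_complexes E \<and>
    (\<forall>k. \<forall>P \<in> C. \<forall>x \<in> Hom T P (cob X k). cdiff X k \<cdot> x = Zero T P (cob X (k + 1)) \<longrightarrow>
      (\<exists>e \<in> D. Cod T e = P \<and> (\<exists>y \<in> Hom T (Dom T e) (cob X (k - 1)). x \<cdot> e = cdiff X (k - 1) \<cdot> y)))"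
proof (cases "X \<in> bounded_complexes E")
  case True
  have "Hom E P (cob X k) = Hom T P (cob X k)" if "P \<in> C" for P k using Hom_E_eq that cx_T(1)[OF True] by blast
  then show ?thesis unfolding ex.effaceable_iff using D_dom_cod
    by (auto simp: induced_exact_simps cong: conj_cong ball_cong bex_cong)
next
  case False
  then show ?thesis by (simp add: ex.effaceable_iff)
qed

text \<open>A kernel as seen from \<open>C\<close>: uniqueness of the factorisation makes
  \<open>m\<close> monic for maps out of objects of \<open>C\<close>.\<close>

definition kernel :: "('o, 'm) cochain_complex \<Rightarrow> int \<Rightarrow> 'o \<Rightarrow> 'm \<Rightarrow> bool" where
  "kernel X n Z m \<longleftrightarrow> Z \<in> C \<and> m \<in> Hom T Z (cob X n) \<and> cdiff X n \<cdot> m = Zero T Z (cob X (n + 1)) \<and>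
     (\<forall>Q \<in> C. \<forall>x \<in> Hom T Q (cob X n). cdiff X n \<cdot> x = Zero T Q (cob X (n + 1)) \<longrightarrow>
        (\<exists>!y. y \<in> Hom T Q Z \<and> x = m \<cdot> y))"

text \<open>Write the differential in degree \<open>n\<close> as \<open>m e\<close>. The cocycle
  \<open>m\<close> becomes a coboundary after a deflation \<open>d\<close>, and since
  \<open>m\<close> is monic this says \<open>d = e y\<close>; the obscure axiom makes
  \<open>e\<close> a deflation, and its kernel is the kernel one degree lower.\<close>

lemma kernel_step:
  assumes X: "ex.effaceable X" and k: "kernel X (n + 1) Z m"
  shows "\<exists>e u w L. e \<in> Hom T (cob X n) Z \<and> cdiff X n = m \<cdot> e \<and> tri u e w L (cob X n) Z \<and> kernel X n L u"
proof -
  have Xb: "X \<in> bounded_complexes E" using X by (simp add: effaceable_E)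
  note cx = cx_T[OF Xb]
  have Z: "Z \<in> C" and m: "m \<in> Hom T Z (cob X (n + 1))" "cdiff X (n + 1) \<cdot> m = Zero T Z (cob X (n + 1 + 1))"
    and univ: "\<And>Q x. Q \<in> C \<Longrightarrow> x \<in> Hom T Q (cob X (n + 1)) \<Longrightarrow> cdiff X (n + 1) \<cdot> x = Zero T Q (cob X (n + 1 + 1)) \<Longrightarrow>
        (\<exists>!y. y \<in> Hom T Q Z \<and> x = m \<cdot> y)"
    using k unfolding kernel_def by blast+
  obtain e where e: "e \<in> Hom T (cob X n) Z" "cdiff X n = m \<cdot> e"
    using univ[OF cx(1,2)] cx(3)[of "n + 1" n] by auto
  obtain d y where d: "d \<in> D" "Cod T d = Z" "y \<in> Hom T (Dom T d) (cob X n)" "m \<cdot> d = cdiff X n \<cdot> y"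
    using X Z m unfolding effaceable_E by (metis add_diff_cancel_right')
  have dh: "d \<in> Hom T (Dom T d) Z" "Dom T d \<in> C" using D_dom_cod[OF d(1)] d(2) by auto
  have ey: "e \<cdot> y \<in> Hom T (Dom T d) Z" using Comp_closed[OF d(3) e(1)] .
  have mono: "f = g" if "f \<in> Hom T Q Z" "g \<in> Hom T Q Z" "Q \<in> C" "m \<cdot> f = m \<cdot> g" for f g Q
  proof -
    have "m \<cdot> f \<in> Hom T Q (cob X (n + 1))" using Comp_closed[OF that(1) m(1)] .
    moreover have "cdiff X (n + 1) \<cdot> (m \<cdot> f) = Zero T Q (cob X (n + 1 + 1))"
      using Comp_assoc[OF that(1) m(1) cx(2)] m(2) that(1) C_obj[OF cx(1)] by (simp add: Hom_def)
    ultimately show ?thesis using univ[OF that(3)] that by blast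
  qed
  have "m \<cdot> d = m \<cdot> (e \<cdot> y)" using d(4) e(2) Comp_assoc[OF d(3) e(1) m(1)] by simp
  then have "d = e \<cdot> y" using mono dh ey by blast
  then have "e \<in> D" using D_obscure[OF e(1) cx(1) d(3)] d(1) by simp
  then obtain u w L where t: "tri u e w L (cob X n) Z" "L \<in> C" using DE[OF _ e(1)] by blast
  note td = triD[OF t(1)]
  have "kernel X n L u" unfolding kernel_def
  proof (intro conjI ballI impI)
    show "L \<in> C" "u \<in> Hom T L (cob X n)" using t td by auto
    have "(m \<cdot> e) \<cdot> u = m \<cdot> (e \<cdot> u)" using Comp_assoc[OF td(2) e(1) m(1)] .
    then show "cdiff X n \<cdot> u = Zero T L (cob X (n + 1))"
      using tri_zero(1)[OF t(1)] e(2) m(1) td by (simp add: Hom_def)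
    fix Q x assume Q: "Q \<in> C" and x: "x \<in> Hom T Q (cob X n)" "cdiff X n \<cdot> x = Zero T Q (cob X (n + 1))"
    have "m \<cdot> (e \<cdot> x) = m \<cdot> Zero T Q Z"
      using x(2) e(2) Comp_assoc[OF x(1) e(1) m(1)] m(1) C_obj[OF Q] by (simp add: Hom_def)
    then have "e \<cdot> x = Zero T Q Z" using mono[OF Comp_closed[OF x(1) e(1)] _ Q] C_obj Q Z by (simp add: Hom_def)
    from tri_exact[OF t(1) x(1) this] obtain y where y: "y \<in> Hom T Q L" "x = u \<cdot> y" by blast
    then show "\<exists>!y. y \<in> Hom T Q L \<and> x = u \<cdot> y"
      using C_mono[OF t(1,2) Z Q] by (intro ex1I[of _ y]) auto
  qed
  then show ?thesis using e t by blast
qed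

text \<open>The induction descends from the top degree; each kernel is split off by weak idempotent
  completeness (\<open>D_obscure\<close>).\<close>

lemma kernel_exists:
  assumes X: "ex.effaceable X"
  shows "\<exists>Z m. kernel X n Z m"
proof -
  have Xb: "X \<in> bounded_complexes E" using X by (simp add: effaceable_E)
  note cx = cx_T[OF Xb]
  obtain b where b: "b \<ge> 0" "\<And>n. \<bar>n\<bar> > b \<Longrightarrow> is_zero E (cob X n)" using ex.cx_bound[OF Xb] by blast
  \<comment> \<open>Above the bound the term is zero, and its identity is a kernel.\<close>
  have top: "\<exists>Z m. kernel X n Z m" if n: "n > b" for n
  proof -
    have z: "is_zero T (cob X n)" using b(2)[of n] n by (simp add: is_zero_E_iff)
    have o: "cob X n \<in> Obj T" "cob X (n + 1) \<in> Obj T" using C_obj cx(1) by blast+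
    have "cdiff X n = Zero T (cob X n) (cob X (n + 1))"
      by (rule zero_obj_eq[OF z]) (use cx(2)[of n] o in \<open>auto simp: Hom_def\<close>)
    moreover have "\<exists>!y. y \<in> Hom T Q (cob X n) \<and> x = Ide T (cob X n) \<cdot> y" if "x \<in> Hom T Q (cob X n)" for Q x
      using Ide_Comp that by metis
    ultimately have "kernel X n (cob X n) (Ide T (cob X n))" unfolding kernel_def
      using cx(1)[of n] Ide_closed[OF o(1)] o by simp
    then show ?thesis by blast
  qed
  have "\<exists>Z m. kernel X (b + 1 - int k) Z m" for k
  proof (induction k)
    case 0
    show ?case using top[of "b + 1"] by simp
  next
    case (Suc k)
    then obtain Z m where "kernel X ((b - int k) + 1) Z m" by (auto simp: algebra_simps)
    from kernel_step[OF X this] show ?case by (auto simp: algebra_simps)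
  qed
  from this[of "nat (b + 1 - n)"] show ?thesis using top[of n] by (cases "n > b") auto
qed

lemma kernel_iso:
  assumes X: "X \<in> bounded_complexes E" and 1: "kernel X n Z m" and 2: "kernel X n Z' m'"
  shows "\<exists>a. a \<in> Hom T Z' Z \<and> is_iso T a \<and> m' = m \<cdot> a"
proof -
  have u1: "\<And>Q x. Q \<in> C \<Longrightarrow> x \<in> Hom T Q (cob X n) \<Longrightarrow> cdiff X n \<cdot> x = Zero T Q (cob X (n + 1)) \<Longrightarrow>
        (\<exists>!y. y \<in> Hom T Q Z \<and> x = m \<cdot> y)"
    and u2: "\<And>Q x. Q \<in> C \<Longrightarrow> x \<in> Hom T Q (cob X n) \<Longrightarrow> cdiff X n \<cdot> x = Zero T Q (cob X (n + 1)) \<Longrightarrow>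
        (\<exists>!y. y \<in> Hom T Q Z' \<and> x = m' \<cdot> y)"
    and m: "m \<in> Hom T Z (cob X n)" "cdiff X n \<cdot> m = Zero T Z (cob X (n + 1))" "Z \<in> C"
    and m': "m' \<in> Hom T Z' (cob X n)" "cdiff X n \<cdot> m' = Zero T Z' (cob X (n + 1))" "Z' \<in> C"
    using 1 2 unfolding kernel_def by blast+
  obtain a where a: "a \<in> Hom T Z' Z" "m' = m \<cdot> a" using u1[OF m'(3,1,2)] by blast
  obtain b where b: "b \<in> Hom T Z Z'" "m = m' \<cdot> b" using u2[OF m(3,1,2)] by blast
  have "m \<cdot> (a \<cdot> b) = m"
    by (simp only: Comp_assoc[OF b(1) a(1) m(1), symmetric] a(2)[symmetric] b(2)[symmetric])
  then have "a \<cdot> b \<in> Hom T Z Z \<and> m = m \<cdot> (a \<cdot> b)" "Ide T Z \<in> Hom T Z Z \<and> m = m \<cdot> Ide T Z"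
    using Comp_closed[OF b(1) a(1)] Ide_closed[OF C_obj[OF m(3)]] Comp_Ide[OF m(1)] by simp_all
  then have ab: "a \<cdot> b = Ide T Z" using u1[OF m(3,1,2)] by blast
  have "m' \<cdot> (b \<cdot> a) = m'"
    by (simp only: Comp_assoc[OF a(1) b(1) m'(1), symmetric] a(2)[symmetric] b(2)[symmetric])
  then have "b \<cdot> a \<in> Hom T Z' Z' \<and> m' = m' \<cdot> (b \<cdot> a)" "Ide T Z' \<in> Hom T Z' Z' \<and> m' = m' \<cdot> Ide T Z'"
    using Comp_closed[OF a(1) b(1)] Ide_closed[OF C_obj[OF m'(3)]] Comp_Ide[OF m'(1)] by simp_all
  then have ba: "b \<cdot> a = Ide T Z'" using u2[OF m'(3,1,2)] by blast
  show ?thesis using a is_isoI[OF a(1) b(1) ba ab] by blast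
qed

text \<open>A cocycle is killed by \<open>e k\<close> because inflations are monic in
  \<open>C\<close>, so it lifts to \<open>Z k\<close>; pulling back the deflation
  \<open>e (k - 1)\<close> onto \<open>Z k\<close> makes it a coboundary.\<close>

lemma acyclic_imp_effaceable:
  assumes "X \<in> bounded_acyclic_complexes E"
  shows "ex.effaceable X"
proof -
  have X: "X \<in> bounded_complexes E" using assms by (simp add: bounded_acyclic_complexes_def)
  note cx = cx_T[OF X]
  obtain Z m e where Zme: "\<And>n. m n \<in> Hom E (Z n) (cob X n)" "\<And>n. e n \<in> Hom E (cob X n) (Z (n + 1))"
    "\<And>n. (m n, e n) \<in> Ses E" "\<And>n. cdiff X n = Comp E (m (n + 1)) (e n)"
    using assms unfolding bounded_acyclic_complexes_def by blast
  have m: "m n \<in> Hom T (Z n) (cob X n)" "Z n \<in> C" for n using Zme(1)[of n] by (simp_all add: Hom_E)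
  have e: "e n \<in> Hom T (cob X n) (Z (n + 1))" for n using Zme(2)[of n] by (simp add: Hom_E)
  have cd: "cdiff X n = m (n + 1) \<cdot> e n" for n using Zme(4) by (simp add: induced_exact_simps)
  have t: "\<exists>h. tri (m n) (e n) h (Z n) (cob X n) (Z (n + 1))" for n
  proof -
    obtain h where h: "(m n, e n, h) \<in> Tri T" using Zme(3)[of n] by (auto simp: induced_exact_simps)
    then have "tri (m n) (e n) h (Z n) (cob X n) (Z (n + 1))"
      using m[of n] e[of n] Tri_is_triangle[OF h] by (intro triI) (auto simp: Hom_def is_triangle_def)
    then show ?thesis by blast
  qed
  show ?thesis unfolding effaceable_E
  proof (intro conjI X allI ballI impI)
    fix k P x assume P: "P \<in> C" and x: "x \<in> Hom T P (cob X k)" "cdiff X k \<cdot> x = Zero T P (cob X (k + 1))"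
    obtain h where h: "tri (m k) (e k) h (Z k) (cob X k) (Z (k + 1))" using t by blast
    obtain h' where h': "tri (m (k + 1)) (e (k + 1)) h' (Z (k + 1)) (cob X (k + 1)) (Z (k + 1 + 1))" using t by blast
    obtain g where g: "tri (m (k - 1)) (e (k - 1)) g (Z (k - 1)) (cob X (k - 1)) (Z k)" using t[of "k - 1"] by auto
    have "m (k + 1) \<cdot> (e k \<cdot> x) = m (k + 1) \<cdot> Zero T P (Z (k + 1))"
      using x(2) cd[of k] Comp_assoc[OF x(1) e m(1)] m(1)[of "k + 1"] C_obj[OF P] by (simp add: Hom_def)
    then have "e k \<cdot> x = Zero T P (Z (k + 1))"
      using C_mono[OF h' m(2) m(2) P Comp_closed[OF x(1) e], of "Zero T P (Z (k + 1))"] C_obj P m(2) by (simp add: Hom_def)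
    from tri_exact[OF h x(1) this] obtain x' where x': "x' \<in> Hom T P (Z k)" "x = m k \<cdot> x'" by blast
    have "e (k - 1) \<in> D" "e (k - 1) \<in> Hom T (cob X (k - 1)) (Z k)"
      using DI[OF g m(2) cx(1) m(2)] triD(3)[OF g] by auto
    from D_pullback[OF this x'(1) P] obtain d y Q where d: "d \<in> D" "d \<in> Hom T Q P" "y \<in> Hom T Q (cob X (k - 1))"
      "x' \<cdot> d = e (k - 1) \<cdot> y" by blast
    have "x \<cdot> d = m k \<cdot> (e (k - 1) \<cdot> y)" using x'(2) Comp_assoc[OF d(2) x'(1) m(1)] d(4) by simp
    also have "\<dots> = cdiff X (k - 1) \<cdot> y" using Comp_assoc[OF d(3) triD(3)[OF g] m(1)] cd[of "k - 1"] by simp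
    finally show "\<exists>e \<in> D. Cod T e = P \<and> (\<exists>y \<in> Hom T (Dom T e) (cob X (k - 1)). x \<cdot> e = cdiff X (k - 1) \<cdot> y)"
      using d by (intro bexI[of _ d]) (auto simp: Hom_def)
  qed
qed

text \<open>\<open>kernel_step\<close> returns some kernel in degree \<open>n\<close>, whereas the
  factorisations of all differentials must share one family \<open>Z\<close>. The triangle is
  therefore transported along the isomorphism between the two kernels.\<close>

lemma effaceable_imp_acyclic:
  assumes eff: "ex.effaceable X"
  shows "X \<in> bounded_acyclic_complexes E"
proof -
  have X: "X \<in> bounded_complexes E" using eff by (simp add: effaceable_E)
  note cx = cx_T[OF X]
  obtain Z m where k: "\<And>n. kernel X n (Z n) (m n)" using kernel_exists[OF eff] by metis
  have "\<exists>e. m n \<in> Hom E (Z n) (cob X n) \<and> e \<in> Hom E (cob X n) (Z (n + 1)) \<and>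
       (m n, e) \<in> Ses E \<and> cdiff X n = Comp E (m (n + 1)) e" for n
  proof -
    obtain e u w L where e: "e \<in> Hom T (cob X n) (Z (n + 1))" "cdiff X n = m (n + 1) \<cdot> e"
      "tri u e w L (cob X n) (Z (n + 1))" "kernel X n L u" using kernel_step[OF eff k] by blast
    obtain a where a: "a \<in> Hom T (Z n) L" "is_iso T a" "m n = u \<cdot> a" using kernel_iso[OF X e(4) k] by blast
    obtain a' where a': "a' \<in> Hom T L (Z n)" "a \<cdot> a' = Ide T L" using is_iso_inverse[OF a(2,1)] by blast
    note d [simp] = triD(5-)[OF e(3)]
    have arr [simp]: "a \<in> Arr T" "Dom T a = Z n" "Cod T a = L" "a' \<in> Arr T" "Dom T a' = L" "Cod T a' = Z n"
      using a a' by (auto simp: Hom_def)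
    have ZC: "Z n \<in> C" "Z (n + 1) \<in> C" "m n \<in> Hom T (Z n) (cob X n)" using k unfolding kernel_def by blast+
    have SaSa: "S a \<cdot> S a' = Ide T (So L)" using S_simps(6)[of a' a] a'(2) by simp
    have "S a \<cdot> (S a' \<cdot> w) = w" using assoc_cong[OF SaSa, of w] by simp
    then have "tri (m n) e (S a' \<cdot> w) (Z n) (cob X n) (Z (n + 1))"
      by (intro tri_iso[OF e(3) ZC(3) e(1) _ a(1,2), where b = "Ide T (cob X n)" and c = "Ide T (Z (n + 1))"])
        (use a(3) ZC in \<open>simp_all add: Hom_def\<close>)
    from triD[OF this] have "(m n, e) \<in> Ses E" using ZC cx(1) by (auto simp: induced_exact_simps)
    then show ?thesis using e(1,2) ZC cx(1) by (auto simp: Hom_E) (auto simp: induced_exact_simps)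
  qed
  then obtain e where "\<And>n. m n \<in> Hom E (Z n) (cob X n) \<and> e n \<in> Hom E (cob X n) (Z (n + 1)) \<and>
       (m n, e n) \<in> Ses E \<and> cdiff X n = Comp E (m (n + 1)) (e n)" by metis
  then show ?thesis using X unfolding bounded_acyclic_complexes_def by blast
qed

end

text \<open>The image triangle is isomorphic to itself, provided the suspension of the quotient
  preserves identities. That suspension is defined on classes of roofs, so the point is its
  independence of the roof chosen for an identity.\<close>

lemma (in right_fractions) qf_Tri:
  assumes SF: "is_functor K K (Susp K)" and SQ: "\<And>s. s \<in> Q \<Longrightarrow> farr (Susp K) s \<in> Q"
    and t: "(u, v, w) \<in> Tri K" "is_triangle K u v w"
  shows "(qf u, qf v, qf w) \<in> Tri V"
proof -
  note F = functorD[OF SF]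
  have "farr (Susp V) (Ide V X) = Ide V (fob (Susp V) X)" if X: "X \<in> Obj V" for X
  proof -
    have X': "X \<in> Obj K" using X by simp
    let ?R = "roof_rel K N (fob (Susp K) X) (fob (Susp K) X)" and ?I = "Ide K (fob (Susp K) X)"
    let ?S = "{(farr (Susp K) s, farr (Susp K) f) | s f. (s, f) \<in> roof_rel K N X X `` {(Ide K X, Ide K X)}}"
    have I: "(Ide K X, Ide K X) \<in> roofs K N X X" "(?I, ?I) \<in> roofs K N (fob (Susp K) X) (fob (Susp K) X)"
      using X' F(1)[OF X'] by (simp_all add: roofs_iff)
    \<comment> \<open>The legs \<open>s\<close> and \<open>f\<close> of a roof equivalent to an
      identity become one denominator \<open>a\<close> after refinement; by \<open>SQ\<close> this
      persists under suspension.\<close>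
    have rel: "((?I, ?I), x) \<in> ?R" if "x \<in> ?S" for x
    proof -
      from that obtain s f where x: "x = (farr (Susp K) s, farr (Susp K) f)"
        and sf: "((Ide K X, Ide K X), (s, f)) \<in> roof_rel K N X X" by blast
      obtain a b where a: "(s, f) \<in> roofs K N X X" "a \<in> Arr K" "b \<in> Arr K" "Dom K a = Dom K b"
        "Cod K a = Dom K (Ide K X)" "Cod K b = Dom K s" "Ide K X \<cdot> a = s \<cdot> b" "Ide K X \<cdot> a \<in> Q" "Ide K X \<cdot> a = f \<cdot> b"
        using roof_relE[OF sf] by blast
      have ax: "Cod K a = X" "a = s \<cdot> b" "a = f \<cdot> b" "a \<in> Q" using a X' by auto
      have s: "s \<in> Q" "f \<in> Arr K" "Dom K s = Dom K f" "Cod K s = X" "Cod K f = X" using a(1) by (auto simp: roofs_iff)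
      have e: "farr (Susp K) s \<cdot> farr (Susp K) b = farr (Susp K) a" "farr (Susp K) f \<cdot> farr (Susp K) b = farr (Susp K) a"
        using F(6)[of b s] F(6)[of b f] a(3,6) s ax by simp_all
      have Sa: "farr (Susp K) a \<in> Q" by (rule SQ[OF ax(4)])
      show ?thesis unfolding x
        by (rule roof_relI[where a = "farr (Susp K) a" and b = "farr (Susp K) b", OF I(2)])
          (use SQ[OF s(1)] s a(2-4,6) ax(1) e Sa F X' in \<open>simp_all add: roofs_iff\<close>)
    qed
    have mem: "(?I, ?I) \<in> ?S"
      using roof_refl[OF I(1)] F(5)[OF X'] by force
    have "?R `` ?S = ?R `` {(?I, ?I)}"
    proof
      show "?R `` ?S \<subseteq> ?R `` {(?I, ?I)}"
      proof
        fix y assume "y \<in> ?R `` ?S"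
        then obtain x where x: "x \<in> ?S" "(x, y) \<in> ?R" by blast
        show "y \<in> ?R `` {(?I, ?I)}"
          using roof_trans[of ?I ?I "fst x" "snd x" _ _ "fst y" "snd y"] rel[OF x(1)] x(2) by simp
      qed
      show "?R `` {(?I, ?I)} \<subseteq> ?R `` ?S" using mem by blast
    qed
    then show ?thesis using X' F(1)[OF X'] by (simp add: verdier_susp_def roof_class_def Let_def)
  qed
  moreover have "is_triangle V (qf u) (qf v) (qf w)"
  proof -
    have a: "u \<in> Arr K" "v \<in> Arr K" "w \<in> Arr K" "Cod K u = Dom K v" "Cod K v = Dom K w" "Cod K w = fob (Susp K) (Dom K u)"
      using t(2) by (simp_all add: is_triangle_def)
    have "qf u \<in> Hom V (Dom K u) (Cod K u)" "qf v \<in> Hom V (Dom K v) (Cod K v)" "qf w \<in> Hom V (Dom K w) (Cod K w)"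
      using a by (auto intro!: qf_hom HomI)
    then show ?thesis using a unfolding is_triangle_def Hom_def by (simp add: verdier_susp_def)
  qed
  ultimately have "triangle_iso V (qf u, qf v, qf w) (qf u, qf v, qf w)"
    by (rule triangle_iso_refl[OF category_V, rotated])
  then show ?thesis unfolding Tri_verdier using t(1) by blast
qed

section \<open>Realization functors\<close>

locale realization = admissible T C for T :: "('o, 'm) tri_category" (structure) and C :: "'o set" +
  fixes F :: "(('o, 'm) cochain_complex, ('o, 'm) derived_arr, 'o, 'm) cfunctor"
    and \<phi> :: "('o, 'm) cochain_complex \<Rightarrow> 'm"
  assumes real: "realization_functor T C F \<phi>"
begin

abbreviation "N \<equiv> bounded_acyclic_complexes E"

sublocale rf: right_fractions "Kb E" N "quot_system (Kb E) N"
  by (rule ex.right_fractions_Kb) (use acyclic_imp_effaceable effaceable_imp_acyclic in blast)+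

lemma quot_iff: "s \<in> quot_system (Kb E) N \<longleftrightarrow> ex.qis s"
  using ex.quot_system_iff acyclic_imp_effaceable effaceable_imp_acyclic by blast

lemma Db_eq: "Db E = rf.V"
  by (simp add: Db_def)

lemma category_Db: "category (Db E)"
  unfolding Db_eq by (rule rf.category_V)

lemma F_functor: "is_functor (Db E) T F"
  using real by (simp add: realization_functor_def triangle_functor_def additive_functor_def)

abbreviation "Fq u \<equiv> farr F (rf.qf u)"

lemma Fq_hom: "u \<in> Hom (Kb E) X Y \<Longrightarrow> Fq u \<in> Hom T (fob F X) (fob F Y)"
  using functor_hom[OF F_functor[unfolded Db_eq] rf.qf_hom] .

lemma Fq_comp: "f \<in> Hom (Kb E) X Y \<Longrightarrow> g \<in> Hom (Kb E) Y Z \<Longrightarrow> Fq (Comp (Kb E) g f) = Fq g \<cdot> Fq f"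
proof -
  assume f: "f \<in> Hom (Kb E) X Y" and g: "g \<in> Hom (Kb E) Y Z"
  then have "rf.qf (Comp (Kb E) g f) = Comp rf.V (rf.qf g) (rf.qf f)" by (intro rf.qf_comp) (auto simp: Hom_def)
  then show ?thesis
    using functorD(6)[OF F_functor[unfolded Db_eq], of "rf.qf f" "rf.qf g"] rf.qf_hom[OF f] rf.qf_hom[OF g] by (simp add: Hom_def)
qed

lemma F_obj: "X \<in> bounded_complexes E \<Longrightarrow> fob F X \<in> Obj T"
  using functorD(1)[OF F_functor, of X] by (simp add: Db_eq ex.Obj_K)

lemma qis_S: "s \<in> quot_system (Kb E) N \<Longrightarrow> farr (Susp (Kb E)) s \<in> quot_system (Kb E) N"
  unfolding quot_iff using ex.qis_shift[of s "Dom (Kb E) s" "Cod (Kb E) s"] by (auto simp: ex.qis_def Hom_def)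

text \<open>The connecting map of the image is twisted by \<open>\<phi>\<close>, hence left
  existential.\<close>

lemma F_triangle:
  assumes std: "(u, v, w) \<in> std_triangles E" and u: "u \<in> Hom (Kb E) X Y" and Z: "Cod (Kb E) v = Z"
  shows "\<exists>v' w'. tri (Fq u) v' w' (fob F X) (fob F Y) (fob F Z)"
proof -
  note t = ex.stdD(1,2)[OF std u Z]
  have "(rf.qf u, rf.qf v, rf.qf w) \<in> Tri (Db E)"
    unfolding Db_eq by (rule rf.qf_Tri[OF ex.is_functor_Kb_susp qis_S ex.std_Tri[OF std] ex.std_is_triangle[OF std]])
  then have "(Fq u, Fq v, \<phi> (Dom (Db E) (rf.qf u)) \<cdot> Fq w) \<in> Tri T"
    using real unfolding realization_functor_def triangle_functor_def by blast
  then have t': "(Fq u, Fq v, \<phi> (Dom (Db E) (rf.qf u)) \<cdot> Fq w) \<in> Tri T" .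
  have "Cod T (Fq v) = Dom T (\<phi> (Dom (Db E) (rf.qf u)) \<cdot> Fq w)" using Tri_is_triangle[OF t'] by (simp add: is_triangle_def)
  then show ?thesis using triI[OF t', of "fob F X" "fob F Y" "fob F Z"] Fq_hom[OF u] Fq_hom[OF t(1)]
    by (auto simp: Hom_def)
qed

definition \<eta> :: "'o \<Rightarrow> 'm" where
  "\<eta> = (SOME \<eta>. natural_iso E T (F \<circ>\<^sub>F Db_embedding E) functor_id \<eta>)"

lemma \<eta>:
  "P \<in> C \<Longrightarrow> \<eta> P \<in> Hom T (fob F (stalk E 0 P)) P" "P \<in> C \<Longrightarrow> is_iso T (\<eta> P)"
  "e \<in> Hom T P P' \<Longrightarrow> P \<in> C \<Longrightarrow> P' \<in> C \<Longrightarrow> \<eta> P' \<cdot> Fq (stalk_map E 0 e) = e \<cdot> \<eta> P"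
proof -
  have "\<exists>\<eta>. natural_iso E T (F \<circ>\<^sub>F Db_embedding E) functor_id \<eta>"
    using real by (simp add: realization_functor_def)
  then have n: "natural_iso E T (F \<circ>\<^sub>F Db_embedding E) functor_id \<eta>" unfolding \<eta>_def by (rule someI_ex)
  have ob: "fob (Db_embedding E) P = stalk E 0 P" for P
    by (simp add: Db_embedding_def stalk_functor_simps quot_functor_def)
  have ar: "farr (Db_embedding E) e = rf.qf (stalk_map E 0 e)" for e
    by (simp add: Db_embedding_def stalk_functor_simps)
  show "P \<in> C \<Longrightarrow> \<eta> P \<in> Hom T (fob F (stalk E 0 P)) P" "P \<in> C \<Longrightarrow> is_iso T (\<eta> P)"
    using natural_isoD(1,2)[OF n, of P] by (simp_all add: ob induced_exact_simps)
  show "e \<in> Hom T P P' \<Longrightarrow> P \<in> C \<Longrightarrow> P' \<in> C \<Longrightarrow> \<eta> P' \<cdot> Fq (stalk_map E 0 e) = e \<cdot> \<eta> P"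
    using natural_isoD(3)[OF n, of e P P'] by (simp add: ar Hom_E)
qed

lemma F_stalk: "P \<in> C \<Longrightarrow> isomorphic T (fob F (stalk E 0 P)) P"
  using \<eta>(1,2) unfolding isomorphic_def by blast

lemma stalk_bc: "P \<in> C \<Longrightarrow> stalk E k P \<in> bounded_complexes E"
  by (rule ex.stalk_cx) (simp add: induced_exact_simps)

lemma F_shift: "X \<in> bounded_complexes E \<Longrightarrow> isomorphic T (fob F (shift E X)) (So (fob F X))"
proof -
  assume X: "X \<in> bounded_complexes E"
  have n: "natural_iso (Db E) T (F \<circ>\<^sub>F Susp (Db E)) (Susp T \<circ>\<^sub>F F) \<phi>"
    using real by (simp add: realization_functor_def triangle_functor_def)
  have "X \<in> Obj (Db E)" using X by (simp add: Db_eq ex.Obj_K)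
  moreover have "fob (Susp (Db E)) X = shift E X" by (simp add: Db_eq verdier_susp_def Kb_simps)
  ultimately show ?thesis using natural_isoD(1,2)[OF n, of X] unfolding isomorphic_def by auto
qed

lemma F_shifts: "X \<in> bounded_complexes E \<Longrightarrow>
    (shift E ^^ k) X \<in> bounded_complexes E \<and> isomorphic T (fob F ((shift E ^^ k) X)) ((So ^^ k) (fob F X))"
proof (induction k)
  case 0
  then show ?case using F_obj by simp
next
  case (Suc k)
  then have "isomorphic T (So (fob F ((shift E ^^ k) X))) (So ((So ^^ k) (fob F X)))" using S_iso by blast
  then show ?case using Suc isomorphic_trans[OF F_shift] by simp
qed

lemma F_Z0: "is_zero T (fob F ex.Z0)"
proof -
  have "is_zero T (zero_obj E)" using ex.zero_obj by (simp add: is_zero_E_iff)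
  then show ?thesis using iso_zero F_stalk C_zero by blast
qed

text \<open>Zero maps factor through the zero complex, which \<open>F\<close> sends to a zero
  object; no sum of roofs has to be computed.\<close>

lemma Fq_zero:
  assumes "X \<in> bounded_complexes E" "Y \<in> bounded_complexes E"
  shows "Fq (Zero (Kb E) X Y) = Zero T (fob F X) (fob F Y)"
proof -
  have o: "X \<in> Obj (Kb E)" "Y \<in> Obj (Kb E)" using assms by (simp_all add: ex.Obj_K)
  note z1 = ex.zero_hom[OF o(1) ex.Z0(1)] and z2 = ex.zero_hom[OF ex.Z0(1) o(2)]
  have "Zero (Kb E) X Y = Comp (Kb E) (Zero (Kb E) ex.Z0 Y) (Zero (Kb E) X ex.Z0)"
    using ex.comp_zero_K[OF z2 o(1)] by simp
  then have e: "Fq (Zero (Kb E) X Y) = Fq (Zero (Kb E) ex.Z0 Y) \<cdot> Fq (Zero (Kb E) X ex.Z0)"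
    using Fq_comp[OF z1 z2] by simp
  have "Fq (Zero (Kb E) X ex.Z0) = Zero T (fob F X) (fob F ex.Z0)"
    by (rule zero_obj_eq[OF F_Z0]) (use Fq_hom[OF z1] F_obj[OF assms(1)] F_Z0 in \<open>auto simp: Hom_def is_zero_def\<close>)
  then show ?thesis using e Fq_hom[OF z2] F_obj[OF assms(1)] by (simp add: Hom_def)
qed

lemma F_zero_if:
  assumes X: "X \<in> bounded_complexes E" and z: "rf.qf (Ide (Kb E) X) = rf.qf (Zero (Kb E) X X)"
  shows "is_zero T (fob F X)"
proof -
  have o: "X \<in> Obj (Kb E)" using X by (simp add: ex.Obj_K)
  have "rf.qf (Ide (Kb E) X) = Ide rf.V X" using o by (simp add: rf.qf_def)
  then have "Fq (Ide (Kb E) X) = Ide T (fob F X)" using functorD(5)[OF F_functor[unfolded Db_eq], of X] o by simp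
  then show ?thesis using Fq_zero[OF X X] z F_obj[OF X] by (simp add: is_zero_iff)
qed

text \<open>The denominator \<open>0 -> X\<close> equalises the identity and the zero endomorphism
  of \<open>X\<close>, so these coincide in the quotient.\<close>

lemma F_effaceable:
  assumes "ex.effaceable X"
  shows "is_zero T (fob F X)"
proof -
  have X: "X \<in> Obj (Kb E)" using assms by (simp add: ex.effaceable_def)
  note z = ex.zero_hom[OF ex.Z0(1) X] and i = ex.K.Ide_closed[OF X] and zz = ex.zero_hom[OF X X]
  have "rf.qf (Ide (Kb E) X) = rf.qf (Zero (Kb E) X X)"
  proof (rule rf.qf_eqI[where s = "Zero (Kb E) ex.Z0 X"])
    show "Zero (Kb E) ex.Z0 X \<in> quot_system (Kb E) N" unfolding quot_iff by (rule ex.qis_zero[OF assms])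
    show "Comp (Kb E) (Ide (Kb E) X) (Zero (Kb E) ex.Z0 X) = Comp (Kb E) (Zero (Kb E) X X) (Zero (Kb E) ex.Z0 X)"
      using ex.K.Ide_Comp[OF z] ex.zero_comp_K[OF z X] by simp
  qed (use z i zz in \<open>auto simp: Hom_def\<close>)
  then show ?thesis using F_zero_if X by (simp add: ex.Obj_K)
qed

lemma F_zero_terms:
  assumes X: "X \<in> bounded_complexes E" and z: "\<And>n. is_zero E (cob X n)"
  shows "is_zero T (fob F X)"
proof -
  have "Ide E (cob X n) = Zero E (cob X n) (cob X n)" for n using z[of n] by (simp add: ex.is_zero_iff)
  then have "Ide (Kb E) X = Zero (Kb E) X X" by (simp add: Kb_simps)
  then show ?thesis using F_zero_if[OF X] by simp
qed

text \<open>The cone of \<open>s\<close> is effaceable, so \<open>F\<close> sends it to a zero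
  object.\<close>

lemma Fq_qis:
  assumes s: "s \<in> Hom (Kb E) X Y" and q: "ex.qis s"
  shows "is_iso T (Fq s)"
proof -
  obtain v w where std: "(s, v, w) \<in> std_triangles E" using ex.std_exists[OF s] by blast
  obtain v' w' where "tri (Fq s) v' w' (fob F X) (fob F Y) (fob F (Cod (Kb E) v))" using F_triangle[OF std s refl] by blast
  moreover have "is_zero T (fob F (Cod (Kb E) v))" using F_effaceable ex.qis_iff_effaceable_cone[OF std] q by blast
  ultimately show ?thesis by (rule tri_cone_zero)
qed

text \<open>A complex in degrees \<open>\<le> 0\<close> is the cone of \<open>d : Y \<rightarrow> X\<^sup>0\<close> where \<open>Y\<close> is its truncation to negative
  degrees, shifted.\<close>

lemma truncation:
  assumes X: "X \<in> bounded_complexes E" and pos: "\<And>n. n > 0 \<Longrightarrow> is_zero E (cob X n)"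
  obtains Y where "Y \<in> bounded_complexes E" "\<And>n. n > 0 \<Longrightarrow> is_zero E (cob Y n)"
    "\<And>n. n \<le> 0 \<Longrightarrow> cob Y n = cob X (n - 1)" "dtri (fob F Y) (fob F (stalk E 0 (cob X 0))) (fob F X)"
proof -
  define c where "c = (\<lambda>m. if m \<le> 0 then cob X (m - 1) else zero_obj E)"
  \<comment> \<open>The differential of \<open>Y\<close> is negated so that the sign in the mapping
    cone restores that of \<open>X\<close>; in degrees \<open>m \<ge> 0\<close> it ends in a zero
    object.\<close>
  define Y where "Y = \<lparr>cob = c, cdiff = (\<lambda>m. if m < 0 then neg E (cdiff X (m - 1)) else Zero E (c m) (c (m + 1)))\<rparr>"
  let ?P = "cob X 0" and ?S = "stalk E 0 (cob X 0)"
  have cobY [simp]: "cob Y m = c m" for m by (simp add: Y_def)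
  have c_obj [simp]: "c m \<in> Obj E" for m using X by (simp add: c_def)
  have c_neg [simp]: "m \<le> 0 \<Longrightarrow> c m = cob X (m - 1)" for m by (simp add: c_def)
  have c_pos: "m > 0 \<Longrightarrow> is_zero E (c m)" for m by (simp add: c_def ex.zero_obj)
  have dY_neg: "m < 0 \<Longrightarrow> cdiff Y m = neg E (cdiff X (m - 1))" for m by (simp add: Y_def)
  have dY_nn: "\<not> m < 0 \<Longrightarrow> cdiff Y m = Zero E (c m) (c (m + 1))" for m by (simp add: Y_def)
  have dY [simp]: "cdiff Y m \<in> Arr E" "Dom E (cdiff Y m) = c m" "Cod E (cdiff Y m) = c (m + 1)" for m
    using X by (cases "m < 0"; simp add: dY_neg dY_nn)+
  obtain b where b: "b \<ge> 0" "\<And>n. \<bar>n\<bar> > b \<Longrightarrow> is_zero E (cob X n)" using ex.cx_bound[OF X] by blast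
  have Y: "Y \<in> bounded_complexes E"
  proof (rule ex.cxI[where b = "b + 1"])
    fix n
    show "Comp E (cdiff Y (n + 1)) (cdiff Y n) = Zero E (cob Y n) (cob Y (n + 2))"
    proof (cases "n + 1 < 0")
      case True
      then show ?thesis using X by (simp add: dY_neg add.commute[of 1])
    next
      case False
      then show ?thesis by (simp add: dY_nn[of "n + 1"] add.commute[of 2])
    qed
    assume n: "\<bar>n\<bar> > b + 1"
    show "is_zero E (cob Y n)" using n b(2)[of "n - 1"] by (cases "n > 0") (auto simp: c_pos)
  qed simp_all
  have P: "?P \<in> Obj E" using X by simp
  have S: "?S \<in> bounded_complexes E" using P by simp
  \<comment> \<open>Only degree 0 carries a map, the differential of \<open>X\<close> from degree -1
    to degree 0.\<close>
  define f where "f = (\<lambda>m::int. if m = 0 then cdiff X (- 1) else Zero E (c m) (cob ?S m))"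
  have f_arr [simp]: "f m \<in> Arr E" "Dom E (f m) = c m" "Cod E (f m) = cob ?S m" for m
    using X P by (auto simp: f_def)
  have f: "f \<in> chain_maps E Y ?S"
  proof (rule ex.chain_mapsI)
    fix m
    show "Comp E (cdiff ?S m) (f m) = Comp E (f (m + 1)) (cdiff Y m)"
    proof (cases "m = - 1")
      case True
      then show ?thesis using X P by (simp add: f_def dY_neg)
    next
      case False
      then show ?thesis using P by (intro ex.zero_obj_eq[OF ex.zero_obj]) simp_all
    qed
  qed simp_all
  \<comment> \<open>\<open>X\<close> is itself a mapping cone of \<open>f\<close>: in each degree at
    least one of the two summands is zero, so the biproduct structure consists of identities and
    zero maps.\<close>
  define i where "i = (\<lambda>n::int. if n < 0 then Ide E (cob X n) else Zero E (c (n + 1)) (cob X n))"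
  define p where "p = (\<lambda>n::int. if n < 0 then Ide E (cob X n) else Zero E (cob X n) (c (n + 1)))"
  define j where "j = (\<lambda>n::int. if n = 0 then Ide E ?P else Zero E (cob ?S n) (cob X n))"
  define q where "q = (\<lambda>n::int. if n = 0 then Ide E ?P else Zero E (cob X n) (cob ?S n))"
  have z: "Ide E (zero_obj E) = Zero E (zero_obj E) (zero_obj E)" using ex.zero_obj by (simp add: ex.is_zero_iff)
  have bp: "biproduct E (cob Y (n + 1)) (cob ?S n) (cob X n) (i n) (j n) (p n) (q n)" for n
  proof -
    consider "n < 0" | "n = 0" | "n > 0" by linarith
    then show ?thesis
    proof cases
      case 1
      then show ?thesis using X z by (simp add: biproduct_def Hom_def i_def j_def p_def q_def)
    next
      case 2
      then show ?thesis using X z by (simp add: biproduct_def Hom_def i_def j_def p_def q_def c_def)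
    next
      case 3
      then have "Ide E (cob X n) = Zero E (cob X n) (cob X n)" using pos[of n] by (simp add: ex.is_zero_iff)
      then show ?thesis using X z 3 by (simp add: biproduct_def Hom_def i_def j_def p_def q_def c_def)
    qed
  qed
  have cone: "cone E Y ?S X f i j p q"
  proof
    show "mapping_cone E Y ?S f X i j p q" unfolding mapping_cone_def
    proof (intro allI conjI bp)
      fix n
      note B [simp] = ex.biproductD[OF bp]
      let ?rhs = "Plus E (Plus E (Comp E (i (n + 1)) (Comp E (neg E (cdiff Y (n + 1))) (p n)))
           (Comp E (j (n + 1)) (Comp E (f (n + 1)) (p n))))
          (Comp E (j (n + 1)) (Comp E (cdiff ?S n) (q n)))"
      have arr: "?rhs \<in> Arr E" "Dom E ?rhs = cob X n" "Cod E ?rhs = cob X (n + 1)" using P by simp_all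
      consider "n + 1 < 0" | "n = - 1" | "n + 1 > 0" by linarith
      then show "cdiff X n = ?rhs"
      proof cases
        case 1
        then show ?thesis using X P by (simp add: i_def p_def j_def dY_neg f_def)
      next
        case 2
        then show ?thesis using X P by (simp add: i_def p_def j_def q_def f_def dY_nn)
      next
        case 3
        show ?thesis by (rule ex.zero_obj_eq[OF pos[OF 3]]) (use arr X in simp_all)
      qed
    qed
  qed (rule Y S f)+
  have std: "(htpy_class E Y ?S f, htpy_class E ?S X j, htpy_class E X (shift E Y) p) \<in> std_triangles E"
    by (rule ex.std_triangleI[OF cone])
  have "dtri (fob F Y) (fob F ?S) (fob F X)"
    using F_triangle[OF std ex.Kb_homI[OF Y S f], of X] dtriI by (auto simp: Kb_simps)
  then show ?thesis using that[OF Y] c_pos by simp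
qed

text \<open>Each truncation splits off the term in degree 0 as a layer from \<open>C\<close> and
  moves the rest up by one degree, so \<open>k\<close> drops by one; at \<open>k = 0\<close> what is
  left has zero terms only.\<close>

lemma F_V:
  assumes "X \<in> bounded_complexes E" "\<And>n. n > 0 \<Longrightarrow> is_zero E (cob X n)" "\<And>n. n < - int k \<Longrightarrow> is_zero E (cob X n)"
  shows "fob F X \<in> V k"
  using assms
proof (induction k arbitrary: X)
  case 0
  obtain Y where Y: "Y \<in> bounded_complexes E" "\<And>n. n > 0 \<Longrightarrow> is_zero E (cob Y n)"
    "\<And>n. n \<le> 0 \<Longrightarrow> cob Y n = cob X (n - 1)" "dtri (fob F Y) (fob F (stalk E 0 (cob X 0))) (fob F X)"
    using truncation[OF 0(1,2)] by blast
  have "is_zero E (cob Y n)" for n using Y(2)[of n] Y(3)[of n] 0(3)[of "n - 1"] by (cases "n > 0") auto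
  then have "is_zero T (fob F Y)" using F_zero_terms[OF Y(1)] by blast
  then have "isomorphic T (fob F (stalk E 0 (cob X 0))) (fob F X)" using dtri_zero_first[OF Y(4)] by blast
  moreover have "cob X 0 \<in> C" using cx_T(1)[OF 0(1)] .
  ultimately show ?case using C_iso F_stalk isomorphic_sym by (metis V.simps(1))
next
  case (Suc k)
  obtain Y where Y: "Y \<in> bounded_complexes E" "\<And>n. n > 0 \<Longrightarrow> is_zero E (cob Y n)"
    "\<And>n. n \<le> 0 \<Longrightarrow> cob Y n = cob X (n - 1)" "dtri (fob F Y) (fob F (stalk E 0 (cob X 0))) (fob F X)"
    using truncation[OF Suc.prems(1,2)] by blast
  have "fob F Y \<in> V k" by (rule Suc.IH[OF Y(1,2)]) (use Y(3) Suc.prems(3) in auto)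
  moreover have "cob X 0 \<in> C" using cx_T(1)[OF Suc.prems(1)] .
  then have "fob F (stalk E 0 (cob X 0)) \<in> C" using C_iso F_stalk isomorphic_sym by blast
  ultimately show ?case using Y(4) by auto
qed

lemma F_shifted_V:
  assumes X: "X \<in> bounded_complexes E"
  shows "\<exists>k n. (So ^^ k) (fob F X) \<in> V n"
proof -
  obtain b where b: "b \<ge> 0" "\<And>n. \<bar>n\<bar> > b \<Longrightarrow> is_zero E (cob X n)" using ex.cx_bound[OF X] by blast
  have cob: "cob ((shift E ^^ k) X) n = cob X (n + int k)" for k n
    by (induction k arbitrary: n) (simp_all add: algebra_simps)
  \<comment> \<open>A complex supported in degrees from \<open>- b\<close> to \<open>b\<close> is
    moved to degrees from \<open>- 2 b\<close> to 0 by \<open>b\<close> shifts.\<close>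
  have "fob F ((shift E ^^ nat b) X) \<in> V (nat (2 * b))"
    by (rule F_V) (use F_shifts[OF X] b in \<open>auto simp: cob\<close>)
  then show ?thesis using V_iso F_shifts[OF X] by blast
qed

lemma thick_V:
  assumes S: "thick_subcategory T S'" "C \<subseteq> S'"
  shows "V n \<subseteq> S'"
proof (induction n)
  case (Suc n)
  have tri: "\<forall>(u, v, w) \<in> Tri T. Dom T u \<in> S' \<and> Dom T v \<in> S' \<longrightarrow> Dom T w \<in> S'"
    using S(1) by (simp add: thick_subcategory_def triangulated_subcategory_def)
  show ?case
  proof
    fix X assume "X \<in> V (Suc n)"
    then obtain B P where BP: "B \<in> V n" "P \<in> C" "dtri B P X" by auto
    then obtain u v w where t: "tri u v w B P X" by (auto simp: dtri_def)
    have "Dom T u \<in> S' \<and> Dom T v \<in> S' \<longrightarrow> Dom T w \<in> S'" using tri triD(1)[OF t] by blast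
    then show "X \<in> S'" using triD(8,10,12)[OF t] BP S(2) Suc by auto
  qed
qed (use S in simp)

lemma thick_all: "thick_subcategory T (Obj T)"
  unfolding thick_subcategory_def triangulated_subcategory_def closed_under_iso_def closed_under_summands_def
proof (intro conjI ballI impI subset_refl)
  show "\<exists>Z \<in> Obj T. is_zero T Z" using zero_exists by (auto simp: is_zero_def)
next
  fix t assume "t \<in> Tri T"
  then show "case t of (u, v, w) \<Rightarrow> Dom T u \<in> Obj T \<and> Dom T v \<in> Obj T \<longrightarrow> Dom T w \<in> Obj T"
    using Tri_is_triangle by (cases t) (auto simp: is_triangle_def)
qed auto

lemma equivalence_imp:
  assumes eqv: "equivalence_of_categories (Db E) T F"
  shows "fully_faithful (Db E) T F" "thick_closure T C = Obj T"
proof -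
  show "fully_faithful (Db E) T F" by (rule equivalence_imp_fully_faithful[OF category_Db category_axioms eqv])
  show "thick_closure T C = Obj T"
  proof
    show "thick_closure T C \<subseteq> Obj T" using thick_all C_obj unfolding thick_closure_def by blast
    show "Obj T \<subseteq> thick_closure T C" unfolding thick_closure_def
    proof (intro subsetI InterI, elim CollectE conjE)
      fix A S' assume A: "A \<in> Obj T" and S: "thick_subcategory T S'" "C \<subseteq> S'"
      obtain X where X: "X \<in> bounded_complexes E" "isomorphic T (fob F X) A"
        using equivalence_essentially_surjective[OF eqv A] by (auto simp: Db_eq ex.Obj_K)
      obtain k n where "(So ^^ k) (fob F X) \<in> V n" using F_shifted_V[OF X(1)] by blast
      then have "(So ^^ k) (fob F X) \<in> S'" using thick_V[OF S] by blast
      moreover have sus: "\<And>Y. Y \<in> Obj T \<Longrightarrow> Y \<in> S' \<longleftrightarrow> So Y \<in> S'" and iso: "closed_under_iso T S'"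
        using S(1) unfolding thick_subcategory_def triangulated_subcategory_def by blast+
      \<comment> \<open>The suspension reflects membership in a triangulated subcategory, so
        membership descends along \<open>k\<close> desuspensions.\<close>
      have "(So ^^ k) Y \<in> S' \<Longrightarrow> Y \<in> S'" if "Y \<in> Obj T" for Y
      proof (induction k)
        case (Suc k)
        have "(So ^^ k) Y \<in> Obj T" using that by (induction k) auto
        then show ?case using Suc sus by auto
      qed simp
      ultimately have "fob F X \<in> S'" using F_obj[OF X(1)] by blast
      then show "A \<in> S'" using iso X(2) A unfolding closed_under_iso_def by blast
    qed
  qed
qed

section \<open>Consequences of full faithfulness: local killing and the essential image\<close>

context
  assumes ff: "fully_faithful (Db E) T F"
begin

text \<open>Fullness gives a fraction, and clearing its denominator turns it into an equation
  between images of homotopy classes.\<close>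

lemma F_lift:
  assumes u: "u \<in> Hom T (fob F X) (fob F Y)" and X: "X \<in> bounded_complexes E" and Y: "Y \<in> bounded_complexes E"
  obtains W s f where "s \<in> Hom (Kb E) W X" "ex.qis s" "f \<in> Hom (Kb E) W Y" "u \<cdot> Fq s = Fq f"
proof -
  obtain \<alpha> where \<alpha>: "\<alpha> \<in> Hom rf.V X Y" "farr F \<alpha> = u"
    using fully_faithful_full[OF ff u] X Y by (auto simp: Db_eq ex.Obj_K)
  obtain s f where sf: "(s, f) \<in> roofs (Kb E) N X Y" "\<alpha> = roof_class (Kb E) N (s, f)" using rf.V_homE[OF \<alpha>(1)] .
  have s: "s \<in> Hom (Kb E) (Dom (Kb E) s) X" "ex.qis s" "f \<in> Hom (Kb E) (Dom (Kb E) s) Y"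
    using sf(1) quot_iff[of s] by (auto simp: rf.roofs_iff Hom_def)
  have "u \<cdot> Fq s = Fq f"
    using functorD(6)[OF F_functor[unfolded Db_eq], of "rf.qf s" \<alpha>] rf.qf_hom[OF s(1)] \<alpha> rf.roof_comp_qf[OF sf(1)] sf(2)
    by (simp add: Hom_def)
  then show ?thesis using that s by blast
qed

text \<open>The composite \<open>s t\<close> represents a deflation \<open>e\<close>; the
  identifications \<open>\<theta>\<close> and \<open>\<eta>\<close> of values of \<open>F\<close>
  with objects of \<open>T\<close> transport the vanishing of \<open>f t\<close> to that of
  \<open>h e\<close>.\<close>

lemma C_killed:
  assumes X: "X \<in> C" and k: "k \<ge> 1"
  shows "locally_killed ((So ^^ k) X)"
  unfolding locally_killed_def
proof (intro conjI ballI)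
  have "(shift E ^^ m) (stalk E 0 X) = stalk E (- int m) X" for m
  proof (induction m)
    case (Suc m)
    then show ?case using ex.shift_stalk[of X "- int (Suc m)"] X by (simp add: induced_exact_simps)
  qed simp
  then have "isomorphic T (fob F (stalk E (- int k) X)) ((So ^^ k) (fob F (stalk E 0 X)))"
    using F_shifts[OF stalk_bc[OF X], of k 0] by simp
  moreover have "isomorphic T ((So ^^ k) (fob F (stalk E 0 X))) ((So ^^ k) X)"
    using F_stalk[OF X] S_iso by (induction k) auto
  ultimately obtain \<theta> where \<theta>: "\<theta> \<in> Hom T ((So ^^ k) X) (fob F (stalk E (- int k) X))" "is_iso T \<theta>"
    using isomorphic_sym[OF isomorphic_trans] unfolding isomorphic_def by blast
  show o: "(So ^^ k) X \<in> Obj T" using Hom_obj[OF \<theta>(1)] by blast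
  obtain \<theta>' where \<theta>': "\<theta>' \<in> Hom T (fob F (stalk E (- int k) X)) ((So ^^ k) X)" "\<theta>' \<cdot> \<theta> = Ide T ((So ^^ k) X)"
    using is_iso_inverse[OF \<theta>(2,1)] by blast
  fix P h assume P: "P \<in> C" and h: "h \<in> Hom T P ((So ^^ k) X)"
  note \<theta>h = Comp_closed[OF h \<theta>(1)]
  obtain W s f where s: "s \<in> Hom (Kb E) W (stalk E 0 P)" "ex.qis s" "f \<in> Hom (Kb E) W (stalk E (- int k) X)"
    "((\<theta> \<cdot> h) \<cdot> \<eta> P) \<cdot> Fq s = Fq f"
    using F_lift[OF Comp_closed[OF \<eta>(1)[OF P] \<theta>h] stalk_bc[OF P] stalk_bc[OF X]] by blast
  have PE: "P \<in> Obj E" "X \<in> Obj E" using P X by (simp_all add: induced_exact_simps)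
  \<comment> \<open>The identity of the stalk is a cohomology element of the target of
    \<open>s\<close>; local surjectivity lifts it to \<open>W\<close> over a deflation
    \<open>e\<close>.\<close>
  obtain e t where e: "e \<in> D" "Cod T e = P" "t \<in> Hom (Kb E) (stalk E 0 (Dom T e)) W"
    "Comp (Kb E) (Ide (Kb E) (stalk E 0 P)) (stalk_map E 0 e) = Comp (Kb E) s t"
    using ex.qisE(1)[OF s(2,1) PE(1) ex.K.Ide_closed[OF ex.stalk_obj[OF PE(1)]]] by (auto simp: induced_exact_simps)
  have e': "e \<in> Hom T (Dom T e) P" "Dom T e \<in> C" using D_dom_cod[OF e(1)] e(2) by auto
  have sm: "stalk_map E 0 e \<in> Hom (Kb E) (stalk E 0 (Dom T e)) (stalk E 0 P)"
    using ex.sm_hom[OF e(1), of 0] e(2) by (simp add: induced_exact_simps)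
  have st: "stalk_map E 0 e = Comp (Kb E) s t" using e(4) ex.K.Ide_Comp[OF sm] by simp
  \<comment> \<open>Here \<open>k \<ge> 1\<close> matters: the two stalks sit in degrees 0 and
    \<open>- k\<close>.\<close>
  have "Comp (Kb E) f t = Zero (Kb E) (stalk E 0 (Dom T e)) (stalk E (- int k) X)"
    by (rule ex.stalk_hom_zero[OF ex.K.Comp_closed[OF e(3) s(3)]]) (use k e' PE in \<open>auto simp: induced_exact_simps\<close>)
  then have ft: "Fq f \<cdot> Fq t = Zero T (fob F (stalk E 0 (Dom T e))) (fob F (stalk E (- int k) X))"
    using Fq_comp[OF e(3) s(3)] Fq_zero[OF stalk_bc[OF e'(2)] stalk_bc[OF X]] by simp
  note g = Comp_closed[OF \<eta>(1)[OF P] \<theta>h]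
  have "((\<theta> \<cdot> h) \<cdot> \<eta> P) \<cdot> Fq (stalk_map E 0 e) = (((\<theta> \<cdot> h) \<cdot> \<eta> P) \<cdot> Fq s) \<cdot> Fq t"
    using Fq_comp[OF e(3) s(1)] st Comp_assoc[OF Fq_hom[OF e(3)] Fq_hom[OF s(1)] g] by simp
  then have z: "((\<theta> \<cdot> h) \<cdot> \<eta> P) \<cdot> Fq (stalk_map E 0 e) = Zero T (fob F (stalk E 0 (Dom T e))) (fob F (stalk E (- int k) X))"
    using s(4) ft by simp
  have "((\<theta> \<cdot> h) \<cdot> \<eta> P) \<cdot> Fq (stalk_map E 0 e) = (\<theta> \<cdot> h) \<cdot> (e \<cdot> \<eta> (Dom T e))"
    using Comp_assoc[OF Fq_hom[OF sm] \<eta>(1)[OF P] \<theta>h] \<eta>(3)[OF e'(1,2) P] by simp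
  also have "\<dots> = (\<theta> \<cdot> (h \<cdot> e)) \<cdot> \<eta> (Dom T e)"
    using Comp_assoc[OF \<eta>(1)[OF e'(2)] e'(1) \<theta>h] Comp_assoc[OF e'(1) h \<theta>(1)] by simp
  finally have z2: "(\<theta> \<cdot> (h \<cdot> e)) \<cdot> \<eta> (Dom T e) = Zero T (fob F (stalk E 0 (Dom T e))) (fob F (stalk E (- int k) X))"
    using z by simp
  note he = Comp_closed[OF e'(1) h]
  have o2: "fob F (stalk E (- int k) X) \<in> Obj T" "Dom T e \<in> Obj T" using Hom_obj[OF \<theta>(1)] C_obj e' by blast+
  have "\<theta> \<cdot> (h \<cdot> e) = Zero T (Dom T e) (fob F (stalk E (- int k) X))"
    by (rule iso_epi[OF \<eta>(1,2)[OF e'(2)] Comp_closed[OF he \<theta>(1)]])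
      (use z2 o2 \<eta>(1)[OF e'(2)] in \<open>auto simp: Hom_def\<close>)
  then have "\<theta>' \<cdot> (\<theta> \<cdot> (h \<cdot> e)) = Zero T (Dom T e) ((So ^^ k) X)" using \<theta>'(1) o2 by (simp add: Hom_def)
  then have "h \<cdot> e = Zero T (Dom T e) ((So ^^ k) X)"
    using Comp_assoc[OF he \<theta>(1) \<theta>'(1)] \<theta>'(2) Ide_Comp[OF he] by simp
  then show "\<exists>e \<in> D. Cod T e = P \<and> h \<cdot> e = Zero T (Dom T e) ((So ^^ k) X)" using e by blast
qed

definition I :: "'o set" where
  "I = {A. \<exists>X \<in> bounded_complexes E. isomorphic T (fob F X) A}"

lemma I_obj: "A \<in> I \<Longrightarrow> A \<in> Obj T"
  unfolding I_def using isomorphic_obj by blast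

lemma I_iso: "isomorphic T A B \<Longrightarrow> A \<in> I \<Longrightarrow> B \<in> I"
  unfolding I_def using isomorphic_trans by blast

lemma C_I: "C \<subseteq> I"
  unfolding I_def using F_stalk stalk_bc by blast

lemma I_S: "A \<in> I \<Longrightarrow> So A \<in> I"
  unfolding I_def using isomorphic_trans[OF F_shift S_iso] ex.shift_cx by blast

text \<open>The shift of \<open>unshift E X\<close> is \<open>X\<close> itself, so a preimage of
  \<open>So A\<close> desuspends to a preimage of \<open>A\<close>.\<close>

lemma I_unS:
  assumes "So A \<in> I" "A \<in> Obj T"
  shows "A \<in> I"
proof -
  obtain X where X: "X \<in> bounded_complexes E" "isomorphic T (fob F X) (So A)" using assms(1) by (auto simp: I_def)
  have u: "unshift E X \<in> bounded_complexes E" "shift E (unshift E X) = X" using X(1) by simp_all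
  have "isomorphic T (So (fob F (unshift E X))) (So A)"
    using isomorphic_trans[OF isomorphic_sym[OF F_shift[OF u(1)]]] X(2) u(2) by simp
  then have "isomorphic T (fob F (unshift E X)) A" using S_reflects_iso F_obj[OF u(1)] assms(2) by blast
  then show ?thesis using u(1) by (auto simp: I_def)
qed

text \<open>Represent the map between preimages by a roof. Its numerator \<open>f\<close> has a
  mapping cone, whose image is a triangle isomorphic to the given one: the denominator becomes
  invertible in \<open>T\<close> and is absorbed into \<open>a\<close>, and the five lemma treats
  the third vertices.\<close>

lemma I_cone:
  assumes "dtri A B Z" "A \<in> I" "B \<in> I"
  shows "Z \<in> I"
proof -
  obtain u v w where t: "tri u v w A B Z" using assms(1) by (auto simp: dtri_def)
  note d = triD[OF t]
  obtain X a where X: "X \<in> bounded_complexes E" "a \<in> Hom T (fob F X) A" "is_iso T a"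
    using assms(2) by (auto simp: I_def isomorphic_def)
  obtain Y b where Y: "Y \<in> bounded_complexes E" "b \<in> Hom T (fob F Y) B" "is_iso T b"
    using assms(3) by (auto simp: I_def isomorphic_def)
  obtain b' where b': "b' \<in> Hom T B (fob F Y)" "b \<cdot> b' = Ide T B" using is_iso_inverse[OF Y(3,2)] by blast
  note ua = Comp_closed[OF X(2) d(2)]
  note g = Comp_closed[OF ua b'(1)]
  obtain W s f where s: "s \<in> Hom (Kb E) W X" "ex.qis s" "f \<in> Hom (Kb E) W Y" "(b' \<cdot> (u \<cdot> a)) \<cdot> Fq s = Fq f"
    using F_lift[OF g X(1) Y(1)] by blast
  obtain v1 w1 where std: "(f, v1, w1) \<in> std_triangles E" using ex.std_exists[OF s(3)] by blast
  define Z1 where "Z1 = Cod (Kb E) v1"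
  have Z1: "Z1 \<in> bounded_complexes E"
    using ex.K.Hom_obj[OF ex.stdD(1)[OF std s(3) Z1_def[symmetric]]] by (simp add: ex.Obj_K)
  obtain v2 w2 where t2: "tri (Fq f) v2 w2 (fob F W) (fob F Y) (fob F Z1)" using F_triangle[OF std s(3) Z1_def[symmetric]] by blast
  note as = Comp_closed[OF Fq_hom[OF s(1)] X(2)]
  have as_iso: "is_iso T (a \<cdot> Fq s)" using iso_comp[OF Fq_qis[OF s(1,2)] Fq_hom[OF s(1)] X(3,2)] .
  have "b \<cdot> Fq f = (b \<cdot> (b' \<cdot> (u \<cdot> a))) \<cdot> Fq s" using s(4) Comp_assoc[OF Fq_hom[OF s(1)] g Y(2)] by simp
  also have "b \<cdot> (b' \<cdot> (u \<cdot> a)) = u \<cdot> a" using Comp_assoc[OF ua b'(1) Y(2)] b'(2) Ide_Comp[OF ua] by simp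
  finally have sq: "b \<cdot> Fq f = u \<cdot> (a \<cdot> Fq s)" using Comp_assoc[OF Fq_hom[OF s(1)] X(2) d(2)] by simp
  obtain c where c: "c \<in> Hom T (fob F Z1) Z" "c \<cdot> v2 = v \<cdot> b" "S (a \<cdot> Fq s) \<cdot> w2 = w \<cdot> c"
    using tri_morph[OF t2 t as Y(2) sq] by blast
  have "is_iso T c" by (rule tri_five[OF t2 t as as_iso Y(2,3) c(1) sq c(2,3)])
  then show ?thesis using c(1) Z1 unfolding I_def isomorphic_def by blast
qed

lemma I_middle: "dtri X Y Z \<Longrightarrow> X \<in> I \<Longrightarrow> Z \<in> I \<Longrightarrow> Y \<in> I"
  using I_cone[OF dtri_rot[OF dtri_rot]] I_S I_unS dtri_obj by blast

text \<open>\<open>retract_V\<close> applies once suspensions have moved the object into some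
  \<open>V n\<close>; \<open>I_unS\<close> then undoes them.\<close>

lemma I_retract:
  assumes "retract A M" "M \<in> I"
  shows "A \<in> I"
proof -
  obtain X where X: "X \<in> bounded_complexes E" "isomorphic T (fob F X) M" using assms(2) by (auto simp: I_def)
  have r: "retract A (fob F X)" using retract_trans[OF assms(1) retract_iso[OF isomorphic_sym[OF X(2)]]] .
  then have A: "A \<in> Obj T" unfolding retract_def using Hom_obj by blast
  obtain k n where V: "(So ^^ k) (fob F X) \<in> V n" using F_shifted_V[OF X(1)] by blast
  have rk: "retract ((So ^^ k) A) ((So ^^ k) (fob F X))" using r retract_S by (induction k) auto
  have "(So ^^ k) A \<in> I"
  proof (rule retract_V[where I = I, OF _ _ _ _ _ V rk])
    show "locally_killed ((So ^^ m) Y)" if "Y \<in> C" "1 \<le> m" for Y m using C_killed that by blast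
  qed (use I_iso C_I I_S I_middle in blast)+
  then show ?thesis
  proof (induction k)
    case (Suc k)
    have "(So ^^ k) A \<in> Obj T" using A by (induction k) auto
    then show ?case using Suc I_unS by simp
  qed simp
qed

lemma thick_I: "thick_subcategory T I"
  unfolding thick_subcategory_def triangulated_subcategory_def closed_under_iso_def closed_under_summands_def
proof (intro conjI ballI impI)
  show "I \<subseteq> Obj T" using I_obj by blast
  show "\<exists>Z \<in> I. is_zero T Z" using zero_exists C_zero C_I by blast
  show "Y \<in> I" if "X \<in> I" "isomorphic T X Y" for X Y using I_iso that by blast
  show "X \<in> I \<longleftrightarrow> So X \<in> I" if "X \<in> Obj T" for X using I_S I_unS that by blast
  show "X \<in> I" if "B \<in> I" "is_direct_sum T X Y B" for X Y B using I_retract direct_sum_retract that by blast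
  fix t assume "t \<in> Tri T"
  then show "case t of (u, v, w) \<Rightarrow> Dom T u \<in> I \<and> Dom T v \<in> I \<longrightarrow> Dom T w \<in> I"
    using I_cone[OF dtriI[OF Tri_tri]] by (cases t) auto
qed

lemma imp_equivalence:
  assumes "thick_closure T C = Obj T"
  shows "equivalence_of_categories (Db E) T F"
proof (rule equivalenceI[OF category_Db category_axioms ff])
  fix A assume "A \<in> Obj T"
  then have "A \<in> I" using assms thick_I C_I unfolding thick_closure_def by blast
  then show "\<exists>X \<in> Obj (Db E). isomorphic T (fob F X) A" by (auto simp: I_def Db_eq ex.Obj_K)
qed

end

end

theorem corollary2p19:
  fixes T :: "('o, 'm) tri_category"
    and C :: "'o set"
    and F :: "(('o, 'm) cochain_complex, ('o, 'm) derived_arr, 'o, 'm) cfunctor"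
    and \<phi> :: "('o, 'm) cochain_complex \<Rightarrow> 'm"
  assumes "triangulated_category T"
    and "admissible_exact T C"
    and "realization_functor T C F \<phi>"
  shows "triangle_equivalence (Db (induced_exact T C)) T F \<phi> \<longleftrightarrow>
         fully_faithful (Db (induced_exact T C)) T F \<and> thick_closure T C = Obj T"
proof -
  interpret realization T C F \<phi>
    using assms by (simp add: realization_def realization_axioms_def admissible_def admissible_axioms_def)
  have "triangle_functor (Db E) T F \<phi>" using assms(3) by (simp add: realization_functor_def)
  then show ?thesis unfolding triangle_equivalence_def using equivalence_imp imp_equivalence by blast
qed

end
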